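(* Let $p$ be an odd prime, $F$ a number field, $F_\infty/F$ a $\mathbb{Z}_p$-extension with Galois group $\Gamma$, $\Lambda=\mathbb{Z}_p[[\Gamma]]$, and $E/F$ an elliptic curve. Let $r,t,b_1,\dots,b_t$ be the non-negative integers (which exist by a theorem of Lee) such that there is a pseudo-isomorphism of $\Lambda$-modules $$\left(E(F_\infty)\otimes_{\mathbb{Z}}\mathbb{Q}_p/\mathbb{Z}_p\right)^\vee\sim\Lambda^r\oplus\bigoplus_{i=1}^t\Lambda/\Phi_{b_i}.$$ If $r=0$, then there is a pseudo-isomorphism of $\Lambda$-modules $$\mathcal{M}(E/F_\infty)^\vee\sim\bigoplus_{i=1}^u\Lambda/\Phi_{c_i}$$ for certain non-negative integers $u$ and $c_1,\dots,c_u$, where $\mathcal{M}(E/F_\infty)$ is the fine Mordell--Weil group of $E$ over $F_\infty$.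
   Context: $M^\vee=\mathrm{Hom}(M,\mathbb{Q}_p/\mathbb{Z}_p)$ denotes the Pontryagin dual. $\Lambda$ is identified with $\mathbb{Z}_p[[X]]$ via $X=\gamma-1$, where $\gamma$ is a topological generator of $\Gamma$. For $n\ge1$, $\Phi_n=\frac{(1+X)^{p^n}-1}{(1+X)^{p^{n-1}}-1}$ is the $p^n$-th cyclotomic polynomial in $X+1$, and $\Phi_0=X$. A pseudo-isomorphism (denoted $\sim$) is a $\Lambda$-homomorphism with finite kernel and cokernel. Fine Mordell--Weil group (Wuthrich): for an algebraic extension $K/F$, $$\mathcal{M}(E/K)=\ker\left(E(K)\otimes\mathbb{Q}_p/\mathbb{Z}_p\rightarrow\bigoplus_{v\mid p}E(K_v)\otimes\mathbb{Q}_p/\mathbb{Z}_p\right),$$ i.e. the elements whose image is trivial at every place $v$ of $K$ above $p$. Here $K_v$ is the completion of $K$ at $v$ (if $K/F$ is infinite, the union of the completions of the finite subextensions at the places below $v$). Known theorem (Lee), used to define $r$: for every $E/F$ and every $\mathbb{Z}_p$-extension $F_\infty/F$, a pseudo-isomorphism as displayed in the claim exists, for certain non-negative integers $r,t,b_i$. *)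

theory Defs
  imports
    "HOL-Algebra.Algebra"
    "HOL-Algebra.Algebraic_Closure_Type"
    "HOL-Analysis.Function_Topology"
    "HOL-Analysis.Abstract_Metric_Spaces"
begin

section \<open>Completions\<close>

text \<open>
  For a family \<open>Ls\<close> of subsets of a field \<open>K\<close> with absolute value \<open>v\<close>, \<open>completion K Ls v\<close> consists of
  the Cauchy sequences with values in some member of \<open>Ls\<close>, modulo null sequences. If \<open>Ls\<close> is a
  directed family of subfields, this is the directed union of the completions of its members; if
  \<open>Ls = {carrier K}\<close>, it is the usual completion of \<open>K\<close>.
\<close>

definition cauchy_seq :: "('a, 'm) ring_scheme \<Rightarrow> ('a \<Rightarrow> real) \<Rightarrow> (nat \<Rightarrow> 'a) \<Rightarrow> bool" where
  "cauchy_seq K v s \<longleftrightarrow> (\<forall>e>0. \<exists>N. \<forall>m\<ge>N. \<forall>n\<ge>N. v (s m \<ominus>\<^bsub>K\<^esub> s n) < e)"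

definition cauchy_ring ::
    "('a, 'm) ring_scheme \<Rightarrow> 'a set set \<Rightarrow> ('a \<Rightarrow> real) \<Rightarrow> (nat \<Rightarrow> 'a) ring" where
  "cauchy_ring K Ls v =
    \<lparr>carrier = {s. (\<exists>L\<in>Ls. range s \<subseteq> L) \<and> cauchy_seq K v s},
     monoid.mult = \<lambda>s t n. s n \<otimes>\<^bsub>K\<^esub> t n, one = \<lambda>n. \<one>\<^bsub>K\<^esub>,
     ring.zero = \<lambda>n. \<zero>\<^bsub>K\<^esub>, add = \<lambda>s t n. s n \<oplus>\<^bsub>K\<^esub> t n\<rparr>"

definition null_seqs ::
    "('a, 'm) ring_scheme \<Rightarrow> 'a set set \<Rightarrow> ('a \<Rightarrow> real) \<Rightarrow> (nat \<Rightarrow> 'a) set" where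
  "null_seqs K Ls v = {s \<in> carrier (cauchy_ring K Ls v). (\<lambda>n. v (s n)) \<longlonglongrightarrow> 0}"

definition completion ::
    "('a, 'm) ring_scheme \<Rightarrow> 'a set set \<Rightarrow> ('a \<Rightarrow> real) \<Rightarrow> (nat \<Rightarrow> 'a) set ring" where
  "completion K Ls v = cauchy_ring K Ls v Quot null_seqs K Ls v"

definition completion_embed ::
    "('a, 'm) ring_scheme \<Rightarrow> 'a set set \<Rightarrow> ('a \<Rightarrow> real) \<Rightarrow> 'a \<Rightarrow> (nat \<Rightarrow> 'a) set" where
  "completion_embed K Ls v x = null_seqs K Ls v +>\<^bsub>cauchy_ring K Ls v\<^esub> (\<lambda>n. x)"


section \<open>The p-adic numbers\<close>

abbreviation rat_field :: "rat ring" where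
  "rat_field \<equiv> ring_of_type_algebra"

type_synonym padic = "(nat \<Rightarrow> rat) set"

definition padic_abs :: "nat \<Rightarrow> rat \<Rightarrow> real" where
  "padic_abs p x = (if x = 0 then 0 else
     real p powi (int (multiplicity (int p) (snd (quotient_of x)))
                - int (multiplicity (int p) (fst (quotient_of x)))))"

definition Qp :: "nat \<Rightarrow> padic ring" where
  "Qp p = completion rat_field {UNIV} (padic_abs p)"

definition padic_norm :: "nat \<Rightarrow> padic \<Rightarrow> real" where
  "padic_norm p x = (THE r. \<forall>s\<in>x. (\<lambda>n. padic_abs p (s n)) \<longlonglongrightarrow> r)"

definition Zp_set :: "nat \<Rightarrow> padic set" where
  "Zp_set p = {x \<in> carrier (Qp p). padic_norm p x \<le> 1}"

definition Zp :: "nat \<Rightarrow> padic ring" where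
  "Zp p = (Qp p)\<lparr>carrier := Zp_set p\<rparr>"

definition Zp_topology :: "nat \<Rightarrow> padic topology" where
  "Zp_topology p = Metric_space.mtopology (Zp_set p) (\<lambda>x y. padic_norm p (x \<ominus>\<^bsub>Qp p\<^esub> y))"

definition QpZp :: "nat \<Rightarrow> padic set monoid" where
  "QpZp p = Qp p A_Mod Zp_set p"

text \<open>The multiplication of a coset in \<open>Q\<^sub>p/Z\<^sub>p\<close> by a p-adic integer \<open>z\<close>.\<close>

definition QpZp_smult :: "nat \<Rightarrow> padic \<Rightarrow> padic set \<Rightarrow> padic set" where
  "QpZp_smult p z C = (\<Union>x\<in>C. Zp_set p +>\<^bsub>Qp p\<^esub> (z \<otimes>\<^bsub>Qp p\<^esub> x))"


section \<open>Modules and pseudo-isomorphisms\<close>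

text \<open>
  The record type of modules extends that of rings; the multiplicative fields carry no information
  for modules and are left undefined below.
\<close>

definition regular_module :: "('a, 'm) ring_scheme \<Rightarrow> ('a, 'a) module" where
  "regular_module R =
    \<lparr>carrier = carrier R, monoid.mult = undefined, one = undefined,
     ring.zero = \<zero>\<^bsub>R\<^esub>, add = ring.add R, module.smult = monoid.mult R\<rparr>"

definition quotient_module :: "('a, 'm) ring_scheme \<Rightarrow> 'a set \<Rightarrow> ('a, 'a set) module" where
  "quotient_module R I =
    \<lparr>carrier = carrier (R Quot I), monoid.mult = undefined, one = undefined,
     ring.zero = \<zero>\<^bsub>R Quot I\<^esub>, add = ring.add (R Quot I),
     module.smult = \<lambda>r C. (I +>\<^bsub>R\<^esub> r) \<otimes>\<^bsub>R Quot I\<^esub> C\<rparr>"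

definition direct_sum :: "'i set \<Rightarrow> ('i \<Rightarrow> ('r, 'a) module) \<Rightarrow> ('r, 'i \<Rightarrow> 'a) module" where
  \<comment> \<open>for finite index sets\<close>
  "direct_sum I M =
    \<lparr>carrier = (\<Pi>\<^sub>E i\<in>I. carrier (M i)), monoid.mult = undefined, one = undefined,
     ring.zero = \<lambda>i\<in>I. \<zero>\<^bsub>M i\<^esub>, add = \<lambda>x y. \<lambda>i\<in>I. x i \<oplus>\<^bsub>M i\<^esub> y i,
     module.smult = \<lambda>r x. \<lambda>i\<in>I. r \<odot>\<^bsub>M i\<^esub> x i\<rparr>"

definition direct_sum2 :: "('r, 'a) module \<Rightarrow> ('r, 'b) module \<Rightarrow> ('r, 'a \<times> 'b) module" where
  "direct_sum2 M N =
    \<lparr>carrier = carrier M \<times> carrier N, monoid.mult = undefined, one = undefined,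
     ring.zero = (\<zero>\<^bsub>M\<^esub>, \<zero>\<^bsub>N\<^esub>),
     add = \<lambda>x y. (fst x \<oplus>\<^bsub>M\<^esub> fst y, snd x \<oplus>\<^bsub>N\<^esub> snd y),
     module.smult = \<lambda>r x. (r \<odot>\<^bsub>M\<^esub> fst x, r \<odot>\<^bsub>N\<^esub> snd x)\<rparr>"

definition module_hom ::
    "('r, 'm) ring_scheme \<Rightarrow> ('r, 'a) module \<Rightarrow> ('r, 'b) module \<Rightarrow> ('a \<Rightarrow> 'b) set" where
  "module_hom R M N =
    {h \<in> carrier M \<rightarrow> carrier N.
      (\<forall>x\<in>carrier M. \<forall>y\<in>carrier M. h (x \<oplus>\<^bsub>M\<^esub> y) = h x \<oplus>\<^bsub>N\<^esub> h y) \<and>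
      (\<forall>r\<in>carrier R. \<forall>x\<in>carrier M. h (r \<odot>\<^bsub>M\<^esub> x) = r \<odot>\<^bsub>N\<^esub> h x)}"

definition pseudo_isomorphic ::
    "('r, 'm) ring_scheme \<Rightarrow> ('r, 'a) module \<Rightarrow> ('r, 'b) module \<Rightarrow> bool" where
  "pseudo_isomorphic R M N \<longleftrightarrow>
    (\<exists>h\<in>module_hom R M N. finite (a_kernel M N h) \<and>
       finite (carrier (N A_Mod (h ` carrier M))))"


section \<open>The Iwasawa algebra\<close>

definition power_series_ring :: "('a, 'm) ring_scheme \<Rightarrow> (nat \<Rightarrow> 'a) ring" where
  "power_series_ring R =
    \<lparr>carrier = UNIV \<rightarrow> carrier R,
     monoid.mult = \<lambda>f g n. \<Oplus>\<^bsub>R\<^esub>i\<in>{..n}. f i \<otimes>\<^bsub>R\<^esub> g (n - i),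
     one = \<lambda>n. if n = 0 then \<one>\<^bsub>R\<^esub> else \<zero>\<^bsub>R\<^esub>,
     ring.zero = \<lambda>n. \<zero>\<^bsub>R\<^esub>, add = \<lambda>f g n. f n \<oplus>\<^bsub>R\<^esub> g n\<rparr>"

definition power_series_X :: "('a, 'm) ring_scheme \<Rightarrow> nat \<Rightarrow> 'a" where
  "power_series_X R = (\<lambda>n. if n = 1 then \<one>\<^bsub>R\<^esub> else \<zero>\<^bsub>R\<^esub>)"

definition Lambda :: "nat \<Rightarrow> (nat \<Rightarrow> padic) ring" where
  "Lambda p = power_series_ring (Zp p)"

definition Lambda_X :: "nat \<Rightarrow> nat \<Rightarrow> padic" where
  "Lambda_X p = power_series_X (Zp p)"

text \<open>\<open>omega p n\<close> is \<open>(1 + X)\<close> to the power \<open>p ^ n\<close>, minus 1.\<close>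

definition omega :: "nat \<Rightarrow> nat \<Rightarrow> nat \<Rightarrow> padic" where
  "omega p n = (\<one>\<^bsub>Lambda p\<^esub> \<oplus>\<^bsub>Lambda p\<^esub> Lambda_X p) [^]\<^bsub>Lambda p\<^esub> (p ^ n) \<ominus>\<^bsub>Lambda p\<^esub> \<one>\<^bsub>Lambda p\<^esub>"

text \<open>The quotient of \<open>omega p n\<close> by \<open>omega p (n - 1)\<close> is taken in the domain \<open>Lambda p\<close>.\<close>

definition Phi :: "nat \<Rightarrow> nat \<Rightarrow> nat \<Rightarrow> padic" where
  "Phi p n = (if n = 0 then Lambda_X p else
     (THE q. q \<in> carrier (Lambda p) \<and> q \<otimes>\<^bsub>Lambda p\<^esub> omega p (n - 1) = omega p n))"

definition Lambda_mod_Phi :: "nat \<Rightarrow> nat \<Rightarrow> (nat \<Rightarrow> padic, (nat \<Rightarrow> padic) set) module" where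
  "Lambda_mod_Phi p n = quotient_module (Lambda p) (PIdl\<^bsub>Lambda p\<^esub> (Phi p n))"

text \<open>
  \<open>pontryagin_dual p A s\<close> is \<open>Hom(A, Q\<^sub>p/Z\<^sub>p)\<close> as a \<open>Lambda p\<close>-module, for an abelian group \<open>A\<close>
  with an action of \<open>\<Gamma>\<close>, where \<open>s\<close> is the action on \<open>A\<close> of the inverse of the chosen topological
  generator \<open>\<gamma>\<close>. As \<open>(\<gamma> \<phi>) a = \<phi> (s a)\<close>, the variable \<open>X = \<gamma> - 1\<close> acts by precomposition with
  \<open>T = s - 1\<close> (groups being written multiplicatively). If \<open>A\<close> is a discrete \<open>p\<close>-primary
  \<open>\<Gamma>\<close>-module, then \<open>T\<close> is nilpotent at every element, so that the product over \<open>i\<close> is finite.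
\<close>

definition pontryagin_dual ::
    "nat \<Rightarrow> 'a monoid \<Rightarrow> ('a \<Rightarrow> 'a) \<Rightarrow> (nat \<Rightarrow> padic, 'a \<Rightarrow> padic set) module" where
  "pontryagin_dual p A s =
    (let T = (\<lambda>a. s a \<otimes>\<^bsub>A\<^esub> inv\<^bsub>A\<^esub> a) in
    \<lparr>carrier = hom A (QpZp p) \<inter> extensional (carrier A), monoid.mult = undefined, one = undefined,
     ring.zero = \<lambda>a\<in>carrier A. \<one>\<^bsub>QpZp p\<^esub>,
     add = \<lambda>\<phi> \<psi>. \<lambda>a\<in>carrier A. \<phi> a \<otimes>\<^bsub>QpZp p\<^esub> \<psi> a,
     module.smult = \<lambda>f \<phi>. \<lambda>a\<in>carrier A.
       (\<Otimes>\<^bsub>QpZp p\<^esub>i\<in>{i. (T ^^ i) a \<noteq> \<one>\<^bsub>A\<^esub>}. QpZp_smult p (f i) (\<phi> ((T ^^ i) a)))\<rparr>)"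


section \<open>Tensor products of abelian groups\<close>

text \<open>Groups are written multiplicatively, except the free abelian group, where \<open>+\<close> is used.\<close>

definition tensor_relations ::
    "('a, 'm) monoid_scheme \<Rightarrow> ('b, 'n) monoid_scheme \<Rightarrow> ('a \<times> 'b \<Rightarrow>\<^sub>0 int) set" where
  "tensor_relations A B = generate (free_Abelian_group (carrier A \<times> carrier B))
    ({frag_of (a \<otimes>\<^bsub>A\<^esub> a', b) - frag_of (a, b) - frag_of (a', b) | a a' b.
        a \<in> carrier A \<and> a' \<in> carrier A \<and> b \<in> carrier B} \<union>
     {frag_of (a, b \<otimes>\<^bsub>B\<^esub> b') - frag_of (a, b) - frag_of (a, b') | a b b'.
        a \<in> carrier A \<and> b \<in> carrier B \<and> b' \<in> carrier B})"

definition tensor ::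
    "('a, 'm) monoid_scheme \<Rightarrow> ('b, 'n) monoid_scheme \<Rightarrow> ('a \<times> 'b \<Rightarrow>\<^sub>0 int) set monoid" where
  "tensor A B = free_Abelian_group (carrier A \<times> carrier B) Mod tensor_relations A B"

text \<open>For a homomorphism \<open>f\<close> from a group \<open>A\<close> to \<open>A'\<close>, \<open>tensor_map A' B f\<close> is the induced
  homomorphism \<open>f \<otimes> id\<close> from \<open>tensor A B\<close> to \<open>tensor A' B\<close>.\<close>

definition tensor_map ::
    "('c, 'm) monoid_scheme \<Rightarrow> ('b, 'n) monoid_scheme \<Rightarrow> ('a \<Rightarrow> 'c) \<Rightarrow>
     ('a \<times> 'b \<Rightarrow>\<^sub>0 int) set \<Rightarrow> ('c \<times> 'b \<Rightarrow>\<^sub>0 int) set" where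
  "tensor_map A' B f C =
    (\<Union>x\<in>C. tensor_relations A' B #>\<^bsub>free_Abelian_group (carrier A' \<times> carrier B)\<^esub>
       frag_extend (\<lambda>(a, b). frag_of (f a, b)) x)"


section \<open>Elliptic curves\<close>

text \<open>The Weierstrass curve \<open>y\<^sup>2 + a1 x y + a3 y = x\<^sup>3 + a2 x\<^sup>2 + a4 x + a6\<close>.\<close>

datatype 'a weierstrass =
  Weierstrass (coeff_a1: 'a) (coeff_a2: 'a) (coeff_a3: 'a) (coeff_a4: 'a) (coeff_a6: 'a)

datatype 'a point = Infinity | Affine 'a 'a

context
  fixes R :: "('a, 'm) ring_scheme" (structure)
begin

definition discriminant :: "'a weierstrass \<Rightarrow> 'a" where
  "discriminant E = (case E of Weierstrass a1 a2 a3 a4 a6 \<Rightarrow>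
    let b2 = a1 [^] (2::nat) \<oplus> [(4::nat)] \<cdot> a2;
        b4 = [(2::nat)] \<cdot> a4 \<oplus> a1 \<otimes> a3;
        b6 = a3 [^] (2::nat) \<oplus> [(4::nat)] \<cdot> a6;
        b8 = a1 [^] (2::nat) \<otimes> a6 \<oplus> [(4::nat)] \<cdot> (a2 \<otimes> a6) \<ominus> a1 \<otimes> a3 \<otimes> a4
             \<oplus> a2 \<otimes> a3 [^] (2::nat) \<ominus> a4 [^] (2::nat)
    in [(9::nat)] \<cdot> (b2 \<otimes> b4 \<otimes> b6) \<ominus> b2 [^] (2::nat) \<otimes> b8
       \<ominus> [(8::nat)] \<cdot> (b4 [^] (3::nat)) \<ominus> [(27::nat)] \<cdot> (b6 [^] (2::nat)))"

definition elliptic_curve :: "'a set \<Rightarrow> 'a weierstrass \<Rightarrow> bool" where \<comment> \<open>defined over \<open>F\<close>\<close>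
  "elliptic_curve F E \<longleftrightarrow> set_weierstrass E \<subseteq> F \<and> discriminant E \<noteq> \<zero>"

definition points :: "'a weierstrass \<Rightarrow> 'a point set" where
  "points E = (case E of Weierstrass a1 a2 a3 a4 a6 \<Rightarrow>
    insert Infinity {Affine x y | x y. x \<in> carrier R \<and> y \<in> carrier R \<and>
      y [^] (2::nat) \<oplus> a1 \<otimes> x \<otimes> y \<oplus> a3 \<otimes> y =
      x [^] (3::nat) \<oplus> a2 \<otimes> x [^] (2::nat) \<oplus> a4 \<otimes> x \<oplus> a6})"

text \<open>The chord and tangent law: \<open>y = l x + n\<close> is the line through the two points (respectively the
  tangent line), and the third point of intersection is reflected.\<close>

fun point_add :: "'a weierstrass \<Rightarrow> 'a point \<Rightarrow> 'a point \<Rightarrow> 'a point" where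
  "point_add E Infinity Q = Q"
| "point_add E P Infinity = P"
| "point_add (Weierstrass a1 a2 a3 a4 a6) (Affine x1 y1) (Affine x2 y2) =
    (if x1 = x2 \<and> y1 \<oplus> y2 \<oplus> a1 \<otimes> x2 \<oplus> a3 = \<zero> then Infinity
     else
       let l = (if x1 = x2
                then ([(3::nat)] \<cdot> (x1 [^] (2::nat)) \<oplus> [(2::nat)] \<cdot> (a2 \<otimes> x1) \<oplus> a4 \<ominus> a1 \<otimes> y1)
                     \<otimes> inv ([(2::nat)] \<cdot> y1 \<oplus> a1 \<otimes> x1 \<oplus> a3)
                else (y2 \<ominus> y1) \<otimes> inv (x2 \<ominus> x1));
           n = y1 \<ominus> l \<otimes> x1;
           x3 = l [^] (2::nat) \<oplus> a1 \<otimes> l \<ominus> a2 \<ominus> x1 \<ominus> x2;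
           y3 = \<ominus> (l \<oplus> a1) \<otimes> x3 \<ominus> n \<ominus> a3
       in Affine x3 y3)"

definition point_group :: "'a weierstrass \<Rightarrow> 'a point monoid" where
  "point_group E = \<lparr>carrier = points E, monoid.mult = point_add E, one = Infinity\<rparr>"

end


section \<open>Number fields and their extensions\<close>

text \<open>Throughout, \<open>K\<close> is a field and \<open>F\<close> is a subfield of \<open>K\<close>; the extension is \<open>K/F\<close>.\<close>

definition number_field :: "('a, 'm) ring_scheme \<Rightarrow> 'a set \<Rightarrow> bool" where
  "number_field K F \<longleftrightarrow> subfield F K \<and>
    (\<exists>Q. subfield Q K \<and> K\<lparr>carrier := Q\<rparr> \<simeq> rat_field \<and> ring.finite_dimension K Q F)"

definition finite_subextensions :: "('a, 'm) ring_scheme \<Rightarrow> 'a set \<Rightarrow> 'a set set" where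
  "finite_subextensions K F = {L. subfield L K \<and> F \<subseteq> L \<and> ring.finite_dimension K F L}"

definition galois_group :: "('a, 'm) ring_scheme \<Rightarrow> 'a set \<Rightarrow> ('a \<Rightarrow> 'a) monoid" where
  "galois_group K F = (BijGroup (carrier K))
    \<lparr>carrier := {\<sigma> \<in> Bij (carrier K). \<sigma> \<in> ring_hom K K \<and> (\<forall>x\<in>F. \<sigma> x = x)}\<rparr>"

text \<open>The Krull topology is the topology of pointwise convergence for the discrete topology on \<open>K\<close>.\<close>

definition krull_topology :: "('a, 'm) ring_scheme \<Rightarrow> 'a set \<Rightarrow> ('a \<Rightarrow> 'a) topology" where
  "krull_topology K F =
    subtopology (product_topology (\<lambda>_. discrete_topology (carrier K)) (carrier K))
      (carrier (galois_group K F))"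

definition galois_extension :: "('a, 'm) ring_scheme \<Rightarrow> 'a set \<Rightarrow> bool" where
  "galois_extension K F \<longleftrightarrow> field K \<and> subfield F K \<and>
    (\<forall>x\<in>carrier K. ring.algebraic K F x) \<and>
    {x \<in> carrier K. \<forall>\<sigma>\<in>carrier (galois_group K F). \<sigma> x = x} = F"

definition Zp_extension :: "nat \<Rightarrow> ('a, 'm) ring_scheme \<Rightarrow> 'a set \<Rightarrow> bool" where
  "Zp_extension p K F \<longleftrightarrow> galois_extension K F \<and>
    (\<exists>h\<in>iso (add_monoid (Zp p)) (galois_group K F).
       homeomorphic_map (Zp_topology p) (krull_topology K F) h)"

definition topological_generator :: "('a, 'm) ring_scheme \<Rightarrow> 'a set \<Rightarrow> ('a \<Rightarrow> 'a) \<Rightarrow> bool" where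
  "topological_generator K F \<gamma> \<longleftrightarrow> \<gamma> \<in> carrier (galois_group K F) \<and>
    krull_topology K F closure_of generate (galois_group K F) {\<gamma>} = carrier (galois_group K F)"

text \<open>Each place of \<open>K\<close> above \<open>p\<close> is represented by its unique absolute value \<open>v\<close> that extends the
  p-adic absolute value of the rational numbers, i.e. with \<open>v p = 1 / p\<close>.\<close>

definition place_above :: "nat \<Rightarrow> ('a, 'm) ring_scheme \<Rightarrow> ('a \<Rightarrow> real) \<Rightarrow> bool" where
  "place_above p K v \<longleftrightarrow>
    (\<forall>x\<in>carrier K. v x \<ge> 0 \<and> (v x = 0 \<longleftrightarrow> x = \<zero>\<^bsub>K\<^esub>)) \<and>
    (\<forall>x\<in>carrier K. \<forall>y\<in>carrier K. v (x \<otimes>\<^bsub>K\<^esub> y) = v x * v y) \<and>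
    (\<forall>x\<in>carrier K. \<forall>y\<in>carrier K. v (x \<oplus>\<^bsub>K\<^esub> y) \<le> max (v x) (v y)) \<and>
    v ([p] \<cdot>\<^bsub>K\<^esub> \<one>\<^bsub>K\<^esub>) = 1 / real p"

text \<open>\<open>local_field K F v\<close> is the union of the completions at \<open>v\<close> of the finite subextensions of
  \<open>K/F\<close>; it is the completion of \<open>K\<close> if \<open>K/F\<close> is finite.\<close>

definition local_field :: "('a, 'm) ring_scheme \<Rightarrow> 'a set \<Rightarrow> ('a \<Rightarrow> real) \<Rightarrow> (nat \<Rightarrow> 'a) set ring" where
  "local_field K F v = completion K (finite_subextensions K F) v"

definition local_embed ::
    "('a, 'm) ring_scheme \<Rightarrow> 'a set \<Rightarrow> ('a \<Rightarrow> real) \<Rightarrow> 'a \<Rightarrow> (nat \<Rightarrow> 'a) set" where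
  "local_embed K F v = completion_embed K (finite_subextensions K F) v"


section \<open>The fine Mordell--Weil group\<close>

type_synonym 'a mw = "('a point \<times> padic set \<Rightarrow>\<^sub>0 int) set"

definition MW_tensor :: "nat \<Rightarrow> ('a, 'm) ring_scheme \<Rightarrow> 'a weierstrass \<Rightarrow> 'a mw monoid" where
  "MW_tensor p K E = tensor (point_group K E) (QpZp p)"

definition MW_action ::
    "nat \<Rightarrow> ('a, 'm) ring_scheme \<Rightarrow> 'a weierstrass \<Rightarrow> ('a \<Rightarrow> 'a) \<Rightarrow> 'a mw \<Rightarrow> 'a mw" where
  "MW_action p K E \<sigma> = tensor_map (point_group K E) (QpZp p) (map_point \<sigma>)"

definition localization ::
    "nat \<Rightarrow> ('a, 'm) ring_scheme \<Rightarrow> 'a set \<Rightarrow> 'a weierstrass \<Rightarrow> ('a \<Rightarrow> real) \<Rightarrow>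
     'a mw \<Rightarrow> (nat \<Rightarrow> 'a) set mw" where
  "localization p K F E v =
    tensor_map (point_group (local_field K F v) (map_weierstrass (local_embed K F v) E)) (QpZp p)
      (map_point (local_embed K F v))"

definition fine_MW ::
    "nat \<Rightarrow> ('a, 'm) ring_scheme \<Rightarrow> 'a set \<Rightarrow> 'a weierstrass \<Rightarrow> 'a mw monoid" where
  "fine_MW p K F E = (MW_tensor p K E)
    \<lparr>carrier := {x \<in> carrier (MW_tensor p K E). \<forall>v. place_above p K v \<longrightarrow>
       localization p K F E v x =
       \<one>\<^bsub>MW_tensor p (local_field K F v) (map_weierstrass (local_embed K F v) E)\<^esub>}\<rparr>"

text \<open>The duals as modules over \<open>Lambda p\<close>, identified with the Iwasawa algebra of the Galois group
  by means of the topological generator \<open>\<gamma>\<close>.\<close>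

definition MW_dual ::
    "nat \<Rightarrow> ('a, 'm) ring_scheme \<Rightarrow> 'a set \<Rightarrow> 'a weierstrass \<Rightarrow> ('a \<Rightarrow> 'a) \<Rightarrow>
     (nat \<Rightarrow> padic, 'a mw \<Rightarrow> padic set) module" where
  "MW_dual p K F E \<gamma> =
    pontryagin_dual p (MW_tensor p K E) (MW_action p K E (inv\<^bsub>galois_group K F\<^esub> \<gamma>))"

definition fine_MW_dual ::
    "nat \<Rightarrow> ('a, 'm) ring_scheme \<Rightarrow> 'a set \<Rightarrow> 'a weierstrass \<Rightarrow> ('a \<Rightarrow> 'a) \<Rightarrow>
     (nat \<Rightarrow> padic, 'a mw \<Rightarrow> padic set) module" where
  "fine_MW_dual p K F E \<gamma> =
    pontryagin_dual p (fine_MW p K F E) (MW_action p K E (inv\<^bsub>galois_group K F\<^esub> \<gamma>))"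

end

theory Submission
  imports Defs "HOL-Decision_Procs.Commutative_Ring"
begin

text \<open>Let \<open>A\<close> be \<open>E(F\<^sub>\<infinity>) \<otimes> \<rat>\<^sub>p/\<int>\<^sub>p\<close> and \<open>B\<close> its fine subgroup. As \<open>\<rat>\<^sub>p/\<int>\<^sub>p\<close> is divisible, restriction makes the
  dual of \<open>B\<close> a quotient of the dual of \<open>A\<close>, which for \<open>r = 0\<close> is pseudo-isomorphic to a sum \<open>P\<close> of
  modules \<open>\<Lambda>/\<Phi>\<^sub>b\<close>. Such a module is \<open>p\<close>-torsion free, finite modulo every power of \<open>p\<close>, and
  every nonzero submodule contains a multiple by a power of \<open>p\<close> of the whole module, because \<open>\<Phi>\<^sub>b\<close> is of
  Eisenstein type (or equal to \<open>X\<close>). These three properties imply that every quotient of \<open>P\<close> is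
  pseudo-isomorphic to the sum of some of the summands.

  The subgroup \<open>B\<close> is stable under the Galois group, because conjugation permutes the places above \<open>p\<close>.
  Every point is fixed by some \<open>\<gamma>\<close> to the power \<open>p\<^sup>n\<close>, so that \<open>\<gamma> - 1\<close> acts locally nilpotently on
  \<open>A\<close> and power series act on the duals. Of the chord and tangent law, only its closure and its
  functoriality in the field are needed.\<close>

section \<open>Completions of non-archimedean fields\<close>

text \<open>After inverting \<open>p\<close>, each summand \<open>Lambda_mod_Phi p b\<close> becomes
  the field generated over Q_p by a root of \<open>Phi p b\<close>, hence a simple module. So
  \<open>P\<close> becomes semisimple, and a quotient of a semisimple module is a sum of some of the
  simple summands. The three properties are the integral trace of this: the usual choice of a
  complement is carried out with multiplication by a power of \<open>p\<close> in place of division,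
  and finiteness modulo that power keeps the loss finite on both sides. No classification of
  \<open>\<Lambda>\<close>-modules is involved.

  A pseudo-isomorphism has a direction, and the given one leaves the dual of \<open>A\<close>. The
  kernel of restriction to \<open>B\<close> is therefore pushed forward into \<open>P\<close>, and
  the map that kills its image is carried back to the dual of \<open>B\<close>. Finiteness of the
  new kernel and cokernel is then obtained by counting: finitely many residues, each with a finite
  fibre.

  That \<open>p\<close> is odd enters through the sign of \<open>(-1) ^ (p ^ n)\<close>, when
  \<open>(x - 1) ^ (p ^ n)\<close> is compared with \<open>x ^ (p ^ n) - 1\<close> modulo
  \<open>p\<close>.\<close>

locale nonarch_field = field K for K (structure) +
  fixes v :: "'a \<Rightarrow> real" and Ls :: "'a set set"
  assumes v_nonneg [simp]: "x \<in> carrier K \<Longrightarrow> 0 \<le> v x"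
    and v_zero_iff [simp]: "x \<in> carrier K \<Longrightarrow> v x = 0 \<longleftrightarrow> x = \<zero>"
    and v_mult [simp]: "x \<in> carrier K \<Longrightarrow> y \<in> carrier K \<Longrightarrow> v (x \<otimes> y) = v x * v y"
    and v_ultra: "x \<in> carrier K \<Longrightarrow> y \<in> carrier K \<Longrightarrow> v (x \<oplus> y) \<le> max (v x) (v y)"
    and Ls_nonempty: "Ls \<noteq> {}"
    and Ls_subfield: "L \<in> Ls \<Longrightarrow> subfield L K"
    and Ls_directed: "L \<in> Ls \<Longrightarrow> L' \<in> Ls \<Longrightarrow> \<exists>L''\<in>Ls. L \<subseteq> L'' \<and> L' \<subseteq> L''"
    and Ls_cover: "carrier K \<subseteq> \<Union>Ls"
begin

abbreviation C where "C \<equiv> cauchy_ring K Ls v"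
abbreviation N where "N \<equiv> null_seqs K Ls v"
abbreviation Q where "Q \<equiv> completion K Ls v"
abbreviation cl where "cl s \<equiv> N +>\<^bsub>C\<^esub> s"

text \<open>Written exactly like \<open>padic_norm\<close>, so that the two agree over the rational
  numbers. That the limit exists and does not depend on the representative is
  \<open>cnorm_lim\<close>.\<close>

definition cnorm :: "(nat \<Rightarrow> 'a) set \<Rightarrow> real" where
  "cnorm x = (THE r. \<forall>s\<in>x. (\<lambda>n. v (s n)) \<longlonglongrightarrow> r)"

lemma v_zero [simp]: "v \<zero> = 0"
  by simp

lemma v_one [simp]: "v \<one> = 1"
proof -
  have "v \<one> * v \<one> = v \<one>" using v_mult[of \<one> \<one>] by simp
  moreover have "v \<one> \<noteq> 0" by simp
  ultimately show ?thesis by simp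
qed

lemma v_uminus [simp]:
  assumes x: "x \<in> carrier K" shows "v (\<ominus> x) = v x"
proof -
  have "v (\<ominus> \<one>) * v (\<ominus> \<one>) = v (\<ominus> \<one> \<otimes> \<ominus> \<one>)" by (subst v_mult) auto
  also have "\<ominus> \<one> \<otimes> \<ominus> \<one> = \<one>" by (simp add: l_minus)
  finally have "v (\<ominus> \<one>) * v (\<ominus> \<one>) = 1" by simp
  then have "v (\<ominus> \<one>) = 1" using v_nonneg[of "\<ominus> \<one>"] 
    by (metis a_inv_closed abs_of_nonneg one_closed real_sqrt_abs2 real_sqrt_one)
  then show ?thesis using x v_mult[of "\<ominus> \<one>" x] by (simp add: l_minus)
qed

lemma v_diff_commute: "x \<in> carrier K \<Longrightarrow> y \<in> carrier K \<Longrightarrow> v (x \<ominus> y) = v (y \<ominus> x)"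
  using v_uminus[of "x \<ominus> y"] by (simp add: minus_eq minus_add a_comm)

lemma v_add_le: "x \<in> carrier K \<Longrightarrow> y \<in> carrier K \<Longrightarrow> v (x \<oplus> y) \<le> v x + v y"
  using v_ultra[of x y] v_nonneg[of x] v_nonneg[of y] by linarith

lemma v_rev_triangle:
  assumes "x \<in> carrier K" "y \<in> carrier K" shows "\<bar>v x - v y\<bar> \<le> v (x \<ominus> y)"
proof -
  have "(x \<ominus> y) \<oplus> y = x" "(y \<ominus> x) \<oplus> x = y" using assms by algebra+
  then have "v x \<le> v (x \<ominus> y) + v y" "v y \<le> v (y \<ominus> x) + v x"
    using assms v_add_le[of "x \<ominus> y" y] v_add_le[of "y \<ominus> x" x] by simp_all
  with v_diff_commute[OF assms] show ?thesis by auto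
qed

text \<open>In an ultrametric triangle the two longest sides are equal. This rigidity makes the
  values of a Cauchy sequence stabilise instead of merely converge.\<close>

lemma v_eq_of_close:
  assumes "x \<in> carrier K" "y \<in> carrier K" "v (x \<ominus> y) < v y" shows "v x = v y"
proof -
  have "(x \<ominus> y) \<oplus> y = x" "(y \<ominus> x) \<oplus> x = y" using assms by algebra+
  then have "v x \<le> max (v (x \<ominus> y)) (v y)" "v y \<le> max (v (y \<ominus> x)) (v x)"
    using assms v_ultra[of "x \<ominus> y" y] v_ultra[of "y \<ominus> x" x] by simp_all
  with v_diff_commute[OF assms(1,2)] assms(3) show ?thesis by auto
qed

section \<open>Cauchy sequences and the ideal of null sequences\<close>

lemma in_C_iff: "s \<in> carrier C \<longleftrightarrow> (\<exists>L\<in>Ls. range s \<subseteq> L) \<and> cauchy_seq K v s"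
  by (simp add: cauchy_ring_def)

lemma C_closed [simp]: "s \<in> carrier C \<Longrightarrow> s n \<in> carrier K"
  using Ls_subfield subfieldE(3) unfolding in_C_iff by blast

lemma cauchyD:
  "s \<in> carrier C \<Longrightarrow> e > 0 \<Longrightarrow> \<exists>N0. \<forall>m\<ge>N0. \<forall>n\<ge>N0. v (s m \<ominus> s n) < e"
  by (simp add: in_C_iff cauchy_seq_def)

text \<open>This is where directedness of \<open>Ls\<close> enters: sums and products of two
  sequences must again take their values in a single member.\<close>

lemma common_subfield:
  assumes "s \<in> carrier C" "t \<in> carrier C"
  obtains L where "L \<in> Ls" "range s \<subseteq> L" "range t \<subseteq> L"
  using assms Ls_directed unfolding in_C_iff by (meson subset_trans)

lemma C_bounded:
  assumes s: "s \<in> carrier C" shows "\<exists>B>0. \<forall>n. v (s n) \<le> B"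
proof -
  obtain N0 where N0: "\<And>m n. m \<ge> N0 \<Longrightarrow> n \<ge> N0 \<Longrightarrow> v (s m \<ominus> s n) < 1"
    using cauchyD[OF s, of 1] by auto
  \<comment> \<open>The maximum covers the indices up to \<open>N0\<close>; later values differ from
    \<open>v (s N0)\<close> by less than 1, which the summand 1 absorbs. The 0 makes positivity
    evident.\<close>
  define B where "B = max (Max ((\<lambda>n. v (s n)) ` {..N0})) 0 + 1"
  have le: "v (s n) \<le> B - 1" if "n \<le> N0" for n
    unfolding B_def using that by (simp add: le_max_iff_disj)
  have "v (s n) \<le> B" for n
  proof (cases "n \<le> N0")
    case True then show ?thesis using le[of n] by simp
  next
    case False
    then have "v (s n \<ominus> s N0) < 1" using N0 by simp
    then show ?thesis using v_rev_triangle[of "s n" "s N0"] s le[of N0] by auto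
  qed
  moreover have "B > 0" unfolding B_def by (simp add: add_pos_nonneg add_nonneg_pos)
  ultimately show ?thesis by blast
qed

lemma C_const [simp]: assumes "x \<in> carrier K" shows "(\<lambda>n. x) \<in> carrier C"
proof -
  obtain L where "L \<in> Ls" "x \<in> L" using assms Ls_cover by blast
  then show ?thesis using assms unfolding in_C_iff cauchy_seq_def
    by (auto simp: minus_eq r_neg)
qed

lemma C_add: assumes s: "s \<in> carrier C" and t: "t \<in> carrier C"
  shows "(\<lambda>n. s n \<oplus> t n) \<in> carrier C"
proof -
  obtain L where L: "L \<in> Ls" "range s \<subseteq> L" "range t \<subseteq> L" using common_subfield[OF s t] .
  have "range (\<lambda>n. s n \<oplus> t n) \<subseteq> L"
    using L subringE(7)[OF subfieldE(1)[OF Ls_subfield[OF L(1)]]] by auto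
  moreover have "cauchy_seq K v (\<lambda>n. s n \<oplus> t n)" unfolding cauchy_seq_def
  proof (intro allI impI)
    fix e :: real assume "e > 0"
    then obtain N1 N2 where 1: "\<And>m n. m \<ge> N1 \<Longrightarrow> n \<ge> N1 \<Longrightarrow> v (s m \<ominus> s n) < e"
      and 2: "\<And>m n. m \<ge> N2 \<Longrightarrow> n \<ge> N2 \<Longrightarrow> v (t m \<ominus> t n) < e"
      using cauchyD s t by metis
    have "v ((s m \<oplus> t m) \<ominus> (s n \<oplus> t n)) < e" if "m \<ge> max N1 N2" "n \<ge> max N1 N2" for m n
    proof -
      have "(s m \<oplus> t m) \<ominus> (s n \<oplus> t n) = (s m \<ominus> s n) \<oplus> (t m \<ominus> t n)"
        using C_closed[OF s, of m] C_closed[OF s, of n] C_closed[OF t, of m] C_closed[OF t, of n]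
        by algebra
      then show ?thesis using 1[of m n] 2[of m n] that s t
          v_ultra[of "s m \<ominus> s n" "t m \<ominus> t n"] by auto
    qed
    then show "\<exists>N. \<forall>m\<ge>N. \<forall>n\<ge>N. v (s m \<oplus> t m \<ominus> (s n \<oplus> t n)) < e" by blast
  qed
  ultimately show ?thesis using L unfolding in_C_iff by blast
qed

lemma C_mult: assumes s: "s \<in> carrier C" and t: "t \<in> carrier C"
  shows "(\<lambda>n. s n \<otimes> t n) \<in> carrier C"
proof -
  obtain L where L: "L \<in> Ls" "range s \<subseteq> L" "range t \<subseteq> L" using common_subfield[OF s t] .
  have "range (\<lambda>n. s n \<otimes> t n) \<subseteq> L"
    using L subringE(6)[OF subfieldE(1)[OF Ls_subfield[OF L(1)]]] by auto
  moreover have "cauchy_seq K v (\<lambda>n. s n \<otimes> t n)" unfolding cauchy_seq_def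
  proof (intro allI impI)
    fix e :: real assume e: "e > 0"
    obtain A B where A: "A > 0" "\<And>n. v (s n) \<le> A" and B: "B > 0" "\<And>n. v (t n) \<le> B"
      using C_bounded s t by metis
    from e A B obtain N1 N2 where 1: "\<And>m n. m \<ge> N1 \<Longrightarrow> n \<ge> N1 \<Longrightarrow> v (s m \<ominus> s n) < e / B"
      and 2: "\<And>m n. m \<ge> N2 \<Longrightarrow> n \<ge> N2 \<Longrightarrow> v (t m \<ominus> t n) < e / A"
      using cauchyD s t by (metis divide_pos_pos)
    have "v ((s m \<otimes> t m) \<ominus> (s n \<otimes> t n)) < e" if "m \<ge> max N1 N2" "n \<ge> max N1 N2" for m n
    proof -
      have eq: "(s m \<otimes> t m) \<ominus> (s n \<otimes> t n) = (s m \<ominus> s n) \<otimes> t m \<oplus> s n \<otimes> (t m \<ominus> t n)"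
        using C_closed[OF s, of m] C_closed[OF s, of n] C_closed[OF t, of m] C_closed[OF t, of n]
        by algebra
      have "v (s m \<ominus> s n) * v (t m) \<le> v (s m \<ominus> s n) * B" using s t B
        by (intro mult_left_mono) auto
      also have "\<dots> < e" using 1[of m n] that B by (simp add: field_simps)
      finally have a: "v (s m \<ominus> s n) * v (t m) < e" .
      have "v (s n) * v (t m \<ominus> t n) \<le> A * v (t m \<ominus> t n)" using s t A
        by (intro mult_right_mono) auto
      also have "\<dots> < e" using 2[of m n] that A by (simp add: field_simps)
      finally have b: "v (s n) * v (t m \<ominus> t n) < e" .
      show ?thesis using a b s t v_ultra[of "(s m \<ominus> s n) \<otimes> t m" "s n \<otimes> (t m \<ominus> t n)"]
        unfolding eq by auto
    qed
    then show "\<exists>N. \<forall>m\<ge>N. \<forall>n\<ge>N. v (s m \<otimes> t m \<ominus> (s n \<otimes> t n)) < e" by blast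
  qed
  ultimately show ?thesis using L unfolding in_C_iff by blast
qed

lemma C_ops [simp]:
  "\<zero>\<^bsub>C\<^esub> = (\<lambda>n. \<zero>)" "\<one>\<^bsub>C\<^esub> = (\<lambda>n. \<one>)"
  "s \<oplus>\<^bsub>C\<^esub> t = (\<lambda>n. s n \<oplus> t n)" "s \<otimes>\<^bsub>C\<^esub> t = (\<lambda>n. s n \<otimes> t n)"
  by (simp_all add: cauchy_ring_def)

lemma C_uminus: assumes "s \<in> carrier C" shows "(\<lambda>n. \<ominus> s n) \<in> carrier C"
  using C_mult[OF C_const[of "\<ominus> \<one>"] assms] assms by (simp add: l_minus)

lemma C_cring: "cring C"
proof (intro cringI abelian_groupI comm_monoidI)
  fix s assume "s \<in> carrier C"
  then show "\<exists>y\<in>carrier C. y \<oplus>\<^bsub>C\<^esub> s = \<zero>\<^bsub>C\<^esub>"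
    by (intro bexI[of _ "\<lambda>n. \<ominus> s n"] C_uminus) (auto simp: l_neg)
qed (auto simp: C_add C_mult a_ac m_ac l_distr r_distr intro!: ext)

sublocale C: cring C by (rule C_cring)

lemma C_a_inv [simp]: "s \<in> carrier C \<Longrightarrow> \<ominus>\<^bsub>C\<^esub> s = (\<lambda>n. \<ominus> s n)"
  by (rule C.minus_equality) (auto simp: C_uminus l_neg)

lemma C_minus [simp]: "s \<in> carrier C \<Longrightarrow> t \<in> carrier C \<Longrightarrow> s \<ominus>\<^bsub>C\<^esub> t = (\<lambda>n. s n \<ominus> t n)"
  by (simp add: a_minus_def)

lemma in_N_iff: "s \<in> N \<longleftrightarrow> s \<in> carrier C \<and> (\<lambda>n. v (s n)) \<longlonglongrightarrow> 0"
  by (auto simp: null_seqs_def)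

lemma N_ideal: "ideal N C"
proof (rule idealI[OF C.ring_axioms])
  show "subgroup N (add_monoid C)"
  proof (rule C.add.subgroupI)
    fix s t assume st: "s \<in> N" "t \<in> N"
    then have "(\<lambda>n. v (s n) + v (t n)) \<longlonglongrightarrow> 0" unfolding in_N_iff
      using tendsto_add[of "\<lambda>n. v (s n)" 0 sequentially "\<lambda>n. v (t n)" 0] by auto
    then have "(\<lambda>n. v (s n \<oplus> t n)) \<longlonglongrightarrow> 0"
      by (rule Lim_null_comparison[rotated]) (use st in \<open>auto simp: in_N_iff v_add_le\<close>)
    then show "s \<oplus>\<^bsub>C\<^esub> t \<in> N" using st by (auto simp: in_N_iff C_add)
  next
    fix s assume s: "s \<in> N"
    then have "(\<lambda>n. v (\<ominus> s n)) = (\<lambda>n. v (s n))" by (auto simp: in_N_iff)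
    then show "\<ominus>\<^bsub>C\<^esub> s \<in> N" using s by (auto simp: in_N_iff C_uminus)
  next
    have "(\<lambda>n. \<zero>) \<in> N" by (simp add: in_N_iff)
    then show "N \<noteq> {}" by blast
  qed (auto simp: in_N_iff)
next
  fix s t assume st: "s \<in> N" "t \<in> carrier C"
  then obtain B where B: "B > 0" "\<And>n. v (t n) \<le> B" using C_bounded by blast
  have "(\<lambda>n. B * v (s n)) \<longlonglongrightarrow> 0" using st tendsto_mult_right_zero unfolding in_N_iff by blast
  then have "(\<lambda>n. v (t n \<otimes> s n)) \<longlonglongrightarrow> 0"
    by (rule Lim_null_comparison[rotated])
      (use st B in \<open>auto simp: in_N_iff abs_mult intro!: mult_right_mono always_eventually\<close>)
  then show 1: "t \<otimes>\<^bsub>C\<^esub> s \<in> N" using st by (auto simp: in_N_iff C_mult)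
  show "s \<otimes>\<^bsub>C\<^esub> t \<in> N" using 1 st C.m_comm[of s t] by (simp add: in_N_iff)
qed

sublocale N: ideal N C by (rule N_ideal)

section \<open>The completion as a field\<close>

lemma Q_cring: "cring Q"
  unfolding completion_def by (rule N.quotient_is_cring[OF C_cring])

lemma cl_hom: "cl \<in> ring_hom C Q"
  unfolding completion_def by (rule N.rcos_ring_hom)

lemma Q_carrier: "carrier Q = cl ` carrier C"
  by (auto simp: completion_def FactRing_def A_RCOSETS_def')

lemma cl_closed [simp]: "s \<in> carrier C \<Longrightarrow> cl s \<in> carrier Q"
  by (simp add: Q_carrier)

lemma cl_eq_iff:
  "s \<in> carrier C \<Longrightarrow> t \<in> carrier C \<Longrightarrow> cl s = cl t \<longleftrightarrow> (\<lambda>n. s n \<ominus> t n) \<in> N"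
  using N.a_rcos_module_minus[OF C.ring_axioms, of t s] N.a_repr_independence'[of s t]
    N.a_rcos_self[of s] C_minus[of s t] by auto

lemma cl_add: "s \<in> carrier C \<Longrightarrow> t \<in> carrier C \<Longrightarrow> cl s \<oplus>\<^bsub>Q\<^esub> cl t = cl (\<lambda>n. s n \<oplus> t n)"
  using ring_hom_add[OF cl_hom, of s t] by simp

lemma cl_mult: "s \<in> carrier C \<Longrightarrow> t \<in> carrier C \<Longrightarrow> cl s \<otimes>\<^bsub>Q\<^esub> cl t = cl (\<lambda>n. s n \<otimes> t n)"
  using ring_hom_mult[OF cl_hom, of s t] by simp

lemma cl_one: "\<one>\<^bsub>Q\<^esub> = cl (\<lambda>n. \<one>)"
  using ring_hom_one[OF cl_hom] by simp

lemma cl_zero: "\<zero>\<^bsub>Q\<^esub> = cl (\<lambda>n. \<zero>)"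
  using N.a_rcos_const[OF N.zero_closed] by (simp add: completion_def FactRing_def)

lemma cl_zero_iff: "s \<in> carrier C \<Longrightarrow> cl s = \<zero>\<^bsub>Q\<^esub> \<longleftrightarrow> s \<in> N"
  using cl_eq_iff[of s "\<lambda>n. \<zero>"] by (simp add: cl_zero minus_eq)

text \<open>A sequence that is not null has values at least some \<open>e\<close> arbitrarily far
  out. Once all differences are below \<open>e\<close>, a single such term fixes every later value,
  by \<open>v_eq_of_close\<close>.\<close>

lemma eventually_const:
  assumes s: "s \<in> carrier C" "s \<notin> N"
  shows "\<exists>N0. v (s N0) > 0 \<and> (\<forall>n\<ge>N0. v (s n) = v (s N0))"
proof -
  have "\<not> (\<lambda>n. v (s n)) \<longlonglongrightarrow> 0" using s by (simp add: in_N_iff)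
  then obtain e where e: "e > 0" "\<And>N. \<exists>n\<ge>N. v (s n) \<ge> e"
    unfolding LIMSEQ_def using s by (auto simp: dist_real_def not_less)
  obtain N1 where N1: "\<And>m n. m \<ge> N1 \<Longrightarrow> n \<ge> N1 \<Longrightarrow> v (s m \<ominus> s n) < e"
    using cauchyD[OF s(1) e(1)] by auto
  obtain N0 where N0: "N0 \<ge> N1" "v (s N0) \<ge> e" using e(2) by blast
  have "v (s n) = v (s N0)" if "n \<ge> N0" for n
    using N1[of n N0] N0 that s by (intro v_eq_of_close) auto
  moreover have "v (s N0) > 0" using N0 e by linarith
  ultimately show ?thesis by blast
qed

lemma C_inverse:
  assumes s: "s \<in> carrier C" "s \<notin> N"
  shows "\<exists>t\<in>carrier C. cl s \<otimes>\<^bsub>Q\<^esub> cl t = \<one>\<^bsub>Q\<^esub>"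
proof -
  obtain N0 where N0: "v (s N0) > 0" "\<And>n. n \<ge> N0 \<Longrightarrow> v (s n) = v (s N0)"
    using eventually_const[OF s] by blast
  define r where "r = v (s N0)"
  have nz: "s n \<noteq> \<zero>" if "n \<ge> N0" for n using N0(1) N0(2)[OF that] s(1) by auto
  \<comment> \<open>Only terms before \<open>N0\<close> can vanish. Giving the inverse the value
    zero there keeps it inside \<open>L\<close>, and a finite initial segment does not affect the
    class.\<close>
  define t where "t = (\<lambda>n. if s n = \<zero> then \<zero> else inv (s n))"
  have tK [simp]: "t n \<in> carrier K" for n using s(1) field_Units by (auto simp: t_def)
  obtain L where L: "L \<in> Ls" "range s \<subseteq> L" using s by (auto simp: in_C_iff)
  have "range t \<subseteq> L"
    using L subfield_m_inv(1)[OF Ls_subfield[OF L(1)]] subringE(2)[OF subfieldE(1)[OF Ls_subfield[OF L(1)]]]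
    by (auto simp: t_def)
  moreover have "cauchy_seq K v t" unfolding cauchy_seq_def
  proof (intro allI impI)
    fix e :: real assume e: "e > 0"
    \<comment> \<open>The inverses of two late terms differ by a quantity of value
      \<open>v (s n \<ominus> s m) / (r * r)\<close>, whence this tolerance.\<close>
    have "0 < e * (r * r)" using e N0(1) by (simp add: r_def)
    then obtain N1 where N1: "\<And>m n. m \<ge> N1 \<Longrightarrow> n \<ge> N1 \<Longrightarrow> v (s m \<ominus> s n) < e * (r * r)"
      using cauchyD[OF s(1)] by blast
    have "v (t m \<ominus> t n) < e" if mn: "m \<ge> max N0 N1" "n \<ge> max N0 N1" for m n
    proof -
      have nz': "s m \<noteq> \<zero>" "s n \<noteq> \<zero>" using nz mn by auto
      have c: "s m \<in> carrier K" "s n \<in> carrier K" using s by auto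
      have "(t m \<ominus> t n) \<otimes> (s m \<otimes> s n) = (t m \<otimes> s m) \<otimes> s n \<ominus> (t n \<otimes> s n) \<otimes> s m"
        using tK[of m] tK[of n] c by algebra
      moreover have "t m \<otimes> s m = \<one>" "t n \<otimes> s n = \<one>" using nz' c field_Units by (auto simp: t_def)
      ultimately have "v ((t m \<ominus> t n) \<otimes> (s m \<otimes> s n)) = v (s n \<ominus> s m)" using c by simp
      then have "v (t m \<ominus> t n) * (v (s m) * v (s n)) = v (s n \<ominus> s m)" using c by simp
      then have "v (t m \<ominus> t n) * (r * r) < e * (r * r)"
        using N1[of n m] mn N0(2)[of m] N0(2)[of n] by (simp add: r_def)
      then show ?thesis using N0(1) unfolding r_def[symmetric]
        by (simp add: mult_less_cancel_right_pos)
    qed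
    then show "\<exists>N. \<forall>m\<ge>N. \<forall>n\<ge>N. v (t m \<ominus> t n) < e" by blast
  qed
  ultimately have t: "t \<in> carrier C" using L unfolding in_C_iff by blast
  have "s n \<otimes> t n \<ominus> \<one> = \<zero>" if "n \<ge> N0" for n
    using nz[OF that] s field_Units by (simp add: t_def minus_eq r_neg)
  then have "eventually (\<lambda>n. v (s n \<otimes> t n \<ominus> \<one>) = 0) sequentially"
    unfolding eventually_sequentially by (intro exI[of _ N0]) simp
  then have "(\<lambda>n. s n \<otimes> t n \<ominus> \<one>) \<in> N"
    using s t C.minus_closed[OF C_mult[OF s(1) t], of "\<lambda>n. \<one>"]
    by (auto simp: in_N_iff C_mult intro: tendsto_eventually)
  then show ?thesis using s t by (intro bexI[of _ t]) (auto simp: cl_mult cl_one cl_eq_iff C_mult)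
qed

lemma Q_field: "field Q"
proof -
  interpret Q: cring Q by (rule Q_cring)
  show ?thesis
  proof (rule Q.cring_fieldI2)
    have "(\<lambda>n. \<one>) \<notin> N" by (simp add: in_N_iff LIMSEQ_const_iff)
    then show "\<zero>\<^bsub>Q\<^esub> \<noteq> \<one>\<^bsub>Q\<^esub>" using cl_zero_iff[of "\<lambda>n. \<one>"] by (simp add: cl_one)
  next
    fix a assume a: "a \<in> carrier Q" "a \<noteq> \<zero>\<^bsub>Q\<^esub>"
    then obtain s where "s \<in> carrier C" "a = cl s" by (auto simp: Q_carrier)
    then show "\<exists>b\<in>carrier Q. a \<otimes>\<^bsub>Q\<^esub> b = \<one>\<^bsub>Q\<^esub>"
      using C_inverse[of s] a cl_zero_iff[of s] by (metis cl_closed)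
  qed
qed

sublocale Q: field Q by (rule Q_field)

lemma cl_minus:
  assumes "s \<in> carrier C" "t \<in> carrier C" shows "cl s \<ominus>\<^bsub>Q\<^esub> cl t = cl (\<lambda>n. s n \<ominus> t n)"
proof -
  have "cl (\<lambda>n. s n \<ominus> t n) \<oplus>\<^bsub>Q\<^esub> cl t = cl (\<lambda>n. s n \<ominus> t n \<oplus> t n)"
    using assms C.minus_closed[OF assms] by (simp add: cl_add)
  also have "(\<lambda>n. s n \<ominus> t n \<oplus> t n) = s" using assms by (auto simp: minus_eq a_assoc l_neg)
  finally have e: "cl s = cl (\<lambda>n. s n \<ominus> t n) \<oplus>\<^bsub>Q\<^esub> cl t" ..
  have "cl (\<lambda>n. s n \<ominus> t n) \<in> carrier Q" using assms C.minus_closed[OF assms] by simp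
  then show ?thesis unfolding e using assms
    by (simp add: Q.minus_eq Q.a_assoc Q.r_neg)
qed

lemma embed_eq: "completion_embed K Ls v x = cl (\<lambda>n. x)"
  by (simp add: completion_embed_def)

lemma embed_hom: "completion_embed K Ls v \<in> ring_hom K Q"
  by (rule ring_hom_memI) (auto simp: embed_eq cl_add cl_mult cl_one)

section \<open>The absolute value on the completion\<close>

lemma v_lim_unique_class:
  assumes "s \<in> carrier C" "t \<in> carrier C" "(\<lambda>n. s n \<ominus> t n) \<in> N" "(\<lambda>n. v (s n)) \<longlonglongrightarrow> l"
  shows "(\<lambda>n. v (t n)) \<longlonglongrightarrow> l"
proof -
  have "(\<lambda>n. v (t n) - v (s n)) \<longlonglongrightarrow> 0"
  proof (rule Lim_null_comparison[OF always_eventually])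
    show "\<forall>n. Real_Vector_Spaces.norm (v (t n) - v (s n)) \<le> v (s n \<ominus> t n)"
      using v_rev_triangle assms by (metis C_closed abs_minus_commute real_norm_def)
    show "(\<lambda>n. v (s n \<ominus> t n)) \<longlonglongrightarrow> 0" using assms(3) by (simp add: in_N_iff)
  qed
  from tendsto_add[OF this assms(4)] show ?thesis by simp
qed

lemma v_lim_exists: assumes "s \<in> carrier C" shows "\<exists>l. (\<lambda>n. v (s n)) \<longlonglongrightarrow> l"
proof (cases "s \<in> N")
  case False
  then obtain N0 where "\<forall>n\<ge>N0. v (s n) = v (s N0)" using eventually_const assms by blast
  then have "eventually (\<lambda>n. v (s n) = v (s N0)) sequentially"
    unfolding eventually_sequentially by blast
  then show ?thesis by (blast intro: tendsto_eventually)
qed (auto simp: in_N_iff)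

lemma in_cl_iff: assumes "s \<in> carrier C"
  shows "t \<in> cl s \<longleftrightarrow> t \<in> carrier C \<and> (\<lambda>n. s n \<ominus> t n) \<in> N"
  using assms cl_eq_iff[of s t] N.a_rcos_self[of t] N.a_repr_independence'[of t s]
    N.a_elemrcos_carrier[OF assms, of t] by auto

lemma cnorm_lim:
  assumes s: "s \<in> carrier C" shows "(\<lambda>n. v (s n)) \<longlonglongrightarrow> cnorm (cl s)"
proof -
  obtain l where l: "(\<lambda>n. v (s n)) \<longlonglongrightarrow> l" using v_lim_exists[OF s] by blast
  have "cnorm (cl s) = l" unfolding cnorm_def
  proof (rule the_equality)
    show "\<forall>t\<in>cl s. (\<lambda>n. v (t n)) \<longlonglongrightarrow> l" using v_lim_unique_class[OF s _ _ l] in_cl_iff[OF s] by blast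
    fix r assume "\<forall>t\<in>cl s. (\<lambda>n. v (t n)) \<longlonglongrightarrow> r"
    then have "(\<lambda>n. v (s n)) \<longlonglongrightarrow> r" using N.a_rcos_self[OF s] by blast
    then show "r = l" using l LIMSEQ_unique by blast
  qed
  with l show ?thesis by simp
qed

lemma cnorm_eqI: "s \<in> carrier C \<Longrightarrow> (\<lambda>n. v (s n)) \<longlonglongrightarrow> l \<Longrightarrow> cnorm (cl s) = l"
  using cnorm_lim LIMSEQ_unique by blast

lemma cnorm_nonneg: "x \<in> carrier Q \<Longrightarrow> 0 \<le> cnorm x"
  by (auto simp: Q_carrier intro!: LIMSEQ_le_const[OF cnorm_lim])

lemma cnorm_zero_iff: "x \<in> carrier Q \<Longrightarrow> cnorm x = 0 \<longleftrightarrow> x = \<zero>\<^bsub>Q\<^esub>"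
proof -
  assume "x \<in> carrier Q"
  then obtain s where s: "s \<in> carrier C" "x = cl s" by (auto simp: Q_carrier)
  show ?thesis using cnorm_lim[OF s(1)] cnorm_eqI[OF s(1), of 0] cl_zero_iff[OF s(1)] s
    by (auto simp: in_N_iff)
qed

lemma cnorm_mult: "x \<in> carrier Q \<Longrightarrow> y \<in> carrier Q \<Longrightarrow> cnorm (x \<otimes>\<^bsub>Q\<^esub> y) = cnorm x * cnorm y"
  by (auto simp: Q_carrier cl_mult C_mult intro!: cnorm_eqI tendsto_mult cnorm_lim)

lemma cnorm_ultra: 
  assumes "x \<in> carrier Q" "y \<in> carrier Q" shows "cnorm (x \<oplus>\<^bsub>Q\<^esub> y) \<le> max (cnorm x) (cnorm y)"
proof -
  obtain s t where st: "s \<in> carrier C" "t \<in> carrier C" and xy: "x = cl s" "y = cl t"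
    using assms by (auto simp: Q_carrier)
  have "cnorm (cl (\<lambda>n. s n \<oplus> t n)) \<le> max (cnorm x) (cnorm y)" unfolding xy
    by (rule LIMSEQ_le[OF cnorm_lim tendsto_max[OF cnorm_lim cnorm_lim]])
      (use st in \<open>auto simp: C_add intro!: v_ultra\<close>)
  then show ?thesis using st by (simp add: xy cl_add)
qed

lemma cnorm_embed: "x \<in> carrier K \<Longrightarrow> cnorm (completion_embed K Ls v x) = v x"
  by (auto simp: embed_eq intro!: cnorm_eqI)

text \<open>As values stabilise along a representative, the completion has the same value group as
  the field. For the p-adic numbers this yields norms that are integral powers of
  \<open>p\<close>.\<close>

lemma cnorm_value:
  assumes "x \<in> carrier Q" "x \<noteq> \<zero>\<^bsub>Q\<^esub>" shows "\<exists>a\<in>carrier K. a \<noteq> \<zero> \<and> cnorm x = v a"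
proof -
  obtain s where s: "s \<in> carrier C" "x = cl s" using assms by (auto simp: Q_carrier)
  then obtain N0 where N0: "v (s N0) > 0" "\<forall>n\<ge>N0. v (s n) = v (s N0)"
    using eventually_const cl_zero_iff assms by metis
  then have "eventually (\<lambda>n. v (s n) = v (s N0)) sequentially"
    unfolding eventually_sequentially by blast
  then have "cnorm x = v (s N0)" unfolding s by (intro cnorm_eqI s(1) tendsto_eventually)
  then show ?thesis using s N0 v_zero_iff[of "s N0"] C_closed[OF s(1)] by (metis less_irrefl)
qed

lemma embed_dense:
  assumes "x \<in> carrier Q" "e > 0"
  shows "\<exists>a\<in>carrier K. cnorm (x \<ominus>\<^bsub>Q\<^esub> completion_embed K Ls v a) < e"
proof -
  obtain s where s: "s \<in> carrier C" "x = cl s" using assms by (auto simp: Q_carrier)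
  \<comment> \<open>A limit of values below \<open>e / 2\<close> is known to be at most
    \<open>e / 2\<close>; the halving restores the strict inequality.\<close>
  obtain N1 where N1: "\<And>m n. m \<ge> N1 \<Longrightarrow> n \<ge> N1 \<Longrightarrow> v (s m \<ominus> s n) < e / 2"
    using cauchyD[OF s(1), of "e / 2"] assms(2) by auto
  have a: "s N1 \<in> carrier K" using s by simp
  have C: "(\<lambda>n. s n \<ominus> s N1) \<in> carrier C" using C.minus_closed[OF s(1) C_const[OF a]] s a by simp
  have "cnorm (cl (\<lambda>n. s n \<ominus> s N1)) \<le> e / 2"
    by (rule LIMSEQ_le_const2[OF cnorm_lim[OF C]]) (use N1 less_imp_le in blast)
  then show ?thesis using a s assms(2)
    by (intro bexI[of _ "s N1"]) (auto simp: embed_eq cl_minus)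
qed

end

section \<open>The p-adic numbers\<close>

lemma rat_field_simps [simp]:
  "carrier rat_field = UNIV" "x \<otimes>\<^bsub>rat_field\<^esub> y = x * y" "x \<oplus>\<^bsub>rat_field\<^esub> y = x + y"
  "\<one>\<^bsub>rat_field\<^esub> = 1" "\<zero>\<^bsub>rat_field\<^esub> = 0"
  by (simp_all add: ring_of_type_algebra_def)

lemma rat_field_field: "field rat_field"
  by (rule field_from_type_algebra)

lemma rat_field_a_inv [simp]: "\<ominus>\<^bsub>rat_field\<^esub> x = - x"
proof -
  interpret field rat_field by (rule rat_field_field)
  show ?thesis by (rule minus_equality) auto
qed

locale padic =
  fixes p :: nat
  assumes prime_p: "Factorial_Ring.prime p"
begin

lemma prime_elem_p: "prime_elem (int p)" "\<not> is_unit (int p)"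
  using prime_p by auto

lemma p_gt: "p > 0" "p > 1" "real p > 1"
  using prime_gt_1_nat[OF prime_p] by auto

text \<open>\<open>padic_abs\<close> is defined through the reduced fraction. Cross-multiplying with
  it and comparing multiplicities of \<open>p\<close> frees the formula from reducedness, so that
  common denominators may be used.\<close>

lemma padic_abs_frac:
  assumes "a \<noteq> 0" "b \<noteq> 0"
  shows "padic_abs p (of_int a / of_int b) =
    real p powi (int (multiplicity (int p) b) - int (multiplicity (int p) a))"
proof -
  define x :: rat where "x = of_int a / of_int b"
  obtain n d where nd: "quotient_of x = (n, d)" by (cases "quotient_of x")
  have d: "d \<noteq> 0" using quotient_of_denom_pos[OF nd] by simp
  have x: "x = of_int n / of_int d" using quotient_of_div[OF nd] .
  have nz: "x \<noteq> 0" using assms by (simp add: x_def)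
  then have n: "n \<noteq> 0" using x by auto
  have "(of_int (a * d) :: rat) = of_int (n * b)"
    using x assms d by (simp add: x_def field_simps)
  then have "a * d = n * b" by (simp only: of_int_eq_iff)
  then have "multiplicity (int p) (a * d) = multiplicity (int p) (n * b)" by simp
  then have "multiplicity (int p) a + multiplicity (int p) d = multiplicity (int p) n + multiplicity (int p) b"
    using assms d n prime_elem_p by (simp add: prime_elem_multiplicity_mult_distrib)
  then have "int (multiplicity (int p) d) - int (multiplicity (int p) n) =
    int (multiplicity (int p) b) - int (multiplicity (int p) a)" by linarith
  then show ?thesis using nz nd by (simp add: padic_abs_def x_def)
qed

lemma padic_abs_int: "a \<noteq> 0 \<Longrightarrow> padic_abs p (of_int a) = real p powi (- int (multiplicity (int p) a))"
  using padic_abs_frac[of a 1] by simp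

lemma padic_abs_zero [simp]: "padic_abs p 0 = 0"
  by (simp add: padic_abs_def)

lemma padic_abs_int_le:
  assumes "int p ^ k dvd a" shows "padic_abs p (of_int a) \<le> real p powi (- int k)"
proof (cases "a = 0")
  case False
  then have "k \<le> multiplicity (int p) a" using assms prime_elem_p by (intro multiplicity_geI) auto
  then show ?thesis using False p_gt by (simp add: padic_abs_int power_int_increasing)
qed (use p_gt in auto)

lemma obtain_frac:
  fixes x :: rat obtains a b where "b \<noteq> 0" "coprime a b" "x = of_int a / of_int b"
proof -
  obtain n d where nd: "quotient_of x = (n, d)" by (cases "quotient_of x")
  show ?thesis using that[of d n] quotient_of_denom_pos[OF nd] quotient_of_div[OF nd]
      quotient_of_coprime[OF nd] by simp
qed

lemma nonarch: "nonarch_field rat_field (padic_abs p) {UNIV}"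
proof -
  interpret field rat_field by (rule rat_field_field)
  have pos: "padic_abs p x \<ge> 0" for x using p_gt by (auto simp: padic_abs_def)
  show ?thesis
  proof (intro nonarch_field.intro rat_field_field nonarch_field_axioms.intro, goal_cases)
    case (1 x) show ?case by (rule pos)
  next
    case (2 x) show ?case using p_gt by (auto simp: padic_abs_def)
  next
    case (3 x y)
    obtain a b where ab: "b \<noteq> 0" "x = of_int a / of_int b" by (rule obtain_frac)
    obtain c d where cd: "d \<noteq> 0" "y = of_int c / of_int d" by (rule obtain_frac)
    show ?case
    proof (cases "a = 0 \<or> c = 0")
      case False
      have xy: "x * y = of_int (a * c) / of_int (b * d)" using ab cd by simp
      have "padic_abs p (x * y) = real p powi (int (multiplicity (int p) (b * d)) - int (multiplicity (int p) (a * c)))"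
        unfolding xy by (rule padic_abs_frac) (use False ab cd in auto)
      also have "\<dots> = real p powi ((int (multiplicity (int p) b) - int (multiplicity (int p) a)) +
          (int (multiplicity (int p) d) - int (multiplicity (int p) c)))"
        using False ab(1) cd(1) prime_elem_p
        by (simp add: prime_elem_multiplicity_mult_distrib algebra_simps)
      also have "\<dots> = padic_abs p x * padic_abs p y"
        using False ab cd p_gt by (simp add: padic_abs_frac power_int_add)
      finally show ?thesis by simp
    qed (use ab cd in auto)
  next
    case (4 x y)
    obtain a b where ab: "b \<noteq> 0" "x = of_int a / of_int b" by (rule obtain_frac)
    obtain c d where cd: "d \<noteq> 0" "y = of_int c / of_int d" by (rule obtain_frac)
    \<comment> \<open>Over a common denominator the ultrametric inequality becomes a statement about
      the multiplicity of \<open>p\<close> in a sum of integers.\<close>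
    have x: "x = of_int (a * d) / of_int (b * d)" and y: "y = of_int (c * b) / of_int (b * d)"
      using ab cd by (simp_all add: field_simps)
    have xy: "x + y = of_int (a * d + c * b) / of_int (b * d)" unfolding x y
      by (simp add: add_divide_distrib)
    show ?case
    proof (cases "a = 0 \<or> c = 0 \<or> a * d + c * b = 0")
      case True
      moreover have "x + y = 0" if "a * d + c * b = 0" unfolding xy using that by (simp only: of_int_0 div_0)
      ultimately consider "x = 0" | "y = 0" | "x + y = 0" using ab cd by auto
      then show ?thesis using pos[of x] by cases (auto simp: le_max_iff_disj)
    next
      case False
      let ?m = "multiplicity (int p)"
      have nz: "a * d \<noteq> 0" "c * b \<noteq> 0" "b * d \<noteq> 0" "a * d + c * b \<noteq> 0" using False ab cd by auto
      have "int p ^ min (?m (a * d)) (?m (c * b)) dvd a * d + c * b"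
        by (intro dvd_add) (meson min.cobounded1 min.cobounded2 multiplicity_dvd')+
      then have ge: "?m (a * d + c * b) \<ge> min (?m (a * d)) (?m (c * b))"
        using nz prime_elem_p by (intro multiplicity_geI) auto
      have "padic_abs p (x + y) = real p powi (int (?m (b * d)) - int (?m (a * d + c * b)))"
        unfolding xy using nz by (intro padic_abs_frac)
      also have "\<dots> \<le> max (real p powi (int (?m (b * d)) - int (?m (a * d))))
                          (real p powi (int (?m (b * d)) - int (?m (c * b))))"
        using ge p_gt by (cases "?m (a * d) \<le> ?m (c * b)")
          (auto simp: le_max_iff_disj intro!: power_int_increasing)
      also have "\<dots> = max (padic_abs p x) (padic_abs p y)"
        unfolding x y padic_abs_frac[OF nz(1,3)] padic_abs_frac[OF nz(2,3)] ..
      finally show ?thesis by simp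
    qed
  qed (use carrier_is_subfield in auto)
qed

section \<open>The field Q_p and its norm\<close>

sublocale rat: nonarch_field rat_field "padic_abs p" "{UNIV}"
  by (rule nonarch)

abbreviation Qf where "Qf \<equiv> Qp p"
abbreviation emb where "emb \<equiv> completion_embed rat_field {UNIV} (padic_abs p)"
abbreviation nrm where "nrm \<equiv> padic_norm p"

sublocale Qp: field "Qp p"
  using rat.Q_field by (simp add: Qp_def)

lemma nrm_cnorm: "nrm = rat.cnorm"
  by (rule ext) (simp add: padic_norm_def rat.cnorm_def)

lemma nrm_nonneg: "x \<in> carrier Qf \<Longrightarrow> 0 \<le> nrm x"
  and nrm_zero_iff: "x \<in> carrier Qf \<Longrightarrow> nrm x = 0 \<longleftrightarrow> x = \<zero>\<^bsub>Qf\<^esub>"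
  and nrm_mult: "x \<in> carrier Qf \<Longrightarrow> y \<in> carrier Qf \<Longrightarrow> nrm (x \<otimes>\<^bsub>Qf\<^esub> y) = nrm x * nrm y"
  and nrm_ultra: "x \<in> carrier Qf \<Longrightarrow> y \<in> carrier Qf \<Longrightarrow> nrm (x \<oplus>\<^bsub>Qf\<^esub> y) \<le> max (nrm x) (nrm y)"
  and nrm_emb: "nrm (emb r) = padic_abs p r"
  and emb_hom: "emb \<in> ring_hom rat_field Qf"
  and emb_dense: "x \<in> carrier Qf \<Longrightarrow> e > 0 \<Longrightarrow> \<exists>a. nrm (x \<ominus>\<^bsub>Qf\<^esub> emb a) < e"
  using rat.cnorm_nonneg rat.cnorm_zero_iff rat.cnorm_mult rat.cnorm_ultra rat.cnorm_embed
    rat.embed_hom rat.embed_dense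
  by (auto simp: nrm_cnorm Qp_def)

lemma emb_closed [simp]: "emb r \<in> carrier Qf"
  using ring_hom_closed[OF emb_hom] by simp

lemma emb_add: "emb (r + s) = emb r \<oplus>\<^bsub>Qf\<^esub> emb s"
  and emb_mult: "emb (r * s) = emb r \<otimes>\<^bsub>Qf\<^esub> emb s"
  and emb_one: "emb 1 = \<one>\<^bsub>Qf\<^esub>"
  using ring_hom_add[OF emb_hom, of r s] ring_hom_mult[OF emb_hom, of r s] ring_hom_one[OF emb_hom]
  by simp_all

lemma emb_zero: "emb 0 = \<zero>\<^bsub>Qf\<^esub>"
  using nrm_zero_iff[of "emb 0"] by (simp add: nrm_emb)

lemma emb_diff: "emb (r - s) = emb r \<ominus>\<^bsub>Qf\<^esub> emb s"
proof -
  have "emb r = emb (r - s) \<oplus>\<^bsub>Qf\<^esub> emb s" by (simp flip: emb_add)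
  then show ?thesis by (simp add: Qp.minus_eq Qp.a_assoc Qp.r_neg)
qed

lemma emb_power: "emb (r ^ n) = emb r [^]\<^bsub>Qf\<^esub> n"
  by (induction n) (simp_all add: emb_one emb_mult power_Suc2 del: power_Suc)

lemma emb_of_nat_mult: "x \<in> carrier Qf \<Longrightarrow> emb (of_nat n) \<otimes>\<^bsub>Qf\<^esub> x = [n] \<cdot>\<^bsub>Qf\<^esub> x"
  by (induction n) (simp_all add: emb_zero emb_one emb_add Qp.l_distr Qp.a_comm)

lemma nrm_value:
  assumes "x \<in> carrier Qf" "x \<noteq> \<zero>\<^bsub>Qf\<^esub>" shows "\<exists>k::int. nrm x = real p powi k"
  using rat.cnorm_value[of x] assms by (auto simp: nrm_cnorm Qp_def padic_abs_def)

lemma nrm_one [simp]: "nrm \<one>\<^bsub>Qf\<^esub> = 1"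
  using nrm_emb[of 1] padic_abs_int[of 1] by (simp add: emb_one)

lemma nrm_uminus: "x \<in> carrier Qf \<Longrightarrow> nrm (\<ominus>\<^bsub>Qf\<^esub> x) = nrm x"
proof -
  assume x: "x \<in> carrier Qf"
  have "\<ominus>\<^bsub>Qf\<^esub> x = emb (- 1) \<otimes>\<^bsub>Qf\<^esub> x"
    using x emb_diff[of 0 1] by (simp add: emb_zero emb_one Qp.minus_eq Qp.l_minus)
  then show ?thesis using x padic_abs_int[of "-1"] by (simp add: nrm_mult nrm_emb)
qed

lemma nrm_ultra_diff: "x \<in> carrier Qf \<Longrightarrow> y \<in> carrier Qf \<Longrightarrow> nrm (x \<ominus>\<^bsub>Qf\<^esub> y) \<le> max (nrm x) (nrm y)"
  using nrm_ultra[of x "\<ominus>\<^bsub>Qf\<^esub> y"] by (simp add: Qp.minus_eq nrm_uminus)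

lemma nrm_inv: "x \<in> carrier Qf \<Longrightarrow> x \<noteq> \<zero>\<^bsub>Qf\<^esub> \<Longrightarrow> nrm (inv\<^bsub>Qf\<^esub> x) = 1 / nrm x"
  using nrm_mult[of x "inv\<^bsub>Qf\<^esub> x"] Qp.field_Units nrm_zero_iff[of x] by (simp add: field_simps)

section \<open>The ring Z_p and its uniformizer \<open>p\<close>\<close>

lemma Zp_set_iff: "x \<in> Zp_set p \<longleftrightarrow> x \<in> carrier Qf \<and> nrm x \<le> 1"
  by (simp add: Zp_set_def)

lemma Zp_subring: "subring (Zp_set p) Qf"
proof (rule Qp.subringI)
  fix x y assume xy: "x \<in> Zp_set p" "y \<in> Zp_set p"
  show "x \<otimes>\<^bsub>Qf\<^esub> y \<in> Zp_set p" using xy nrm_nonneg by (auto simp: Zp_set_iff nrm_mult intro!: mult_le_one)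
  show "x \<oplus>\<^bsub>Qf\<^esub> y \<in> Zp_set p" using xy nrm_ultra[of x y] by (auto simp: Zp_set_iff)
qed (auto simp: Zp_set_iff nrm_uminus)

sublocale Zp: domain "Zp p"
  unfolding Zp_def by (rule Qp.subring_is_domain[OF Zp_subring])

lemma Zp_simps [simp]:
  "carrier (Zp p) = Zp_set p" "x \<otimes>\<^bsub>Zp p\<^esub> y = x \<otimes>\<^bsub>Qf\<^esub> y" "x \<oplus>\<^bsub>Zp p\<^esub> y = x \<oplus>\<^bsub>Qf\<^esub> y"
  "\<one>\<^bsub>Zp p\<^esub> = \<one>\<^bsub>Qf\<^esub>" "\<zero>\<^bsub>Zp p\<^esub> = \<zero>\<^bsub>Qf\<^esub>"
  by (simp_all add: Zp_def)

lemma Zp_pow [simp]: "x [^]\<^bsub>Zp p\<^esub> (n::nat) = x [^]\<^bsub>Qf\<^esub> n"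
  by (induction n) auto

lemma Zp_add_pow [simp]: "[(n::nat)] \<cdot>\<^bsub>Zp p\<^esub> x = [n] \<cdot>\<^bsub>Qf\<^esub> x"
  by (induction n) (simp_all add: add_pow_def)

definition \<pi> where "\<pi> = emb (of_nat p)"

lemma nrm_pi: "nrm \<pi> = 1 / real p"
  unfolding \<pi>_def nrm_emb using padic_abs_int[of "int p"] p_gt prime_elem_p
  by (simp add: power_int_minus field_simps)

lemma pi_Zp: "\<pi> \<in> Zp_set p" and pi_nz: "\<pi> \<noteq> \<zero>\<^bsub>Qf\<^esub>"
  using nrm_pi p_gt nrm_zero_iff[of \<pi>] by (auto simp: Zp_set_iff \<pi>_def)

lemma pi_eq: "\<pi> = [p] \<cdot>\<^bsub>Zp p\<^esub> \<one>\<^bsub>Zp p\<^esub>"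
  using emb_of_nat_mult[of "\<one>\<^bsub>Qf\<^esub>" p] by (simp add: \<pi>_def)

lemma pi_carrier [simp]: "\<pi> \<in> carrier Qf" using pi_Zp by (simp add: Zp_set_iff)

lemma nrm_pi_pow: "nrm (\<pi> [^]\<^bsub>Qf\<^esub> (k::nat)) = real p powi (- int k)"
proof -
  have "nrm (\<pi> [^]\<^bsub>Qf\<^esub> k) = 1 / real p ^ k"
    by (induction k) (auto simp: nrm_mult nrm_pi)
  then show ?thesis by (simp add: power_int_minus field_simps)
qed

lemma pi_pow_nz: "\<pi> [^]\<^bsub>Qf\<^esub> (k::nat) \<noteq> \<zero>\<^bsub>Qf\<^esub>"
  using nrm_zero_iff[of "\<pi> [^]\<^bsub>Qf\<^esub> k"] p_gt by (simp add: nrm_pi_pow)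

lemma divide_pi_pow:
  assumes "x \<in> carrier Qf" "nrm x \<le> real p powi (- int k)"
  shows "\<exists>y\<in>Zp_set p. x = \<pi> [^]\<^bsub>Qf\<^esub> k \<otimes>\<^bsub>Qf\<^esub> y"
proof -
  let ?P = "\<pi> [^]\<^bsub>Qf\<^esub> k"
  have P: "?P \<in> carrier Qf" "?P \<in> Units Qf" using pi_pow_nz Qp.field_Units by auto
  have "nrm (inv\<^bsub>Qf\<^esub> ?P \<otimes>\<^bsub>Qf\<^esub> x) = nrm x / real p powi (- int k)"
    using P assms pi_pow_nz by (simp add: nrm_mult nrm_inv nrm_pi_pow)
  also have "\<dots> \<le> 1" using assms p_gt by simp
  finally have "inv\<^bsub>Qf\<^esub> ?P \<otimes>\<^bsub>Qf\<^esub> x \<in> Zp_set p" using assms P by (simp add: Zp_set_iff)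
  moreover have "x = ?P \<otimes>\<^bsub>Qf\<^esub> (inv\<^bsub>Qf\<^esub> ?P \<otimes>\<^bsub>Qf\<^esub> x)"
    using P assms by (simp add: Qp.m_assoc[symmetric])
  ultimately show ?thesis by blast
qed

lemma Zp_unit: assumes "x \<in> carrier Qf" "nrm x = 1" shows "x \<in> Units (Zp p)"
proof -
  have "x \<noteq> \<zero>\<^bsub>Qf\<^esub>" using assms nrm_zero_iff[of x] by auto
  then have "x \<in> Units Qf" "nrm (inv\<^bsub>Qf\<^esub> x) = 1" using assms Qp.field_Units by (auto simp: nrm_inv)
  then have "inv\<^bsub>Qf\<^esub> x \<otimes>\<^bsub>Qf\<^esub> x = \<one>\<^bsub>Qf\<^esub>" "x \<otimes>\<^bsub>Qf\<^esub> inv\<^bsub>Qf\<^esub> x = \<one>\<^bsub>Qf\<^esub>"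
    "inv\<^bsub>Qf\<^esub> x \<in> Zp_set p" "x \<in> Zp_set p" using assms by (simp_all add: Zp_set_iff)
  then show ?thesis unfolding Units_def by force
qed

lemma pi_not_unit: "\<pi> \<notin> Units (Zp p)"
proof
  assume "\<pi> \<in> Units (Zp p)"
  then obtain y where y: "y \<in> Zp_set p" "y \<otimes>\<^bsub>Qf\<^esub> \<pi> = \<one>\<^bsub>Qf\<^esub>" by (auto simp: Units_def)
  then have "nrm y * nrm \<pi> = 1" using nrm_mult[of y \<pi>] by (simp add: Zp_set_iff)
  then have "nrm y = real p" using p_gt by (simp add: nrm_pi field_simps)
  then show False using y p_gt by (simp add: Zp_set_iff)
qed

text \<open>The norm is an integral power of \<open>p\<close> that is at most 1, and its exponent
  supplies \<open>k\<close>. The remaining factor has norm 1 and is thus a unit.\<close>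

lemma Zp_factor:
  assumes "x \<in> Zp_set p" "x \<noteq> \<zero>\<^bsub>Qf\<^esub>"
  shows "\<exists>(k::nat) u. u \<in> Units (Zp p) \<and> x = \<pi> [^]\<^bsub>Zp p\<^esub> k \<otimes>\<^bsub>Zp p\<^esub> u"
proof -
  have x: "x \<in> carrier Qf" "nrm x \<le> 1" using assms by (auto simp: Zp_set_iff)
  obtain j where j: "nrm x = real p powi j" using nrm_value x assms by blast
  have "j \<le> 0"
  proof (rule ccontr)
    assume "\<not> j \<le> 0"
    then have "real p powi 0 < real p powi j" using p_gt by (intro power_int_strict_increasing) auto
    then show False using x j by simp
  qed
  define k where "k = nat (- j)"
  have jk: "j = - int k" using \<open>j \<le> 0\<close> by (simp add: k_def)
  obtain y where y: "y \<in> Zp_set p" "x = \<pi> [^]\<^bsub>Qf\<^esub> k \<otimes>\<^bsub>Qf\<^esub> y"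
    using divide_pi_pow[of x k] x j jk by auto
  have "nrm x = real p powi (- int k) * nrm y" using y by (simp add: Zp_set_iff nrm_mult nrm_pi_pow)
  then have "nrm y = 1" using j jk p_gt by simp
  then have "y \<in> Units (Zp p)" using y Zp_unit by (simp add: Zp_set_iff)
  then show ?thesis using y by auto
qed

text \<open>Representatives modulo \<open>p ^ k\<close> are the integers from 0 to
  \<open>p ^ k - 1\<close>: a p-adic integer is close to a rational number whose denominator is
  prime to \<open>p\<close>, and that denominator can be inverted modulo
  \<open>p ^ k\<close>.\<close>

lemma Zp_residues:
  "\<exists>S. finite S \<and> S \<subseteq> Zp_set p \<and>
     (\<forall>x\<in>Zp_set p. \<exists>c\<in>S. \<exists>y\<in>Zp_set p. x = c \<oplus>\<^bsub>Qf\<^esub> \<pi> [^]\<^bsub>Qf\<^esub> (k::nat) \<otimes>\<^bsub>Qf\<^esub> y)"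
proof -
  have int_Zp: "emb (of_int c) \<in> Zp_set p" for c
    using padic_abs_int_le[of 0 c] by (simp add: Zp_set_iff nrm_emb)
  define S where "S = (\<lambda>c. emb (of_int c)) ` {0..<int p ^ k}"
  have "\<exists>c\<in>S. \<exists>y\<in>Zp_set p. x = c \<oplus>\<^bsub>Qf\<^esub> \<pi> [^]\<^bsub>Qf\<^esub> k \<otimes>\<^bsub>Qf\<^esub> y" if xZ: "x \<in> Zp_set p" for x
  proof -
    have x: "x \<in> carrier Qf" "nrm x \<le> 1" using xZ by (auto simp: Zp_set_iff)
    define e where "e = real p powi (- int k)"
    have e: "0 < e" "e \<le> 1" using p_gt by (auto simp: e_def power_int_minus field_simps)
    obtain a where a: "nrm (x \<ominus>\<^bsub>Qf\<^esub> emb a) < e" using emb_dense[OF x(1) e(1)] by blast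
    have "emb a = x \<ominus>\<^bsub>Qf\<^esub> (x \<ominus>\<^bsub>Qf\<^esub> emb a)"
      using x(1) emb_closed[of a] by algebra
    then have "nrm (emb a) \<le> max (nrm x) (nrm (x \<ominus>\<^bsub>Qf\<^esub> emb a))"
      using nrm_ultra_diff[of x "x \<ominus>\<^bsub>Qf\<^esub> emb a"] x by simp
    then have a1: "padic_abs p a \<le> 1" using a e x by (simp add: nrm_emb)
    obtain n d where nd: "d \<noteq> 0" "coprime n d" "a = of_int n / of_int d" by (rule obtain_frac)
    \<comment> \<open>The approximation has absolute value at most 1; in lowest terms, a factor
      \<open>p\<close> of the denominator would push it above 1.\<close>
    have pd: "\<not> int p dvd d"
    proof
      assume "int p dvd d"
      then have "\<not> int p dvd n" using nd(2) prime_elem_p coprime_common_divisor by blast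
      then have n: "n \<noteq> 0" "multiplicity (int p) n = 0" by (auto simp: not_dvd_imp_multiplicity_0)
      have "multiplicity (int p) d \<ge> 1" using \<open>int p dvd d\<close> nd prime_elem_p
        by (intro multiplicity_geI) auto
      then have "real p powi 0 < padic_abs p a" using n nd p_gt
        by (auto simp: padic_abs_frac intro!: power_int_strict_increasing)
      then show False using a1 by simp
    qed
    then have "coprime d (int p ^ k)" using prime_p
      by (metis coprime_commute coprime_power_right_iff prime_imp_coprime prime_int_nat_transfer
          prime_nat_int_transfer)
    then obtain g h where gh: "g * d + h * int p ^ k = 1" using bezout_int[of d "int p ^ k"] by auto
    \<comment> \<open>By Bezout \<open>g\<close> inverts \<open>d\<close> modulo
      \<open>p ^ k\<close>, so \<open>c\<close> is the residue of the fraction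
      \<open>n / d\<close>.\<close>
    define c where "c = (g * n) mod int p ^ k"
    have c: "c \<in> {0..<int p ^ k}" using p_gt by (simp add: c_def)
    have "n - d * c = n * (g * d + h * int p ^ k) - d * (g * n - int p ^ k * (g * n div int p ^ k))"
      unfolding gh by (simp add: c_def minus_mult_div_eq_mod)
    also have "\<dots> = int p ^ k * (n * h + d * (g * n div int p ^ k))" by (simp add: algebra_simps)
    finally have "int p ^ k dvd n - d * c" by simp
    then have 1: "padic_abs p (of_int (n - d * c)) \<le> e" unfolding e_def by (rule padic_abs_int_le)
    have ac: "a - of_int c = of_int (n - d * c) / of_int d" using nd by (simp add: field_simps)
    have d1: "padic_abs p (of_int d) = 1" using pd nd by (simp add: padic_abs_int not_dvd_imp_multiplicity_0)
    have "padic_abs p ((a - of_int c) * of_int d) = padic_abs p (a - of_int c) * padic_abs p (of_int d)"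
      using rat.v_mult by simp
    then have "padic_abs p (a - of_int c) = padic_abs p (of_int (n - d * c))"
      using nd ac d1 by simp
    then have 2: "nrm (emb a \<ominus>\<^bsub>Qf\<^esub> emb (of_int c)) \<le> e" using 1 by (simp add: nrm_emb flip: emb_diff)
    have eq: "x \<ominus>\<^bsub>Qf\<^esub> emb (of_int c) = (x \<ominus>\<^bsub>Qf\<^esub> emb a) \<oplus>\<^bsub>Qf\<^esub> (emb a \<ominus>\<^bsub>Qf\<^esub> emb (of_int c))"
      using x by (simp add: Qp.minus_eq Qp.a_assoc Qp.r_neg2 Qp.r_neg1)
    have "nrm (x \<ominus>\<^bsub>Qf\<^esub> emb (of_int c)) \<le> e" unfolding eq
      using nrm_ultra[of "x \<ominus>\<^bsub>Qf\<^esub> emb a" "emb a \<ominus>\<^bsub>Qf\<^esub> emb (of_int c)"] a 2 x by simp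
    then obtain y where y: "y \<in> Zp_set p" "x \<ominus>\<^bsub>Qf\<^esub> emb (of_int c) = \<pi> [^]\<^bsub>Qf\<^esub> k \<otimes>\<^bsub>Qf\<^esub> y"
      using divide_pi_pow[of "x \<ominus>\<^bsub>Qf\<^esub> emb (of_int c)" k] x unfolding e_def by auto
    have "x = emb (of_int c) \<oplus>\<^bsub>Qf\<^esub> (x \<ominus>\<^bsub>Qf\<^esub> emb (of_int c))"
      using x by (simp add: Qp.minus_eq Qp.a_comm Qp.a_lcomm Qp.r_neg)
    then show ?thesis using y c unfolding S_def by auto
  qed
  moreover have "finite S" "S \<subseteq> Zp_set p" using int_Zp by (auto simp: S_def)
  ultimately show ?thesis by blast
qed

text \<open>An integer prime to \<open>p\<close> has norm 1 and is therefore a unit. Transported to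
  the Galois group, this provides roots of order prime to \<open>p\<close>.\<close>

lemma Zp_divide_coprime:
  assumes "z \<in> Zp_set p" "\<not> p dvd u"
  shows "\<exists>y\<in>Zp_set p. [u] \<cdot>\<^bsub>Zp p\<^esub> y = z"
proof -
  have u: "u \<noteq> 0" "\<not> int p dvd int u" using assms by (auto intro: ccontr)
  then have "padic_abs p (of_nat u) = 1"
    using padic_abs_int[of "int u"] by (simp add: not_dvd_imp_multiplicity_0)
  then have "emb (of_nat u) \<in> Units (Zp p)" by (intro Zp_unit) (auto simp: nrm_emb)
  then obtain w where w: "w \<in> Zp_set p" "emb (of_nat u) \<otimes>\<^bsub>Qf\<^esub> w = \<one>\<^bsub>Qf\<^esub>" by (auto simp: Units_def)
  have wz: "w \<otimes>\<^bsub>Qf\<^esub> z \<in> Zp_set p" using Zp.m_closed[of w z] w assms by simp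
  moreover have "[u] \<cdot>\<^bsub>Zp p\<^esub> (w \<otimes>\<^bsub>Qf\<^esub> z) = z"
  proof -
    have "[u] \<cdot>\<^bsub>Zp p\<^esub> (w \<otimes>\<^bsub>Qf\<^esub> z) = emb (of_nat u) \<otimes>\<^bsub>Qf\<^esub> (w \<otimes>\<^bsub>Qf\<^esub> z)"
      using wz by (simp add: emb_of_nat_mult Zp_set_iff)
    also have "\<dots> = (emb (of_nat u) \<otimes>\<^bsub>Qf\<^esub> w) \<otimes>\<^bsub>Qf\<^esub> z" 
      using w(1) assms(1) by (simp add: Zp_set_iff Qp.m_assoc)
    also have "\<dots> = z" unfolding w(2) using assms by (simp add: Zp_set_iff)
    finally show ?thesis .
  qed
  ultimately show ?thesis by blast
qed

section \<open>The group Q_p/Z_p\<close>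

lemma Zp_abelian_subgroup: "abelian_subgroup (Zp_set p) Qf"
  using subring.axioms(1)[OF Zp_subring] Qp.abelian_group_axioms
  by (intro abelian_subgroupI3 additive_subgroupI)

sublocale Zpsub: abelian_subgroup "Zp_set p" "Qp p"
  by (rule Zp_abelian_subgroup)

sublocale QpZp: comm_group "QpZp p"
  unfolding QpZp_def by (rule Zpsub.a_factorgroup_is_comm_group)

abbreviation qz where "qz x \<equiv> Zp_set p +>\<^bsub>Qp p\<^esub> x"

lemma QpZp_carrier: "carrier (QpZp p) = qz ` carrier Qf"
  by (auto simp: QpZp_def A_FactGroup_def' A_RCOSETS_def')

lemma qz_closed [simp]: "x \<in> carrier Qf \<Longrightarrow> qz x \<in> carrier (QpZp p)"
  by (simp add: QpZp_carrier)

lemma qz_mult: "x \<in> carrier Qf \<Longrightarrow> y \<in> carrier Qf \<Longrightarrow> qz x \<otimes>\<^bsub>QpZp p\<^esub> qz y = qz (x \<oplus>\<^bsub>Qf\<^esub> y)"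
  by (simp add: QpZp_def Zpsub.a_rcos_sum)

lemma QpZp_one: "\<one>\<^bsub>QpZp p\<^esub> = Zp_set p"
  by (simp add: QpZp_def A_FactGroup_def')

lemma qz_one: "x \<in> Zp_set p \<Longrightarrow> qz x = \<one>\<^bsub>QpZp p\<^esub>"
  using Zpsub.a_rcos_const by (simp add: QpZp_one)

lemma qz_pow: "x \<in> carrier Qf \<Longrightarrow> qz x [^]\<^bsub>QpZp p\<^esub> (n::nat) = qz ([n] \<cdot>\<^bsub>Qf\<^esub> x)"
  by (induction n) (simp_all add: qz_mult qz_one Zpsub.zero_closed)

lemma QpZp_p_primary:
  assumes "q \<in> carrier (QpZp p)" shows "\<exists>m. q [^]\<^bsub>QpZp p\<^esub> (p ^ m) = \<one>\<^bsub>QpZp p\<^esub>"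
proof -
  obtain x where x: "x \<in> carrier Qf" "q = qz x" using assms by (auto simp: QpZp_carrier)
  obtain m where m: "nrm x < real p ^ m" using real_arch_pow[OF p_gt(3)] by blast
  have "[(p ^ m)] \<cdot>\<^bsub>Qf\<^esub> x = \<pi> [^]\<^bsub>Qf\<^esub> m \<otimes>\<^bsub>Qf\<^esub> x"
    using emb_of_nat_mult[OF x(1), of "p ^ m"] by (simp add: emb_power \<pi>_def)
  moreover have "nrm (\<pi> [^]\<^bsub>Qf\<^esub> m \<otimes>\<^bsub>Qf\<^esub> x) \<le> 1"
    using x m p_gt by (simp add: nrm_mult nrm_pi_pow power_int_minus field_simps)
  ultimately have "[(p ^ m)] \<cdot>\<^bsub>Qf\<^esub> x \<in> Zp_set p" using x by (simp add: Zp_set_iff)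
  then show ?thesis using x qz_pow qz_one by metis
qed

text \<open>Divisibility makes this group injective among abelian groups; \<open>hom_extend\<close>
  turns it into surjectivity of restriction between duals.\<close>

lemma QpZp_divisible:
  assumes "q \<in> carrier (QpZp p)" "n > 0"
  shows "\<exists>r\<in>carrier (QpZp p). r [^]\<^bsub>QpZp p\<^esub> (n::nat) = q"
proof -
  obtain x where x: "x \<in> carrier Qf" "q = qz x" using assms by (auto simp: QpZp_carrier)
  let ?y = "emb (1 / of_nat n) \<otimes>\<^bsub>Qf\<^esub> x"
  have "[n] \<cdot>\<^bsub>Qf\<^esub> ?y = emb (of_nat n * (1 / of_nat n)) \<otimes>\<^bsub>Qf\<^esub> x"
    using x by (simp only: emb_of_nat_mult[symmetric] emb_mult Qp.m_closed emb_closed Qp.m_assoc)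
  also have "\<dots> = x" using x assms by (simp add: emb_one)
  finally have "qz ?y [^]\<^bsub>QpZp p\<^esub> n = q" using x by (simp add: qz_pow)
  then show ?thesis using x by (intro bexI[of _ "qz ?y"]) auto
qed

text \<open>\<open>QpZp_smult\<close> is a union over all representatives of a coset. They all
  contribute the same coset, because \<open>z\<close> maps \<open>Zp_set p\<close> into itself, so
  the union can be evaluated at one of them.\<close>

lemma smult_qz:
  assumes z: "z \<in> Zp_set p" and x: "x \<in> carrier Qf"
  shows "QpZp_smult p z (qz x) = qz (z \<otimes>\<^bsub>Qf\<^esub> x)"
proof -
  have zc: "z \<in> carrier Qf" using z by (simp add: Zp_set_iff)
  have "qz (z \<otimes>\<^bsub>Qf\<^esub> x') = qz (z \<otimes>\<^bsub>Qf\<^esub> x)" if x': "x' \<in> qz x" for x'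
  proof -
    obtain w where w: "w \<in> Zp_set p" "x' = w \<oplus>\<^bsub>Qf\<^esub> x"
      using x' unfolding a_r_coset_def' by blast
    have wc: "w \<in> carrier Qf" using w by (simp add: Zp_set_iff)
    have "z \<otimes>\<^bsub>Qf\<^esub> w \<in> Zp_set p" using Zp.m_closed[of z w] z w by simp
    then have "qz (z \<otimes>\<^bsub>Qf\<^esub> w) \<otimes>\<^bsub>QpZp p\<^esub> qz (z \<otimes>\<^bsub>Qf\<^esub> x) = qz (z \<otimes>\<^bsub>Qf\<^esub> x)"
      using zc x by (simp add: qz_one)
    then show ?thesis using zc wc x by (simp add: w(2) Qp.r_distr qz_mult)
  qed
  moreover have "x \<in> qz x" by (rule Zpsub.a_rcos_self[OF x])
  ultimately show ?thesis unfolding QpZp_smult_def by blast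
qed

lemma smult_closed: "z \<in> Zp_set p \<Longrightarrow> q \<in> carrier (QpZp p) \<Longrightarrow> QpZp_smult p z q \<in> carrier (QpZp p)"
  by (auto simp: QpZp_carrier smult_qz Zp_set_iff)

lemma smult_mult:
  "z \<in> Zp_set p \<Longrightarrow> q \<in> carrier (QpZp p) \<Longrightarrow> q' \<in> carrier (QpZp p) \<Longrightarrow>
    QpZp_smult p z (q \<otimes>\<^bsub>QpZp p\<^esub> q') = QpZp_smult p z q \<otimes>\<^bsub>QpZp p\<^esub> QpZp_smult p z q'"
  by (auto simp: QpZp_carrier smult_qz qz_mult Zp_set_iff Qp.r_distr)

lemma smult_one: "z \<in> Zp_set p \<Longrightarrow> QpZp_smult p z \<one>\<^bsub>QpZp p\<^esub> = \<one>\<^bsub>QpZp p\<^esub>"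
  using smult_qz[of z "\<zero>\<^bsub>Qf\<^esub>"] qz_one[OF Zpsub.zero_closed] by (simp add: Zp_set_iff)

end

section \<open>Integer polynomials in an endomorphism\<close>

lemma freshman_prime:
  fixes a b :: "'a::comm_ring_1"
  assumes p: "Factorial_Ring.prime (p::nat)"
  shows "\<exists>r. (a + b) ^ p = a ^ p + b ^ p + of_nat p * r"
proof -
  have p1: "p > 1" using prime_gt_1_nat[OF p] .
  define r where "r = (\<Sum>k\<in>{1..<p}. of_nat ((p choose k) div p) * a ^ k * b ^ (p - k))"
  have "(a + b) ^ p = (\<Sum>k\<le>p. of_nat (p choose k) * a ^ k * b ^ (p - k))" by (rule binomial_ring)
  also have "{..p} = insert 0 (insert p {1..<p})" using p1 by auto
  also have "(\<Sum>k\<in>insert 0 (insert p {1..<p}). of_nat (p choose k) * a ^ k * b ^ (p - k)) =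
      b ^ p + (a ^ p + (\<Sum>k\<in>{1..<p}. of_nat (p choose k) * a ^ k * b ^ (p - k)))"
    using p1 by simp
  also have "(\<Sum>k\<in>{1..<p}. of_nat (p choose k) * a ^ k * b ^ (p - k)) = of_nat p * r"
    unfolding r_def sum_distrib_left
  proof (rule sum.cong[OF refl])
    fix k assume "k \<in> {1..<p}"
    then have "k * (p choose k) = p * ((p - 1) choose (k - 1))" by (intro times_binomial_minus1_eq) auto
    then have "p dvd k * (p choose k)" by simp
    moreover have "\<not> p dvd k" using \<open>k \<in> {1..<p}\<close> by (auto dest: dvd_imp_le)
    ultimately have "p dvd p choose k" using p by (simp add: prime_dvd_mult_iff)
    then have "of_nat (p choose k) = (of_nat p * of_nat ((p choose k) div p) :: 'a)"
      by (metis dvd_mult_div_cancel of_nat_mult)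
    then show "of_nat (p choose k) * a ^ k * b ^ (p - k) =
        of_nat p * (of_nat ((p choose k) div p) * a ^ k * b ^ (p - k))" by (simp add: mult.assoc)
  qed
  finally show ?thesis by (intro exI[of _ r]) (simp add: algebra_simps)
qed

text \<open>Applied to integer polynomials at two places: for the nilpotence of \<open>s - 1\<close>
  on \<open>p\<close>-primary elements, and for the shape of the cyclotomic polynomials modulo
  \<open>p\<close>.\<close>

lemma freshman_prime_power:
  fixes a b :: "'a::comm_ring_1"
  assumes p: "Factorial_Ring.prime (p::nat)"
  shows "\<exists>r. (a + b) ^ (p ^ n) = a ^ (p ^ n) + b ^ (p ^ n) + of_nat p * r"
proof (induction n)
  case 0 then show ?case by (intro exI[of _ 0]) simp
next
  case (Suc n)
  then obtain r where r: "(a + b) ^ (p ^ n) = a ^ (p ^ n) + b ^ (p ^ n) + of_nat p * r" by blast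
  have p0: "p > 0" using prime_gt_0_nat[OF p] .
  obtain r1 where r1: "(a ^ (p ^ n) + b ^ (p ^ n) + of_nat p * r) ^ p =
      (a ^ (p ^ n) + b ^ (p ^ n)) ^ p + (of_nat p * r) ^ p + of_nat p * r1"
    using freshman_prime[OF p] by blast
  obtain r2 where r2: "(a ^ (p ^ n) + b ^ (p ^ n)) ^ p = (a ^ (p ^ n)) ^ p + (b ^ (p ^ n)) ^ p + of_nat p * r2"
    using freshman_prime[OF p] by blast
  define u where "u = of_nat p * r"
  \<comment> \<open>The error term of the previous stage, raised to the power \<open>p\<close>, is
    still divisible by \<open>p\<close>.\<close>
  have "u ^ p = u * u ^ (p - 1)" using p0 by (simp add: power_eq_if)
  then obtain t where t: "u ^ p = of_nat p * t" unfolding u_def by (metis mult.assoc)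
  have "(a + b) ^ (p ^ Suc n) = ((a + b) ^ (p ^ n)) ^ p"
    "a ^ (p ^ Suc n) = (a ^ (p ^ n)) ^ p" "b ^ (p ^ Suc n) = (b ^ (p ^ n)) ^ p"
    by (simp_all add: mult.commute flip: power_mult)
  then have "(a + b) ^ (p ^ Suc n) = a ^ (p ^ Suc n) + b ^ (p ^ Suc n) + of_nat p * (t + r1 + r2)"
    using r1[folded u_def] r[folded u_def] r2 t by (simp only: distrib_left add.assoc add.commute add.left_commute)
  then show ?case by blast
qed

locale group_endo = comm_group G for G (structure) + fixes s
  assumes s_hom: "s \<in> hom G G"
begin

text \<open>An endomorphism turns an abelian group into a module over the integer polynomials, with
  the variable acting as \<open>s\<close>. The fold is Horner's scheme in multiplicative notation.
  Polynomial identities can then be applied to group elements.\<close>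

definition act :: "int poly \<Rightarrow> 'a \<Rightarrow> 'a" where
  "act q a = fold_coeffs (\<lambda>c h. a [^] c \<otimes> s h) q \<one>"

lemma s_closed [simp]: "a \<in> carrier G \<Longrightarrow> s a \<in> carrier G"
  using s_hom by (auto simp: hom_def)

lemma s_mult: "a \<in> carrier G \<Longrightarrow> b \<in> carrier G \<Longrightarrow> s (a \<otimes> b) = s a \<otimes> s b"
  using s_hom by (auto simp: hom_def)

lemma s_one [simp]: "s \<one> = \<one>"
  using hom_one[OF s_hom] is_group by simp

lemma s_int_pow: "a \<in> carrier G \<Longrightarrow> s (a [^] (c::int)) = s a [^] c"
proof -
  assume a: "a \<in> carrier G"
  interpret group_hom G G s using s_hom by unfold_locales
  show ?thesis using a by (simp add: hom_int_pow)
qed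

lemma act_0 [simp]: "act 0 a = \<one>"
  by (simp add: act_def)

lemma act_pCons: "a \<in> carrier G \<Longrightarrow> act (pCons c q) a = a [^] c \<otimes> s (act q a)"
  by (cases "q = 0 \<and> c = 0") (auto simp: act_def)

lemma act_closed [simp]: "a \<in> carrier G \<Longrightarrow> act q a \<in> carrier G"
  by (induction q) (auto simp: act_pCons)

lemma act_add: "a \<in> carrier G \<Longrightarrow> act (q + r) a = act q a \<otimes> act r a"
proof (induction q r rule: poly_induct2)
  case (pCons c q d r)
  then show ?case by (simp add: act_pCons int_pow_mult s_mult m_ac)
qed simp

lemma act_smult: "a \<in> carrier G \<Longrightarrow> act (smult c q) a = act q a [^] (c::int)"
  by (induction q) (auto simp: act_pCons int_pow_distrib s_int_pow int_pow_pow mult.commute)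

lemma act_arg_one [simp]: "act q \<one> = \<one>"
  by (induction q) (auto simp: act_pCons)

lemma act_mult: "a \<in> carrier G \<Longrightarrow> act (q * r) a = act q (act r a)"
  by (induction q) (auto simp: act_pCons act_add act_smult)

lemma act_one: "a \<in> carrier G \<Longrightarrow> act 1 a = a"
  by (simp add: one_pCons act_pCons)

lemma act_X: "a \<in> carrier G \<Longrightarrow> act [:0, 1:] a = s a"
  by (simp add: act_pCons)

lemma act_minus: "a \<in> carrier G \<Longrightarrow> act (q - r) a = act q a \<otimes> inv (act r a)"
  using act_add[of a q "smult (- 1) r"] act_smult[of a "- 1" r] by (simp add: int_pow_neg int_pow_1)

lemma funpow_closed [simp]: "a \<in> carrier G \<Longrightarrow> (s ^^ n) a \<in> carrier G"
  by (induction n) auto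

lemma act_X_power: "a \<in> carrier G \<Longrightarrow> act ([:0, 1:] ^ n) a = (s ^^ n) a"
  by (induction n arbitrary: a) (simp_all only: power_0 act_one funpow_0 power_Suc act_mult act_X
      funpow.simps comp_apply funpow_closed id_apply)

lemma act_of_nat: "a \<in> carrier G \<Longrightarrow> act (of_nat n) a = a [^] (n::nat)"
  by (simp add: of_nat_poly act_pCons int_pow_int)

definition T :: "'a \<Rightarrow> 'a" where "T a = s a \<otimes> inv a"

lemma T_closed [simp]: "a \<in> carrier G \<Longrightarrow> T a \<in> carrier G"
  by (simp add: T_def)

lemma T_hom: "T \<in> hom G G"
  unfolding T_def by (intro homI) (auto simp: s_mult inv_mult m_ac)

lemma act_T: "a \<in> carrier G \<Longrightarrow> act ([:0, 1:] - 1) a = T a"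
  unfolding T_def by (simp only: act_minus act_X act_one)

lemma T_funpow_closed [simp]: "a \<in> carrier G \<Longrightarrow> (T ^^ n) a \<in> carrier G"
  by (induction n) auto

lemma act_T_power: "a \<in> carrier G \<Longrightarrow> act (([:0, 1:] - 1) ^ n) a = (T ^^ n) a"
  by (induction n arbitrary: a) (simp_all only: power_0 act_one funpow_0 power_Suc act_mult act_T
      funpow.simps comp_apply T_funpow_closed id_apply)

text \<open>Modulo \<open>p\<close>, \<open>(x - 1) ^ (p ^ n)\<close> equals
  \<open>x ^ (p ^ n) - 1\<close>, and the latter kills an element fixed by the
  \<open>p ^ n\<close>-th iterate of \<open>s\<close>. So a block of \<open>p ^ n\<close>
  applications of \<open>T\<close> sends \<open>a\<close> to a \<open>p\<close>-th power of some
  \<open>act r a\<close>, which lowers the exponent \<open>m\<close> by one.\<close>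

lemma T_nilpotent:
  assumes p: "Factorial_Ring.prime (p::nat)" "odd p"
    and "a \<in> carrier G" "(s ^^ (p ^ n)) a = a" "a [^] (p ^ m) = \<one>"
  shows "(T ^^ (p ^ n * m)) a = \<one>"
  using assms(3-)
proof (induction m arbitrary: a)
  case (Suc m)
  let ?x = "[:0, 1:] :: int poly"
  obtain r where "(?x + (- 1)) ^ (p ^ n) = ?x ^ (p ^ n) + (- 1) ^ (p ^ n) + of_nat p * r"
    using freshman_prime_power[OF p(1)] by blast
  \<comment> \<open>An odd power of -1 is -1; here \<open>p\<close> must be odd.\<close>
  then have r: "(?x - 1) ^ (p ^ n) = ?x ^ (p ^ n) - 1 + of_nat p * r"
    using p(2) by (simp only: diff_conv_add_uminus power_minus_odd[of "p ^ n"] even_power power_one not_False_eq_True simp_thms)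
  define a' where "a' = (T ^^ (p ^ n)) a"
  have a'c: "a' \<in> carrier G" using Suc.prems by (simp add: a'_def)
  have "a' = act (?x ^ (p ^ n) - 1 + of_nat p * r) a"
    unfolding a'_def r[symmetric] using Suc.prems by (simp only: act_T_power)
  also have "\<dots> = (act (?x ^ (p ^ n)) a \<otimes> inv a) \<otimes> act r a [^] p"
    using Suc.prems by (simp only: act_add act_minus act_one act_mult act_of_nat act_closed)
  also have "\<dots> = act r a [^] p"
    using Suc.prems by (simp only: act_X_power) simp
  finally have a': "a' = act r a [^] p" .
  have "act r a [^] (p ^ Suc m) = act (r * of_nat (p ^ Suc m)) a"
    using Suc.prems by (simp only: mult.commute[of r] act_mult act_of_nat act_closed)
  also have "\<dots> = act r \<one>" using Suc.prems by (simp only: act_mult act_of_nat)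
  finally have "act r a [^] (p ^ Suc m) = \<one>" by simp
  then have "a' [^] (p ^ m) = \<one>" using Suc.prems by (simp add: a' nat_pow_pow)
  \<comment> \<open>The induction hypothesis needs \<open>a'\<close> to be fixed too. This holds
    because powers of \<open>x\<close> and of \<open>x - 1\<close> commute.\<close>
  moreover have "(s ^^ (p ^ n)) a' = a'"
  proof -
    have "(s ^^ (p ^ n)) a' = act (?x ^ (p ^ n) * (?x - 1) ^ (p ^ n)) a"
      unfolding a'_def using Suc.prems by (simp only: act_mult act_X_power act_T_power T_funpow_closed)
    also have "\<dots> = act ((?x - 1) ^ (p ^ n) * ?x ^ (p ^ n)) a" by (simp only: mult.commute)
    also have "\<dots> = a'" unfolding a'_def using Suc.prems
      by (simp only: act_mult act_X_power act_T_power)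
    finally show ?thesis .
  qed
  ultimately have "(T ^^ (p ^ n * m)) a' = \<one>" using Suc.IH a'c by blast
  moreover have "p ^ n * Suc m = p ^ n * m + p ^ n" by simp
  ultimately show ?case by (simp only: a'_def funpow_add comp_apply)
qed simp

end

text \<open>\<open>q\<close> is the cyclotomic polynomial of order \<open>p ^ Suc n\<close> in the
  variable \<open>1 + x\<close>. Modulo \<open>p\<close> both differences of powers of
  \<open>y\<close> become powers of \<open>x\<close>, so \<open>q\<close> is congruent to
  \<open>x ^ d\<close>. Its constant term is \<open>p\<close> itself, which gives the cofactor
  \<open>w\<close> the constant term 1.\<close>

lemma cyclotomic_int_poly:
  assumes p: "Factorial_Ring.prime (p::nat)"
  defines "y \<equiv> [:1, 1:] :: int poly"
  shows "\<exists>q w d. q * (y ^ (p ^ n) - 1) = y ^ (p ^ Suc n) - 1 \<and> q = [:0, 1:] ^ d + of_nat p * w \<and>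
    coeff w 0 = 1 \<and> d > 0"
proof -
  let ?x = "[:0, 1:] :: int poly"
  have p1: "p > 1" using prime_gt_1_nat[OF p] .
  define q where "q = (\<Sum>i<p. (y ^ (p ^ n)) ^ i)"
  have q: "q * (y ^ (p ^ n) - 1) = y ^ (p ^ Suc n) - 1"
  proof -
    have "y ^ (p ^ Suc n) = (y ^ (p ^ n)) ^ p" by (simp add: mult.commute flip: power_mult)
    then show ?thesis using power_diff_1_eq[of "y ^ (p ^ n)" p] unfolding q_def by (simp only: mult.commute)
  qed
  \<comment> \<open>Each of the \<open>p\<close> summands has constant term 1.\<close>
  have q0: "coeff q 0 = int p"
    unfolding q_def y_def by (simp add: coeff_sum coeff_0_power)
  have yx: "y = ?x + 1" by (simp add: y_def one_pCons)
  obtain r where r: "y ^ (p ^ n) = ?x ^ (p ^ n) + 1 + of_nat p * r"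
    using freshman_prime_power[OF p, of ?x 1 n] unfolding yx by auto
  obtain r' where r': "y ^ (p ^ Suc n) = ?x ^ (p ^ Suc n) + 1 + of_nat p * r'"
    using freshman_prime_power[OF p, of ?x 1 "Suc n"] unfolding yx by auto
  have "q * (?x ^ (p ^ n) + of_nat p * r) = ?x ^ (p ^ Suc n) + of_nat p * r'"
    using q unfolding r r' by simp
  then have e: "q * ?x ^ (p ^ n) = ?x ^ (p ^ Suc n) + of_nat p * (r' - q * r)"
    by (simp add: algebra_simps)
  define d where "d = p ^ Suc n - p ^ n"
  have d: "p ^ Suc n = d + p ^ n" "d > 0" using p1 by (auto simp: d_def)
  \<comment> \<open>Reading \<open>e\<close> from the coefficient \<open>p ^ n\<close> on cancels
    the factor \<open>x ^ (p ^ n)\<close>. For the same reason \<open>w\<close> below is a shift of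
    the error term.\<close>
  have c: "coeff q j = coeff (?x ^ d) j + int p * coeff (r' - q * r) (j + p ^ n)" for j
  proof -
    have "coeff (q * ?x ^ (p ^ n)) (j + p ^ n) = coeff q j"
      by (simp add: mult.commute[of q] coeff_monom_mult flip: monom_altdef[of 1, simplified])
    moreover have "coeff (?x ^ (p ^ Suc n)) (j + p ^ n) = coeff (?x ^ d) j"
      unfolding d(1) by (simp flip: monom_altdef[of 1, simplified])
    moreover have "coeff (of_nat p * (r' - q * r)) (j + p ^ n) = int p * coeff (r' - q * r) (j + p ^ n)"
      by (simp add: of_nat_poly)
    ultimately show ?thesis unfolding e by simp
  qed
  define w where "w = poly_shift (p ^ n) (r' - q * r)"
  have w: "coeff w j = coeff (r' - q * r) (j + p ^ n)" for j
    by (simp add: w_def coeff_poly_shift add.commute)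
  have qw: "q = ?x ^ d + of_nat p * w"
    by (rule poly_eqI) (simp add: c w of_nat_poly)
  have "coeff (?x ^ d) 0 = 0" using d by (simp add: coeff_0_power)
  then have "int p = int p * coeff w 0" using q0 arg_cong[OF qw, of "\<lambda>q. coeff q 0"]
    by (simp add: of_nat_poly)
  then have "coeff w 0 = 1" using p1 by simp
  then show ?thesis using q qw d by blast
qed

section \<open>Power series over a discrete valuation ring\<close>

lemma PS_simps:
  "f \<in> carrier (power_series_ring R) \<longleftrightarrow> (\<forall>n. f n \<in> carrier R)"
  "(f \<otimes>\<^bsub>power_series_ring R\<^esub> g) n = (\<Oplus>\<^bsub>R\<^esub>i\<in>{..n}. f i \<otimes>\<^bsub>R\<^esub> g (n - i))"
  "\<one>\<^bsub>power_series_ring R\<^esub> = (\<lambda>n. if n = 0 then \<one>\<^bsub>R\<^esub> else \<zero>\<^bsub>R\<^esub>)"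
  "\<zero>\<^bsub>power_series_ring R\<^esub> = (\<lambda>n. \<zero>\<^bsub>R\<^esub>)"
  "(f \<oplus>\<^bsub>power_series_ring R\<^esub> g) = (\<lambda>n. f n \<oplus>\<^bsub>R\<^esub> g n)"
  by (auto simp: power_series_ring_def)

section \<open>Formal power series over a commutative ring\<close>

context cring
begin

abbreviation PS where "PS \<equiv> power_series_ring R"

definition mon :: "'a \<Rightarrow> nat \<Rightarrow> nat \<Rightarrow> 'a" where
  "mon c m = (\<lambda>n. if n = m then c else \<zero>)"

lemma PS_coeff [simp]: "f \<in> carrier PS \<Longrightarrow> f n \<in> carrier R"
  by (simp add: PS_simps)

text \<open>Coefficient \<open>n\<close> of a product sees only coefficients up to \<open>n\<close>
  of the factors. This reduces ring laws to polynomials and makes multiplication compatible with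
  X-adic limits.\<close>

lemma PS_mult_cong:
  assumes "\<And>i. i \<le> n \<Longrightarrow> f i = f' i" "\<And>i. i \<le> n \<Longrightarrow> g i = g' i"
    "f' \<in> carrier PS" "g' \<in> carrier PS"
  shows "(f \<otimes>\<^bsub>PS\<^esub> g) n = (f' \<otimes>\<^bsub>PS\<^esub> g') n"
  unfolding PS_simps(2) using assms by (intro finsum_cong') (auto simp: PS_simps(1))

lemma PS_m_closed: "f \<in> carrier PS \<Longrightarrow> g \<in> carrier PS \<Longrightarrow> f \<otimes>\<^bsub>PS\<^esub> g \<in> carrier PS"
  unfolding PS_simps(1) by (auto simp: PS_simps(2) intro!: finsum_closed)

definition trunc :: "nat \<Rightarrow> (nat \<Rightarrow> 'a) \<Rightarrow> nat \<Rightarrow> 'a" where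
  "trunc n f = (\<lambda>i. if i \<le> n then f i else \<zero>)"

lemma trunc_up: "f \<in> carrier PS \<Longrightarrow> trunc n f \<in> up R"
  by (intro mem_upI) (auto simp: trunc_def PS_simps(1) intro!: exI[of _ n] bound.intro)

lemma trunc_PS [simp]: "f \<in> carrier PS \<Longrightarrow> trunc n f \<in> carrier PS"
  by (auto simp: PS_simps trunc_def)

lemma trunc_le [simp]: "i \<le> n \<Longrightarrow> trunc n f i = f i"
  by (simp add: trunc_def)

lemma UP_PS_mult: "f \<in> up R \<Longrightarrow> g \<in> up R \<Longrightarrow> f \<otimes>\<^bsub>UP R\<^esub> g = f \<otimes>\<^bsub>PS\<^esub> g"
  by (rule ext) (simp add: UP_def PS_simps(2))

text \<open>Each coefficient of a product only involves truncations, so associativity and commutativity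
  are inherited from polynomials.\<close>

lemma UP_cring': "cring (UP R)"
  by (rule UP_cring.UP_cring[OF UP_cring.intro[OF cring_axioms]])

lemma UP_carrier: "carrier (UP R) = up R"
  by (simp add: UP_def)

lemma PS_m_comm:
  assumes f: "f \<in> carrier PS" and g: "g \<in> carrier PS"
  shows "f \<otimes>\<^bsub>PS\<^esub> g = g \<otimes>\<^bsub>PS\<^esub> f"
proof
  fix n
  have up: "trunc n f \<in> up R" "trunc n g \<in> up R" using f g by (simp_all add: trunc_up)
  have "(f \<otimes>\<^bsub>PS\<^esub> g) n = (trunc n f \<otimes>\<^bsub>PS\<^esub> trunc n g) n"
    by (rule PS_mult_cong) (simp_all add: f g)
  also have "trunc n f \<otimes>\<^bsub>PS\<^esub> trunc n g = trunc n g \<otimes>\<^bsub>PS\<^esub> trunc n f"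
    unfolding UP_PS_mult[OF up, symmetric] UP_PS_mult[OF up(2,1), symmetric]
    by (rule comm_monoid.m_comm[OF cring.axioms(2)[OF UP_cring']]) (simp_all only: UP_carrier up)
  also have "\<dots> n = (g \<otimes>\<^bsub>PS\<^esub> f) n"
    by (rule PS_mult_cong) (simp_all add: f g)
  finally show "(f \<otimes>\<^bsub>PS\<^esub> g) n = (g \<otimes>\<^bsub>PS\<^esub> f) n" .
qed

lemma PS_m_assoc:
  assumes f: "f \<in> carrier PS" and g: "g \<in> carrier PS" and h: "h \<in> carrier PS"
  shows "f \<otimes>\<^bsub>PS\<^esub> g \<otimes>\<^bsub>PS\<^esub> h = f \<otimes>\<^bsub>PS\<^esub> (g \<otimes>\<^bsub>PS\<^esub> h)"
proof
  fix n
  let ?f = "trunc n f" and ?g = "trunc n g" and ?h = "trunc n h"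
  have up: "?f \<in> up R" "?g \<in> up R" "?h \<in> up R" using f g h by (simp_all add: trunc_up)
  have upD: "?f \<otimes>\<^bsub>PS\<^esub> ?g \<in> up R" "?g \<otimes>\<^bsub>PS\<^esub> ?h \<in> up R"
    unfolding UP_PS_mult[OF up(1,2), symmetric] UP_PS_mult[OF up(2,3), symmetric]
    using up up_mult_closed[OF up(1,2)] up_mult_closed[OF up(2,3)] by (simp_all add: UP_def)
  have t1: "(f \<otimes>\<^bsub>PS\<^esub> g) i = (?f \<otimes>\<^bsub>PS\<^esub> ?g) i" if "i \<le> n" for i
    by (rule PS_mult_cong) (use f g that in simp_all)
  have t2: "(g \<otimes>\<^bsub>PS\<^esub> h) i = (?g \<otimes>\<^bsub>PS\<^esub> ?h) i" if "i \<le> n" for i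
    by (rule PS_mult_cong) (use g h that in simp_all)
  have "(f \<otimes>\<^bsub>PS\<^esub> g \<otimes>\<^bsub>PS\<^esub> h) n = (?f \<otimes>\<^bsub>PS\<^esub> ?g \<otimes>\<^bsub>PS\<^esub> ?h) n"
    by (rule PS_mult_cong) (simp_all add: t1 f g h PS_m_closed)
  also have "?f \<otimes>\<^bsub>PS\<^esub> ?g \<otimes>\<^bsub>PS\<^esub> ?h = ?f \<otimes>\<^bsub>PS\<^esub> (?g \<otimes>\<^bsub>PS\<^esub> ?h)"
    unfolding UP_PS_mult[OF upD(1) up(3), symmetric] UP_PS_mult[OF up(1) upD(2), symmetric]
    unfolding UP_PS_mult[OF up(1,2), symmetric] UP_PS_mult[OF up(2,3), symmetric]
    by (rule monoid.m_assoc[OF comm_monoid.axioms(1)[OF cring.axioms(2)[OF UP_cring']]])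
      (simp_all only: UP_carrier up)
  also have "\<dots> n = (f \<otimes>\<^bsub>PS\<^esub> (g \<otimes>\<^bsub>PS\<^esub> h)) n"
    by (rule PS_mult_cong) (simp_all add: t2[symmetric] f g h PS_m_closed)
  finally show "(f \<otimes>\<^bsub>PS\<^esub> g \<otimes>\<^bsub>PS\<^esub> h) n = (f \<otimes>\<^bsub>PS\<^esub> (g \<otimes>\<^bsub>PS\<^esub> h)) n" .
qed

lemma mon_closed [simp]: "c \<in> carrier R \<Longrightarrow> mon c m \<in> carrier PS"
  by (simp add: PS_simps mon_def)

lemma mon_mult:
  assumes c: "c \<in> carrier R" and f: "f \<in> carrier PS"
  shows "(mon c m \<otimes>\<^bsub>PS\<^esub> f) n = (if n < m then \<zero> else c \<otimes> f (n - m))"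
proof (cases "n < m")
  case True
  have "(mon c m \<otimes>\<^bsub>PS\<^esub> f) n = (\<Oplus>i\<in>{..n}. \<zero>)" unfolding PS_simps(2)
    using True f by (intro finsum_cong') (simp_all add: mon_def)
  then show ?thesis using True by simp
next
  case False
  have "(mon c m \<otimes>\<^bsub>PS\<^esub> f) n = (\<Oplus>i\<in>{..n}. if m = i then c \<otimes> f (n - i) else \<zero>)" unfolding PS_simps(2)
    using f c by (intro finsum_cong') (auto simp: mon_def)
  also have "\<dots> = c \<otimes> f (n - m)" using False f c by (intro add.finprod_singleton) auto
  finally show ?thesis using False by simp
qed

lemma PS_one: "\<one>\<^bsub>PS\<^esub> = mon \<one> 0"
  by (simp add: PS_simps mon_def)

lemma PS_cring: "cring PS"
proof (intro cringI abelian_groupI comm_monoidI)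
  fix f assume f: "f \<in> carrier PS"
  show "\<exists>g\<in>carrier PS. g \<oplus>\<^bsub>PS\<^esub> f = \<zero>\<^bsub>PS\<^esub>"
    using f by (intro bexI[of _ "\<lambda>n. \<ominus> f n"]) (auto simp: PS_simps l_neg)
  show "\<one>\<^bsub>PS\<^esub> \<otimes>\<^bsub>PS\<^esub> f = f"
    by (rule ext) (simp add: PS_one mon_mult f)
  fix g assume g: "g \<in> carrier PS"
  show "f \<otimes>\<^bsub>PS\<^esub> g = g \<otimes>\<^bsub>PS\<^esub> f" by (rule PS_m_comm[OF f g])
  fix h assume h: "h \<in> carrier PS"
  show "f \<otimes>\<^bsub>PS\<^esub> g \<otimes>\<^bsub>PS\<^esub> h = f \<otimes>\<^bsub>PS\<^esub> (g \<otimes>\<^bsub>PS\<^esub> h)" by (rule PS_m_assoc[OF f g h])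
  show "(f \<oplus>\<^bsub>PS\<^esub> g) \<otimes>\<^bsub>PS\<^esub> h = f \<otimes>\<^bsub>PS\<^esub> h \<oplus>\<^bsub>PS\<^esub> g \<otimes>\<^bsub>PS\<^esub> h"
  proof
    fix n
    have c: "f i \<in> carrier R" "g i \<in> carrier R" "h i \<in> carrier R" for i using f g h by simp_all
    have "((f \<oplus>\<^bsub>PS\<^esub> g) \<otimes>\<^bsub>PS\<^esub> h) n = (\<Oplus>i\<in>{..n}. f i \<otimes> h (n - i) \<oplus> g i \<otimes> h (n - i))"
      unfolding PS_simps(2,5) by (intro finsum_cong') (simp_all add: c l_distr)
    also have "\<dots> = (f \<otimes>\<^bsub>PS\<^esub> h \<oplus>\<^bsub>PS\<^esub> g \<otimes>\<^bsub>PS\<^esub> h) n"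
      unfolding PS_simps(2,5) by (rule finsum_addf) (simp_all add: c)
    finally show "((f \<oplus>\<^bsub>PS\<^esub> g) \<otimes>\<^bsub>PS\<^esub> h) n = (f \<otimes>\<^bsub>PS\<^esub> h \<oplus>\<^bsub>PS\<^esub> g \<otimes>\<^bsub>PS\<^esub> h) n" .
  qed
qed (simp_all add: PS_m_closed, simp_all add: PS_simps a_ac)

end

text \<open>Z_p up to notation: a discrete valuation ring with the prime number \<open>p\<close> as
  uniformizer. The last assumption is finiteness of the ring modulo each power of \<open>p\<close>,
  expressed by representatives.\<close>

locale dvr = "domain" R for R (structure) +
  fixes p :: nat and \<pi>
  assumes prime_p: "Factorial_Ring.prime p"
    and pi_eq: "\<pi> = [p] \<cdot> \<one>"
    and pi_nonzero: "\<pi> \<noteq> \<zero>"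
    and pi_not_unit: "\<pi> \<notin> Units R"
    and pi_factor: "x \<in> carrier R \<Longrightarrow> x \<noteq> \<zero> \<Longrightarrow> \<exists>(k::nat) u. u \<in> Units R \<and> x = \<pi> [^] k \<otimes> u"
    and residues: "\<exists>S. finite S \<and> S \<subseteq> carrier R \<and>
      (\<forall>x\<in>carrier R. \<exists>c\<in>S. \<exists>y\<in>carrier R. x = c \<oplus> \<pi> [^] (k::nat) \<otimes> y)"
begin

sublocale P: cring PS by (rule PS_cring)

abbreviation "XX \<equiv> mon \<one> 1"
abbreviation "PI \<equiv> mon \<pi> 0"

lemma pi_closed [simp]: "\<pi> \<in> carrier R" by (simp add: pi_eq)

lemma coeff_add: "(f \<oplus>\<^bsub>PS\<^esub> g) n = f n \<oplus> g n"
  by (simp add: PS_simps)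

lemma coeff_zero: "\<zero>\<^bsub>PS\<^esub> n = \<zero>"
  by (simp add: PS_simps)

lemma coeff_a_inv: assumes "f \<in> carrier PS" shows "(\<ominus>\<^bsub>PS\<^esub> f) n = \<ominus> f n"
proof -
  have "(\<ominus>\<^bsub>PS\<^esub> f \<oplus>\<^bsub>PS\<^esub> f) n = \<zero>" using assms by (simp only: P.l_neg coeff_zero)
  then have "(\<ominus>\<^bsub>PS\<^esub> f) n \<oplus> f n = \<zero>" by (simp only: coeff_add)
  then show ?thesis using assms minus_equality[of "(\<ominus>\<^bsub>PS\<^esub> f) n" "f n"] by simp
qed

lemma coeff_minus: "f \<in> carrier PS \<Longrightarrow> g \<in> carrier PS \<Longrightarrow> (f \<ominus>\<^bsub>PS\<^esub> g) n = f n \<ominus> g n"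
  unfolding a_minus_def by (simp only: coeff_add coeff_a_inv)

lemma coeff_mult_0 [simp]: "f \<in> carrier PS \<Longrightarrow> g \<in> carrier PS \<Longrightarrow> (f \<otimes>\<^bsub>PS\<^esub> g) 0 = f 0 \<otimes> g 0"
  by (simp add: PS_simps(2))

lemma mon_mult_mon:
  "a \<in> carrier R \<Longrightarrow> b \<in> carrier R \<Longrightarrow> mon a m \<otimes>\<^bsub>PS\<^esub> mon b n = mon (a \<otimes> b) (m + n)"
  by (rule ext, subst mon_mult[OF _ mon_closed]) (auto simp: mon_def)

lemma mon_0_pow: "a \<in> carrier R \<Longrightarrow> mon a 0 [^]\<^bsub>PS\<^esub> (k::nat) = mon (a [^] k) 0"
  by (induction k) (simp_all add: PS_one mon_mult_mon)

lemma mon_Suc: "mon \<one> (Suc m) = mon \<one> m \<otimes>\<^bsub>PS\<^esub> XX"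
  by (simp add: mon_mult_mon)

lemma shift_closed [simp]: "f \<in> carrier PS \<Longrightarrow> (\<lambda>n. f (n + m)) \<in> carrier PS"
  by (simp add: PS_simps)

lemma PS_shift:
  assumes "f \<in> carrier PS" "\<And>i. i < m \<Longrightarrow> f i = \<zero>"
  shows "f = mon \<one> m \<otimes>\<^bsub>PS\<^esub> (\<lambda>n. f (n + m))"
  by (rule ext, subst mon_mult) (use assms in auto)

lemma PS_split:
  assumes "f \<in> carrier PS"
  shows "f = (\<lambda>n. if n < m then f n else \<zero>) \<oplus>\<^bsub>PS\<^esub> mon \<one> m \<otimes>\<^bsub>PS\<^esub> (\<lambda>n. f (n + m))"
  by (rule ext, subst coeff_add, subst mon_mult) (use assms in auto)

lemma PS_split1:
  assumes "f \<in> carrier PS"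
  shows "f = mon (f 0) 0 \<oplus>\<^bsub>PS\<^esub> XX \<otimes>\<^bsub>PS\<^esub> (\<lambda>n. f (n + 1))"
  by (rule ext, subst coeff_add, subst mon_mult[OF _ shift_closed]) (use assms in \<open>auto simp: mon_def\<close>)

text \<open>X-adic completeness: if the coefficients up to \<open>m\<close> no longer change from
  stage \<open>m\<close> on, the diagonal is the limit.\<close>

lemma PS_limit:
  assumes s: "\<And>m. s m \<in> carrier PS" and st: "\<And>m i. i \<le> m \<Longrightarrow> s (Suc m) i = s m i"
  shows "(\<lambda>i. s i i) \<in> carrier PS" "i \<le> m \<Longrightarrow> s m i = s i i"
proof -
  show "(\<lambda>i. s i i) \<in> carrier PS" using s by (simp add: PS_simps)
  show "i \<le> m \<Longrightarrow> s m i = s i i"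
    by (induction m rule: dec_induct) (use st in auto)
qed

text \<open>With \<open>f = f 0 + X f'\<close> and \<open>b\<close> the inverse of
  \<open>f 0\<close>, an inverse \<open>S\<close> of \<open>f\<close> must satisfy
  \<open>S = b - b X f' S\<close>. The iteration of this equation converges, and its limit is the
  inverse.\<close>

lemma PS_unit:
  assumes f: "f \<in> carrier PS" and u: "f 0 \<in> Units R"
  shows "f \<in> Units PS"
proof -
  define b where "b = inv (f 0)"
  have b: "b \<in> carrier R" "f 0 \<otimes> b = \<one>" using u by (auto simp: b_def)
  define f' where "f' = (\<lambda>n. f (n + 1))"
  have f': "f' \<in> carrier PS" using f shift_closed[of f 1] by (simp add: f'_def)
  define s where "s = rec_nat (mon b 0) (\<lambda>_ g. mon b 0 \<ominus>\<^bsub>PS\<^esub> mon b 1 \<otimes>\<^bsub>PS\<^esub> (f' \<otimes>\<^bsub>PS\<^esub> g))"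
  have s0: "s 0 = mon b 0" and sS: "s (Suc m) = mon b 0 \<ominus>\<^bsub>PS\<^esub> mon b 1 \<otimes>\<^bsub>PS\<^esub> (f' \<otimes>\<^bsub>PS\<^esub> s m)" for m
    by (simp_all add: s_def)
  have sc: "s m \<in> carrier PS" for m by (induction m) (use b f' in \<open>auto simp: s0 sS\<close>)
  have coef: "(mon b 0 \<ominus>\<^bsub>PS\<^esub> mon b 1 \<otimes>\<^bsub>PS\<^esub> (f' \<otimes>\<^bsub>PS\<^esub> g)) i =
      (if i = 0 then b else \<ominus> (b \<otimes> (f' \<otimes>\<^bsub>PS\<^esub> g) (i - 1)))" if "g \<in> carrier PS" for g i
  proof -
    have "(mon b 0 \<ominus>\<^bsub>PS\<^esub> mon b 1 \<otimes>\<^bsub>PS\<^esub> (f' \<otimes>\<^bsub>PS\<^esub> g)) i = mon b 0 i \<ominus> (mon b 1 \<otimes>\<^bsub>PS\<^esub> (f' \<otimes>\<^bsub>PS\<^esub> g)) i"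
      using b f' that by (intro coeff_minus) auto
    also have "(mon b 1 \<otimes>\<^bsub>PS\<^esub> (f' \<otimes>\<^bsub>PS\<^esub> g)) i = (if i < 1 then \<zero> else b \<otimes> (f' \<otimes>\<^bsub>PS\<^esub> g) (i - 1))"
      using b f' that by (intro mon_mult) auto
    finally show ?thesis using b f' that by (simp add: mon_def minus_eq)
  qed
  \<comment> \<open>The factor \<open>X\<close> in the recursion delays the influence of the
    previous stage by one coefficient, so each step settles one more coefficient.\<close>
  have stab: "s (Suc m) i = s m i" if "i \<le> m" for m i using that
  proof (induction m arbitrary: i)
    case 0 then show ?case unfolding sS coef[OF sc] by (simp add: s0 mon_def)
  next
    case (Suc m)
    have "(f' \<otimes>\<^bsub>PS\<^esub> s (Suc m)) (i - 1) = (f' \<otimes>\<^bsub>PS\<^esub> s m) (i - 1)"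
      by (rule PS_mult_cong) (use Suc f' sc in auto)
    then show ?case unfolding sS[of "Suc m"] coef[OF sc] unfolding sS[of m] coef[OF sc] by simp
  qed
  define S where "S = (\<lambda>i. s i i)"
  have S: "S \<in> carrier PS" "\<And>i m. i \<le> m \<Longrightarrow> s m i = S i"
    unfolding S_def using PS_limit[of s, OF sc stab] by blast+
  have "S = mon b 0 \<ominus>\<^bsub>PS\<^esub> mon b 1 \<otimes>\<^bsub>PS\<^esub> (f' \<otimes>\<^bsub>PS\<^esub> S)"
  proof
    fix i
    have "S i = s (Suc i) i" using S(2)[of i "Suc i"] by simp
    also have "\<dots> = (mon b 0 \<ominus>\<^bsub>PS\<^esub> mon b 1 \<otimes>\<^bsub>PS\<^esub> (f' \<otimes>\<^bsub>PS\<^esub> s i)) i" by (simp only: sS)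
    also have "(f' \<otimes>\<^bsub>PS\<^esub> s i) (i - 1) = (f' \<otimes>\<^bsub>PS\<^esub> S) (i - 1)"
      by (rule PS_mult_cong) (use S f' in auto)
    then have "(mon b 0 \<ominus>\<^bsub>PS\<^esub> mon b 1 \<otimes>\<^bsub>PS\<^esub> (f' \<otimes>\<^bsub>PS\<^esub> s i)) i =
        (mon b 0 \<ominus>\<^bsub>PS\<^esub> mon b 1 \<otimes>\<^bsub>PS\<^esub> (f' \<otimes>\<^bsub>PS\<^esub> S)) i"
      unfolding coef[OF sc] coef[OF S(1)] by simp
    finally show "S i = (mon b 0 \<ominus>\<^bsub>PS\<^esub> mon b 1 \<otimes>\<^bsub>PS\<^esub> (f' \<otimes>\<^bsub>PS\<^esub> S)) i" .
  qed
  moreover have b1: "mon b 1 = mon b 0 \<otimes>\<^bsub>PS\<^esub> XX" using b by (simp add: mon_mult_mon)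
  ultimately have Se: "S = mon b 0 \<otimes>\<^bsub>PS\<^esub> (\<one>\<^bsub>PS\<^esub> \<ominus>\<^bsub>PS\<^esub> XX \<otimes>\<^bsub>PS\<^esub> (f' \<otimes>\<^bsub>PS\<^esub> S))"
    using b f' S(1) mon_closed[of b 0] mon_closed[of \<one> 1]
    by (simp add: P.minus_eq P.r_distr P.r_minus P.m_assoc)
  have fe: "f = mon (f 0) 0 \<oplus>\<^bsub>PS\<^esub> XX \<otimes>\<^bsub>PS\<^esub> f'" unfolding f'_def by (rule PS_split1[OF f])
  have ab: "mon (f 0) 0 \<otimes>\<^bsub>PS\<^esub> mon b 0 = \<one>\<^bsub>PS\<^esub>" using b Units_closed[OF u] by (simp add: mon_mult_mon PS_one)
  let ?A = "mon (f 0) 0" and ?B = "mon b 0"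
  have c: "?A \<in> carrier PS" "?B \<in> carrier PS" "XX \<in> carrier PS" using b f by auto
  have "f \<otimes>\<^bsub>PS\<^esub> S = ?A \<otimes>\<^bsub>PS\<^esub> S \<oplus>\<^bsub>PS\<^esub> XX \<otimes>\<^bsub>PS\<^esub> (f' \<otimes>\<^bsub>PS\<^esub> S)"
    by (subst fe) (use c f' S(1) in \<open>simp add: P.l_distr P.m_assoc\<close>)
  also have "?A \<otimes>\<^bsub>PS\<^esub> S = (?A \<otimes>\<^bsub>PS\<^esub> ?B) \<otimes>\<^bsub>PS\<^esub> (\<one>\<^bsub>PS\<^esub> \<ominus>\<^bsub>PS\<^esub> XX \<otimes>\<^bsub>PS\<^esub> (f' \<otimes>\<^bsub>PS\<^esub> S))"
    by (subst Se) (use c f' S(1) in \<open>simp add: P.m_assoc\<close>)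
  also have "\<dots> = \<one>\<^bsub>PS\<^esub> \<ominus>\<^bsub>PS\<^esub> XX \<otimes>\<^bsub>PS\<^esub> (f' \<otimes>\<^bsub>PS\<^esub> S)" using c f' S(1) by (simp add: ab)
  also have "(\<one>\<^bsub>PS\<^esub> \<ominus>\<^bsub>PS\<^esub> XX \<otimes>\<^bsub>PS\<^esub> (f' \<otimes>\<^bsub>PS\<^esub> S)) \<oplus>\<^bsub>PS\<^esub> XX \<otimes>\<^bsub>PS\<^esub> (f' \<otimes>\<^bsub>PS\<^esub> S) = \<one>\<^bsub>PS\<^esub>"
    using c f' S(1) by (simp add: P.minus_eq P.a_assoc P.l_neg)
  finally have "f \<otimes>\<^bsub>PS\<^esub> S = \<one>\<^bsub>PS\<^esub>" .
  moreover then have "S \<otimes>\<^bsub>PS\<^esub> f = \<one>\<^bsub>PS\<^esub>" using P.m_comm[of S f] f S(1) by simp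
  ultimately show ?thesis using f S(1) unfolding Units_def by blast
qed

text \<open>After the largest power of \<open>X\<close> is split off from each factor, the constant
  terms are nonzero, and so is their product.\<close>

lemma PS_domain: "domain PS"
proof (rule domainI[OF PS_cring])
  show "\<one>\<^bsub>PS\<^esub> \<noteq> \<zero>\<^bsub>PS\<^esub>"
  proof
    assume "\<one>\<^bsub>PS\<^esub> = \<zero>\<^bsub>PS\<^esub>"
    then have "\<one>\<^bsub>PS\<^esub> 0 = \<zero>\<^bsub>PS\<^esub> 0" by simp
    then show False by (simp add: PS_one mon_def coeff_zero)
  qed
  fix f g assume fg: "f \<otimes>\<^bsub>PS\<^esub> g = \<zero>\<^bsub>PS\<^esub>" "f \<in> carrier PS" "g \<in> carrier PS"
  have lead: "\<exists>m f'. f' \<in> carrier PS \<and> f = mon \<one> m \<otimes>\<^bsub>PS\<^esub> f' \<and> f' 0 \<noteq> \<zero>"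
    if f: "f \<in> carrier PS" "f \<noteq> \<zero>\<^bsub>PS\<^esub>" for f
  proof -
    have "\<exists>n. f n \<noteq> \<zero>" using f(2) by (auto simp: PS_simps)
    then obtain m where m: "f m \<noteq> \<zero>" "\<And>i. i < m \<Longrightarrow> f i = \<zero>"
      using exists_least_iff[of "\<lambda>n. f n \<noteq> \<zero>"] by blast
    show ?thesis
    proof (intro exI conjI)
      show "(\<lambda>n. f (n + m)) \<in> carrier PS" by (rule shift_closed[OF f(1)])
      show "f = mon \<one> m \<otimes>\<^bsub>PS\<^esub> (\<lambda>n. f (n + m))" by (rule PS_shift[OF f(1) m(2)])
      show "(\<lambda>n. f (n + m)) 0 \<noteq> \<zero>" using m(1) by simp
    qed
  qed
  show "f = \<zero>\<^bsub>PS\<^esub> \<or> g = \<zero>\<^bsub>PS\<^esub>"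
  proof (rule ccontr)
    assume "\<not> ?thesis"
    then obtain m f' n g' where f': "f' \<in> carrier PS" "f = mon \<one> m \<otimes>\<^bsub>PS\<^esub> f'" "f' 0 \<noteq> \<zero>"
      and g': "g' \<in> carrier PS" "g = mon \<one> n \<otimes>\<^bsub>PS\<^esub> g'" "g' 0 \<noteq> \<zero>"
      using lead[OF fg(2)] lead[OF fg(3)] by blast
    have "f \<otimes>\<^bsub>PS\<^esub> g = (mon \<one> m \<otimes>\<^bsub>PS\<^esub> mon \<one> n) \<otimes>\<^bsub>PS\<^esub> (f' \<otimes>\<^bsub>PS\<^esub> g')"
      unfolding f'(2) g'(2) using f'(1) g'(1) by (simp add: P.m_ac)
    also have "\<dots> = mon \<one> (m + n) \<otimes>\<^bsub>PS\<^esub> (f' \<otimes>\<^bsub>PS\<^esub> g')" by (simp add: mon_mult_mon)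
    finally have "(f \<otimes>\<^bsub>PS\<^esub> g) (m + n) = f' 0 \<otimes> g' 0" using f'(1) g'(1) by (simp add: mon_mult)
    then have "f' 0 \<otimes> g' 0 = \<zero>" by (simp add: fg(1) coeff_zero)
    from integral[OF this PS_coeff[OF f'(1)] PS_coeff[OF g'(1)]] show False using f'(3) g'(3) by blast
  qed
qed

lemma PI_cancel:
  assumes "f \<in> carrier PS" "g \<in> carrier PS" "PI \<otimes>\<^bsub>PS\<^esub> f = PI \<otimes>\<^bsub>PS\<^esub> g" shows "f = g"
proof
  fix n
  have "(PI \<otimes>\<^bsub>PS\<^esub> f) n = (PI \<otimes>\<^bsub>PS\<^esub> g) n" by (simp only: assms(3))
  then have "\<pi> \<otimes> f n = \<pi> \<otimes> g n"
    using mon_mult[OF pi_closed assms(1), of 0 n] mon_mult[OF pi_closed assms(2), of 0 n] by simp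
  then show "f n = g n" using assms pi_nonzero m_lcancel[of \<pi> "f n" "g n"] by simp
qed

end

text \<open>Both \<open>X\<close> and the shifted cyclotomic polynomials \<open>\<Phi>\<^sub>n\<close> satisfy these conditions.\<close>

locale eisenstein = dvr +
  fixes \<phi> w :: "nat \<Rightarrow> 'a" and d :: nat
  assumes w_closed [simp]: "w \<in> carrier PS" and d_pos: "d > 0"
    and phi_eq: "\<phi> = mon \<one> d \<oplus>\<^bsub>PS\<^esub> PI \<otimes>\<^bsub>PS\<^esub> w"
    and phi_cases: "w 0 = \<one> \<or> \<phi> = XX"
begin

lemma phi_closed [simp]: "\<phi> \<in> carrier PS"
  by (simp add: phi_eq)

text \<open>Modulo \<open>\<pi>\<close> the series \<open>\<phi>\<close> is a power of
  \<open>X\<close>, which is not a zero divisor. So if \<open>\<pi>\<close> divides a multiple of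
  \<open>\<phi>\<close>, it already divides the cofactor. In terms of modules: the quotient by
  \<open>\<phi>\<close> has no \<open>\<pi>\<close>-torsion.\<close>

lemma phi_tf:
  assumes f: "f \<in> carrier PS" and g: "g \<in> carrier PS" and eq: "PI \<otimes>\<^bsub>PS\<^esub> f = \<phi> \<otimes>\<^bsub>PS\<^esub> g"
  shows "\<exists>g'\<in>carrier PS. f = \<phi> \<otimes>\<^bsub>PS\<^esub> g'"
proof -
  let ?h = "f \<ominus>\<^bsub>PS\<^esub> w \<otimes>\<^bsub>PS\<^esub> g"
  have h: "?h \<in> carrier PS" using f g by simp
  have "mon \<one> d \<otimes>\<^bsub>PS\<^esub> g = \<phi> \<otimes>\<^bsub>PS\<^esub> g \<ominus>\<^bsub>PS\<^esub> PI \<otimes>\<^bsub>PS\<^esub> (w \<otimes>\<^bsub>PS\<^esub> g)"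
    using g mon_closed[of \<one> d] mon_closed[of \<pi> 0] w_closed unfolding phi_eq
    by (simp add: P.l_distr P.m_assoc P.minus_eq P.a_assoc P.r_neg)
  also have "\<dots> = PI \<otimes>\<^bsub>PS\<^esub> ?h" unfolding eq[symmetric]
    using f g mon_closed[of \<pi> 0] by (simp add: P.r_distr P.minus_eq P.r_minus)
  finally have e: "mon \<one> d \<otimes>\<^bsub>PS\<^esub> g = PI \<otimes>\<^bsub>PS\<^esub> ?h" .
  \<comment> \<open>Multiplication by \<open>X ^ d\<close> only shifts coefficients, so division by
    it is the opposite shift of the right-hand side of \<open>e\<close>.\<close>
  define g' where "g' = (\<lambda>n. ?h (n + d))"
  have g': "g' \<in> carrier PS" unfolding g'_def by (rule shift_closed[OF h])
  have gg': "g = PI \<otimes>\<^bsub>PS\<^esub> g'"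
  proof
    fix n
    have "(mon \<one> d \<otimes>\<^bsub>PS\<^esub> g) (n + d) = (PI \<otimes>\<^bsub>PS\<^esub> ?h) (n + d)" by (simp only: e)
    also have "(mon \<one> d \<otimes>\<^bsub>PS\<^esub> g) (n + d) = g n" using g by (subst mon_mult) auto
    also have "(PI \<otimes>\<^bsub>PS\<^esub> ?h) (n + d) = \<pi> \<otimes> ?h (n + d)" using h by (subst mon_mult) auto
    also have "\<pi> \<otimes> ?h (n + d) = (PI \<otimes>\<^bsub>PS\<^esub> g') n" using g' by (subst mon_mult) (auto simp: g'_def)
    finally show "g n = (PI \<otimes>\<^bsub>PS\<^esub> g') n" .
  qed
  have "PI \<otimes>\<^bsub>PS\<^esub> f = PI \<otimes>\<^bsub>PS\<^esub> (\<phi> \<otimes>\<^bsub>PS\<^esub> g')"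
    unfolding eq gg' using g' by (simp add: P.m_lcomm)
  then have "f = \<phi> \<otimes>\<^bsub>PS\<^esub> g'" by (rule PI_cancel[OF f P.m_closed[OF phi_closed g']])
  then show ?thesis using g' by blast
qed

text \<open>Modulo \<open>\<phi>\<close>, the monomial \<open>X ^ d\<close> is
  \<open>- \<pi> w\<close>; its \<open>k\<close>-th power is therefore divisible by the
  \<open>k\<close>-th power of \<open>\<pi>\<close>.\<close>

lemma X_power_mod:
  "\<exists>a\<in>carrier PS. \<exists>g\<in>carrier PS. mon \<one> (d * k) = PI [^]\<^bsub>PS\<^esub> k \<otimes>\<^bsub>PS\<^esub> a \<oplus>\<^bsub>PS\<^esub> \<phi> \<otimes>\<^bsub>PS\<^esub> g"
proof (induction k)
  case 0
  show ?case by (rule bexI[of _ "\<one>\<^bsub>PS\<^esub>"], rule bexI[of _ "\<zero>\<^bsub>PS\<^esub>"]) (auto simp flip: PS_one)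
next
  case (Suc k)
  then obtain a g where ag: "a \<in> carrier PS" "g \<in> carrier PS"
    "mon \<one> (d * k) = PI [^]\<^bsub>PS\<^esub> k \<otimes>\<^bsub>PS\<^esub> a \<oplus>\<^bsub>PS\<^esub> \<phi> \<otimes>\<^bsub>PS\<^esub> g" by blast
  let ?P = "PI [^]\<^bsub>PS\<^esub> k"
  have c: "?P \<in> carrier PS" "PI \<in> carrier PS" "mon \<one> d \<in> carrier PS" by auto
  have Xd: "mon \<one> d = \<phi> \<ominus>\<^bsub>PS\<^esub> PI \<otimes>\<^bsub>PS\<^esub> w" unfolding phi_eq using c w_closed
    by (simp add: P.minus_eq P.a_assoc P.r_neg)
  have "mon \<one> (d * Suc k) = mon \<one> (d * k) \<otimes>\<^bsub>PS\<^esub> mon \<one> d" by (simp add: mon_mult_mon add.commute)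
  also have "\<dots> = (?P \<otimes>\<^bsub>PS\<^esub> a \<oplus>\<^bsub>PS\<^esub> \<phi> \<otimes>\<^bsub>PS\<^esub> g) \<otimes>\<^bsub>PS\<^esub> (\<phi> \<ominus>\<^bsub>PS\<^esub> PI \<otimes>\<^bsub>PS\<^esub> w)" by (simp only: Xd ag(3))
  also have "\<dots> = (?P \<otimes>\<^bsub>PS\<^esub> PI) \<otimes>\<^bsub>PS\<^esub> (\<ominus>\<^bsub>PS\<^esub> (a \<otimes>\<^bsub>PS\<^esub> w)) \<oplus>\<^bsub>PS\<^esub>
      \<phi> \<otimes>\<^bsub>PS\<^esub> (?P \<otimes>\<^bsub>PS\<^esub> a \<oplus>\<^bsub>PS\<^esub> g \<otimes>\<^bsub>PS\<^esub> (\<phi> \<ominus>\<^bsub>PS\<^esub> PI \<otimes>\<^bsub>PS\<^esub> w))"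
    using ag(1,2) c w_closed phi_closed by algebra
  finally show ?case using ag(1,2) c
    by (intro bexI[of _ "\<ominus>\<^bsub>PS\<^esub> (a \<otimes>\<^bsub>PS\<^esub> w)"]
        bexI[of _ "?P \<otimes>\<^bsub>PS\<^esub> a \<oplus>\<^bsub>PS\<^esub> g \<otimes>\<^bsub>PS\<^esub> (\<phi> \<ominus>\<^bsub>PS\<^esub> PI \<otimes>\<^bsub>PS\<^esub> w)"]) auto
qed

text \<open>By \<open>X_power_mod\<close> everything from degree \<open>d * k\<close> on is
  absorbed, and the finitely many remaining coefficients matter only modulo the \<open>k\<close>-th
  power of \<open>\<pi>\<close>. Representatives are polynomials of degree below
  \<open>d * k\<close> with coefficients from a finite residue system.\<close>

lemma phi_fin:
  "\<exists>S. finite S \<and> S \<subseteq> carrier PS \<and> (\<forall>y\<in>carrier PS. \<exists>c\<in>S. \<exists>a\<in>carrier PS. \<exists>g\<in>carrier PS.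
     y = c \<oplus>\<^bsub>PS\<^esub> PI [^]\<^bsub>PS\<^esub> (k::nat) \<otimes>\<^bsub>PS\<^esub> a \<oplus>\<^bsub>PS\<^esub> \<phi> \<otimes>\<^bsub>PS\<^esub> g)"
proof -
  obtain T where T: "finite T" "T \<subseteq> carrier R"
    "\<And>x. x \<in> carrier R \<Longrightarrow> \<exists>c\<in>T. \<exists>y\<in>carrier R. x = c \<oplus> \<pi> [^] k \<otimes> y"
    using residues[of k] by blast
  obtain rc ry where rc: "\<And>x. x \<in> carrier R \<Longrightarrow> rc x \<in> T \<and> ry x \<in> carrier R \<and> x = rc x \<oplus> \<pi> [^] k \<otimes> ry x"
    using T(3) by metis
  define S where "S = {f. \<forall>x. (x \<in> {..<d * k} \<longrightarrow> f x \<in> T) \<and> (x \<notin> {..<d * k} \<longrightarrow> f x = \<zero>)}"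
  have fin: "finite S" unfolding S_def by (rule finite_set_of_finite_funs) (use T in auto)
  have sub: "S \<subseteq> carrier PS"
  proof
    fix f assume "f \<in> S"
    then have "f n \<in> carrier R" for n using T(2) by (cases "n < d * k") (auto simp: S_def)
    then show "f \<in> carrier PS" by (simp add: PS_simps)
  qed
  obtain a0 g0 where ag: "a0 \<in> carrier PS" "g0 \<in> carrier PS"
    "mon \<one> (d * k) = PI [^]\<^bsub>PS\<^esub> k \<otimes>\<^bsub>PS\<^esub> a0 \<oplus>\<^bsub>PS\<^esub> \<phi> \<otimes>\<^bsub>PS\<^esub> g0" using X_power_mod by blast
  let ?P = "PI [^]\<^bsub>PS\<^esub> k"
  have "\<exists>c\<in>S. \<exists>a\<in>carrier PS. \<exists>g\<in>carrier PS. y = c \<oplus>\<^bsub>PS\<^esub> ?P \<otimes>\<^bsub>PS\<^esub> a \<oplus>\<^bsub>PS\<^esub> \<phi> \<otimes>\<^bsub>PS\<^esub> g"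
    if y: "y \<in> carrier PS" for y
  proof -
    define c where "c = (\<lambda>n. if n < d * k then rc (y n) else \<zero>)"
    define z where "z = (\<lambda>n. if n < d * k then ry (y n) else \<zero>)"
    define y' where "y' = (\<lambda>n. y (n + d * k))"
    have cS: "c \<in> S" using y rc by (auto simp: S_def c_def)
    have cl: "c \<in> carrier PS" "y' \<in> carrier PS" "?P \<in> carrier PS"
      using cS sub shift_closed[OF y] by (auto simp: y'_def)
    have "z n \<in> carrier R" for n using rc[of "y n"] y by (simp add: z_def)
    then have cl: "c \<in> carrier PS" "z \<in> carrier PS" "y' \<in> carrier PS" "?P \<in> carrier PS"
      using cl by (simp_all add: PS_simps(1)[of z])
    have tr: "(\<lambda>n. if n < d * k then y n else \<zero>) = c \<oplus>\<^bsub>PS\<^esub> ?P \<otimes>\<^bsub>PS\<^esub> z"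
    proof
      fix n
      have "(?P \<otimes>\<^bsub>PS\<^esub> z) n = \<pi> [^] k \<otimes> z n" using cl by (simp add: mon_0_pow mon_mult)
      then show "(if n < d * k then y n else \<zero>) = (c \<oplus>\<^bsub>PS\<^esub> ?P \<otimes>\<^bsub>PS\<^esub> z) n"
        using rc[of "y n"] y unfolding coeff_add by (simp add: c_def z_def)
    qed
    have "y = (c \<oplus>\<^bsub>PS\<^esub> ?P \<otimes>\<^bsub>PS\<^esub> z) \<oplus>\<^bsub>PS\<^esub> mon \<one> (d * k) \<otimes>\<^bsub>PS\<^esub> y'"
      unfolding tr[symmetric] y'_def by (rule PS_split[OF y])
    also have "\<dots> = c \<oplus>\<^bsub>PS\<^esub> ?P \<otimes>\<^bsub>PS\<^esub> (z \<oplus>\<^bsub>PS\<^esub> a0 \<otimes>\<^bsub>PS\<^esub> y') \<oplus>\<^bsub>PS\<^esub> \<phi> \<otimes>\<^bsub>PS\<^esub> (g0 \<otimes>\<^bsub>PS\<^esub> y')"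
      unfolding ag(3) using cl ag(1,2) phi_closed by algebra
    finally show ?thesis using cS cl ag(1,2) 
      by (intro bexI[of _ c] bexI[of _ "z \<oplus>\<^bsub>PS\<^esub> a0 \<otimes>\<^bsub>PS\<^esub> y'"] bexI[of _ "g0 \<otimes>\<^bsub>PS\<^esub> y'"]) auto
  qed
  then show ?thesis using fin sub by blast
qed

text \<open>In the quotient by \<open>\<phi>\<close> every nonzero element divides a power of
  \<open>\<pi>\<close>. For \<open>\<phi> = X\<close> the quotient is the valuation ring itself.
  Otherwise \<open>w\<close> is a unit and \<open>X\<close> behaves as a uniformizer of the
  quotient: \<open>x\<close> is divided by \<open>X\<close> until a unit appears, and endless
  division would put \<open>x\<close> into the ideal.\<close>

lemma phi_div:
  assumes x: "x \<in> carrier PS" "x \<notin> PIdl\<^bsub>PS\<^esub> \<phi>"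
  shows "\<exists>(k::nat). \<exists>l\<in>carrier PS. \<exists>g\<in>carrier PS. PI [^]\<^bsub>PS\<^esub> k = l \<otimes>\<^bsub>PS\<^esub> x \<oplus>\<^bsub>PS\<^esub> \<phi> \<otimes>\<^bsub>PS\<^esub> g"
proof (cases "\<phi> = XX")
  case True
  define x' where "x' = (\<lambda>n. x (n + 1))"
  have x': "x' \<in> carrier PS" unfolding x'_def by (rule shift_closed[OF x(1)])
  have xe: "x = mon (x 0) 0 \<oplus>\<^bsub>PS\<^esub> \<phi> \<otimes>\<^bsub>PS\<^esub> x'" unfolding True x'_def by (rule PS_split1[OF x(1)])
  have "x 0 \<noteq> \<zero>"
  proof
    assume "x 0 = \<zero>"
    then have "mon (x 0) 0 = \<zero>\<^bsub>PS\<^esub>" by (auto simp: mon_def PS_simps)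
    then have "x = \<zero>\<^bsub>PS\<^esub> \<oplus>\<^bsub>PS\<^esub> \<phi> \<otimes>\<^bsub>PS\<^esub> x'" by (rule subst) (rule xe)
    also have "\<dots> = x' \<otimes>\<^bsub>PS\<^esub> \<phi>" using x' P.m_comm[of \<phi> x'] by simp
    finally have "x = x' \<otimes>\<^bsub>PS\<^esub> \<phi>" .
    then show False using x(2) x' by (auto simp: cgenideal_def)
  qed
  then obtain k u where u: "u \<in> Units R" "x 0 = \<pi> [^] (k::nat) \<otimes> u" using pi_factor[of "x 0"] x by auto
  let ?u = "mon (inv u) 0"
  have "PI [^]\<^bsub>PS\<^esub> k = ?u \<otimes>\<^bsub>PS\<^esub> mon (x 0) 0"
    using u Units_closed[OF u(1)] m_lcomm[of "inv u" "\<pi> [^] k" u] by (simp add: mon_0_pow mon_mult_mon)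
  also have "\<dots> = ?u \<otimes>\<^bsub>PS\<^esub> x \<oplus>\<^bsub>PS\<^esub> \<phi> \<otimes>\<^bsub>PS\<^esub> (\<ominus>\<^bsub>PS\<^esub> (?u \<otimes>\<^bsub>PS\<^esub> x'))"
  proof -
    have c: "?u \<in> carrier PS" "mon (x 0) 0 \<in> carrier PS" using u x by auto
    show ?thesis by (subst (2) xe) (use c x' phi_closed in algebra)
  qed
  finally show ?thesis using u x x' by (intro exI[of _ k] bexI[of _ ?u] bexI[of _ "\<ominus>\<^bsub>PS\<^esub> (?u \<otimes>\<^bsub>PS\<^esub> x')"]) auto
next
  case False
  then have w0: "w 0 = \<one>" using phi_cases by blast
  then have "w \<in> Units PS" by (intro PS_unit) auto
  then obtain w' where w': "w' \<in> carrier PS" "w \<otimes>\<^bsub>PS\<^esub> w' = \<one>\<^bsub>PS\<^esub>" unfolding Units_def by blast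
  let ?D = "mon \<one> (d - 1)"
  have c: "XX \<in> carrier PS" "PI \<in> carrier PS" "?D \<in> carrier PS" by auto
  have XD: "mon \<one> d = XX \<otimes>\<^bsub>PS\<^esub> ?D" using d_pos by (simp add: mon_mult_mon)
  \<comment> \<open>Solving \<open>\<phi> = X ^ d + \<pi> w\<close> for \<open>\<pi>\<close>, with
    \<open>w'\<close> the inverse of \<open>w\<close>, shows that \<open>\<pi>\<close> is a multiple
    of \<open>X\<close> modulo \<open>\<phi>\<close>; here \<open>d > 0\<close> is
    essential.\<close>
  have PIe: "PI \<otimes>\<^bsub>PS\<^esub> z = XX \<otimes>\<^bsub>PS\<^esub> (\<ominus>\<^bsub>PS\<^esub> (?D \<otimes>\<^bsub>PS\<^esub> (w' \<otimes>\<^bsub>PS\<^esub> z))) \<oplus>\<^bsub>PS\<^esub> \<phi> \<otimes>\<^bsub>PS\<^esub> (w' \<otimes>\<^bsub>PS\<^esub> z)"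
    if z: "z \<in> carrier PS" for z
  proof -
    have "XX \<otimes>\<^bsub>PS\<^esub> (\<ominus>\<^bsub>PS\<^esub> (?D \<otimes>\<^bsub>PS\<^esub> (w' \<otimes>\<^bsub>PS\<^esub> z))) \<oplus>\<^bsub>PS\<^esub> \<phi> \<otimes>\<^bsub>PS\<^esub> (w' \<otimes>\<^bsub>PS\<^esub> z) =
        PI \<otimes>\<^bsub>PS\<^esub> ((w \<otimes>\<^bsub>PS\<^esub> w') \<otimes>\<^bsub>PS\<^esub> z)"
      unfolding phi_eq XD using c w'(1) z w_closed by algebra
    then show ?thesis unfolding w'(2) using z by simp
  qed
  \<comment> \<open>The constant term of a series that is not a unit is divisible by
    \<open>\<pi>\<close>, hence by \<open>X\<close> modulo \<open>\<phi>\<close>; the other terms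
    are divisible by \<open>X\<close> anyway.\<close>
  have step: "\<exists>y'\<in>carrier PS. \<exists>c\<in>carrier PS. y = XX \<otimes>\<^bsub>PS\<^esub> y' \<oplus>\<^bsub>PS\<^esub> \<phi> \<otimes>\<^bsub>PS\<^esub> c"
    if y: "y \<in> carrier PS" "y \<notin> Units PS" for y
  proof -
    have y0: "y 0 \<notin> Units R" using y PS_unit by blast
    have "\<exists>z\<in>carrier R. y 0 = \<pi> \<otimes> z"
    proof (cases "y 0 = \<zero>")
      case True then show ?thesis by (intro bexI[of _ \<zero>]) auto
    next
      case False
      then obtain k u where u: "u \<in> Units R" "y 0 = \<pi> [^] (k::nat) \<otimes> u" using pi_factor[of "y 0"] y by auto
      then have "k \<noteq> 0" using y0 by (cases k) auto
      then obtain j where "k = Suc j" by (cases k) auto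
      then show ?thesis using u by (intro bexI[of _ "\<pi> [^] j \<otimes> u"]) (auto simp: m_ac)
    qed
    then obtain z where z: "z \<in> carrier R" "y 0 = \<pi> \<otimes> z" by blast
    define y' where "y' = (\<lambda>n. y (n + 1))"
    have y': "y' \<in> carrier PS" unfolding y'_def by (rule shift_closed[OF y(1)])
    let ?Z = "mon z 0"
    have Z: "?Z \<in> carrier PS" using z by simp
    have "y = mon (y 0) 0 \<oplus>\<^bsub>PS\<^esub> XX \<otimes>\<^bsub>PS\<^esub> y'" unfolding y'_def by (rule PS_split1[OF y(1)])
    also have "mon (y 0) 0 = PI \<otimes>\<^bsub>PS\<^esub> ?Z" using z by (simp add: mon_mult_mon)
    also have "PI \<otimes>\<^bsub>PS\<^esub> ?Z \<oplus>\<^bsub>PS\<^esub> XX \<otimes>\<^bsub>PS\<^esub> y' =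
        XX \<otimes>\<^bsub>PS\<^esub> (y' \<ominus>\<^bsub>PS\<^esub> ?D \<otimes>\<^bsub>PS\<^esub> (w' \<otimes>\<^bsub>PS\<^esub> ?Z)) \<oplus>\<^bsub>PS\<^esub> \<phi> \<otimes>\<^bsub>PS\<^esub> (w' \<otimes>\<^bsub>PS\<^esub> ?Z)"
      unfolding PIe[OF Z] using c Z y' w'(1) phi_closed by algebra
    finally show ?thesis using c Z y' w'
      by (intro bexI[of _ "y' \<ominus>\<^bsub>PS\<^esub> ?D \<otimes>\<^bsub>PS\<^esub> (w' \<otimes>\<^bsub>PS\<^esub> ?Z)"] bexI[of _ "w' \<otimes>\<^bsub>PS\<^esub> ?Z"]) auto
  qed
  obtain Y Cc where YC: "\<And>y. y \<in> carrier PS \<Longrightarrow> y \<notin> Units PS \<Longrightarrow>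
      Y y \<in> carrier PS \<and> Cc y \<in> carrier PS \<and> y = XX \<otimes>\<^bsub>PS\<^esub> Y y \<oplus>\<^bsub>PS\<^esub> \<phi> \<otimes>\<^bsub>PS\<^esub> Cc y"
    using step by metis
  define xs where "xs = (\<lambda>m. (Y ^^ m) x)"
  have xs0: "xs 0 = x" and xsS: "xs (Suc m) = Y (xs m)" for m by (simp_all add: xs_def)
  have "\<exists>m. xs m \<in> Units PS"
  proof (rule ccontr)
    assume nu: "\<not> ?thesis"
    have xsc: "xs m \<in> carrier PS" for m by (induction m) (use x YC nu in \<open>auto simp: xs0 xsS\<close>)
    have Ccc: "Cc (xs m) \<in> carrier PS" for m using YC xsc nu by blast
    have xse: "xs m = XX \<otimes>\<^bsub>PS\<^esub> xs (Suc m) \<oplus>\<^bsub>PS\<^esub> \<phi> \<otimes>\<^bsub>PS\<^esub> Cc (xs m)" for m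
      using YC[OF xsc] nu unfolding xsS by blast
    \<comment> \<open>The cofactors of \<open>\<phi>\<close> collected during the first
      \<open>m + 1\<close> divisions. New contributions start in degree \<open>m + 1\<close>, so the
      sums converge, and in the limit the remainder disappears: \<open>x\<close> becomes a multiple
      of \<open>\<phi>\<close>.\<close>
    define s where "s = rec_nat (Cc x) (\<lambda>m g. g \<oplus>\<^bsub>PS\<^esub> mon \<one> (Suc m) \<otimes>\<^bsub>PS\<^esub> Cc (xs (Suc m)))"
    have s0: "s 0 = Cc (xs 0)" and sS: "s (Suc m) = s m \<oplus>\<^bsub>PS\<^esub> mon \<one> (Suc m) \<otimes>\<^bsub>PS\<^esub> Cc (xs (Suc m))" for m
      by (simp_all add: s_def xs0)
    have sc: "s m \<in> carrier PS" for m by (induction m) (use Ccc in \<open>auto simp: s0 sS\<close>)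
    have stab: "s (Suc m) i = s m i" if "i \<le> m" for m i
      unfolding sS coeff_add using that Ccc[of "Suc m"] PS_coeff[OF sc, of m i] by (subst mon_mult) auto
    have xe: "x = \<phi> \<otimes>\<^bsub>PS\<^esub> s m \<oplus>\<^bsub>PS\<^esub> mon \<one> (Suc m) \<otimes>\<^bsub>PS\<^esub> xs (Suc m)" for m
    proof (induction m)
      case 0
      show ?case using xse[of 0] xsc[of "Suc 0"] Ccc[of 0] c phi_closed
        by (simp only: xs0 s0 P.a_comm P.m_closed One_nat_def)
    next
      case (Suc m)
      have M: "mon \<one> (Suc m) \<in> carrier PS" by simp
      have "\<phi> \<otimes>\<^bsub>PS\<^esub> (s m \<oplus>\<^bsub>PS\<^esub> mon \<one> (Suc m) \<otimes>\<^bsub>PS\<^esub> Cc (xs (Suc m))) \<oplus>\<^bsub>PS\<^esub>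
          (mon \<one> (Suc m) \<otimes>\<^bsub>PS\<^esub> XX) \<otimes>\<^bsub>PS\<^esub> xs (Suc (Suc m)) =
          \<phi> \<otimes>\<^bsub>PS\<^esub> s m \<oplus>\<^bsub>PS\<^esub> mon \<one> (Suc m) \<otimes>\<^bsub>PS\<^esub> (XX \<otimes>\<^bsub>PS\<^esub> xs (Suc (Suc m)) \<oplus>\<^bsub>PS\<^esub> \<phi> \<otimes>\<^bsub>PS\<^esub> Cc (xs (Suc m)))"
        using M xsc[of "Suc (Suc m)"] sc[of m] Ccc[of "Suc m"] c phi_closed by algebra
      then show ?case unfolding sS mon_Suc[of "Suc m"] xse[of "Suc m", symmetric] using Suc by simp
    qed
    define S where "S = (\<lambda>i. s i i)"
    have S: "S \<in> carrier PS" unfolding S_def by (rule PS_limit(1)[of s, OF sc stab])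
    have Si: "s m i = S i" if "i \<le> m" for i m
      unfolding S_def using PS_limit(2)[of s, OF sc stab that] .
    have "x = \<phi> \<otimes>\<^bsub>PS\<^esub> S"
    proof
      fix n
      have "x n = (\<phi> \<otimes>\<^bsub>PS\<^esub> s n) n \<oplus> (mon \<one> (Suc n) \<otimes>\<^bsub>PS\<^esub> xs (Suc n)) n"
        by (subst xe[of n]) (rule coeff_add)
      also have "(mon \<one> (Suc n) \<otimes>\<^bsub>PS\<^esub> xs (Suc n)) n = \<zero>" using xsc by (subst mon_mult) auto
      also have "(\<phi> \<otimes>\<^bsub>PS\<^esub> s n) n = (\<phi> \<otimes>\<^bsub>PS\<^esub> S) n" by (rule PS_mult_cong) (use Si S in auto)
      finally show "x n = (\<phi> \<otimes>\<^bsub>PS\<^esub> S) n" using S PS_coeff[OF P.m_closed[OF phi_closed S]] by simp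
    qed
    then have "x = S \<otimes>\<^bsub>PS\<^esub> \<phi>" using S P.m_comm[of S \<phi>] by simp
    then show False using x(2) S by (auto simp: cgenideal_def)
  qed
  then obtain m where m: "xs m \<in> Units PS" "\<And>i. i < m \<Longrightarrow> xs i \<notin> Units PS"
    using exists_least_iff[of "\<lambda>m. xs m \<in> Units PS"] by blast
  have "j \<le> m \<Longrightarrow> xs j \<in> carrier PS \<and> (\<exists>s\<in>carrier PS. x = mon \<one> j \<otimes>\<^bsub>PS\<^esub> xs j \<oplus>\<^bsub>PS\<^esub> \<phi> \<otimes>\<^bsub>PS\<^esub> s)" for j
  proof (induction j)
    case 0
    show ?case using x by (auto simp: xs0 intro!: bexI[of _ "\<zero>\<^bsub>PS\<^esub>"] simp flip: PS_one)
  next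
    case (Suc j)
    then obtain s where s: "s \<in> carrier PS" "x = mon \<one> j \<otimes>\<^bsub>PS\<^esub> xs j \<oplus>\<^bsub>PS\<^esub> \<phi> \<otimes>\<^bsub>PS\<^esub> s" "xs j \<in> carrier PS" by auto
    have YCj: "xs (Suc j) \<in> carrier PS" "Cc (xs j) \<in> carrier PS"
      "xs j = XX \<otimes>\<^bsub>PS\<^esub> xs (Suc j) \<oplus>\<^bsub>PS\<^esub> \<phi> \<otimes>\<^bsub>PS\<^esub> Cc (xs j)"
      using YC[OF s(3)] m(2)[of j] Suc.prems unfolding xsS by auto
    have M: "mon \<one> j \<in> carrier PS" by simp
    have "x = mon \<one> j \<otimes>\<^bsub>PS\<^esub> (XX \<otimes>\<^bsub>PS\<^esub> xs (Suc j) \<oplus>\<^bsub>PS\<^esub> \<phi> \<otimes>\<^bsub>PS\<^esub> Cc (xs j)) \<oplus>\<^bsub>PS\<^esub> \<phi> \<otimes>\<^bsub>PS\<^esub> s"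
      unfolding YCj(3)[symmetric] by (rule s(2))
    also have "\<dots> = (mon \<one> j \<otimes>\<^bsub>PS\<^esub> XX) \<otimes>\<^bsub>PS\<^esub> xs (Suc j) \<oplus>\<^bsub>PS\<^esub> \<phi> \<otimes>\<^bsub>PS\<^esub> (mon \<one> j \<otimes>\<^bsub>PS\<^esub> Cc (xs j) \<oplus>\<^bsub>PS\<^esub> s)"
      using M c YCj(1,2) s(1) phi_closed by algebra
    finally show ?case unfolding mon_Suc using YCj(1,2) s(1) M by blast
  qed
  then obtain s where s: "s \<in> carrier PS" "x = mon \<one> m \<otimes>\<^bsub>PS\<^esub> xs m \<oplus>\<^bsub>PS\<^esub> \<phi> \<otimes>\<^bsub>PS\<^esub> s" by blast
  obtain u where u: "u \<in> carrier PS" "xs m \<otimes>\<^bsub>PS\<^esub> u = \<one>\<^bsub>PS\<^esub>" using m(1) unfolding Units_def by blast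
  have xsm: "xs m \<in> carrier PS" using m(1) by auto
  \<comment> \<open>As \<open>\<pi>\<close> is a multiple of \<open>X\<close> modulo
    \<open>\<phi>\<close>, the \<open>j\<close>-th power of \<open>\<pi>\<close> is a multiple of
    \<open>X ^ j\<close>. It remains to express \<open>X ^ m\<close> by \<open>x\<close>.\<close>
  have "\<exists>l\<in>carrier PS. \<exists>g\<in>carrier PS. PI [^]\<^bsub>PS\<^esub> j = l \<otimes>\<^bsub>PS\<^esub> mon \<one> j \<oplus>\<^bsub>PS\<^esub> \<phi> \<otimes>\<^bsub>PS\<^esub> g" for j :: nat
  proof (induction j)
    case 0
    show ?case by (rule bexI[of _ "\<one>\<^bsub>PS\<^esub>"], rule bexI[of _ "\<zero>\<^bsub>PS\<^esub>"]) (auto simp flip: PS_one)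
  next
    case (Suc j)
    then obtain l g where lg: "l \<in> carrier PS" "g \<in> carrier PS"
      "PI [^]\<^bsub>PS\<^esub> j = l \<otimes>\<^bsub>PS\<^esub> mon \<one> j \<oplus>\<^bsub>PS\<^esub> \<phi> \<otimes>\<^bsub>PS\<^esub> g" by blast
    have M: "mon \<one> j \<in> carrier PS" by simp
    let ?e = "\<ominus>\<^bsub>PS\<^esub> (?D \<otimes>\<^bsub>PS\<^esub> w')"
    have e: "?e \<in> carrier PS" using w' by simp
    have P1: "PI = XX \<otimes>\<^bsub>PS\<^esub> ?e \<oplus>\<^bsub>PS\<^esub> \<phi> \<otimes>\<^bsub>PS\<^esub> w'" using PIe[of "\<one>\<^bsub>PS\<^esub>"] w' by simp
    have e1: "PI [^]\<^bsub>PS\<^esub> Suc j = PI [^]\<^bsub>PS\<^esub> j \<otimes>\<^bsub>PS\<^esub> PI" by simp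
    have e2: "PI [^]\<^bsub>PS\<^esub> j \<otimes>\<^bsub>PS\<^esub> PI =
        (l \<otimes>\<^bsub>PS\<^esub> mon \<one> j \<oplus>\<^bsub>PS\<^esub> \<phi> \<otimes>\<^bsub>PS\<^esub> g) \<otimes>\<^bsub>PS\<^esub> (XX \<otimes>\<^bsub>PS\<^esub> ?e \<oplus>\<^bsub>PS\<^esub> \<phi> \<otimes>\<^bsub>PS\<^esub> w')"
      by (rule arg_cong2[OF lg(3) P1])
    have e3: "(l \<otimes>\<^bsub>PS\<^esub> m \<oplus>\<^bsub>PS\<^esub> \<phi> \<otimes>\<^bsub>PS\<^esub> g) \<otimes>\<^bsub>PS\<^esub> (x \<otimes>\<^bsub>PS\<^esub> e \<oplus>\<^bsub>PS\<^esub> \<phi> \<otimes>\<^bsub>PS\<^esub> w') =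
        (l \<otimes>\<^bsub>PS\<^esub> e) \<otimes>\<^bsub>PS\<^esub> (m \<otimes>\<^bsub>PS\<^esub> x) \<oplus>\<^bsub>PS\<^esub>
        \<phi> \<otimes>\<^bsub>PS\<^esub> (l \<otimes>\<^bsub>PS\<^esub> m \<otimes>\<^bsub>PS\<^esub> w' \<oplus>\<^bsub>PS\<^esub> g \<otimes>\<^bsub>PS\<^esub> (x \<otimes>\<^bsub>PS\<^esub> e \<oplus>\<^bsub>PS\<^esub> \<phi> \<otimes>\<^bsub>PS\<^esub> w'))"
      if "m \<in> carrier PS" "x \<in> carrier PS" "e \<in> carrier PS" for m x e
      using that lg(1,2) w'(1) phi_closed by algebra
    let ?l = "l \<otimes>\<^bsub>PS\<^esub> ?e"
    let ?g = "l \<otimes>\<^bsub>PS\<^esub> mon \<one> j \<otimes>\<^bsub>PS\<^esub> w' \<oplus>\<^bsub>PS\<^esub> g \<otimes>\<^bsub>PS\<^esub> (XX \<otimes>\<^bsub>PS\<^esub> ?e \<oplus>\<^bsub>PS\<^esub> \<phi> \<otimes>\<^bsub>PS\<^esub> w')"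
    have eq: "PI [^]\<^bsub>PS\<^esub> Suc j = ?l \<otimes>\<^bsub>PS\<^esub> mon \<one> (Suc j) \<oplus>\<^bsub>PS\<^esub> \<phi> \<otimes>\<^bsub>PS\<^esub> ?g"
      by (subst mon_Suc) (rule trans[OF e1 trans[OF e2 e3[OF M c(1) e]]])
    have "?l \<in> carrier PS" "?g \<in> carrier PS" using lg(1,2) M e c(1) w'(1) by simp_all
    then show ?case using eq by (intro bexI[of _ ?l] bexI[of _ ?g])
  qed
  then obtain l g where lg: "l \<in> carrier PS" "g \<in> carrier PS"
    "PI [^]\<^bsub>PS\<^esub> m = l \<otimes>\<^bsub>PS\<^esub> mon \<one> m \<oplus>\<^bsub>PS\<^esub> \<phi> \<otimes>\<^bsub>PS\<^esub> g" by blast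
  have M: "mon \<one> m \<in> carrier PS" by simp
  \<comment> \<open>Multiplying \<open>s(2)\<close> by the inverse \<open>u\<close> of
    \<open>xs m\<close> gives \<open>X ^ m = u x - \<phi> s u\<close>; substituted into
    \<open>lg(3)\<close>, this yields the cofactors \<open>l u\<close> and
    \<open>g - l u s\<close>.\<close>
  have "l \<otimes>\<^bsub>PS\<^esub> u \<otimes>\<^bsub>PS\<^esub> x \<oplus>\<^bsub>PS\<^esub> \<phi> \<otimes>\<^bsub>PS\<^esub> (g \<ominus>\<^bsub>PS\<^esub> l \<otimes>\<^bsub>PS\<^esub> u \<otimes>\<^bsub>PS\<^esub> s) =
      l \<otimes>\<^bsub>PS\<^esub> (mon \<one> m \<otimes>\<^bsub>PS\<^esub> (xs m \<otimes>\<^bsub>PS\<^esub> u)) \<oplus>\<^bsub>PS\<^esub> \<phi> \<otimes>\<^bsub>PS\<^esub> g"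
    unfolding s(2) using lg(1,2) M u(1) xsm s(1) phi_closed by algebra
  also have "\<dots> = PI [^]\<^bsub>PS\<^esub> m" unfolding u(2) lg(3) using M by simp
  finally show ?thesis using lg(1,2) u(1) s(1)
    by (intro exI[of _ m] bexI[of _ "l \<otimes>\<^bsub>PS\<^esub> u"] bexI[of _ "g \<ominus>\<^bsub>PS\<^esub> l \<otimes>\<^bsub>PS\<^esub> u \<otimes>\<^bsub>PS\<^esub> s"]) auto
qed

end

section \<open>The modules \<open>\<Lambda>/\<Phi>\<^sub>n\<close>\<close>

context dvr
begin

lemma X_group_endo: "group_endo (add_monoid PS) (\<lambda>f. XX \<otimes>\<^bsub>PS\<^esub> f)"
proof (intro group_endo.intro group_endo_axioms.intro P.a_comm_group)
  show "(\<lambda>f. XX \<otimes>\<^bsub>PS\<^esub> f) \<in> hom (add_monoid PS) (add_monoid PS)"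
    by (rule homI) (simp_all add: P.r_distr)
qed

interpretation G: group_endo "add_monoid PS" "\<lambda>f. XX \<otimes>\<^bsub>PS\<^esub> f"
  by (rule X_group_endo)

text \<open>The ring homomorphism from the integer polynomials to the power series with
  \<open>x\<close> going to \<open>X\<close>. It is obtained from the module structure of
  \<open>group_endo\<close> by acting on 1, so its laws are those of \<open>act\<close>.\<close>

definition ev :: "int poly \<Rightarrow> nat \<Rightarrow> 'a" where
  "ev q = G.act q \<one>\<^bsub>PS\<^esub>"

lemma ev_closed [simp]: "ev q \<in> carrier PS"
  using G.act_closed[of "\<one>\<^bsub>PS\<^esub>" q] by (simp add: ev_def)

lemma act_pCons: "f \<in> carrier PS \<Longrightarrow> G.act (pCons c q) f = [c] \<cdot>\<^bsub>PS\<^esub> f \<oplus>\<^bsub>PS\<^esub> XX \<otimes>\<^bsub>PS\<^esub> G.act q f"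
  using G.act_pCons[of f c q] by (simp add: add_pow_def)

lemma act_closed: "f \<in> carrier PS \<Longrightarrow> G.act q f \<in> carrier PS"
  using G.act_closed[of f q] by simp

lemma act_ev:
  assumes f: "f \<in> carrier PS" shows "G.act q f = ev q \<otimes>\<^bsub>PS\<^esub> f"
proof (induction q)
  case 0 then show ?case using f G.act_0[of f] G.act_0[of "\<one>\<^bsub>PS\<^esub>"] by (simp add: ev_def)
next
  case (pCons c q)
  have c: "[c] \<cdot>\<^bsub>PS\<^esub> \<one>\<^bsub>PS\<^esub> \<in> carrier PS" by simp
  have "ev (pCons c q) = [c] \<cdot>\<^bsub>PS\<^esub> \<one>\<^bsub>PS\<^esub> \<oplus>\<^bsub>PS\<^esub> XX \<otimes>\<^bsub>PS\<^esub> ev q"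
    unfolding ev_def by (rule act_pCons) simp
  then have "ev (pCons c q) \<otimes>\<^bsub>PS\<^esub> f = ([c] \<cdot>\<^bsub>PS\<^esub> \<one>\<^bsub>PS\<^esub>) \<otimes>\<^bsub>PS\<^esub> f \<oplus>\<^bsub>PS\<^esub> XX \<otimes>\<^bsub>PS\<^esub> (ev q \<otimes>\<^bsub>PS\<^esub> f)"
    using f c by (simp add: P.l_distr P.m_assoc)
  also have "([c] \<cdot>\<^bsub>PS\<^esub> \<one>\<^bsub>PS\<^esub>) \<otimes>\<^bsub>PS\<^esub> f = [c] \<cdot>\<^bsub>PS\<^esub> f" using f by (simp add: P.add_pow_ldistr_int)
  finally show ?case unfolding act_pCons[OF f] pCons.IH ..
qed

lemma ev_mult: "ev (q * r) = ev q \<otimes>\<^bsub>PS\<^esub> ev r"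
  using G.act_mult[of "\<one>\<^bsub>PS\<^esub>" q r] act_ev[of "G.act r \<one>\<^bsub>PS\<^esub>" q] act_closed[of "\<one>\<^bsub>PS\<^esub>" r]
  by (simp add: ev_def)

lemma ev_add: "ev (q + r) = ev q \<oplus>\<^bsub>PS\<^esub> ev r"
  using G.act_add[of "\<one>\<^bsub>PS\<^esub>" q r] by (simp add: ev_def)

lemma ev_one: "ev 1 = \<one>\<^bsub>PS\<^esub>"
  using G.act_one[of "\<one>\<^bsub>PS\<^esub>"] by (simp add: ev_def)

lemma ev_minus: "ev (q - r) = ev q \<ominus>\<^bsub>PS\<^esub> ev r"
  using G.act_minus[of "\<one>\<^bsub>PS\<^esub>" q r] by (simp add: ev_def a_minus_def a_inv_def)

lemma ev_X: "ev [:0, 1:] = XX"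
  using G.act_X[of "\<one>\<^bsub>PS\<^esub>"] by (simp add: ev_def)

lemma ev_power: "ev (q ^ n) = ev q [^]\<^bsub>PS\<^esub> n"
  by (induction n) (simp_all only: power_0 ev_one power_Suc2 ev_mult P.nat_pow_0 P.nat_pow_Suc)

lemma X_pow: "XX [^]\<^bsub>PS\<^esub> n = mon \<one> n"
  by (induction n) (simp_all only: P.nat_pow_0 PS_one P.nat_pow_Suc mon_Suc)

lemma PI_eq: "[p] \<cdot>\<^bsub>PS\<^esub> \<one>\<^bsub>PS\<^esub> = PI"
proof -
  have "[n] \<cdot>\<^bsub>PS\<^esub> \<one>\<^bsub>PS\<^esub> = mon ([n] \<cdot> \<one>) 0" for n :: nat
  proof (induction n)
    case 0 show ?case by (auto simp: mon_def PS_simps)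
  next
    case (Suc n)
    then show ?case by (intro ext) (simp add: PS_one, simp add: coeff_add mon_def)
  qed
  then show ?thesis by (simp add: pi_eq)
qed

lemma ev_p: "ev (of_nat p) = PI"
  using G.act_of_nat[of "\<one>\<^bsub>PS\<^esub>" p] PI_eq by (simp add: ev_def add_pow_def)

lemma ev_coeff_0: assumes "poly.coeff q 0 = 1" shows "ev q 0 = \<one>"
proof -
  obtain r where q: "q = pCons 1 r" using assms by (cases q) auto
  have "ev q = [(1::int)] \<cdot>\<^bsub>PS\<^esub> \<one>\<^bsub>PS\<^esub> \<oplus>\<^bsub>PS\<^esub> XX \<otimes>\<^bsub>PS\<^esub> ev r"
    unfolding q ev_def by (rule act_pCons) simp
  moreover have "[(1::int)] \<cdot>\<^bsub>PS\<^esub> \<one>\<^bsub>PS\<^esub> = \<one>\<^bsub>PS\<^esub>" using P.add.int_pow_1[of "\<one>\<^bsub>PS\<^esub>"] by simp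
  moreover have "(XX \<otimes>\<^bsub>PS\<^esub> ev r) 0 = \<zero>" by (subst mon_mult) auto
  ultimately show ?thesis by (simp add: coeff_add) (simp add: PS_one mon_def)
qed

definition om :: "nat \<Rightarrow> nat \<Rightarrow> 'a" where
  "om n = (\<one>\<^bsub>PS\<^esub> \<oplus>\<^bsub>PS\<^esub> XX) [^]\<^bsub>PS\<^esub> (p ^ n) \<ominus>\<^bsub>PS\<^esub> \<one>\<^bsub>PS\<^esub>"

lemma om_closed [simp]: "om n \<in> carrier PS"
  by (simp add: om_def)

lemma om_ev: "om n = ev ([:1, 1:] ^ (p ^ n) - 1)"
proof -
  have "[:1, 1:] = 1 + [:0, 1:: int:]" by (simp add: one_pCons)
  then show ?thesis by (simp only: ev_minus ev_power ev_add ev_one ev_X om_def)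
qed

text \<open>The image of \<open>cyclotomic_int_poly\<close> under \<open>ev\<close>; it identifies
  the quotient of consecutive \<open>om\<close> as a series of Eisenstein type.\<close>

lemma om_step:
  "\<exists>q w d. eisenstein R p \<pi> q w d \<and> w 0 = \<one> \<and> q \<otimes>\<^bsub>PS\<^esub> om n = om (Suc n)"
proof -
  obtain q w :: "int poly" and d where q: "q * ([:1, 1:] ^ (p ^ n) - 1) = [:1, 1:] ^ (p ^ Suc n) - 1"
    "q = [:0, 1:] ^ d + of_nat p * w" "poly.coeff w 0 = 1" "d > 0"
    using cyclotomic_int_poly[OF prime_p, of n] by blast
  have "ev q = mon \<one> d \<oplus>\<^bsub>PS\<^esub> PI \<otimes>\<^bsub>PS\<^esub> ev w"
    unfolding q(2) by (simp only: ev_add ev_power ev_X X_pow ev_mult ev_p)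
  then have "eisenstein R p \<pi> (ev q) (ev w) d"
    using q(3,4) ev_coeff_0 by unfold_locales auto
  moreover have "ev q \<otimes>\<^bsub>PS\<^esub> om n = om (Suc n)"
    unfolding om_ev by (simp only: ev_mult[symmetric] q(1))
  ultimately show ?thesis using ev_coeff_0[OF q(3)] by blast
qed

lemma om_0: "om 0 = XX"
proof -
  have "XX \<in> carrier PS" "\<one>\<^bsub>PS\<^esub> \<in> carrier PS" by auto
  then have "\<one>\<^bsub>PS\<^esub> \<oplus>\<^bsub>PS\<^esub> XX \<ominus>\<^bsub>PS\<^esub> \<one>\<^bsub>PS\<^esub> = XX" by algebra
  then show ?thesis by (simp add: om_def)
qed

text \<open>Cancelling \<open>om n\<close> is what makes the quotient in the definition of
  \<open>Phi\<close> unique. In the induction step the factor \<open>q\<close> has constant term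
  \<open>\<pi>\<close> and so is not zero.\<close>

lemma om_nonzero: "om n \<noteq> \<zero>\<^bsub>PS\<^esub>"
proof (induction n)
  case 0
  have "XX 1 \<noteq> \<zero>\<^bsub>PS\<^esub> 1" by (simp add: mon_def coeff_zero)
  then show ?case unfolding om_0 by metis
next
  case (Suc n)
  interpret D: "domain" PS by (rule PS_domain)
  obtain q w d where e: "eisenstein R p \<pi> q w d" and w0: "w 0 = \<one>" and q: "q \<otimes>\<^bsub>PS\<^esub> om n = om (Suc n)"
    using om_step by blast
  interpret eisenstein R p \<pi> q w d by (rule e)
  have "q 0 = \<pi>" unfolding phi_eq coeff_add using d_pos by (simp add: mon_def[of \<one>] w0) (simp add: mon_def)
  then have "q \<noteq> \<zero>\<^bsub>PS\<^esub>" using pi_nonzero by (auto simp: coeff_zero)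
  then show ?case using Suc D.integral[of q "om n"] unfolding q[symmetric] by auto
qed

lemma Phi_unique:
  assumes "q \<in> carrier PS" "q \<otimes>\<^bsub>PS\<^esub> om n = om (Suc n)"
  shows "(THE q. q \<in> carrier PS \<and> q \<otimes>\<^bsub>PS\<^esub> om n = om (Suc n)) = q"
proof -
  interpret D: "domain" PS by (rule PS_domain)
  show ?thesis
  proof (rule the_equality)
    fix q' assume "q' \<in> carrier PS \<and> q' \<otimes>\<^bsub>PS\<^esub> om n = om (Suc n)"
    then show "q' = q" using assms om_nonzero[of n] D.m_rcancel[of "om n" q' q] by simp
  qed (use assms in simp)
qed

end

section \<open>The series \<open>Phi\<close> over Z_p\<close>

context padic
begin

lemma Zp_dvr: "dvr (Zp p) p \<pi>"
proof (intro dvr.intro dvr_axioms.intro Zp.domain_axioms)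
  show "\<pi> = [p] \<cdot>\<^bsub>Zp p\<^esub> \<one>\<^bsub>Zp p\<^esub>" by (rule pi_eq)
  fix k :: nat
  show "\<exists>S. finite S \<and> S \<subseteq> carrier (Zp p) \<and> (\<forall>x\<in>carrier (Zp p). \<exists>c\<in>S. \<exists>y\<in>carrier (Zp p).
      x = c \<oplus>\<^bsub>Zp p\<^esub> \<pi> [^]\<^bsub>Zp p\<^esub> k \<otimes>\<^bsub>Zp p\<^esub> y)"
    using Zp_residues[of k] by simp
qed (use prime_p pi_nz pi_not_unit Zp_factor in auto)

sublocale Zd: dvr "Zp p" p \<pi>
  by (rule Zp_dvr)

abbreviation "LL \<equiv> power_series_ring (Zp p)"

lemma Lambda_eq: "Lambda p = LL"
  by (simp add: Lambda_def)

lemma Lambda_X_eq: "Lambda_X p = Zd.XX"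
  unfolding Lambda_X_def power_series_X_def Zp.mon_def ..

lemma omega_eq: "omega p n = Zd.om n"
  by (simp only: omega_def Zd.om_def Lambda_eq Lambda_X_eq)

lemma Phi_eisenstein: "\<exists>w d. eisenstein (Zp p) p \<pi> (Phi p n) w d"
proof (cases n)
  case 0
  \<comment> \<open>For \<open>n = 0\<close> the series is \<open>X = X ^ 1 + \<pi> 0\<close>: it
    falls under the second alternative of \<open>phi_cases\<close>, with \<open>w = 0\<close> and
    \<open>d = 1\<close>.\<close>
  have w: "\<zero>\<^bsub>LL\<^esub> \<in> carrier LL" by (rule Zd.P.zero_closed)
  have "Phi p n = Zd.XX" using 0 by (simp only: Phi_def Lambda_X_eq) simp
  moreover have "Zd.XX = Zd.XX \<oplus>\<^bsub>LL\<^esub> Zd.PI \<otimes>\<^bsub>LL\<^esub> \<zero>\<^bsub>LL\<^esub>"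
    using Zp.mon_closed[OF Zp.one_closed, of 1] Zp.mon_closed[OF Zd.pi_closed, of 0]
    by (simp only: Zd.P.r_null Zd.P.r_zero)
  ultimately have "eisenstein (Zp p) p \<pi> (Phi p n) \<zero>\<^bsub>LL\<^esub> 1"
    using w by (intro eisenstein.intro eisenstein_axioms.intro Zp_dvr) simp_all
  then show ?thesis by blast
next
  case (Suc m)
  obtain q w d where e: "eisenstein (Zp p) p \<pi> q w d" and q: "q \<otimes>\<^bsub>LL\<^esub> Zd.om m = Zd.om (Suc m)"
    using Zd.om_step by blast
  have "q \<in> carrier LL" by (rule eisenstein.phi_closed[OF e])
  then have "Phi p n = q" using Zd.Phi_unique[OF _ q] Suc by (simp add: Phi_def Lambda_eq omega_eq)
  then show ?thesis using e by blast
qed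

end

section \<open>Submodules of direct sums up to pseudo-isomorphism\<close>

lemma (in abelian_group) minus_eq_zero_iff:
  assumes "x \<in> carrier G" "y \<in> carrier G"
  shows "x \<ominus> y = \<zero> \<longleftrightarrow> x = y"
proof
  assume e: "x \<ominus> y = \<zero>"
  have "(x \<ominus> y) \<oplus> y = x" using assms by (simp add: minus_eq a_assoc l_neg)
  then show "x = y" using assms by (simp add: e)
qed (use assms in \<open>simp add: minus_eq r_neg\<close>)

lemma direct_sum_simps:
  "carrier (direct_sum I M) = (\<Pi>\<^sub>E i\<in>I. carrier (M i))"
  "\<zero>\<^bsub>direct_sum I M\<^esub> = (\<lambda>i\<in>I. \<zero>\<^bsub>M i\<^esub>)"
  "x \<oplus>\<^bsub>direct_sum I M\<^esub> y = (\<lambda>i\<in>I. x i \<oplus>\<^bsub>M i\<^esub> y i)"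
  "r \<odot>\<^bsub>direct_sum I M\<^esub> x = (\<lambda>i\<in>I. r \<odot>\<^bsub>M i\<^esub> x i)"
  by (simp_all add: direct_sum_def)

lemma direct_sum_module:
  assumes "cring R" and M: "\<And>i. i \<in> I \<Longrightarrow> module R (M i)"
  shows "module R (direct_sum I M)"
proof (rule moduleI[OF assms(1)])
  have ab: "abelian_group (M i)" if "i \<in> I" for i using M[OF that] by (rule module.axioms(2))
  have am: "abelian_monoid (M i)" if "i \<in> I" for i using ab[OF that] by (rule abelian_group.axioms(1))
  show "abelian_group (direct_sum I M)"
  proof (rule abelian_groupI)
    fix x y z assume x: "x \<in> carrier (direct_sum I M)" and y: "y \<in> carrier (direct_sum I M)"
      and z: "z \<in> carrier (direct_sum I M)"
    show "x \<oplus>\<^bsub>direct_sum I M\<^esub> y \<in> carrier (direct_sum I M)"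
      using x y ab by (auto simp: direct_sum_simps PiE_mem intro!: abelian_monoid.a_closed[OF am])
    show "x \<oplus>\<^bsub>direct_sum I M\<^esub> y \<oplus>\<^bsub>direct_sum I M\<^esub> z = x \<oplus>\<^bsub>direct_sum I M\<^esub> (y \<oplus>\<^bsub>direct_sum I M\<^esub> z)"
      using x y z by (auto simp: direct_sum_simps PiE_mem intro!: restrict_ext abelian_monoid.a_assoc[OF am])
    show "x \<oplus>\<^bsub>direct_sum I M\<^esub> y = y \<oplus>\<^bsub>direct_sum I M\<^esub> x"
      using x y by (auto simp: direct_sum_simps PiE_mem intro!: restrict_ext abelian_monoid.a_comm[OF am])
  next
    fix x assume x: "x \<in> carrier (direct_sum I M)"
    show "\<zero>\<^bsub>direct_sum I M\<^esub> \<oplus>\<^bsub>direct_sum I M\<^esub> x = x"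
    proof
      fix i
      show "(\<zero>\<^bsub>direct_sum I M\<^esub> \<oplus>\<^bsub>direct_sum I M\<^esub> x) i = x i"
      proof (cases "i \<in> I")
        case True
        then have "x i \<in> carrier (M i)" using x unfolding direct_sum_simps by (rule PiE_mem[rotated])
        then show ?thesis using True by (simp add: direct_sum_simps abelian_monoid.l_zero[OF am])
      next
        case False
        then have "x i = undefined" using x unfolding direct_sum_simps by (intro PiE_arb)
        then show ?thesis using False by (simp add: direct_sum_simps)
      qed
    qed
    have xi: "x i \<in> carrier (M i)" if "i \<in> I" for i using x that unfolding direct_sum_simps by (rule PiE_mem)
    have "(\<lambda>i\<in>I. \<ominus>\<^bsub>M i\<^esub> x i) \<in> carrier (direct_sum I M)"
      unfolding direct_sum_simps restrict_PiE_iff using xi abelian_group.a_inv_closed[OF ab] by blast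
    moreover have "(\<lambda>i\<in>I. \<ominus>\<^bsub>M i\<^esub> x i) \<oplus>\<^bsub>direct_sum I M\<^esub> x = \<zero>\<^bsub>direct_sum I M\<^esub>"
      unfolding direct_sum_simps by (rule restrict_ext) (simp add: xi abelian_group.l_neg[OF ab])
    ultimately show "\<exists>y\<in>carrier (direct_sum I M). y \<oplus>\<^bsub>direct_sum I M\<^esub> x = \<zero>\<^bsub>direct_sum I M\<^esub>" by blast
  qed (auto simp: direct_sum_simps intro!: abelian_monoid.zero_closed[OF am])
next
  fix r x assume r: "r \<in> carrier R" and x: "x \<in> carrier (direct_sum I M)"
  have xi: "x i \<in> carrier (M i)" if "i \<in> I" for i using x that unfolding direct_sum_simps by (rule PiE_mem)
  show "r \<odot>\<^bsub>direct_sum I M\<^esub> x \<in> carrier (direct_sum I M)"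
    unfolding direct_sum_simps restrict_PiE_iff using r xi module.smult_closed[OF M] by blast
  fix r' assume r': "r' \<in> carrier R"
  show "(r \<oplus>\<^bsub>R\<^esub> r') \<odot>\<^bsub>direct_sum I M\<^esub> x = r \<odot>\<^bsub>direct_sum I M\<^esub> x \<oplus>\<^bsub>direct_sum I M\<^esub> r' \<odot>\<^bsub>direct_sum I M\<^esub> x"
    unfolding direct_sum_simps by (rule restrict_ext) (simp add: xi r r' module.smult_l_distr[OF M])
  show "(r \<otimes>\<^bsub>R\<^esub> r') \<odot>\<^bsub>direct_sum I M\<^esub> x = r \<odot>\<^bsub>direct_sum I M\<^esub> (r' \<odot>\<^bsub>direct_sum I M\<^esub> x)"
    unfolding direct_sum_simps by (rule restrict_ext) (simp add: xi r r' module.smult_assoc1[OF M])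
next
  fix r x y assume r: "r \<in> carrier R" and x: "x \<in> carrier (direct_sum I M)" and y: "y \<in> carrier (direct_sum I M)"
  have xi: "x i \<in> carrier (M i)" if "i \<in> I" for i using x that unfolding direct_sum_simps by (rule PiE_mem)
  have yi: "y i \<in> carrier (M i)" if "i \<in> I" for i using y that unfolding direct_sum_simps by (rule PiE_mem)
  show "r \<odot>\<^bsub>direct_sum I M\<^esub> (x \<oplus>\<^bsub>direct_sum I M\<^esub> y) = r \<odot>\<^bsub>direct_sum I M\<^esub> x \<oplus>\<^bsub>direct_sum I M\<^esub> r \<odot>\<^bsub>direct_sum I M\<^esub> y"
    unfolding direct_sum_simps by (rule restrict_ext) (simp add: xi yi r module.smult_r_distr[OF M])
next
  fix x assume x: "x \<in> carrier (direct_sum I M)"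
  have xi: "x i \<in> carrier (M i)" if "i \<in> I" for i using x that unfolding direct_sum_simps by (rule PiE_mem)
  have "x \<in> extensional I" using x unfolding direct_sum_simps by (auto simp: PiE_def)
  then show "\<one>\<^bsub>R\<^esub> \<odot>\<^bsub>direct_sum I M\<^esub> x = x"
    unfolding direct_sum_simps by (intro extensionalityI[of _ I]) (simp_all add: xi module.smult_one[OF M])
qed

locale pseudo_module = cring R for R (structure) + fixes c
  assumes c_closed [simp]: "c \<in> carrier R"
begin

text \<open>The three properties of the overview, with \<open>c\<close> in the place of
  \<open>p\<close>. The last one, stated for a single nonzero element, says that no proper nonzero
  submodule survives the inversion of \<open>c\<close>.\<close>

definition good :: "('a, 'd) module \<Rightarrow> bool" where
  "good M \<longleftrightarrow> module R M \<and>
    (\<forall>x\<in>carrier M. c \<odot>\<^bsub>M\<^esub> x = \<zero>\<^bsub>M\<^esub> \<longrightarrow> x = \<zero>\<^bsub>M\<^esub>) \<and>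
    (\<forall>k::nat. \<exists>S. finite S \<and> S \<subseteq> carrier M \<and>
      (\<forall>x\<in>carrier M. \<exists>s\<in>S. \<exists>a\<in>carrier M. x = s \<oplus>\<^bsub>M\<^esub> (c [^] k) \<odot>\<^bsub>M\<^esub> a)) \<and>
    (\<forall>x\<in>carrier M. x \<noteq> \<zero>\<^bsub>M\<^esub> \<longrightarrow> (\<exists>k::nat. \<forall>y\<in>carrier M. \<exists>l\<in>carrier R. (c [^] k) \<odot>\<^bsub>M\<^esub> y = l \<odot>\<^bsub>M\<^esub> x))"

lemma good_module: "good M \<Longrightarrow> module R M"
  by (simp add: good_def)

lemma good_pow_tf:
  assumes "good M" "x \<in> carrier M" "(c [^] (k::nat)) \<odot>\<^bsub>M\<^esub> x = \<zero>\<^bsub>M\<^esub>"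
  shows "x = \<zero>\<^bsub>M\<^esub>"
  using assms(2,3)
proof (induction k arbitrary: x)
  case 0
  then show ?case using module.smult_one[OF good_module[OF assms(1)], of x] by simp
next
  case (Suc k)
  interpret module R M by (rule good_module[OF assms(1)])
  have "(c [^] k) \<odot>\<^bsub>M\<^esub> (c \<odot>\<^bsub>M\<^esub> x) = \<zero>\<^bsub>M\<^esub>" using Suc.prems by (simp flip: smult_assoc1)
  then have "c \<odot>\<^bsub>M\<^esub> x = \<zero>\<^bsub>M\<^esub>" using Suc.IH[of "c \<odot>\<^bsub>M\<^esub> x"] Suc.prems by simp
  then show ?case using assms(1) Suc.prems unfolding good_def by blast
qed

text \<open>Let \<open>J\<close> be maximal such that \<open>S\<close> meets the sum over \<open>J\<close> trivially. Then some power \<open>q\<close> of \<open>c\<close>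
  has the property that for every \<open>y\<close> there is exactly one \<open>\<sigma> y\<close> in \<open>S\<close> that agrees with \<open>q y\<close>
  outside \<open>J\<close>, and \<open>g y\<close> is the difference \<open>q y - \<sigma> y\<close>, which lives on \<open>J\<close>. The function \<open>\<kappa>\<close> records
  the components of \<open>y\<close> outside \<open>J\<close> modulo \<open>q\<close>; it expresses that \<open>S\<close> has finite index in the kernel of \<open>g\<close>.\<close>

lemma direct_sum_quotient:
  fixes M :: "'i \<Rightarrow> ('a, 'd) module"
  assumes I: "finite I" and M: "\<And>i. i \<in> I \<Longrightarrow> good (M i)"
    and S: "S \<subseteq> carrier (direct_sum I M)" "\<zero>\<^bsub>direct_sum I M\<^esub> \<in> S"
      "\<And>x y. x \<in> S \<Longrightarrow> y \<in> S \<Longrightarrow> x \<oplus>\<^bsub>direct_sum I M\<^esub> y \<in> S"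
      "\<And>r x. r \<in> carrier R \<Longrightarrow> x \<in> S \<Longrightarrow> r \<odot>\<^bsub>direct_sum I M\<^esub> x \<in> S"
  shows "\<exists>J g (\<kappa> :: ('i \<Rightarrow> 'd) \<Rightarrow> 'i \<Rightarrow> 'd) F. J \<subseteq> I \<and> g \<in> module_hom R (direct_sum I M) (direct_sum J M) \<and>
    (\<forall>s\<in>S. g s = \<zero>\<^bsub>direct_sum J M\<^esub>) \<and>
    finite F \<and> \<kappa> ` carrier (direct_sum I M) \<subseteq> F \<and>
    (\<forall>y\<in>carrier (direct_sum I M). \<forall>y'\<in>carrier (direct_sum I M). g y = \<zero>\<^bsub>direct_sum J M\<^esub> \<longrightarrow>
       g y' = \<zero>\<^bsub>direct_sum J M\<^esub> \<longrightarrow> \<kappa> y = \<kappa> y' \<longrightarrow> y \<ominus>\<^bsub>direct_sum I M\<^esub> y' \<in> S) \<and>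
    (\<exists>D. finite D \<and> D \<subseteq> carrier (direct_sum J M) \<and>
       (\<forall>z\<in>carrier (direct_sum J M). \<exists>d\<in>D. \<exists>y\<in>carrier (direct_sum I M). z = d \<oplus>\<^bsub>direct_sum J M\<^esub> g y))"
proof -
  let ?P = "direct_sum I M"
  have mod: "module R (M i)" if "i \<in> I" for i using M[OF that] good_module by blast
  interpret P: module R ?P by (rule direct_sum_module[OF cring_axioms mod])
  have Pc: "x i \<in> carrier (M i)" if "x \<in> carrier ?P" "i \<in> I" for x i
    using that by (auto simp: direct_sum_simps)
  have Pext: "x = y" if "x \<in> carrier ?P" "y \<in> carrier ?P" "\<And>i. i \<in> I \<Longrightarrow> x i = y i" for x y
    using that unfolding direct_sum_simps by (rule PiE_ext)
  have Padd: "(x \<oplus>\<^bsub>?P\<^esub> y) i = x i \<oplus>\<^bsub>M i\<^esub> y i" if "i \<in> I" for x y i using that by (simp add: direct_sum_simps)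
  have Psm: "(r \<odot>\<^bsub>?P\<^esub> x) i = r \<odot>\<^bsub>M i\<^esub> x i" if "i \<in> I" for r x i using that by (simp add: direct_sum_simps)
  have Pz: "\<zero>\<^bsub>?P\<^esub> i = \<zero>\<^bsub>M i\<^esub>" if "i \<in> I" for i using that by (simp add: direct_sum_simps)
  have Sneg: "\<ominus>\<^bsub>?P\<^esub> x \<in> S" if "x \<in> S" for x
  proof -
    have "\<ominus>\<^bsub>?P\<^esub> x = (\<ominus> \<one>) \<odot>\<^bsub>?P\<^esub> x" using that S(1) by (subst P.smult_l_minus) auto
    then show ?thesis using S(4)[OF _ that, of "\<ominus> \<one>"] by simp
  qed
  have Pneg: "(\<ominus>\<^bsub>?P\<^esub> x) i = \<ominus>\<^bsub>M i\<^esub> x i" if x: "x \<in> carrier ?P" and i: "i \<in> I" for x i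
  proof -
    interpret Mi: module R "M i" by (rule mod[OF i])
    have "\<ominus>\<^bsub>?P\<^esub> x = (\<ominus> \<one>) \<odot>\<^bsub>?P\<^esub> x" using x by (subst P.smult_l_minus) auto
    then have "(\<ominus>\<^bsub>?P\<^esub> x) i = (\<ominus> \<one>) \<odot>\<^bsub>M i\<^esub> x i" by (simp add: Psm[OF i])
    also have "\<dots> = \<ominus>\<^bsub>M i\<^esub> x i" using Pc[OF x i] by (subst Mi.smult_l_minus) auto
    finally show ?thesis .
  qed
  have Pmin: "(x \<ominus>\<^bsub>?P\<^esub> y) i = x i \<ominus>\<^bsub>M i\<^esub> y i" if "x \<in> carrier ?P" "y \<in> carrier ?P" "i \<in> I" for x y i
    using that by (simp add: a_minus_def Padd Pneg)
  have Smin: "x \<ominus>\<^bsub>?P\<^esub> y \<in> S" if "x \<in> S" "y \<in> S" for x y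
    unfolding a_minus_def using that S(3) Sneg by blast

  define ok where "ok J \<longleftrightarrow> J \<subseteq> I \<and> (\<forall>s\<in>S. (\<forall>i\<in>I - J. s i = \<zero>\<^bsub>M i\<^esub>) \<longrightarrow> s = \<zero>\<^bsub>?P\<^esub>)" for J
  have "ok {}" unfolding ok_def using S(1) by (auto intro!: Pext simp: Pz)
  moreover have "card J \<le> card I" if "ok J" for J using that I by (auto simp: ok_def card_mono)
  ultimately have "\<exists>J. ok J \<and> (\<forall>J'. ok J' \<longrightarrow> card J' \<le> card J)"
    by (intro ex_has_greatest_nat[of ok "{}" card "Suc (card I)"]) (simp_all add: less_Suc_eq_le)
  then obtain J where J: "ok J" "\<And>J'. ok J' \<Longrightarrow> card J' \<le> card J" by blast
  have JI: "J \<subseteq> I" and JS: "\<And>s. s \<in> S \<Longrightarrow> (\<And>i. i \<in> I - J \<Longrightarrow> s i = \<zero>\<^bsub>M i\<^esub>) \<Longrightarrow> s = \<zero>\<^bsub>?P\<^esub>"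
    using J(1) by (auto simp: ok_def)
  have JP: "\<zero>\<^bsub>M i\<^esub> \<in> carrier (M i)" if "i \<in> I" for i
  proof -
    interpret Mi: module R "M i" by (rule mod[OF that])
    show ?thesis by simp
  qed

  \<comment> \<open>Maximality of \<open>J\<close>: adding \<open>i\<close> produces a nonzero
    \<open>s\<close> in \<open>S\<close> supported on \<open>insert i J\<close>. Its component at
    \<open>i\<close> is nonzero, for otherwise \<open>s\<close> would live on \<open>J\<close>. The
    multiples of \<open>s\<close> then reach a multiple by a power of \<open>c\<close> of every
    element of \<open>M i\<close>, without touching the other indices outside
    \<open>J\<close>.\<close>
  have "\<exists>k::nat. \<forall>y\<in>carrier (M i). \<exists>t\<in>S. t i = (c [^] k) \<odot>\<^bsub>M i\<^esub> y \<and> (\<forall>j\<in>I - J. j \<noteq> i \<longrightarrow> t j = \<zero>\<^bsub>M j\<^esub>)"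
    if i: "i \<in> I - J" for i
  proof -
    have "finite J" using JI I finite_subset by blast
    then have "card (insert i J) > card J" using i by simp
    then have "\<not> ok (insert i J)" using J(2)[of "insert i J"] by linarith
    then obtain s where s: "s \<in> S" "\<And>j. j \<in> I - insert i J \<Longrightarrow> s j = \<zero>\<^bsub>M j\<^esub>" "s \<noteq> \<zero>\<^bsub>?P\<^esub>"
      using i JI by (auto simp: ok_def)
    have si: "s i \<noteq> \<zero>\<^bsub>M i\<^esub>" using JS[OF s(1)] s(2,3) by blast
    have sc: "s \<in> carrier ?P" using s(1) S(1) by blast
    have gi: "good (M i)" using M i by blast
    then obtain k :: nat where k: "\<forall>y\<in>carrier (M i). \<exists>l\<in>carrier R. (c [^] k) \<odot>\<^bsub>M i\<^esub> y = l \<odot>\<^bsub>M i\<^esub> s i"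
      using si Pc[OF sc] i unfolding good_def by blast
    show ?thesis
    proof (intro exI[of _ k] ballI)
      fix y assume "y \<in> carrier (M i)"
      then obtain l where l: "l \<in> carrier R" "(c [^] k) \<odot>\<^bsub>M i\<^esub> y = l \<odot>\<^bsub>M i\<^esub> s i" using k by blast
      have "(l \<odot>\<^bsub>?P\<^esub> s) j = \<zero>\<^bsub>M j\<^esub>" if "j \<in> I - J" "j \<noteq> i" for j
      proof -
        interpret Mj: module R "M j" using mod that by blast
        show ?thesis using s(2)[of j] that l by (simp add: Psm)
      qed
      moreover have "(l \<odot>\<^bsub>?P\<^esub> s) i = (c [^] k) \<odot>\<^bsub>M i\<^esub> y" using i l by (simp add: Psm)
      ultimately show "\<exists>t\<in>S. t i = (c [^] k) \<odot>\<^bsub>M i\<^esub> y \<and> (\<forall>j\<in>I - J. j \<noteq> i \<longrightarrow> t j = \<zero>\<^bsub>M j\<^esub>)"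
        using S(4)[OF l(1) s(1)] by blast
    qed
  qed
  then obtain k where k: "\<And>i y. i \<in> I - J \<Longrightarrow> y \<in> carrier (M i) \<Longrightarrow>
      \<exists>t\<in>S. t i = (c [^] (k i::nat)) \<odot>\<^bsub>M i\<^esub> y \<and> (\<forall>j\<in>I - J. j \<noteq> i \<longrightarrow> t j = \<zero>\<^bsub>M j\<^esub>)"
    by metis
  \<comment> \<open>The sum is an exponent that dominates all \<open>k i\<close> at once.\<close>
  define K where "K = (\<Sum>i\<in>I. k i)"
  define q where "q = c [^] K"
  have q [simp]: "q \<in> carrier R" by (simp add: q_def)
  have one: "\<exists>t\<in>S. t i = q \<odot>\<^bsub>M i\<^esub> y \<and> (\<forall>j\<in>I - J. j \<noteq> i \<longrightarrow> t j = \<zero>\<^bsub>M j\<^esub>)"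
    if i: "i \<in> I - J" and y: "y \<in> carrier (M i)" for i y
  proof -
    interpret Mi: module R "M i" using mod i by blast
    have "k i \<le> K" unfolding K_def using I i by (intro member_le_sum) auto
    then have "q = c [^] k i \<otimes> c [^] (K - k i)" by (simp add: q_def nat_pow_mult)
    then have "q \<odot>\<^bsub>M i\<^esub> y = (c [^] k i) \<odot>\<^bsub>M i\<^esub> ((c [^] (K - k i)) \<odot>\<^bsub>M i\<^esub> y)" using y by (simp add: Mi.smult_assoc1)
    then show ?thesis using k[OF i, of "(c [^] (K - k i)) \<odot>\<^bsub>M i\<^esub> y"] y by simp
  qed
  \<comment> \<open>The components outside \<open>J\<close> can be prescribed independently, by
    adding the elements found for single indices.\<close>
  have all: "\<exists>t\<in>S. \<forall>i\<in>I - J. t i = (if i \<in> A then q \<odot>\<^bsub>M i\<^esub> y i else \<zero>\<^bsub>M i\<^esub>)"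
    if y: "y \<in> carrier ?P" and A: "A \<subseteq> I - J" for y A
  proof -
    have "finite A" using A I by (meson finite_Diff finite_subset)
    then show ?thesis using A
    proof (induction A)
      case empty then show ?case using S(2) by (intro bexI[of _ "\<zero>\<^bsub>?P\<^esub>"]) (auto simp: Pz)
    next
      case (insert a A)
      then obtain t where t: "t \<in> S" "\<forall>i\<in>I - J. t i = (if i \<in> A then q \<odot>\<^bsub>M i\<^esub> y i else \<zero>\<^bsub>M i\<^esub>)" by auto
      obtain t' where t': "t' \<in> S" "t' a = q \<odot>\<^bsub>M a\<^esub> y a" "\<forall>j\<in>I - J. j \<noteq> a \<longrightarrow> t' j = \<zero>\<^bsub>M j\<^esub>"
        using one[of a "y a"] Pc[OF y, of a] insert.prems by auto
      have "(t \<oplus>\<^bsub>?P\<^esub> t') i = (if i \<in> insert a A then q \<odot>\<^bsub>M i\<^esub> y i else \<zero>\<^bsub>M i\<^esub>)" if i: "i \<in> I - J" for i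
      proof -
        interpret Mi: module R "M i" using mod i by blast
        have yi: "y i \<in> carrier (M i)" using Pc[OF y] i by blast
        show ?thesis
        proof (cases "i = a")
          case True
          then have "t i = \<zero>\<^bsub>M i\<^esub>" "t' i = q \<odot>\<^bsub>M i\<^esub> y i" using t(2) t'(2) i insert.hyps by auto
          moreover have "\<zero>\<^bsub>M i\<^esub> \<oplus>\<^bsub>M i\<^esub> q \<odot>\<^bsub>M i\<^esub> y i = q \<odot>\<^bsub>M i\<^esub> y i" using yi by simp
          ultimately show ?thesis using i True by (simp add: Padd)
        next
          case False
          then have "t' i = \<zero>\<^bsub>M i\<^esub>" using t'(3) i by blast
          then show ?thesis using t(2) i False yi by (simp add: Padd)
        qed
      qed
      then show ?case using S(3)[OF t(1) t'(1)] by blast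
    qed
  qed
  have "\<exists>\<sigma>. \<forall>y\<in>carrier ?P. \<sigma> y \<in> S \<and> (\<forall>i\<in>I - J. \<sigma> y i = q \<odot>\<^bsub>M i\<^esub> y i)"
    by (rule bchoice) (use all[of _ "I - J"] in force)
  then obtain \<sigma> where \<sigma>: "\<And>y. y \<in> carrier ?P \<Longrightarrow> \<sigma> y \<in> S"
    "\<And>y i. y \<in> carrier ?P \<Longrightarrow> i \<in> I - J \<Longrightarrow> \<sigma> y i = q \<odot>\<^bsub>M i\<^esub> y i" by blast
  have \<sigma>c: "\<sigma> y \<in> carrier ?P" if "y \<in> carrier ?P" for y using \<sigma>(1)[OF that] S(1) by blast
  \<comment> \<open>The difference of two candidates lies in \<open>S\<close> and vanishes outside
    \<open>J\<close>, hence is zero. Although \<open>\<sigma>\<close> comes from a choice, this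
    forces it to be linear.\<close>
  have uniq: "\<sigma> y = t" if y: "y \<in> carrier ?P" and t: "t \<in> S" "\<And>i. i \<in> I - J \<Longrightarrow> t i = q \<odot>\<^bsub>M i\<^esub> y i" for y t
  proof -
    have tc: "t \<in> carrier ?P" using t S by blast
    have "(\<sigma> y \<ominus>\<^bsub>?P\<^esub> t) i = \<zero>\<^bsub>M i\<^esub>" if i: "i \<in> I - J" for i
    proof -
      interpret Mi: module R "M i" using mod i by blast
      have "y i \<in> carrier (M i)" using Pc[OF y] i by blast
      then show ?thesis using Pmin[OF \<sigma>c[OF y] tc, of i] \<sigma>(2)[OF y i] t(2)[OF i] i
        by (simp add: Mi.minus_eq Mi.r_neg)
    qed
    then have "\<sigma> y \<ominus>\<^bsub>?P\<^esub> t = \<zero>\<^bsub>?P\<^esub>" using JS[OF Smin[OF \<sigma>(1)[OF y] t(1)]] by blast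
    then show ?thesis using P.minus_eq_zero_iff[OF \<sigma>c[OF y] tc] by simp
  qed
  have \<sigma>add: "\<sigma> (x \<oplus>\<^bsub>?P\<^esub> y) = \<sigma> x \<oplus>\<^bsub>?P\<^esub> \<sigma> y" if x: "x \<in> carrier ?P" and y: "y \<in> carrier ?P" for x y
  proof (rule uniq)
    fix i assume i: "i \<in> I - J"
    interpret Mi: module R "M i" using mod i by blast
    show "(\<sigma> x \<oplus>\<^bsub>?P\<^esub> \<sigma> y) i = q \<odot>\<^bsub>M i\<^esub> (x \<oplus>\<^bsub>?P\<^esub> y) i"
      using i Pc[OF x, of i] Pc[OF y, of i] \<sigma>(2)[OF x i] \<sigma>(2)[OF y i] by (simp add: Padd Mi.smult_r_distr)
  qed (use x y \<sigma>(1) S(3) in auto)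
  have \<sigma>sm: "\<sigma> (r \<odot>\<^bsub>?P\<^esub> x) = r \<odot>\<^bsub>?P\<^esub> \<sigma> x" if r: "r \<in> carrier R" and x: "x \<in> carrier ?P" for r x
  proof (rule uniq)
    fix i assume i: "i \<in> I - J"
    interpret Mi: module R "M i" using mod i by blast
    have "r \<odot>\<^bsub>M i\<^esub> (q \<odot>\<^bsub>M i\<^esub> x i) = q \<odot>\<^bsub>M i\<^esub> (r \<odot>\<^bsub>M i\<^esub> x i)"
      using r i Pc[OF x, of i] by (simp add: Mi.smult_assoc1[symmetric] m_comm)
    then show "(r \<odot>\<^bsub>?P\<^esub> \<sigma> x) i = q \<odot>\<^bsub>M i\<^esub> (r \<odot>\<^bsub>?P\<^esub> x) i"
      using i \<sigma>(2)[OF x i] by (simp add: Psm)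
  qed (use r x \<sigma>(1) S(4) in auto)

  let ?PJ = "direct_sum J M"
  have modJ: "module R (M i)" if "i \<in> J" for i using mod that JI by blast
  interpret PJ: module R ?PJ by (rule direct_sum_module[OF cring_axioms modJ])
  define g where "g y = (\<lambda>i\<in>J. q \<odot>\<^bsub>M i\<^esub> y i \<ominus>\<^bsub>M i\<^esub> \<sigma> y i)" for y
  have gz: "g y = \<zero>\<^bsub>?PJ\<^esub> \<longleftrightarrow> (\<forall>i\<in>J. q \<odot>\<^bsub>M i\<^esub> y i = \<sigma> y i)" if y: "y \<in> carrier ?P" for y
  proof -
    have "q \<odot>\<^bsub>M i\<^esub> y i \<ominus>\<^bsub>M i\<^esub> \<sigma> y i = \<zero>\<^bsub>M i\<^esub> \<longleftrightarrow> q \<odot>\<^bsub>M i\<^esub> y i = \<sigma> y i" if i: "i \<in> J" for i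
    proof -
      interpret Mi: module R "M i" by (rule modJ[OF i])
      have "y i \<in> carrier (M i)" "\<sigma> y i \<in> carrier (M i)" using Pc y \<sigma>c[OF y] i JI by auto
      then show ?thesis by (simp add: Mi.minus_eq_zero_iff)
    qed
    then show ?thesis unfolding g_def direct_sum_simps by (auto simp: fun_eq_iff restrict_def)
  qed
  have ghom: "g \<in> module_hom R ?P ?PJ" unfolding module_hom_def
  proof (intro CollectI conjI ballI)
    show "g \<in> carrier ?P \<rightarrow> carrier ?PJ"
    proof
      fix y assume y: "y \<in> carrier ?P"
      have "q \<odot>\<^bsub>M i\<^esub> y i \<ominus>\<^bsub>M i\<^esub> \<sigma> y i \<in> carrier (M i)" if i: "i \<in> J" for i
      proof -
        interpret Mi: module R "M i" by (rule modJ[OF i])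
        show ?thesis using Pc[OF y, of i] Pc[OF \<sigma>c[OF y], of i] i JI by auto
      qed
      then show "g y \<in> carrier ?PJ" by (simp add: g_def direct_sum_simps)
    qed
  next
    fix x y assume x: "x \<in> carrier ?P" and y: "y \<in> carrier ?P"
    show "g (x \<oplus>\<^bsub>?P\<^esub> y) = g x \<oplus>\<^bsub>?PJ\<^esub> g y"
      unfolding g_def direct_sum_simps(3)[where I=J] \<sigma>add[OF x y]
    proof (rule restrict_ext)
      fix i assume i: "i \<in> J"
      interpret Mi: module R "M i" by (rule modJ[OF i])
      have iI: "i \<in> I" using i JI by blast
      have c: "x i \<in> carrier (M i)" "y i \<in> carrier (M i)" "\<sigma> x i \<in> carrier (M i)" "\<sigma> y i \<in> carrier (M i)"
        using Pc iI x y \<sigma>c by blast+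
      show "q \<odot>\<^bsub>M i\<^esub> (x \<oplus>\<^bsub>?P\<^esub> y) i \<ominus>\<^bsub>M i\<^esub> (\<sigma> x \<oplus>\<^bsub>?P\<^esub> \<sigma> y) i =
        (\<lambda>i\<in>J. q \<odot>\<^bsub>M i\<^esub> x i \<ominus>\<^bsub>M i\<^esub> \<sigma> x i) i \<oplus>\<^bsub>M i\<^esub> (\<lambda>i\<in>J. q \<odot>\<^bsub>M i\<^esub> y i \<ominus>\<^bsub>M i\<^esub> \<sigma> y i) i"
        using c i iI by (simp add: Padd Mi.smult_r_distr Mi.minus_eq Mi.minus_add Mi.a_ac)
    qed
  next
    fix r x assume r: "r \<in> carrier R" and x: "x \<in> carrier ?P"
    show "g (r \<odot>\<^bsub>?P\<^esub> x) = r \<odot>\<^bsub>?PJ\<^esub> g x"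
      unfolding g_def direct_sum_simps(4)[where I=J] \<sigma>sm[OF r x]
    proof (rule restrict_ext)
      fix i assume i: "i \<in> J"
      interpret Mi: module R "M i" by (rule modJ[OF i])
      have iI: "i \<in> I" using i JI by blast
      have c: "x i \<in> carrier (M i)" "\<sigma> x i \<in> carrier (M i)"
        using Pc iI x \<sigma>c by blast+
      have e: "q \<odot>\<^bsub>M i\<^esub> (r \<odot>\<^bsub>M i\<^esub> x i) = r \<odot>\<^bsub>M i\<^esub> (q \<odot>\<^bsub>M i\<^esub> x i)"
        using r c by (simp add: Mi.smult_assoc1[symmetric] m_comm)
      show "q \<odot>\<^bsub>M i\<^esub> (r \<odot>\<^bsub>?P\<^esub> x) i \<ominus>\<^bsub>M i\<^esub> (r \<odot>\<^bsub>?P\<^esub> \<sigma> x) i =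
        r \<odot>\<^bsub>M i\<^esub> (\<lambda>i\<in>J. q \<odot>\<^bsub>M i\<^esub> x i \<ominus>\<^bsub>M i\<^esub> \<sigma> x i) i"
        using c i iI r e by (simp add: Psm Mi.smult_r_distr Mi.minus_eq Mi.smult_r_minus)
    qed
  qed
  have gadd: "g (x \<oplus>\<^bsub>?P\<^esub> y) = g x \<oplus>\<^bsub>?PJ\<^esub> g y" if "x \<in> carrier ?P" "y \<in> carrier ?P" for x y
    using ghom that by (auto simp: module_hom_def)
  have gc: "g x \<in> carrier ?PJ" if "x \<in> carrier ?P" for x using ghom that by (auto simp: module_hom_def)
  have gS: "g s = \<zero>\<^bsub>?PJ\<^esub>" if s: "s \<in> S" for s
  proof -
    have sc: "s \<in> carrier ?P" using s S(1) by blast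
    have "\<sigma> s = q \<odot>\<^bsub>?P\<^esub> s" by (rule uniq[OF sc S(4)[OF q s]]) (simp add: Psm)
    then show ?thesis using gz[OF sc] JI by (auto simp: Psm)
  qed
  have "\<exists>T. finite T \<and> T \<subseteq> carrier (M i) \<and> (\<forall>x\<in>carrier (M i). \<exists>s\<in>T. \<exists>a\<in>carrier (M i). x = s \<oplus>\<^bsub>M i\<^esub> q \<odot>\<^bsub>M i\<^esub> a)"
    if "i \<in> I" for i using M[OF that] unfolding good_def q_def by blast
  then obtain T where T: "\<And>i. i \<in> I \<Longrightarrow> finite (T i)" "\<And>i. i \<in> I \<Longrightarrow> T i \<subseteq> carrier (M i)"
    "\<And>i x. i \<in> I \<Longrightarrow> x \<in> carrier (M i) \<Longrightarrow> \<exists>s\<in>T i. \<exists>a\<in>carrier (M i). x = s \<oplus>\<^bsub>M i\<^esub> q \<odot>\<^bsub>M i\<^esub> a"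
    by metis
  then obtain rep quo where rep: "\<And>i x. i \<in> I \<Longrightarrow> x \<in> carrier (M i) \<Longrightarrow>
      rep i x \<in> T i \<and> quo i x \<in> carrier (M i) \<and> x = rep i x \<oplus>\<^bsub>M i\<^esub> q \<odot>\<^bsub>M i\<^esub> quo i x"
    by metis
  have repT: "rep i x \<in> T i" and quo_closed: "quo i x \<in> carrier (M i)"
    if "i \<in> I" "x \<in> carrier (M i)" for i x using rep[OF that] by blast+
  define \<kappa> where "\<kappa> y = (\<lambda>i\<in>I - J. rep i (y i))" for y
  define F where "F = (\<Pi>\<^sub>E i\<in>I - J. T i)"
  have F: "finite F" unfolding F_def using I T(1) by (intro finite_PiE) auto
  have \<kappa>F: "\<kappa> ` carrier ?P \<subseteq> F" unfolding \<kappa>_def F_def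
  proof (rule image_subsetI)
    fix y assume y: "y \<in> carrier ?P"
    show "(\<lambda>i\<in>I - J. rep i (y i)) \<in> (\<Pi>\<^sub>E i\<in>I - J. T i)"
      unfolding restrict_PiE_iff using repT Pc[OF y] by blast
  qed
  have ker: "y \<ominus>\<^bsub>?P\<^esub> y' \<in> S"
    if y: "y \<in> carrier ?P" and y': "y' \<in> carrier ?P" and gy: "g y = \<zero>\<^bsub>?PJ\<^esub>" and gy': "g y' = \<zero>\<^bsub>?PJ\<^esub>"
      and eq: "\<kappa> y = \<kappa> y'" for y y'
  proof -
    \<comment> \<open>With equal residues, the components of \<open>y\<close> and \<open>y'\<close>
      outside \<open>J\<close> differ by \<open>q\<close> times the difference of the quotients. So
      \<open>\<sigma> z\<close> agrees with \<open>y - y'\<close> outside \<open>J\<close>, and the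
      aim is to show that they agree everywhere.\<close>
    define z where "z = (\<lambda>i\<in>I. if i \<in> J then \<zero>\<^bsub>M i\<^esub> else quo i (y i) \<ominus>\<^bsub>M i\<^esub> quo i (y' i))"
    have quoc: "quo i (y i) \<in> carrier (M i)" "quo i (y' i) \<in> carrier (M i)" if "i \<in> I" for i
      using quo_closed Pc y y' that by blast+
    have zc: "z \<in> carrier ?P" unfolding direct_sum_simps z_def
    proof (rule restrict_PiE_iff[THEN iffD2], rule ballI)
      fix i assume i: "i \<in> I"
      interpret Mi: module R "M i" by (rule mod[OF i])
      show "(if i \<in> J then \<zero>\<^bsub>M i\<^esub> else quo i (y i) \<ominus>\<^bsub>M i\<^esub> quo i (y' i)) \<in> carrier (M i)"
        using quoc[OF i] by simp
    qed
    have dc: "y \<ominus>\<^bsub>?P\<^esub> y' \<in> carrier ?P" using y y' by simp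
    have tz: "\<sigma> z i = (y \<ominus>\<^bsub>?P\<^esub> y') i" if i: "i \<in> I - J" for i
    proof -
      interpret Mi: module R "M i" using mod i by blast
      have iI: "i \<in> I" using i by blast
      have re: "rep i (y i) = rep i (y' i)" using fun_cong[OF eq, of i] i by (simp add: \<kappa>_def)
      define a where "a = quo i (y i)"
      define a' where "a' = quo i (y' i)"
      define e where "e = rep i (y' i)"
      have c: "a \<in> carrier (M i)" "a' \<in> carrier (M i)" "e \<in> carrier (M i)"
        using quoc[OF iI] rep[OF iI Pc[OF y' iI]] T(2)[OF iI] by (auto simp: a_def a'_def e_def)
      have yi: "y i = e \<oplus>\<^bsub>M i\<^esub> q \<odot>\<^bsub>M i\<^esub> a" "y' i = e \<oplus>\<^bsub>M i\<^esub> q \<odot>\<^bsub>M i\<^esub> a'"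
        using rep[OF iI Pc[OF y iI]] rep[OF iI Pc[OF y' iI]] re by (simp_all add: a_def a'_def e_def)
      have "\<sigma> z i = q \<odot>\<^bsub>M i\<^esub> (a \<ominus>\<^bsub>M i\<^esub> a')" using \<sigma>(2)[OF zc i] i by (simp add: z_def a_def a'_def)
      also have "\<dots> = (e \<oplus>\<^bsub>M i\<^esub> q \<odot>\<^bsub>M i\<^esub> a) \<ominus>\<^bsub>M i\<^esub> (e \<oplus>\<^bsub>M i\<^esub> q \<odot>\<^bsub>M i\<^esub> a')"
        using c by (simp add: Mi.minus_eq Mi.smult_r_distr Mi.smult_r_minus Mi.minus_add Mi.a_ac Mi.r_neg1 Mi.r_neg2)
      also have "\<dots> = (y \<ominus>\<^bsub>?P\<^esub> y') i" by (simp only: yi[symmetric] Pmin[OF y y' iI])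
      finally show ?thesis .
    qed
    \<comment> \<open>\<open>u\<close> is supported on \<open>J\<close> and killed by
      \<open>g\<close>. The first fact gives \<open>\<sigma> u = 0\<close>; with the second,
      \<open>q u\<close> vanishes on \<open>J\<close>, and absence of torsion gives
      \<open>u = 0\<close>.\<close>
    define u where "u = (y \<ominus>\<^bsub>?P\<^esub> y') \<ominus>\<^bsub>?P\<^esub> \<sigma> z"
    have uc: "u \<in> carrier ?P" unfolding u_def using dc \<sigma>c[OF zc] by simp
    have "u \<oplus>\<^bsub>?P\<^esub> (\<sigma> z \<oplus>\<^bsub>?P\<^esub> y') = y" unfolding u_def using y y' \<sigma>c[OF zc]
      by (simp add: P.minus_eq P.a_ac P.r_neg1 P.r_neg2 P.l_neg P.r_neg)
    then have "g y = g u \<oplus>\<^bsub>?PJ\<^esub> (g (\<sigma> z) \<oplus>\<^bsub>?PJ\<^esub> g y')" using uc y' \<sigma>c[OF zc] gadd by (metis P.a_closed)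
    then have gu: "g u = \<zero>\<^bsub>?PJ\<^esub>" using gy gy' gS[OF \<sigma>(1)[OF zc]] gc[OF uc] by simp
    have ui: "u i = \<zero>\<^bsub>M i\<^esub>" if i: "i \<in> I - J" for i
    proof -
      interpret Mi: module R "M i" using mod i by blast
      have "(y \<ominus>\<^bsub>?P\<^esub> y') i \<in> carrier (M i)" using Pc[OF dc] i by blast
      then show ?thesis using Pmin[OF dc \<sigma>c[OF zc], of i] i tz[OF i] by (simp add: u_def Mi.minus_eq Mi.r_neg)
    qed
    have "\<sigma> u = \<zero>\<^bsub>?P\<^esub>"
    proof (rule uniq[OF uc S(2)])
      fix i assume i: "i \<in> I - J"
      interpret Mi: module R "M i" using mod i by blast
      show "\<zero>\<^bsub>?P\<^esub> i = q \<odot>\<^bsub>M i\<^esub> u i" using i by (simp add: Pz ui)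
    qed
    then have "u i = \<zero>\<^bsub>M i\<^esub>" if i: "i \<in> J" for i
      using gz[OF uc] gu i JI good_pow_tf[OF M Pc[OF uc], of i K] by (auto simp: Pz q_def)
    then have "u = \<zero>\<^bsub>?P\<^esub>" using ui uc by (intro Pext) (auto simp: Pz)
    then have "y \<ominus>\<^bsub>?P\<^esub> y' = \<sigma> z" using P.minus_eq_zero_iff[OF dc \<sigma>c[OF zc]] by (simp add: u_def)
    then show ?thesis using \<sigma>(1)[OF zc] by simp
  qed
  define D where "D = (\<Pi>\<^sub>E i\<in>J. T i)"
  have D: "finite D" unfolding D_def using I JI T(1) finite_subset by (intro finite_PiE) blast+
  have DJ: "D \<subseteq> carrier ?PJ" unfolding D_def direct_sum_simps using T(2) JI by (intro PiE_mono) blast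
  have cok: "\<exists>d\<in>D. \<exists>y\<in>carrier ?P. z = d \<oplus>\<^bsub>?PJ\<^esub> g y" if z: "z \<in> carrier ?PJ" for z
  proof -
    have zc: "z i \<in> carrier (M i)" if "i \<in> J" for i using z that by (auto simp: direct_sum_simps)
    define d where "d = (\<lambda>i\<in>J. rep i (z i))"
    \<comment> \<open>An element supported on \<open>J\<close> has \<open>\<sigma> y = 0\<close>, so
      \<open>g\<close> multiplies it by \<open>q\<close>. Hence residues modulo \<open>q\<close> on
      \<open>J\<close> represent the cokernel of \<open>g\<close>.\<close>
    define y where "y = (\<lambda>i\<in>I. if i \<in> J then quo i (z i) else \<zero>\<^bsub>M i\<^esub>)"
    have d: "d \<in> D" unfolding d_def D_def restrict_PiE_iff using repT zc JI by blast
    have y: "y \<in> carrier ?P" unfolding y_def direct_sum_simps restrict_PiE_iff using quo_closed zc JI JP by simp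
    have "\<sigma> y = \<zero>\<^bsub>?P\<^esub>"
    proof (rule uniq[OF y S(2)])
      fix i assume i: "i \<in> I - J"
      interpret Mi: module R "M i" using mod i by blast
      show "\<zero>\<^bsub>?P\<^esub> i = q \<odot>\<^bsub>M i\<^esub> y i" using i by (simp add: Pz y_def)
    qed
    then have "(d \<oplus>\<^bsub>?PJ\<^esub> g y) i = z i" if i: "i \<in> J" for i
    proof -
      interpret Mi: module R "M i" by (rule modJ[OF i])
      have iI: "i \<in> I" using i JI by blast
      have n0: "\<ominus>\<^bsub>M i\<^esub> \<zero>\<^bsub>M i\<^esub> = \<zero>\<^bsub>M i\<^esub>"
        by (rule trans[OF sym[OF Mi.M.l_zero] Mi.M.r_neg]) simp_all
      have qc: "quo i (z i) \<in> carrier (M i)" using rep[OF iI zc[OF i]] by blast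
      have "(d \<oplus>\<^bsub>?PJ\<^esub> g y) i = rep i (z i) \<oplus>\<^bsub>M i\<^esub> q \<odot>\<^bsub>M i\<^esub> quo i (z i)"
        using i iI qc \<open>\<sigma> y = \<zero>\<^bsub>?P\<^esub>\<close>
        by (simp add: direct_sum_simps(3) d_def g_def y_def Pz Mi.minus_eq n0)
      then show ?thesis using rep[OF iI zc[OF i]] by simp
    qed
    then have "z = d \<oplus>\<^bsub>?PJ\<^esub> g y"
      using z d DJ gc[OF y] PJ.a_closed[of d "g y"] unfolding direct_sum_simps(1)
      by (intro PiE_ext[of z J "\<lambda>i. carrier (M i)"]) (auto simp: direct_sum_simps(1))
    then show ?thesis using d y by blast
  qed
  have "\<exists>D. finite D \<and> D \<subseteq> carrier ?PJ \<and> (\<forall>z\<in>carrier ?PJ. \<exists>d\<in>D. \<exists>y\<in>carrier ?P. z = d \<oplus>\<^bsub>?PJ\<^esub> g y)"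
    by (rule exI[of _ D]) (use D DJ cok in simp)
  moreover have "\<forall>y\<in>carrier ?P. \<forall>y'\<in>carrier ?P. g y = \<zero>\<^bsub>?PJ\<^esub> \<longrightarrow> g y' = \<zero>\<^bsub>?PJ\<^esub> \<longrightarrow>
      \<kappa> y = \<kappa> y' \<longrightarrow> y \<ominus>\<^bsub>?P\<^esub> y' \<in> S"
    using ker by simp
  moreover have "\<forall>s\<in>S. g s = \<zero>\<^bsub>?PJ\<^esub>" using gS by simp
  ultimately show ?thesis
    by - (rule exI[of _ J], rule exI[of _ g], rule exI[of _ \<kappa>], rule exI[of _ F], intro conjI,
        (rule JI ghom F \<kappa>F | assumption)+)
qed

end

section \<open>Elementwise handling of pseudo-isomorphisms\<close>

lemma module_homD:
  assumes "h \<in> module_hom R M N"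
  shows "x \<in> carrier M \<Longrightarrow> h x \<in> carrier N"
    "x \<in> carrier M \<Longrightarrow> y \<in> carrier M \<Longrightarrow> h (x \<oplus>\<^bsub>M\<^esub> y) = h x \<oplus>\<^bsub>N\<^esub> h y"
    "r \<in> carrier R \<Longrightarrow> x \<in> carrier M \<Longrightarrow> h (r \<odot>\<^bsub>M\<^esub> x) = r \<odot>\<^bsub>N\<^esub> h x"
  using assms by (auto simp: module_hom_def)

lemma module_hom_group_hom:
  assumes "abelian_group M" "abelian_group N" "h \<in> module_hom R M N"
  shows "abelian_group_hom M N h"
  using assms module_homD[OF assms(3)]
  by (intro abelian_group_homI group_hom.intro group_hom_axioms.intro abelian_group.a_group) (auto intro!: homI)

lemma finite_a_FactGroupI:
  assumes N: "abelian_group N" and H: "additive_subgroup H N"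
    and D: "finite D" "D \<subseteq> carrier N" "\<And>z. z \<in> carrier N \<Longrightarrow> \<exists>d\<in>D. \<exists>y\<in>H. z = d \<oplus>\<^bsub>N\<^esub> y"
  shows "finite (carrier (N A_Mod H))"
proof -
  interpret N: abelian_group N by (rule N)
  interpret H: additive_subgroup H N by (rule H)
  have "carrier (N A_Mod H) \<subseteq> (\<lambda>d. H +>\<^bsub>N\<^esub> d) ` D"
  proof
    fix C assume "C \<in> carrier (N A_Mod H)"
    then obtain z where z: "z \<in> carrier N" "C = H +>\<^bsub>N\<^esub> z"
      by (auto simp: A_FactGroup_def FactGroup_def RCOSETS_def a_r_coset_def)
    then obtain d y where dy: "d \<in> D" "y \<in> H" "z = d \<oplus>\<^bsub>N\<^esub> y" using D(3) by blast
    have "z \<in> H +>\<^bsub>N\<^esub> d" using dy(2,3) N.a_comm[of d y] subsetD[OF D(2) dy(1)] subsetD[OF H.a_subset dy(2)]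
      by (auto simp: a_r_coset_def')
    then have "C = H +>\<^bsub>N\<^esub> d" using z dy D(2) N.a_repr_independence[OF _ _ H.a_subgroup] by auto
    then show "C \<in> (\<lambda>d. H +>\<^bsub>N\<^esub> d) ` D" using dy(1) by blast
  qed
  then show ?thesis using D(1) finite_surj by blast
qed

lemma finite_a_FactGroupD:
  assumes N: "abelian_group N" and H: "additive_subgroup H N" and fin: "finite (carrier (N A_Mod H))"
  shows "\<exists>D. finite D \<and> D \<subseteq> carrier N \<and> (\<forall>z\<in>carrier N. \<exists>d\<in>D. \<exists>y\<in>H. z = d \<oplus>\<^bsub>N\<^esub> y)"
proof -
  interpret N: abelian_group N by (rule N)
  interpret H: additive_subgroup H N by (rule H)
  have eq: "carrier (N A_Mod H) = (\<lambda>z. H +>\<^bsub>N\<^esub> z) ` carrier N"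
    by (auto simp: A_FactGroup_def FactGroup_def RCOSETS_def a_r_coset_def)
  then obtain D where D: "D \<subseteq> carrier N" "finite D" "carrier (N A_Mod H) = (\<lambda>z. H +>\<^bsub>N\<^esub> z) ` D"
    using fin finite_subset_image[of _ "\<lambda>z. H +>\<^bsub>N\<^esub> z" "carrier N"] by (metis subset_refl)
  have "\<exists>d\<in>D. \<exists>y\<in>H. z = d \<oplus>\<^bsub>N\<^esub> y" if z: "z \<in> carrier N" for z
  proof -
    have "H +>\<^bsub>N\<^esub> z \<in> (\<lambda>z. H +>\<^bsub>N\<^esub> z) ` D" using z D(3) eq by blast
    then obtain d where d: "d \<in> D" "H +>\<^bsub>N\<^esub> z = H +>\<^bsub>N\<^esub> d" by blast
    have "z \<in> H +>\<^bsub>N\<^esub> z" using z H.zero_closed by (force simp: a_r_coset_def')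
    then obtain y where "y \<in> H" "z = y \<oplus>\<^bsub>N\<^esub> d" using d(2) by (auto simp: a_r_coset_def')
    then show ?thesis using d(1) D(1) H.a_subset N.a_comm by blast
  qed
  then show ?thesis using D by blast
qed

text \<open>\<open>D\<close> collects representatives of the cokernel. In this form cokernels of
  composed maps are bounded by adding representatives, without passing through quotient
  groups.\<close>

lemma pseudo_isomorphicI:
  assumes M: "abelian_group M" and N: "abelian_group N" and h: "h \<in> module_hom R M N"
    and ker: "finite {x \<in> carrier M. h x = \<zero>\<^bsub>N\<^esub>}"
    and D: "finite D" "D \<subseteq> carrier N" "\<And>z. z \<in> carrier N \<Longrightarrow> \<exists>d\<in>D. \<exists>x\<in>carrier M. z = d \<oplus>\<^bsub>N\<^esub> h x"
  shows "pseudo_isomorphic R M N"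
proof -
  interpret h: abelian_group_hom M N h by (rule module_hom_group_hom[OF M N h])
  have "additive_subgroup (h ` carrier M) N"
    using group_hom.img_is_subgroup[OF h.a_group_hom] by (intro additive_subgroup.intro) simp
  then have "finite (carrier (N A_Mod h ` carrier M))"
    using D by (intro finite_a_FactGroupI[OF N, of _ D]) auto
  then show ?thesis using h ker unfolding pseudo_isomorphic_def a_kernel_def' by blast
qed

lemma pseudo_isomorphicD:
  assumes ps: "pseudo_isomorphic R M N" and M: "abelian_group M" and N: "abelian_group N"
  shows "\<exists>h\<in>module_hom R M N. finite {x \<in> carrier M. h x = \<zero>\<^bsub>N\<^esub>} \<and>
    (\<exists>D. finite D \<and> D \<subseteq> carrier N \<and> (\<forall>z\<in>carrier N. \<exists>d\<in>D. \<exists>x\<in>carrier M. z = d \<oplus>\<^bsub>N\<^esub> h x))"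
proof -
  obtain h where h: "h \<in> module_hom R M N" "finite (a_kernel M N h)"
    "finite (carrier (N A_Mod h ` carrier M))" using ps unfolding pseudo_isomorphic_def by blast
  interpret h: abelian_group_hom M N h by (rule module_hom_group_hom[OF M N h(1)])
  have "additive_subgroup (h ` carrier M) N"
    using group_hom.img_is_subgroup[OF h.a_group_hom] by (intro additive_subgroup.intro) simp
  from finite_a_FactGroupD[OF N this h(3)] have
    "\<exists>D. finite D \<and> D \<subseteq> carrier N \<and> (\<forall>z\<in>carrier N. \<exists>d\<in>D. \<exists>x\<in>carrier M. z = d \<oplus>\<^bsub>N\<^esub> h x)"
    by (simp only: bex_simps)
  then show ?thesis using h(1,2) unfolding a_kernel_def' by blast
qed

text \<open>Serves to replace a subset of the indices by an initial segment of the positive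
  integers, as required by the final statement.\<close>

lemma pseudo_isomorphic_reindex:
  fixes N :: "'i \<Rightarrow> ('r, 'd) module"
  assumes cr: "cring R" and M: "abelian_group M" and N: "\<And>i. i \<in> J \<Longrightarrow> module R (N i)" and e: "bij_betw e I J"
    and ps: "pseudo_isomorphic R M (direct_sum J N)"
  shows "pseudo_isomorphic R M (direct_sum I (\<lambda>i. N (e i)))"
proof -
  have eJ: "e i \<in> J" if "i \<in> I" for i using e that by (auto simp: bij_betw_def)
  define f where "f = inv_into I e"
  have f: "f j \<in> I" "e (f j) = j" if "j \<in> J" for j
    using e that unfolding f_def bij_betw_def by (auto simp: inv_into_into f_inv_into_f)
  have fe: "f (e i) = i" if "i \<in> I" for i using e that by (simp add: f_def bij_betw_def inv_into_f_f)
  let ?P = "direct_sum J N" let ?P' = "direct_sum I (\<lambda>i. N (e i))"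
  interpret P: module R ?P by (rule direct_sum_module[OF cr N])
  interpret P': module R ?P' by (rule direct_sum_module[OF cr]) (use N eJ in blast)
  obtain h D where h: "h \<in> module_hom R M ?P" "finite {x \<in> carrier M. h x = \<zero>\<^bsub>?P\<^esub>}"
    "finite D" "D \<subseteq> carrier ?P" "\<And>z. z \<in> carrier ?P \<Longrightarrow> \<exists>d\<in>D. \<exists>x\<in>carrier M. z = d \<oplus>\<^bsub>?P\<^esub> h x"
    using pseudo_isomorphicD[OF ps M P.M.abelian_group_axioms] by blast
  define t where "t x = (\<lambda>i\<in>I. x (e i))" for x :: "'i \<Rightarrow> 'd"
  have tc: "t x \<in> carrier ?P'" if "x \<in> carrier ?P" for x
    using that eJ unfolding direct_sum_simps t_def by auto
  have tadd: "t (x \<oplus>\<^bsub>?P\<^esub> y) = t x \<oplus>\<^bsub>?P'\<^esub> t y" for x y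
    unfolding direct_sum_simps t_def using eJ by (auto intro!: restrict_ext)
  have tsm: "t (r \<odot>\<^bsub>?P\<^esub> x) = r \<odot>\<^bsub>?P'\<^esub> t x" for r x
    unfolding direct_sum_simps t_def using eJ by (auto intro!: restrict_ext)
  have tsurj: "\<exists>x\<in>carrier ?P. z = t x" if z: "z \<in> carrier ?P'" for z
  proof (rule bexI[of _ "\<lambda>j\<in>J. z (f j)"])
    show "(\<lambda>j\<in>J. z (f j)) \<in> carrier ?P"
      unfolding direct_sum_simps restrict_PiE_iff
    proof
      fix j assume j: "j \<in> J"
      show "z (f j) \<in> carrier (N j)" using PiE_mem[of z I _ "f j"] z f[OF j] by (force simp: direct_sum_simps)
    qed
    show "z = t (\<lambda>j\<in>J. z (f j))"
      using z unfolding t_def direct_sum_simps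
      by (intro extensionalityI[of _ I]) (auto simp: PiE_def eJ fe)
  qed
  have tz: "x = \<zero>\<^bsub>?P\<^esub>" if x: "x \<in> carrier ?P" and tx: "t x = \<zero>\<^bsub>?P'\<^esub>" for x
  proof -
    have "x (e i) = \<zero>\<^bsub>N (e i)\<^esub>" if "i \<in> I" for i
      using fun_cong[OF tx, of i] that by (simp add: t_def direct_sum_simps)
    then have "x j = \<zero>\<^bsub>N j\<^esub>" if "j \<in> J" for j using f[OF that] by metis
    then show ?thesis using x unfolding direct_sum_simps
      by (intro extensionalityI[of _ J]) (auto simp: PiE_def)
  qed
  show ?thesis
  proof (rule pseudo_isomorphicI[OF M P'.M.abelian_group_axioms, of "t \<circ> h" _ "t ` D"])
    show "t \<circ> h \<in> module_hom R M ?P'"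
      using module_homD[OF h(1)] tc tadd tsm by (auto simp: module_hom_def)
    show "finite {x \<in> carrier M. (t \<circ> h) x = \<zero>\<^bsub>?P'\<^esub>}"
      by (rule finite_subset[OF _ h(2)]) (use module_homD(1)[OF h(1)] tz in auto)
    show "t ` D \<subseteq> carrier ?P'" using h(4) tc by blast
    fix z assume "z \<in> carrier ?P'"
    then obtain x where x: "x \<in> carrier ?P" "z = t x" using tsurj by blast
    then obtain d m where "d \<in> D" "m \<in> carrier M" "x = d \<oplus>\<^bsub>?P\<^esub> h m" using h(5) by blast
    then show "\<exists>d\<in>t ` D. \<exists>x\<in>carrier M. z = d \<oplus>\<^bsub>?P'\<^esub> (t \<circ> h) x" using x tadd by auto
  qed (use h in simp)
qed

context pseudo_module
begin

text \<open>The map \<open>g\<close> of \<open>direct_sum_quotient\<close>, taken for the image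
  \<open>S\<close> of the kernel of \<open>res\<close>, vanishes on that image, so \<open>g\<close>
  after \<open>h\<close> factors through \<open>M'\<close>. The kernel of the factored map is finite
  because \<open>\<kappa>\<close> takes finitely many values on it and each fibre is controlled by
  the kernel of \<open>h\<close>. The conditions on scalar multiplication in \<open>M\<close> and
  \<open>M'\<close> are those proved for Pontryagin duals.\<close>

lemma pseudo_isomorphic_quotient:
  fixes N :: "'i \<Rightarrow> ('a, 'd) module"
  assumes I: "finite I" and N: "\<And>i. i \<in> I \<Longrightarrow> good (N i)"
    and M: "abelian_group M" and Msm: "\<And>r x. r \<in> carrier R \<Longrightarrow> x \<in> carrier M \<Longrightarrow> r \<odot>\<^bsub>M\<^esub> x \<in> carrier M"
    and M': "abelian_group M'" and M'0: "\<And>r. r \<in> carrier R \<Longrightarrow> r \<odot>\<^bsub>M'\<^esub> \<zero>\<^bsub>M'\<^esub> = \<zero>\<^bsub>M'\<^esub>"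
    and res: "res \<in> module_hom R M M'" and surj: "\<And>y. y \<in> carrier M' \<Longrightarrow> \<exists>x\<in>carrier M. res x = y"
    and ps: "pseudo_isomorphic R M (direct_sum I N)"
  shows "\<exists>J\<subseteq>I. pseudo_isomorphic R M' (direct_sum J N)"
proof -
  let ?P = "direct_sum I N"
  have mod: "module R (N i)" if "i \<in> I" for i using good_module N that by blast
  interpret P: module R ?P by (rule direct_sum_module[OF cring_axioms mod])
  interpret M: abelian_group M by (rule M)
  interpret M': abelian_group M' by (rule M')
  obtain h D where h: "h \<in> module_hom R M ?P" and hker: "finite {x \<in> carrier M. h x = \<zero>\<^bsub>?P\<^esub>}"
    and D: "finite D" "D \<subseteq> carrier ?P" "\<And>z. z \<in> carrier ?P \<Longrightarrow> \<exists>d\<in>D. \<exists>x\<in>carrier M. z = d \<oplus>\<^bsub>?P\<^esub> h x"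
    using pseudo_isomorphicD[OF ps M P.M.abelian_group_axioms] by blast
  note hD = module_homD[OF h] and rD = module_homD[OF res]
  interpret h: abelian_group_hom M ?P h by (rule module_hom_group_hom[OF M P.M.abelian_group_axioms h])
  interpret r: abelian_group_hom M M' res by (rule module_hom_group_hom[OF M M' res])
  define S where "S = h ` {x \<in> carrier M. res x = \<zero>\<^bsub>M'\<^esub>}"
  have S1: "S \<subseteq> carrier ?P" using hD(1) by (auto simp: S_def)
  have S2: "\<zero>\<^bsub>?P\<^esub> \<in> S" unfolding S_def by (rule image_eqI[of _ _ "\<zero>\<^bsub>M\<^esub>"]) auto
  have S3: "x \<oplus>\<^bsub>?P\<^esub> y \<in> S" if xy: "x \<in> S" "y \<in> S" for x y
  proof -
    obtain a b where "a \<in> carrier M" "b \<in> carrier M" "x = h a" "y = h b" "res a = \<zero>\<^bsub>M'\<^esub>" "res b = \<zero>\<^bsub>M'\<^esub>"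
      using xy by (auto simp: S_def)
    then show ?thesis unfolding S_def by (intro image_eqI[of _ _ "a \<oplus>\<^bsub>M\<^esub> b"]) (auto simp: hD rD)
  qed
  have S4: "r \<odot>\<^bsub>?P\<^esub> x \<in> S" if "r \<in> carrier R" "x \<in> S" for r x
  proof -
    obtain a where "a \<in> carrier M" "x = h a" "res a = \<zero>\<^bsub>M'\<^esub>" using \<open>x \<in> S\<close> unfolding S_def by blast
    then show ?thesis using that unfolding S_def by (intro image_eqI[of _ _ "r \<odot>\<^bsub>M\<^esub> a"]) (auto simp: hD rD Msm M'0)
  qed
  obtain J g and \<kappa> :: "('i \<Rightarrow> 'd) \<Rightarrow> 'i \<Rightarrow> 'd" and F D'
    where J: "J \<subseteq> I" and g: "g \<in> module_hom R ?P (direct_sum J N)" and gS: "\<forall>s\<in>S. g s = \<zero>\<^bsub>direct_sum J N\<^esub>"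
      and F: "finite F" "\<kappa> ` carrier ?P \<subseteq> F"
      and gk: "\<forall>y\<in>carrier ?P. \<forall>y'\<in>carrier ?P. g y = \<zero>\<^bsub>direct_sum J N\<^esub> \<longrightarrow>
        g y' = \<zero>\<^bsub>direct_sum J N\<^esub> \<longrightarrow> \<kappa> y = \<kappa> y' \<longrightarrow> y \<ominus>\<^bsub>?P\<^esub> y' \<in> S"
      and D': "finite D'" "D' \<subseteq> carrier (direct_sum J N)"
        "\<forall>z\<in>carrier (direct_sum J N). \<exists>d\<in>D'. \<exists>y\<in>carrier ?P. z = d \<oplus>\<^bsub>direct_sum J N\<^esub> g y"
    by (rule direct_sum_quotient[OF I N S1 S2 S3 S4, THEN exE]) (assumption+, elim exE conjE, rule that)
  let ?Q = "direct_sum J N"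
  interpret Q: module R ?Q by (rule direct_sum_module[OF cring_axioms]) (use mod J in blast)
  note gD = module_homD[OF g]
  obtain ext where ext: "\<And>y. y \<in> carrier M' \<Longrightarrow> ext y \<in> carrier M" "\<And>y. y \<in> carrier M' \<Longrightarrow> res (ext y) = y"
    using surj by metis
  \<comment> \<open>\<open>ext\<close> is a set-theoretic section of \<open>res\<close>.
    Independence of this choice is the next claim, from which linearity of \<open>k\<close>
    follows.\<close>
  define k where "k y = g (h (ext y))" for y
  have k: "k (res x) = g (h x)" if x: "x \<in> carrier M" for x
  proof -
    let ?e = "ext (res x)"
    have e: "?e \<in> carrier M" "res ?e = res x" using ext x rD(1) by auto
    have "res (x \<ominus>\<^bsub>M\<^esub> ?e) = \<zero>\<^bsub>M'\<^esub>" using x e rD(1)[OF x]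
      by (simp add: M.minus_eq r.hom_add M'.r_neg)
    then have "h (x \<ominus>\<^bsub>M\<^esub> ?e) \<in> S" using x e by (auto simp: S_def)
    moreover have "x = (x \<ominus>\<^bsub>M\<^esub> ?e) \<oplus>\<^bsub>M\<^esub> ?e" using x e by (simp add: M.minus_eq M.a_assoc M.l_neg)
    then have "h x = h (x \<ominus>\<^bsub>M\<^esub> ?e) \<oplus>\<^bsub>?P\<^esub> h ?e" using x e hD(2)[of "x \<ominus>\<^bsub>M\<^esub> ?e" ?e] by simp
    ultimately have "g (h x) = \<zero>\<^bsub>?Q\<^esub> \<oplus>\<^bsub>?Q\<^esub> g (h ?e)" using x e gD(2) S1 hD(1) gS by auto
    then show ?thesis using e gD(1) hD(1) by (simp add: k_def)
  qed
  have khom: "k \<in> module_hom R M' ?Q" unfolding module_hom_def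
  proof (intro CollectI conjI ballI)
    show "k \<in> carrier M' \<rightarrow> carrier ?Q" using ext(1) hD(1) gD(1) by (auto simp: k_def)
  next
    fix x y assume xy: "x \<in> carrier M'" "y \<in> carrier M'"
    have "k (x \<oplus>\<^bsub>M'\<^esub> y) = k (res (ext x \<oplus>\<^bsub>M\<^esub> ext y))" using xy ext rD(2) by simp
    also have "\<dots> = k x \<oplus>\<^bsub>?Q\<^esub> k y" using xy ext(1) by (subst k) (auto simp: hD gD k_def)
    finally show "k (x \<oplus>\<^bsub>M'\<^esub> y) = k x \<oplus>\<^bsub>?Q\<^esub> k y" .
  next
    fix r x assume rx: "r \<in> carrier R" "x \<in> carrier M'"
    have "k (r \<odot>\<^bsub>M'\<^esub> x) = k (res (r \<odot>\<^bsub>M\<^esub> ext x))" using rx ext rD(3) by simp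
    also have "\<dots> = r \<odot>\<^bsub>?Q\<^esub> k x" using rx ext(1) by (subst k) (auto simp: hD gD k_def Msm)
    finally show "k (r \<odot>\<^bsub>M'\<^esub> x) = r \<odot>\<^bsub>?Q\<^esub> k x" .
  qed
  let ?K = "{y \<in> carrier M'. k y = \<zero>\<^bsub>?Q\<^esub>}"
  \<comment> \<open>For \<open>y\<close> and \<open>y'\<close> with the same residues, the
    difference of the values of \<open>h\<close> on their lifts is \<open>h a\<close> for some
    \<open>a\<close> in the kernel of \<open>res\<close>. Correcting the lift by \<open>a\<close>
    shows that \<open>y'\<close> differs from \<open>y\<close> only by the image of an element of
    the finite kernel of \<open>h\<close>.\<close>
  have fib: "finite {y' \<in> ?K. \<kappa> (h (ext y')) = \<kappa> (h (ext y))}" if y: "y \<in> ?K" for y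
  proof (rule finite_subset)
    show "finite ((\<lambda>x. y \<oplus>\<^bsub>M'\<^esub> res x) ` {x \<in> carrier M. h x = \<zero>\<^bsub>?P\<^esub>})" using hker by simp
    show "{y' \<in> ?K. \<kappa> (h (ext y')) = \<kappa> (h (ext y))} \<subseteq> (\<lambda>x. y \<oplus>\<^bsub>M'\<^esub> res x) ` {x \<in> carrier M. h x = \<zero>\<^bsub>?P\<^esub>}"
    proof
      fix y' assume y': "y' \<in> {y' \<in> ?K. \<kappa> (h (ext y')) = \<kappa> (h (ext y))}"
      have c: "ext y \<in> carrier M" "ext y' \<in> carrier M" using y y' ext(1) by auto
      have "h (ext y') \<ominus>\<^bsub>?P\<^esub> h (ext y) \<in> S"
        using y y' c by (intro gk[rule_format] hD(1)) (auto simp: k_def)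
      then obtain a where a: "a \<in> carrier M" "res a = \<zero>\<^bsub>M'\<^esub>" "h (ext y') \<ominus>\<^bsub>?P\<^esub> h (ext y) = h a"
        by (auto simp: S_def)
      define x where "x = (ext y' \<ominus>\<^bsub>M\<^esub> ext y) \<ominus>\<^bsub>M\<^esub> a"
      have x: "x \<in> carrier M" using c a by (simp add: x_def)
      have "h x = (h (ext y') \<ominus>\<^bsub>?P\<^esub> h (ext y)) \<ominus>\<^bsub>?P\<^esub> h a"
        using c a(1) by (simp add: x_def M.minus_eq P.minus_eq hD)
      also have "\<dots> = \<zero>\<^bsub>?P\<^esub>" using a hD(1) by (simp add: P.minus_eq P.r_neg)
      finally have "h x = \<zero>\<^bsub>?P\<^esub>" .
      moreover have "res x = y' \<ominus>\<^bsub>M'\<^esub> y"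
        using c a y y' ext(2) by (simp add: x_def M.minus_eq M'.minus_eq rD)
      then have "y' = y \<oplus>\<^bsub>M'\<^esub> res x" using y y' M'.a_lcomm[of y y' "\<ominus>\<^bsub>M'\<^esub> y"] by (simp add: M'.minus_eq M'.r_neg)
      ultimately show "y' \<in> (\<lambda>x. y \<oplus>\<^bsub>M'\<^esub> res x) ` {x \<in> carrier M. h x = \<zero>\<^bsub>?P\<^esub>}" using x by blast
    qed
  qed
  have "finite ?K"
  proof (rule finite_surj)
    show "finite (\<Union>f\<in>F. {y' \<in> ?K. \<kappa> (h (ext y')) = f})"
    proof (rule finite_UN_I[OF F(1)])
      fix f
      show "finite {y' \<in> ?K. \<kappa> (h (ext y')) = f}"
      proof (cases "\<exists>y\<in>?K. \<kappa> (h (ext y)) = f")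
        case True
        then obtain y where "y \<in> ?K" and f: "\<kappa> (h (ext y)) = f" by blast
        then show ?thesis using fib[of y] unfolding f by simp
      next
        case False then have "{y' \<in> ?K. \<kappa> (h (ext y')) = f} = {}" by blast
        then show ?thesis by (simp only: finite.emptyI)
      qed
    qed
    show "?K \<subseteq> id ` (\<Union>f\<in>F. {y' \<in> ?K. \<kappa> (h (ext y')) = f})"
      using F(2) hD(1)[OF ext(1)] by auto
  qed
  have "pseudo_isomorphic R M' ?Q"
  proof (rule pseudo_isomorphicI[OF M' Q.M.abelian_group_axioms khom \<open>finite ?K\<close>])
    \<comment> \<open>Representatives for the cokernel of \<open>g\<close>, plus images under
      \<open>g\<close> of representatives for the cokernel of \<open>h\<close>.\<close>
    show "finite ((\<lambda>(d', d). d' \<oplus>\<^bsub>?Q\<^esub> g d) ` (D' \<times> D))" using D D' by simp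
    show "(\<lambda>(d', d). d' \<oplus>\<^bsub>?Q\<^esub> g d) ` (D' \<times> D) \<subseteq> carrier ?Q"
    proof -
      have "d' \<oplus>\<^bsub>?Q\<^esub> g d \<in> carrier ?Q" if "d' \<in> D'" "d \<in> D" for d d'
        using that D(2) D'(2) gD(1) by (intro Q.a_closed) blast+
      then show ?thesis by auto
    qed
    fix z assume "z \<in> carrier ?Q"
    then obtain d' y where 1: "d' \<in> D'" "y \<in> carrier ?P" "z = d' \<oplus>\<^bsub>?Q\<^esub> g y" using D'(3) by blast
    then obtain d m where 2: "d \<in> D" "m \<in> carrier M" "y = d \<oplus>\<^bsub>?P\<^esub> h m" using D(3) by blast
    have c: "d \<in> carrier ?P" "d' \<in> carrier ?Q" "h m \<in> carrier ?P" using 1 2 D(2) D'(2) hD(1) by blast+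
    have "z = (d' \<oplus>\<^bsub>?Q\<^esub> g d) \<oplus>\<^bsub>?Q\<^esub> k (res m)"
      using 1 2 c gD by (simp add: k Q.a_assoc)
    moreover have "d' \<oplus>\<^bsub>?Q\<^esub> g d \<in> (\<lambda>(d', d). d' \<oplus>\<^bsub>?Q\<^esub> g d) ` (D' \<times> D)" using 1(1) 2(1) by auto
    ultimately show "\<exists>d\<in>(\<lambda>(d', d). d' \<oplus>\<^bsub>?Q\<^esub> g d) ` (D' \<times> D). \<exists>x\<in>carrier M'. z = d \<oplus>\<^bsub>?Q\<^esub> k x"
      using rD(1)[OF 2(2)] by blast
  qed
  then show ?thesis using J by blast
qed

end

section \<open>Quotients of a ring as modules\<close>

lemma quotient_module_simps:
  assumes "ideal I R"
  shows "carrier (quotient_module R I) = (\<lambda>x. I +>\<^bsub>R\<^esub> x) ` carrier R"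
    "\<zero>\<^bsub>quotient_module R I\<^esub> = I +>\<^bsub>R\<^esub> \<zero>\<^bsub>R\<^esub>"
    "x \<in> carrier R \<Longrightarrow> y \<in> carrier R \<Longrightarrow>
      (I +>\<^bsub>R\<^esub> x) \<oplus>\<^bsub>quotient_module R I\<^esub> (I +>\<^bsub>R\<^esub> y) = I +>\<^bsub>R\<^esub> (x \<oplus>\<^bsub>R\<^esub> y)"
    "x \<in> carrier R \<Longrightarrow> y \<in> carrier R \<Longrightarrow> x \<odot>\<^bsub>quotient_module R I\<^esub> (I +>\<^bsub>R\<^esub> y) = I +>\<^bsub>R\<^esub> (x \<otimes>\<^bsub>R\<^esub> y)"
proof -
  interpret ideal I R by (rule assms)
  show "carrier (quotient_module R I) = (\<lambda>x. I +>\<^bsub>R\<^esub> x) ` carrier R"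
    by (auto simp: quotient_module_def FactRing_def A_RCOSETS_def')
  show "\<zero>\<^bsub>quotient_module R I\<^esub> = I +>\<^bsub>R\<^esub> \<zero>\<^bsub>R\<^esub>"
    using a_rcos_const[OF additive_subgroup.zero_closed[OF is_additive_subgroup]] by (simp add: quotient_module_def FactRing_def)
  note h = ring_hom_add[OF rcos_ring_hom] ring_hom_mult[OF rcos_ring_hom]
  show "x \<in> carrier R \<Longrightarrow> y \<in> carrier R \<Longrightarrow>
      (I +>\<^bsub>R\<^esub> x) \<oplus>\<^bsub>quotient_module R I\<^esub> (I +>\<^bsub>R\<^esub> y) = I +>\<^bsub>R\<^esub> (x \<oplus>\<^bsub>R\<^esub> y)"
    "x \<in> carrier R \<Longrightarrow> y \<in> carrier R \<Longrightarrow> x \<odot>\<^bsub>quotient_module R I\<^esub> (I +>\<^bsub>R\<^esub> y) = I +>\<^bsub>R\<^esub> (x \<otimes>\<^bsub>R\<^esub> y)"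
    by (simp_all add: quotient_module_def h)
qed

lemma quotient_module_module:
  assumes "cring R" and I: "ideal I R"
  shows "module R (quotient_module R I)"
proof -
  interpret cring R by (rule assms(1))
  let ?M = "quotient_module R I"
  note s = quotient_module_simps[OF I]
  have c: "I +>\<^bsub>R\<^esub> x \<in> carrier ?M" if "x \<in> carrier R" for x using that by (simp add: s)
  have "abelian_group ?M"
  proof (rule abelian_groupI)
    fix x assume "x \<in> carrier ?M"
    then obtain a where a: "a \<in> carrier R" "x = I +>\<^bsub>R\<^esub> a" by (auto simp: s(1))
    show "\<zero>\<^bsub>?M\<^esub> \<oplus>\<^bsub>?M\<^esub> x = x" using a by (simp add: s)
    show "\<exists>y\<in>carrier ?M. y \<oplus>\<^bsub>?M\<^esub> x = \<zero>\<^bsub>?M\<^esub>"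
      using a c[of "\<ominus>\<^bsub>R\<^esub> a"] by (intro bexI[of _ "I +>\<^bsub>R\<^esub> (\<ominus>\<^bsub>R\<^esub> a)"]) (auto simp: s l_neg)
  qed (auto simp: s(1), auto simp: s(2-) a_ac)
  then show ?thesis
    by (intro moduleI[OF assms(1)]) (auto simp: s(1), auto simp: s(2-) l_distr r_distr m_assoc)
qed

lemma quotient_module_eq_iff:
  assumes I: "ideal I R" and x: "x \<in> carrier R" and y: "y \<in> carrier R"
  shows "I +>\<^bsub>R\<^esub> x = I +>\<^bsub>R\<^esub> y \<longleftrightarrow> x \<ominus>\<^bsub>R\<^esub> y \<in> I"
proof -
  interpret ideal I R by (rule I)
  show ?thesis using a_rcos_module_minus[OF ring_axioms y x] a_repr_independence'[of x y] a_rcos_self x y by auto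
qed

context eisenstein
begin

lemma pseudo_module_PI: "pseudo_module PS PI"
  by (intro pseudo_module.intro pseudo_module_axioms.intro P.is_cring) simp

lemma PIdl_phi_iff: "x \<in> PIdl\<^bsub>PS\<^esub> \<phi> \<longleftrightarrow> (\<exists>g\<in>carrier PS. x = \<phi> \<otimes>\<^bsub>PS\<^esub> g)"
  unfolding cgenideal_def using P.m_comm[OF _ phi_closed] by (auto, metis)

text \<open>The three conditions are, in this order, the translations of \<open>phi_tf\<close>,
  \<open>phi_fin\<close> and \<open>phi_div\<close> to cosets.\<close>

lemma quotient_good: "pseudo_module.good PS PI (quotient_module PS (PIdl\<^bsub>PS\<^esub> \<phi>))"
proof -
  let ?I = "PIdl\<^bsub>PS\<^esub> \<phi>" let ?M = "quotient_module PS ?I"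
  have I: "ideal ?I PS" by (rule P.cgenideal_ideal[OF phi_closed])
  note s = quotient_module_simps[OF I]
  have c: "?I +>\<^bsub>PS\<^esub> x \<in> carrier ?M" if "x \<in> carrier PS" for x using that by (simp add: s)
  have z: "?I +>\<^bsub>PS\<^esub> x = \<zero>\<^bsub>?M\<^esub> \<longleftrightarrow> x \<in> ?I" if "x \<in> carrier PS" for x
    using that quotient_module_eq_iff[OF I that P.zero_closed] by (simp add: s P.minus_eq)
  have eqI: "?I +>\<^bsub>PS\<^esub> (x \<oplus>\<^bsub>PS\<^esub> \<phi> \<otimes>\<^bsub>PS\<^esub> g) = ?I +>\<^bsub>PS\<^esub> x" if "x \<in> carrier PS" "g \<in> carrier PS" for x g
  proof -
    have "(x \<oplus>\<^bsub>PS\<^esub> \<phi> \<otimes>\<^bsub>PS\<^esub> g) \<ominus>\<^bsub>PS\<^esub> x = \<phi> \<otimes>\<^bsub>PS\<^esub> g"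
      using that P.r_neg1[of x "\<phi> \<otimes>\<^bsub>PS\<^esub> g"] P.r_neg[of x]
      by (simp add: P.minus_eq P.a_assoc P.a_comm[of "\<phi> \<otimes>\<^bsub>PS\<^esub> g"] P.r_neg2)
    then show ?thesis using that by (subst quotient_module_eq_iff[OF I]) (auto simp: PIdl_phi_iff)
  qed
  have PIk: "PI [^]\<^bsub>PS\<^esub> (k::nat) \<in> carrier PS" for k by (intro P.nat_pow_closed) simp
  show ?thesis unfolding pseudo_module.good_def[OF pseudo_module_PI]
  proof (intro conjI ballI allI impI)
    show "module PS ?M" by (rule quotient_module_module[OF P.is_cring I])
  next
    fix x assume "x \<in> carrier ?M" and e: "PI \<odot>\<^bsub>?M\<^esub> x = \<zero>\<^bsub>?M\<^esub>"
    then obtain f where f: "f \<in> carrier PS" "x = ?I +>\<^bsub>PS\<^esub> f" by (auto simp: s(1))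
    then have "PI \<otimes>\<^bsub>PS\<^esub> f \<in> ?I" using e by (simp add: s(4) z)
    then obtain g where g: "g \<in> carrier PS" "PI \<otimes>\<^bsub>PS\<^esub> f = \<phi> \<otimes>\<^bsub>PS\<^esub> g" by (auto simp: PIdl_phi_iff)
    then have "f \<in> ?I" using phi_tf[OF f(1) g] by (simp add: PIdl_phi_iff)
    then show "x = \<zero>\<^bsub>?M\<^esub>" using f z by simp
  next
    fix k :: nat
    obtain S where S: "finite S" "S \<subseteq> carrier PS" "\<forall>y\<in>carrier PS. \<exists>c\<in>S. \<exists>a\<in>carrier PS. \<exists>g\<in>carrier PS.
        y = c \<oplus>\<^bsub>PS\<^esub> PI [^]\<^bsub>PS\<^esub> k \<otimes>\<^bsub>PS\<^esub> a \<oplus>\<^bsub>PS\<^esub> \<phi> \<otimes>\<^bsub>PS\<^esub> g"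
      using phi_fin[of k] by blast
    have "\<exists>s\<in>(\<lambda>x. ?I +>\<^bsub>PS\<^esub> x) ` S. \<exists>a\<in>carrier ?M. x = s \<oplus>\<^bsub>?M\<^esub> PI [^]\<^bsub>PS\<^esub> k \<odot>\<^bsub>?M\<^esub> a" if xM: "x \<in> carrier ?M" for x
    proof -
      obtain y where y: "y \<in> carrier PS" "x = ?I +>\<^bsub>PS\<^esub> y" using xM by (auto simp: s(1))
      then obtain d a g where d: "d \<in> S" "a \<in> carrier PS" "g \<in> carrier PS"
        "y = d \<oplus>\<^bsub>PS\<^esub> PI [^]\<^bsub>PS\<^esub> k \<otimes>\<^bsub>PS\<^esub> a \<oplus>\<^bsub>PS\<^esub> \<phi> \<otimes>\<^bsub>PS\<^esub> g" using S(3) by blast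
      have dc: "d \<in> carrier PS" using d S by blast
      have "x = ?I +>\<^bsub>PS\<^esub> (d \<oplus>\<^bsub>PS\<^esub> PI [^]\<^bsub>PS\<^esub> k \<otimes>\<^bsub>PS\<^esub> a)"
        unfolding y(2) d(4) using dc d(2,3) PIk by (intro eqI) auto
      then have "x = (?I +>\<^bsub>PS\<^esub> d) \<oplus>\<^bsub>?M\<^esub> PI [^]\<^bsub>PS\<^esub> k \<odot>\<^bsub>?M\<^esub> (?I +>\<^bsub>PS\<^esub> a)"
        using dc d(2) PIk by (simp add: s(3,4))
      then show ?thesis using d(1) c[OF d(2)] by blast
    qed
    moreover have "(\<lambda>x. ?I +>\<^bsub>PS\<^esub> x) ` S \<subseteq> carrier ?M" using S(2) c by blast
    ultimately show "\<exists>S. finite S \<and> S \<subseteq> carrier ?M \<and>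
        (\<forall>x\<in>carrier ?M. \<exists>s\<in>S. \<exists>a\<in>carrier ?M. x = s \<oplus>\<^bsub>?M\<^esub> PI [^]\<^bsub>PS\<^esub> k \<odot>\<^bsub>?M\<^esub> a)"
      using S(1) by (intro exI[of _ "(\<lambda>x. ?I +>\<^bsub>PS\<^esub> x) ` S"] conjI finite_imageI ballI)
  next
    fix x assume "x \<in> carrier ?M" and nz: "x \<noteq> \<zero>\<^bsub>?M\<^esub>"
    then obtain f where f: "f \<in> carrier PS" "x = ?I +>\<^bsub>PS\<^esub> f" by (auto simp: s(1))
    then have "f \<notin> ?I" using nz z by simp
    then obtain k :: nat and l g where k: "l \<in> carrier PS" "g \<in> carrier PS"
      "PI [^]\<^bsub>PS\<^esub> k = l \<otimes>\<^bsub>PS\<^esub> f \<oplus>\<^bsub>PS\<^esub> \<phi> \<otimes>\<^bsub>PS\<^esub> g" using phi_div[OF f(1)] by blast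
    have "\<exists>l\<in>carrier PS. PI [^]\<^bsub>PS\<^esub> k \<odot>\<^bsub>?M\<^esub> y = l \<odot>\<^bsub>?M\<^esub> x" if yM: "y \<in> carrier ?M" for y
    proof -
      obtain a where a: "a \<in> carrier PS" "y = ?I +>\<^bsub>PS\<^esub> a" using yM by (auto simp: s(1))
      have "PI [^]\<^bsub>PS\<^esub> k \<odot>\<^bsub>?M\<^esub> y = ?I +>\<^bsub>PS\<^esub> (PI [^]\<^bsub>PS\<^esub> k \<otimes>\<^bsub>PS\<^esub> a)" using a PIk by (simp add: s(4))
      also have "PI [^]\<^bsub>PS\<^esub> k \<otimes>\<^bsub>PS\<^esub> a = (a \<otimes>\<^bsub>PS\<^esub> l) \<otimes>\<^bsub>PS\<^esub> f \<oplus>\<^bsub>PS\<^esub> \<phi> \<otimes>\<^bsub>PS\<^esub> (g \<otimes>\<^bsub>PS\<^esub> a)"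
        unfolding k(3) using k(1,2) a(1) f(1) by (simp add: P.l_distr P.r_distr P.m_ac)
      also have "?I +>\<^bsub>PS\<^esub> \<dots> = ?I +>\<^bsub>PS\<^esub> ((a \<otimes>\<^bsub>PS\<^esub> l) \<otimes>\<^bsub>PS\<^esub> f)"
        using k(1,2) a(1) f(1) by (intro eqI) auto
      also have "\<dots> = (a \<otimes>\<^bsub>PS\<^esub> l) \<odot>\<^bsub>?M\<^esub> x" using k(1) a(1) f by (simp add: s(4))
      finally show ?thesis using a(1) k(1) by (intro bexI[of _ "a \<otimes>\<^bsub>PS\<^esub> l"]) auto
    qed
    then show "\<exists>k::nat. \<forall>y\<in>carrier ?M. \<exists>l\<in>carrier PS. PI [^]\<^bsub>PS\<^esub> k \<odot>\<^bsub>?M\<^esub> y = l \<odot>\<^bsub>?M\<^esub> x"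
      by blast
  qed
qed

end

context padic
begin

lemma Lambda_pseudo_module: "pseudo_module (Lambda p) Zd.PI"
  unfolding Lambda_eq by (intro pseudo_module.intro pseudo_module_axioms.intro Zd.P.is_cring Zp.mon_closed Zd.pi_closed)

lemma Lambda_mod_Phi_good: "pseudo_module.good (Lambda p) Zd.PI (Lambda_mod_Phi p n)"
proof -
  obtain w d where "eisenstein (Zp p) p \<pi> (Phi p n) w d" using Phi_eisenstein by blast
  then interpret E: eisenstein "Zp p" p \<pi> "Phi p n" w d .
  show ?thesis unfolding Lambda_eq Lambda_mod_Phi_def by (rule E.quotient_good)
qed

end

section \<open>Pontryagin duals\<close>

text \<open>Divisible abelian groups are injective. Partial homomorphisms are represented by their
  graphs, as subgroups of the product, so that Zorn's lemma applies to plain inclusion of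
  sets.\<close>

lemma (in comm_group) hom_extend:
  assumes Q: "comm_group Q" and div: "\<And>q n. q \<in> carrier Q \<Longrightarrow> n > 0 \<Longrightarrow> \<exists>r\<in>carrier Q. r [^]\<^bsub>Q\<^esub> (n::nat) = q"
    and H: "subgroup H G" and \<psi>: "\<psi> \<in> hom (G\<lparr>carrier := H\<rparr>) Q"
  shows "\<exists>\<phi>\<in>hom G Q. \<forall>x\<in>H. \<phi> x = \<psi> x"
proof -
  interpret Q: comm_group Q by (rule Q)
  interpret H: subgroup H G by (rule H)
  let ?P = "G \<times>\<times> Q"
  interpret P: group ?P by (rule DirProd_group) auto
  interpret P: comm_group ?P
    by (rule P.group_comm_groupI) (auto simp: DirProd_def m_comm Q.m_comm)
  have P: "carrier ?P = carrier G \<times> carrier Q" "\<one>\<^bsub>?P\<^esub> = (\<one>, \<one>\<^bsub>Q\<^esub>)"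
    "(a, b) \<otimes>\<^bsub>?P\<^esub> (a', b') = (a \<otimes> a', b \<otimes>\<^bsub>Q\<^esub> b')" for a a' b b'
    by (auto simp: DirProd_def)
  have Pinv: "inv\<^bsub>?P\<^esub> (a, b) = (inv a, inv\<^bsub>Q\<^esub> b)" if "a \<in> carrier G" "b \<in> carrier Q" for a b
    using inv_DirProd[OF is_group Q.is_group] that by simp
  have Ppow: "(a, b) [^]\<^bsub>?P\<^esub> (k::int) = (a [^] k, b [^]\<^bsub>Q\<^esub> k)" if "a \<in> carrier G" "b \<in> carrier Q" for a b k
  proof -
    have n: "(a, b) [^]\<^bsub>?P\<^esub> (n::nat) = (a [^] n, b [^]\<^bsub>Q\<^esub> n)" for n
      by (induction n) (auto simp: P)
    show ?thesis using that by (cases k rule: int_cases2) (auto simp: n int_pow_int P.int_pow_neg_int Pinv int_pow_neg_int Q.int_pow_neg_int)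
  qed
  have \<psi>: "\<psi> x \<in> carrier Q" "\<psi> (x \<otimes> y) = \<psi> x \<otimes>\<^bsub>Q\<^esub> \<psi> y" if "x \<in> H" "y \<in> H" for x y
    using \<psi> that by (auto simp: hom_def)
  have \<psi>1: "\<psi> \<one> = \<one>\<^bsub>Q\<^esub>" using \<psi>[of \<one> \<one>] by (simp add: Q.l_cancel_one')
  define gr where "gr = (\<lambda>x. (x, \<psi> x)) ` H"
  \<comment> \<open>A subgroup of the product is the graph of a partial homomorphism exactly if it
    contains only the trivial element over 1.\<close>
  define F where "F = {g. subgroup g ?P \<and> gr \<subseteq> g \<and> (\<forall>q. (\<one>, q) \<in> g \<longrightarrow> q = \<one>\<^bsub>Q\<^esub>)}"
  have "subgroup gr ?P"
  proof (rule P.subgroupI)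
    fix a assume "a \<in> gr"
    then obtain x where x: "x \<in> H" "a = (x, \<psi> x)" by (auto simp: gr_def)
    have "inv\<^bsub>Q\<^esub> (\<psi> x) = \<psi> (inv x)" using \<psi>[of x "inv x"] \<psi>[of "inv x" x] x \<psi>1 H.mem_carrier
      by (intro Q.inv_equality) auto
    then show "inv\<^bsub>?P\<^esub> a \<in> gr" using x \<psi> H.mem_carrier by (auto simp: gr_def Pinv)
  next
    fix a b assume "a \<in> gr" "b \<in> gr"
    then obtain x y where "x \<in> H" "y \<in> H" "a = (x, \<psi> x)" "b = (y, \<psi> y)" by (auto simp: gr_def)
    then show "a \<otimes>\<^bsub>?P\<^esub> b \<in> gr" unfolding gr_def by (intro image_eqI[of _ _ "x \<otimes> y"]) (auto simp: P \<psi>)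
  next
    show "gr \<noteq> {}" unfolding gr_def using H.one_closed by blast
  qed (use \<psi> in \<open>auto simp: gr_def P\<close>)
  then have "gr \<in> F" using \<psi>1 by (auto simp: F_def gr_def)
  have "\<exists>M\<in>F. \<forall>Y\<in>F. M \<subseteq> Y \<longrightarrow> Y = M"
  proof (rule subset_Zorn_nonempty)
    show "F \<noteq> {}" using \<open>gr \<in> F\<close> by blast
    fix C assume C: "C \<noteq> {}" "subset.chain F C"
    have CF: "c \<in> F" if "c \<in> C" for c using C(2) that by (auto simp: subset.chain_def)
    have sub: "subgroup c ?P" if "c \<in> C" for c using CF[OF that] by (simp add: F_def)
    have "subgroup (\<Union>C) ?P"
    proof (rule P.subgroupI)
      show "\<Union>C \<subseteq> carrier ?P" using sub subgroup.subset by blast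
      show "\<Union>C \<noteq> {}" using C(1) sub subgroup.one_closed by fastforce
      show "inv\<^bsub>?P\<^esub> a \<in> \<Union>C" if "a \<in> \<Union>C" for a using that subgroup.m_inv_closed[OF sub] by blast
      fix a b assume "a \<in> \<Union>C" "b \<in> \<Union>C"
      then obtain c d where cd: "c \<in> C" "d \<in> C" "a \<in> c" "b \<in> d" by blast
      then have "c \<subseteq> d \<or> d \<subseteq> c" using C(2) by (auto simp: subset.chain_def)
      then obtain e where "e \<in> C" "a \<in> e" "b \<in> e" using cd by blast
      then show "a \<otimes>\<^bsub>?P\<^esub> b \<in> \<Union>C" using subgroup.m_closed[OF sub] by blast
    qed
    then show "\<Union>C \<in> F" using C(1) CF unfolding F_def by fastforce
  qed
  then obtain g where gF: "g \<in> F" and max: "\<And>Y. Y \<in> F \<Longrightarrow> g \<subseteq> Y \<Longrightarrow> Y = g" by blast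
  interpret g: subgroup g ?P using gF by (simp add: F_def)
  have gc: "a \<in> carrier G" "q \<in> carrier Q" if "(a, q) \<in> g" for a q using g.subset that by (auto simp: P)
  have g1: "q = \<one>\<^bsub>Q\<^esub>" if "(\<one>, q) \<in> g" for q using gF that by (simp add: F_def)
  have gpow: "(a [^] k, q [^]\<^bsub>Q\<^esub> k) \<in> g" if "(a, q) \<in> g" for a q and k :: int
    using P.subgroup_int_pow_closed[OF g.subgroup_axioms that, of k] gc[OF that] by (simp add: Ppow)
  have guniq: "q = q'" if "(a, q) \<in> g" "(a, q') \<in> g" for a q q'
  proof -
    have "(a, q) \<otimes>\<^bsub>?P\<^esub> inv\<^bsub>?P\<^esub> (a, q') \<in> g" using that by blast
    then have "(\<one>, q \<otimes>\<^bsub>Q\<^esub> inv\<^bsub>Q\<^esub> q') \<in> g" using gc[OF that(1)] gc[OF that(2)] by (simp add: P Pinv)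
    then have "q \<otimes>\<^bsub>Q\<^esub> inv\<^bsub>Q\<^esub> q' = \<one>\<^bsub>Q\<^esub>" by (rule g1)
    then show ?thesis using gc(2)[OF that(1)] gc(2)[OF that(2)] by (metis Q.inv_equality Q.inv_closed Q.inv_inv)
  qed
  have total: "\<exists>q. (a, q) \<in> g" if a: "a \<in> carrier G" for a
  proof -
    \<comment> \<open>The exponents of those powers of \<open>a\<close> that lie in the current
      domain; by \<open>K_diff\<close> they are closed under remainders.\<close>
    define K where "K n \<longleftrightarrow> (\<exists>q. (a [^] (n::int), q) \<in> g)" for n
    have K_diff: "K (m - n * k)" if mn: "K m" "K n" for m n k
    proof -
      obtain q r where qr: "(a [^] m, q) \<in> g" "(a [^] n, r) \<in> g" using mn by (auto simp: K_def)
      have "(a [^] m, q) \<otimes>\<^bsub>?P\<^esub> ((a [^] n) [^] (- k), r [^]\<^bsub>Q\<^esub> (- k)) \<in> g" using qr gpow by blast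
      then have "(a [^] (m - n * k), q \<otimes>\<^bsub>Q\<^esub> r [^]\<^bsub>Q\<^esub> (- k)) \<in> g"
        using a by (simp add: P int_pow_pow flip: int_pow_mult)
      then show ?thesis by (auto simp: K_def)
    qed
    \<comment> \<open>A value \<open>c\<close> for \<open>a\<close> that is compatible with all
      values already fixed on powers of \<open>a\<close>. With \<open>m\<close> the least positive
      exponent in the domain, an \<open>m\<close>-th root of the value there works, by divisibility;
      without such an exponent, 1 does.\<close>
    have "\<exists>c\<in>carrier Q. \<forall>n. \<forall>q. (a [^] (n::int), q) \<in> g \<longrightarrow> q = c [^]\<^bsub>Q\<^esub> n"
    proof (cases "\<exists>n::nat. n > 0 \<and> K (int n)")
      case True
      define m where "m = (LEAST n::nat. n > 0 \<and> K (int n))"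
      have m: "m > 0" "K (int m)" using LeastI_ex[OF True] by (auto simp: m_def)
      obtain q0 where q0: "(a [^] int m, q0) \<in> g" using m by (auto simp: K_def)
      obtain c where c: "c \<in> carrier Q" "c [^]\<^bsub>Q\<^esub> m = q0" using div[OF gc(2)[OF q0] m(1)] by blast
      have "q = c [^]\<^bsub>Q\<^esub> n" if n: "(a [^] (n::int), q) \<in> g" for n q
      proof -
        have "K n" using n by (auto simp: K_def)
        then have "K (n - int m * (n div int m))" by (rule K_diff[OF _ m(2)])
        then have "K (n mod int m)" by (simp add: minus_mult_div_eq_mod)
        then have "n mod int m = 0"
          using m not_less_Least[of "nat (n mod int m)" "\<lambda>n. n > 0 \<and> K (int n)"]
          unfolding m_def[symmetric]
          by (smt (verit) int_nat_eq nat_less_iff of_nat_0_less_iff pos_mod_bound pos_mod_sign)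
        then obtain k where k: "n = int m * k" by auto
        have "((a [^] int m) [^] k, q0 [^]\<^bsub>Q\<^esub> k) \<in> g" using q0 by (rule gpow)
        then have "(a [^] n, q0 [^]\<^bsub>Q\<^esub> k) \<in> g" using a by (simp add: k int_pow_pow)
        then have "q = q0 [^]\<^bsub>Q\<^esub> k" using guniq n by blast
        also have "\<dots> = c [^]\<^bsub>Q\<^esub> n" using c by (simp add: k flip: Q.int_pow_pow c(2) int_pow_int)
        finally show ?thesis .
      qed
      then show ?thesis using c(1) by blast
    next
      case False
      have "q = \<one>\<^bsub>Q\<^esub> [^]\<^bsub>Q\<^esub> n" if n: "(a [^] (n::int), q) \<in> g" for n q
      proof -
        have "K n" using n by (auto simp: K_def)
        moreover have "K 0" unfolding K_def using g.one_closed by (auto simp: P)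
        ultimately have "K (0 - n * 1)" using K_diff by blast
        then have "K (- n)" by simp
        then have "n = 0" using \<open>K n\<close> False by (metis linorder_neqE_linordered_idom neg_0_less_iff_less zero_less_imp_eq_int)
        then show ?thesis using n g1 by simp
      qed
      then show ?thesis by blast
    qed
    then obtain c where c: "c \<in> carrier Q" "\<And>n q. (a [^] (n::int), q) \<in> g \<Longrightarrow> q = c [^]\<^bsub>Q\<^esub> n" by blast
    \<comment> \<open>The graph is enlarged by the cyclic group of \<open>(a, c)\<close>.
      Compatibility of \<open>c\<close> is precisely what keeps the enlarged subgroup a graph, and
      maximality then places \<open>a\<close> in the old domain.\<close>
    define L where "L = generate ?P {(a, c)}"
    have ac: "(a, c) \<in> carrier ?P" using a c by (simp add: P)
    have L: "subgroup L ?P" unfolding L_def using ac by (intro P.generate_is_subgroup) auto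
    have L_iff: "l \<in> L \<longleftrightarrow> (\<exists>k::int. l = (a [^] k, c [^]\<^bsub>Q\<^esub> k))" for l
      using P.generate_pow[OF ac] a c(1) by (auto simp: L_def Ppow)
    define Y where "Y = g <#>\<^bsub>?P\<^esub> L"
    have Y: "subgroup Y ?P" unfolding Y_def by (rule P.mult_subgroups[OF g.subgroup_axioms L])
    have "g \<subseteq> Y" 
    proof
      fix x assume x: "x \<in> g"
      then have "x = x \<otimes>\<^bsub>?P\<^esub> \<one>\<^bsub>?P\<^esub>" using g.mem_carrier by simp
      then show "x \<in> Y" using x subgroup.one_closed[OF L] unfolding Y_def set_mult_def by blast
    qed
    moreover have "q = \<one>\<^bsub>Q\<^esub>" if qY: "(\<one>, q) \<in> Y" for q
    proof -
      obtain h r k where hr: "(h, r) \<in> g" and k: "(\<one>, q) = (h, r) \<otimes>\<^bsub>?P\<^esub> (a [^] (k::int), c [^]\<^bsub>Q\<^esub> k)"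
        using qY by (auto simp: Y_def set_mult_def L_iff)
      have hrc: "h \<in> carrier G" "r \<in> carrier Q" using gc[OF hr] by auto
      have "h \<otimes> a [^] k = \<one>" and q: "q = r \<otimes>\<^bsub>Q\<^esub> c [^]\<^bsub>Q\<^esub> k" using k by (simp_all add: P)
      then have "h = a [^] (- k)" using a hrc by (metis int_pow_closed int_pow_neg inv_equality)
      then have "r = c [^]\<^bsub>Q\<^esub> (- k)" using c(2) hr by blast
      then show ?thesis using q c(1) by (simp add: Q.int_pow_neg)
    qed
    ultimately have "Y \<in> F" using Y gF by (auto simp: F_def)
    then have "Y = g" using max \<open>g \<subseteq> Y\<close> by blast
    moreover have "(a, c) \<in> Y"
    proof -
      have "(a, c) \<in> L" using a c(1) by (auto simp: L_iff intro!: exI[of _ 1])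
      moreover have "(a, c) = \<one>\<^bsub>?P\<^esub> \<otimes>\<^bsub>?P\<^esub> (a, c)" using ac by simp
      ultimately show ?thesis using g.one_closed unfolding Y_def set_mult_def by blast
    qed
    ultimately show ?thesis by blast
  qed
  define \<phi> where "\<phi> a = (THE q. (a, q) \<in> g)" for a
  have \<phi>: "\<phi> a = q" if "(a, q) \<in> g" for a q
    unfolding \<phi>_def using that guniq by blast
  have \<phi>g: "(a, \<phi> a) \<in> g" if "a \<in> carrier G" for a using total[OF that] \<phi> by auto
  show ?thesis
  proof (rule bexI[of _ \<phi>], rule ballI)
    fix x assume "x \<in> H"
    then have "(x, \<psi> x) \<in> g" using gF by (auto simp: F_def gr_def)
    then show "\<phi> x = \<psi> x" by (rule \<phi>)
  next
    show "\<phi> \<in> hom G Q"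
    proof (rule homI)
      show "\<phi> x \<in> carrier Q" if "x \<in> carrier G" for x using \<phi>g[OF that] gc by blast
      fix x y assume "x \<in> carrier G" "y \<in> carrier G"
      then have "(x, \<phi> x) \<otimes>\<^bsub>?P\<^esub> (y, \<phi> y) \<in> g" using \<phi>g by blast
      then show "\<phi> (x \<otimes> y) = \<phi> x \<otimes>\<^bsub>Q\<^esub> \<phi> y" by (intro \<phi>) (simp add: P)
    qed
  qed
qed

section \<open>The action of power series on the dual\<close>

locale dual_setup = padic p + group_endo G s for p and G :: "'g monoid" (structure) and s +
  assumes nilp: "a \<in> carrier G \<Longrightarrow> \<exists>n. (T ^^ n) a = \<one>"
begin

abbreviation D where "D \<equiv> pontryagin_dual p G s"
abbreviation QZ where "QZ \<equiv> QpZp p"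

lemma D_def': "D = \<lparr>carrier = hom G QZ \<inter> extensional (carrier G), monoid.mult = undefined, one = undefined,
     ring.zero = \<lambda>a\<in>carrier G. \<one>\<^bsub>QZ\<^esub>,
     add = \<lambda>\<phi> \<psi>. \<lambda>a\<in>carrier G. \<phi> a \<otimes>\<^bsub>QZ\<^esub> \<psi> a,
     module.smult = \<lambda>f \<phi>. \<lambda>a\<in>carrier G.
       (\<Otimes>\<^bsub>QZ\<^esub>i\<in>{i. (T ^^ i) a \<noteq> \<one>}. QpZp_smult p (f i) (\<phi> ((T ^^ i) a)))\<rparr>"
  unfolding pontryagin_dual_def Let_def T_def[abs_def] ..

lemma D_carrier: "\<phi> \<in> carrier D \<longleftrightarrow> \<phi> \<in> hom G QZ \<and> \<phi> \<in> extensional (carrier G)"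
  by (simp add: D_def')

lemma D_simps:
  "\<zero>\<^bsub>D\<^esub> = (\<lambda>a\<in>carrier G. \<one>\<^bsub>QZ\<^esub>)" "\<phi> \<oplus>\<^bsub>D\<^esub> \<psi> = (\<lambda>a\<in>carrier G. \<phi> a \<otimes>\<^bsub>QZ\<^esub> \<psi> a)"
  "f \<odot>\<^bsub>D\<^esub> \<phi> = (\<lambda>a\<in>carrier G. (\<Otimes>\<^bsub>QZ\<^esub>i\<in>{i. (T ^^ i) a \<noteq> \<one>}. QpZp_smult p (f i) (\<phi> ((T ^^ i) a))))"
  by (simp_all add: D_def')

lemma D_closed: "\<phi> \<in> carrier D \<Longrightarrow> a \<in> carrier G \<Longrightarrow> \<phi> a \<in> carrier QZ"
  and D_mult: "\<phi> \<in> carrier D \<Longrightarrow> a \<in> carrier G \<Longrightarrow> b \<in> carrier G \<Longrightarrow> \<phi> (a \<otimes> b) = \<phi> a \<otimes>\<^bsub>QZ\<^esub> \<phi> b"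
  by (auto simp: D_carrier hom_def)

lemma D_one: "\<phi> \<in> carrier D \<Longrightarrow> \<phi> \<one> = \<one>\<^bsub>QZ\<^esub>"
  using hom_one[of \<phi> G QZ] is_group QpZp.is_group by (simp add: D_carrier)

lemma D_abelian_group: "abelian_group D"
proof (rule abelian_groupI)
  fix \<phi> assume \<phi>: "\<phi> \<in> carrier D"
  show "\<zero>\<^bsub>D\<^esub> \<oplus>\<^bsub>D\<^esub> \<phi> = \<phi>"
    using \<phi> D_closed[OF \<phi>] by (intro extensionalityI[of _ "carrier G"]) (auto simp: D_simps D_carrier)
  show "\<exists>\<psi>\<in>carrier D. \<psi> \<oplus>\<^bsub>D\<^esub> \<phi> = \<zero>\<^bsub>D\<^esub>"
  proof (rule bexI[of _ "\<lambda>a\<in>carrier G. inv\<^bsub>QZ\<^esub> \<phi> a"])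
    show "(\<lambda>a\<in>carrier G. inv\<^bsub>QZ\<^esub> \<phi> a) \<oplus>\<^bsub>D\<^esub> \<phi> = \<zero>\<^bsub>D\<^esub>"
      unfolding D_simps using D_closed[OF \<phi>] by (intro restrict_ext) auto
    show "(\<lambda>a\<in>carrier G. inv\<^bsub>QZ\<^esub> \<phi> a) \<in> carrier D"
      using \<phi> D_closed[OF \<phi>] D_mult[OF \<phi>] unfolding D_carrier
      by (auto intro!: homI simp: QpZp.inv_mult)
  qed
next
  fix \<phi> \<psi> assume \<phi>: "\<phi> \<in> carrier D" and \<psi>: "\<psi> \<in> carrier D"
  show "\<phi> \<oplus>\<^bsub>D\<^esub> \<psi> = \<psi> \<oplus>\<^bsub>D\<^esub> \<phi>" unfolding D_simps
    using D_closed[OF \<phi>] D_closed[OF \<psi>] by (intro restrict_ext QpZp.m_comm) auto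
  show "\<phi> \<oplus>\<^bsub>D\<^esub> \<psi> \<in> carrier D" unfolding D_carrier D_simps
    using D_closed[OF \<phi>] D_closed[OF \<psi>] D_mult[OF \<phi>] D_mult[OF \<psi>]
    by (auto intro!: homI simp: QpZp.m_ac)
  fix \<theta> assume \<theta>: "\<theta> \<in> carrier D"
  show "\<phi> \<oplus>\<^bsub>D\<^esub> \<psi> \<oplus>\<^bsub>D\<^esub> \<theta> = \<phi> \<oplus>\<^bsub>D\<^esub> (\<psi> \<oplus>\<^bsub>D\<^esub> \<theta>)" unfolding D_simps
    using D_closed[OF \<phi>] D_closed[OF \<psi>] D_closed[OF \<theta>] by (intro restrict_ext) (auto simp: QpZp.m_assoc)
next
  show "\<zero>\<^bsub>D\<^esub> \<in> carrier D" unfolding D_carrier D_simps by (auto intro!: homI)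
qed

lemma T_funpow_one: assumes "(T ^^ n) a = \<one>" "n \<le> m" shows "(T ^^ m) a = \<one>"
proof -
  have "(T ^^ k) \<one> = \<one>" for k by (induction k) (auto simp: T_def)
  then have "(T ^^ (m - n + n)) a = \<one>" unfolding funpow_add using assms(1) by simp
  then show ?thesis using assms(2) by simp
qed

text \<open>The index set in the definition depends on \<open>a\<close>. Since further factors are
  trivial, any bound \<open>n\<close> may be used, and the products at \<open>a\<close>,
  \<open>b\<close> and \<open>a \<otimes> b\<close> can be compared over one common range.\<close>

lemma smult_eq:
  assumes \<phi>: "\<phi> \<in> carrier D" and f: "f \<in> carrier (Lambda p)" and a: "a \<in> carrier G" and n: "(T ^^ n) a = \<one>"
  shows "(f \<odot>\<^bsub>D\<^esub> \<phi>) a = (\<Otimes>\<^bsub>QZ\<^esub>i\<in>{..<n}. QpZp_smult p (f i) (\<phi> ((T ^^ i) a)))"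
proof -
  have fi: "f i \<in> Zp_set p" for i using f by (auto simp: Lambda_eq PS_simps)
  have c: "QpZp_smult p (f i) (\<phi> ((T ^^ i) a)) \<in> carrier QZ" for i
    using D_closed[OF \<phi>] a fi by (intro smult_closed) auto
  have "{i. (T ^^ i) a \<noteq> \<one>} \<subseteq> {..<n}" using T_funpow_one[OF n] by (auto simp: not_le[symmetric])
  then show ?thesis using a c D_one[OF \<phi>] smult_one[OF fi] unfolding D_simps
    by (simp, intro QpZp.finprod_mono_neutral_cong_left) auto
qed

lemma smult_D_closed:
  assumes f: "f \<in> carrier (Lambda p)" and \<phi>: "\<phi> \<in> carrier D"
  shows "f \<odot>\<^bsub>D\<^esub> \<phi> \<in> carrier D"
  unfolding D_carrier
proof
  show "f \<odot>\<^bsub>D\<^esub> \<phi> \<in> extensional (carrier G)" by (simp add: D_simps)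
  have fi: "f i \<in> Zp_set p" for i using f by (auto simp: Lambda_eq PS_simps)
  have c: "QpZp_smult p (f i) (\<phi> ((T ^^ i) a)) \<in> carrier QZ" if "a \<in> carrier G" for i a
    using D_closed[OF \<phi>] that fi by (intro smult_closed) auto
  show "f \<odot>\<^bsub>D\<^esub> \<phi> \<in> hom G QZ"
  proof (rule homI)
    fix a assume a: "a \<in> carrier G"
    obtain n where n: "(T ^^ n) a = \<one>" using nilp[OF a] by blast
    show "(f \<odot>\<^bsub>D\<^esub> \<phi>) a \<in> carrier QZ"
      unfolding smult_eq[OF \<phi> f a n] using c[OF a] by (intro QpZp.finprod_closed) auto
    fix b assume b: "b \<in> carrier G"
    obtain m where m: "(T ^^ m) b = \<one>" using nilp[OF b] by blast
    define k where "k = max m n"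
    have Tm: "(T ^^ i) (a \<otimes> b) = (T ^^ i) a \<otimes> (T ^^ i) b" for i
      by (induction i) (use a b hom_mult[OF T_hom] in auto)
    have k: "(T ^^ k) a = \<one>" "(T ^^ k) b = \<one>" using T_funpow_one[OF n] T_funpow_one[OF m] by (auto simp: k_def)
    then have kab: "(T ^^ k) (a \<otimes> b) = \<one>" by (simp add: Tm)
    have "(f \<odot>\<^bsub>D\<^esub> \<phi>) (a \<otimes> b) = (\<Otimes>\<^bsub>QZ\<^esub>i\<in>{..<k}. QpZp_smult p (f i) (\<phi> ((T ^^ i) a)) \<otimes>\<^bsub>QZ\<^esub> QpZp_smult p (f i) (\<phi> ((T ^^ i) b)))"
      unfolding smult_eq[OF \<phi> f m_closed[OF a b] kab] using a b c
      by (intro QpZp.finprod_cong') (auto simp: Tm D_mult[OF \<phi>] smult_mult[OF fi] D_closed[OF \<phi>])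
    also have "\<dots> = (f \<odot>\<^bsub>D\<^esub> \<phi>) a \<otimes>\<^bsub>QZ\<^esub> (f \<odot>\<^bsub>D\<^esub> \<phi>) b"
      unfolding smult_eq[OF \<phi> f a k(1)] smult_eq[OF \<phi> f b k(2)] using c a b by (intro QpZp.finprod_multf) auto
    finally show "(f \<odot>\<^bsub>D\<^esub> \<phi>) (a \<otimes> b) = (f \<odot>\<^bsub>D\<^esub> \<phi>) a \<otimes>\<^bsub>QZ\<^esub> (f \<odot>\<^bsub>D\<^esub> \<phi>) b" .
  qed
qed

lemma smult_D_zero:
  assumes f: "f \<in> carrier (Lambda p)" shows "f \<odot>\<^bsub>D\<^esub> \<zero>\<^bsub>D\<^esub> = \<zero>\<^bsub>D\<^esub>"
proof -
  have fi: "f i \<in> Zp_set p" for i using f by (auto simp: Lambda_eq PS_simps)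
  show ?thesis unfolding D_simps(1,3) by (rule restrict_ext) (simp add: smult_one[OF fi])
qed

context
  fixes B assumes B: "subgroup B G" and sB: "\<And>b. b \<in> B \<Longrightarrow> s b \<in> B"
begin

lemma sub_T: "b \<in> B \<Longrightarrow> (group_endo.T (G\<lparr>carrier := B\<rparr>) s ^^ n) b = (T ^^ n) b" and sub_T_in: "b \<in> B \<Longrightarrow> (T ^^ n) b \<in> B"
  and sub_group_endo: "group_endo (G\<lparr>carrier := B\<rparr>) s"
proof -
  interpret B: subgroup B G by (rule B)
  show e: "group_endo (G\<lparr>carrier := B\<rparr>) s"
    using group.group_comm_groupI[OF subgroup_imp_group[OF B]] sB s_mult m_comm B.mem_carrier
    by (intro group_endo.intro group_endo_axioms.intro) (auto intro!: homI)
  show in': "(T ^^ n) b \<in> B" if "b \<in> B" for b n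
    by (induction n) (use that sB B.subset in \<open>auto simp: T_def\<close>)
  show "(group_endo.T (G\<lparr>carrier := B\<rparr>) s ^^ n) b = (T ^^ n) b" if "b \<in> B" for b n
  proof (induction n)
    case (Suc n)
    have "group_endo.T (G\<lparr>carrier := B\<rparr>) s x = T x" if "x \<in> B" for x
      using that by (simp add: group_endo.T_def[OF e] T_def m_inv_consistent[OF B])
    then show ?case using Suc in'[OF that] by simp
  qed simp
qed

lemma sub_dual_setup: "dual_setup p (G\<lparr>carrier := B\<rparr>) s"
proof -
  interpret B: subgroup B G by (rule B)
  show ?thesis
    by (intro dual_setup.intro padic_axioms sub_group_endo dual_setup_axioms.intro)
      (use nilp B.mem_carrier in \<open>auto simp: sub_T\<close>)
qed

text \<open>On \<open>B\<close> the operator \<open>T\<close> of the subgroup is the restriction of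
  that of \<open>G\<close>, so the same factors occur in both scalar products.\<close>

lemma restrict_module_hom:
  "(\<lambda>\<phi>. restrict \<phi> B) \<in> module_hom (Lambda p) D (pontryagin_dual p (G\<lparr>carrier := B\<rparr>) s)"
proof -
  interpret B: subgroup B G by (rule B)
  interpret D': dual_setup p "G\<lparr>carrier := B\<rparr>" s by (rule sub_dual_setup)
  show ?thesis unfolding module_hom_def
  proof (intro CollectI conjI ballI)
    show "(\<lambda>\<phi>. restrict \<phi> B) \<in> carrier D \<rightarrow> carrier (pontryagin_dual p (G\<lparr>carrier := B\<rparr>) s)"
      by (auto simp: D'.D_carrier D_mult D_closed intro!: homI)
  next
    fix \<phi> \<psi>
    show "restrict (\<phi> \<oplus>\<^bsub>D\<^esub> \<psi>) B = restrict \<phi> B \<oplus>\<^bsub>pontryagin_dual p (G\<lparr>carrier := B\<rparr>) s\<^esub> restrict \<psi> B"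
      unfolding D'.D_simps D_simps using B.subset by (auto simp: fun_eq_iff restrict_def)
  next
    fix f \<phi>
    show "restrict (f \<odot>\<^bsub>D\<^esub> \<phi>) B = f \<odot>\<^bsub>pontryagin_dual p (G\<lparr>carrier := B\<rparr>) s\<^esub> restrict \<phi> B"
      unfolding D'.D_simps D_simps using B.subset by (auto simp: fun_eq_iff restrict_def sub_T sub_T_in)
  qed
qed

text \<open>Every character of the subgroup extends because Q_p/Z_p is divisible. No compatibility
  with \<open>s\<close> has to be arranged, as the dual consists of all homomorphisms.\<close>

lemma restrict_surj:
  assumes "\<psi> \<in> carrier (pontryagin_dual p (G\<lparr>carrier := B\<rparr>) s)"
  shows "\<exists>\<phi>\<in>carrier D. restrict \<phi> B = \<psi>"
proof -
  interpret B: subgroup B G by (rule B)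
  interpret D': dual_setup p "G\<lparr>carrier := B\<rparr>" s by (rule sub_dual_setup)
  have \<psi>: "\<psi> \<in> hom (G\<lparr>carrier := B\<rparr>) QZ" "\<psi> \<in> extensional B" using assms by (auto simp: D'.D_carrier)
  obtain \<phi> where \<phi>: "\<phi> \<in> hom G QZ" "\<And>x. x \<in> B \<Longrightarrow> \<phi> x = \<psi> x"
    using hom_extend[OF QpZp.comm_group_axioms QpZp_divisible B \<psi>(1)] by blast
  show ?thesis
  proof (rule bexI[of _ "restrict \<phi> (carrier G)"])
    show "restrict (restrict \<phi> (carrier G)) B = \<psi>"
      using \<psi>(2) \<phi>(2) by (intro extensionalityI[of _ B]) auto
    show "restrict \<phi> (carrier G) \<in> carrier D" using \<phi>(1) by (auto simp: D_carrier hom_def)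
  qed
qed

end

end

section \<open>Tensor products\<close>

text \<open>The left factor is only a set with a binary operation: the associativity of the chord and tangent
  law plays no role.\<close>

locale tensor_setup = B: comm_group B for A (structure) and B +
  assumes A_closed: "a \<in> carrier A \<Longrightarrow> a' \<in> carrier A \<Longrightarrow> a \<otimes>\<^bsub>A\<^esub> a' \<in> carrier A"
begin

abbreviation FG where "FG \<equiv> free_Abelian_group (carrier A \<times> carrier B)"
abbreviation rel where "rel \<equiv> tensor_relations A B"
abbreviation tcl where "tcl x \<equiv> rel #>\<^bsub>FG\<^esub> x"

definition gens where "gens =
    {frag_of (a \<otimes>\<^bsub>A\<^esub> a', b) - frag_of (a, b) - frag_of (a', b) | a a' b.
        a \<in> carrier A \<and> a' \<in> carrier A \<and> b \<in> carrier B} \<union>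
     {frag_of (a, b \<otimes>\<^bsub>B\<^esub> b') - frag_of (a, b) - frag_of (a, b') | a b b'.
        a \<in> carrier A \<and> b \<in> carrier B \<and> b' \<in> carrier B}"

lemma rel_eq: "rel = generate FG gens"
  by (simp add: tensor_relations_def gens_def)

lemma FG_simps [simp]: "x \<otimes>\<^bsub>FG\<^esub> y = x + y" "\<one>\<^bsub>FG\<^esub> = 0" "x \<in> carrier FG \<longleftrightarrow> Poly_Mapping.keys x \<subseteq> carrier A \<times> carrier B"
  by (simp_all add: free_Abelian_group_def)

lemma frag_of_FG: "a \<in> carrier A \<Longrightarrow> b \<in> carrier B \<Longrightarrow> frag_of (a, b) \<in> carrier FG"
  by (simp add: keys_frag_of)

lemma FG_diff: "x \<in> carrier FG \<Longrightarrow> y \<in> carrier FG \<Longrightarrow> x - y \<in> carrier FG"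
  using keys_diff[of x y] by auto

lemma FG_inv: "x \<in> carrier FG \<Longrightarrow> inv\<^bsub>FG\<^esub> x = - x"
  by simp

lemma gens_FG: "gens \<subseteq> carrier FG"
proof
  fix x assume "x \<in> gens"
  then show "x \<in> carrier FG" unfolding gens_def
    by (elim UnE CollectE exE conjE) (hypsubst, intro FG_diff frag_of_FG A_closed B.m_closed; assumption)+
qed

sublocale FG: comm_group FG by (rule abelian_free_Abelian_group)

lemma rel_subgroup: "subgroup rel FG"
  unfolding rel_eq by (rule FG.generate_is_subgroup[OF gens_FG])

lemma rel_FG: "x \<in> rel \<Longrightarrow> x \<in> carrier FG"
  using subgroup.mem_carrier[OF rel_subgroup] .

lemma rel_0: "0 \<in> rel" and rel_add: "x \<in> rel \<Longrightarrow> y \<in> rel \<Longrightarrow> x + y \<in> rel"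
  and rel_diff: "x \<in> rel \<Longrightarrow> y \<in> rel \<Longrightarrow> x - y \<in> rel"
proof -
  show "0 \<in> rel" using subgroup.one_closed[OF rel_subgroup] by simp
  show add: "x + y \<in> rel" if "x \<in> rel" "y \<in> rel" for x y using subgroup.m_closed[OF rel_subgroup that] by simp
  assume "x \<in> rel" "y \<in> rel"
  moreover have "- y \<in> rel"
    using subgroup.m_inv_closed[OF rel_subgroup \<open>y \<in> rel\<close>] FG_inv[OF rel_FG[OF \<open>y \<in> rel\<close>]] by simp
  ultimately show "x - y \<in> rel" using add[of x "- y"] by simp
qed

lemma gens_rel: "x \<in> gens \<Longrightarrow> x \<in> rel"
  unfolding rel_eq by (rule generate.incl)

lemma mem_tcl: "y \<in> tcl x \<longleftrightarrow> y - x \<in> rel"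
  by (force simp: r_coset_def)

lemma tcl_eq_iff: "tcl x = tcl y \<longleftrightarrow> x - y \<in> rel"
proof
  assume "tcl x = tcl y"
  then have "x \<in> tcl y" using mem_tcl[of x x] rel_0 by simp
  then show "x - y \<in> rel" by (simp add: mem_tcl)
next
  assume xy: "x - y \<in> rel"
  have "z - x \<in> rel \<longleftrightarrow> z - y \<in> rel" for z
    using rel_add[OF _ xy, of "z - x"] rel_diff[OF _ xy, of "z - y"] by auto
  then show "tcl x = tcl y" by (auto simp: mem_tcl)
qed

abbreviation TT where "TT \<equiv> tensor A B"

lemma TT_carrier: "carrier TT = tcl ` carrier FG"
  by (auto simp: tensor_def FactGroup_def RCOSETS_def)

lemma tcl_closed: "x \<in> carrier FG \<Longrightarrow> tcl x \<in> carrier TT"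
  unfolding TT_carrier by blast

lemma TT_one: "\<one>\<^bsub>TT\<^esub> = tcl 0"
  by (auto simp: tensor_def FactGroup_def r_coset_def)

lemma TT_mult: "tcl x \<otimes>\<^bsub>TT\<^esub> tcl y = tcl (x + y)"
proof -
  have "z \<in> tcl x <#>\<^bsub>FG\<^esub> tcl y \<longleftrightarrow> z \<in> tcl (x + y)" for z
  proof
    assume "z \<in> tcl x <#>\<^bsub>FG\<^esub> tcl y"
    then obtain u w where "u \<in> tcl x" "w \<in> tcl y" "z = u + w" by (auto simp: set_mult_def)
    then show "z \<in> tcl (x + y)" using rel_add[of "u - x" "w - y"] by (simp add: mem_tcl algebra_simps)
  next
    assume "z \<in> tcl (x + y)"
    then have "z - y \<in> tcl x" "y \<in> tcl y" using rel_0 by (simp_all add: mem_tcl algebra_simps)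
    then show "z \<in> tcl x <#>\<^bsub>FG\<^esub> tcl y" unfolding set_mult_def by force
  qed
  then show ?thesis by (auto simp: tensor_def FactGroup_def)
qed

sublocale TT: comm_group TT
  unfolding tensor_def by (rule FG.abelian_FactGroup[OF rel_subgroup])

lemma tensor_pow: 
  assumes a: "a \<in> carrier A" and b: "b \<in> carrier B"
  shows "tcl (frag_of (a, b)) [^]\<^bsub>TT\<^esub> (n::nat) = tcl (frag_of (a, b [^]\<^bsub>B\<^esub> n))"
proof (induction n)
  have bil: "frag_of (a, c \<otimes>\<^bsub>B\<^esub> d) - (frag_of (a, c) + frag_of (a, d)) \<in> rel"
    if "c \<in> carrier B" "d \<in> carrier B" for c d
    using a that by (intro gens_rel) (auto simp: gens_def diff_diff_eq)
  case 0
  \<comment> \<open>Bilinearity with both right factors 1 says that \<open>a \<otimes> 1\<close>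
    equals twice itself.\<close>
  have "frag_of (a, \<one>\<^bsub>B\<^esub>) \<in> rel"
    using rel_diff[OF rel_0 bil[of "\<one>\<^bsub>B\<^esub>" "\<one>\<^bsub>B\<^esub>"]] by simp
  then have "0 - frag_of (a, \<one>\<^bsub>B\<^esub>) \<in> rel" by (rule rel_diff[OF rel_0])
  then show ?case by (simp add: TT_one tcl_eq_iff)
next
  have bil: "frag_of (a, c \<otimes>\<^bsub>B\<^esub> d) - (frag_of (a, c) + frag_of (a, d)) \<in> rel"
    if "c \<in> carrier B" "d \<in> carrier B" for c d
    using a that by (intro gens_rel) (auto simp: gens_def diff_diff_eq)
  case (Suc n)
  have "tcl (frag_of (a, b [^]\<^bsub>B\<^esub> Suc n)) = tcl (frag_of (a, b [^]\<^bsub>B\<^esub> n) + frag_of (a, b))"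
    unfolding tcl_eq_iff using b by (simp add: bil)
  then show ?case using Suc by (simp add: TT_mult)
qed

text \<open>A pure tensor is killed by any power of \<open>p\<close> that kills its right factor,
  and an element is an integral combination of finitely many pure tensors.\<close>

lemma TT_p_primary:
  fixes p :: nat
  assumes prim: "\<And>b. b \<in> carrier B \<Longrightarrow> \<exists>m. b [^]\<^bsub>B\<^esub> (p ^ m) = \<one>\<^bsub>B\<^esub>" and x: "x \<in> carrier TT"
  shows "\<exists>m. x [^]\<^bsub>TT\<^esub> (p ^ m) = \<one>\<^bsub>TT\<^esub>"
proof -
  obtain c where c: "Poly_Mapping.keys c \<subseteq> carrier A \<times> carrier B" "x = tcl c" using x by (auto simp: TT_carrier)
  have "\<exists>m. tcl c [^]\<^bsub>TT\<^esub> (p ^ m) = \<one>\<^bsub>TT\<^esub> \<and> c \<in> carrier FG" using c(1)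
  proof (induction c rule: frag_induction)
    case zero
    then show ?case using TT.nat_pow_one by (simp add: TT_one[symmetric])
  next
    case (one y)
    then obtain a b where ab: "y = (a, b)" "a \<in> carrier A" "b \<in> carrier B" by blast
    obtain m where m: "b [^]\<^bsub>B\<^esub> (p ^ m) = \<one>\<^bsub>B\<^esub>" using prim[OF ab(3)] by blast
    have "tcl (frag_of y) [^]\<^bsub>TT\<^esub> (p ^ m) = tcl (frag_of (a, \<one>\<^bsub>B\<^esub>))"
      using tensor_pow[OF ab(2,3)] m ab(1) by simp
    also have "\<dots> = \<one>\<^bsub>TT\<^esub>" using tensor_pow[OF ab(2) B.one_closed, of 0] by simp
    finally show ?case using frag_of_FG ab by blast
  next
    case (diff a b)
    then obtain m n where m: "tcl a [^]\<^bsub>TT\<^esub> (p ^ m) = \<one>\<^bsub>TT\<^esub>" "a \<in> carrier FG"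
      and n: "tcl b [^]\<^bsub>TT\<^esub> (p ^ n) = \<one>\<^bsub>TT\<^esub>" "b \<in> carrier FG" by blast
    have ab: "a - b \<in> carrier FG" by (rule FG_diff[OF m(2) n(2)])
    note cl = tcl_closed[OF m(2)] tcl_closed[OF n(2)] tcl_closed[OF ab]
    have 1: "tcl a [^]\<^bsub>TT\<^esub> (p ^ (m + n)) = \<one>\<^bsub>TT\<^esub>"
      unfolding power_add using TT.nat_pow_pow[OF cl(1), of "p ^ m" "p ^ n"] m(1) by simp
    have 2: "tcl b [^]\<^bsub>TT\<^esub> (p ^ (m + n)) = \<one>\<^bsub>TT\<^esub>"
      unfolding power_add using TT.nat_pow_pow[OF cl(2), of "p ^ n" "p ^ m"] n(1) by (simp add: mult.commute)
    have "tcl (a - b) \<otimes>\<^bsub>TT\<^esub> tcl b = tcl a" by (simp add: TT_mult)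
    then have "tcl (a - b) [^]\<^bsub>TT\<^esub> (p ^ (m + n)) \<otimes>\<^bsub>TT\<^esub> tcl b [^]\<^bsub>TT\<^esub> (p ^ (m + n)) = \<one>\<^bsub>TT\<^esub>"
      using TT.nat_pow_distrib[OF cl(3,2)] 1 by simp
    then have "tcl (a - b) [^]\<^bsub>TT\<^esub> (p ^ (m + n)) = \<one>\<^bsub>TT\<^esub>" using 2 cl(3) by simp
    then show ?case using ab by blast
  qed
  then show ?thesis using c(2) by blast
qed

end

section \<open>Functoriality of the tensor product\<close>

locale tensor_hom = S: tensor_setup A B + S': tensor_setup A' B for A and A' and B and f +
  assumes f_closed: "a \<in> carrier A \<Longrightarrow> f a \<in> carrier A'"
    and f_mult: "a \<in> carrier A \<Longrightarrow> a' \<in> carrier A \<Longrightarrow> f (a \<otimes>\<^bsub>A\<^esub> a') = f a \<otimes>\<^bsub>A'\<^esub> f a'"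
begin

definition F where "F = frag_extend (\<lambda>(a, b). frag_of (f a, b))"

lemma F_simps: "F (x + y) = F x + F y" "F (x - y) = F x - F y" "F 0 = 0" "F (frag_of (a, b)) = frag_of (f a, b)"
  by (simp_all add: F_def frag_extend_add frag_extend_diff)

lemma F_uminus: "F (- x) = - F x"
  using F_simps(2)[of 0 x] by (simp add: F_simps)

lemma F_closed: "x \<in> carrier S.FG \<Longrightarrow> F x \<in> carrier S'.FG"
proof -
  assume x: "x \<in> carrier S.FG"
  have "Poly_Mapping.keys (F x) \<subseteq> (\<Union>(a, b)\<in>Poly_Mapping.keys x. {(f a, b)})"
    using keys_frag_extend[of "\<lambda>(a, b). frag_of (f a, b)" x] by (simp add: F_def keys_frag_of case_prod_unfold)
  then show ?thesis using x f_closed by (fastforce simp: subset_iff)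
qed

lemma F_rel: assumes "x \<in> S.rel" shows "F x \<in> S'.rel"
  using assms unfolding S.rel_eq
proof (induction rule: generate.induct)
  case one
  then show ?case using S'.rel_0 by (simp add: F_simps)
next
  have g: "F h \<in> S'.rel" if h: "h \<in> S.gens" for h
  proof (rule S'.gens_rel)
    from h consider a a' b where "h = frag_of (a \<otimes>\<^bsub>A\<^esub> a', b) - frag_of (a, b) - frag_of (a', b)"
        "a \<in> carrier A" "a' \<in> carrier A" "b \<in> carrier B"
      | a b b' where "h = frag_of (a, b \<otimes>\<^bsub>B\<^esub> b') - frag_of (a, b) - frag_of (a, b')"
        "a \<in> carrier A" "b \<in> carrier B" "b' \<in> carrier B" unfolding S.gens_def by blast
    then show "F h \<in> S'.gens"
    proof cases
      case 1
      then have "F h = frag_of (f a \<otimes>\<^bsub>A'\<^esub> f a', b) - frag_of (f a, b) - frag_of (f a', b)"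
        by (simp add: F_simps f_mult)
      then show ?thesis unfolding S'.gens_def using f_closed 1 by blast
    next
      case 2
      then have "F h = frag_of (f a, b \<otimes>\<^bsub>B\<^esub> b') - frag_of (f a, b) - frag_of (f a, b')"
        by (simp add: F_simps)
      then show ?thesis unfolding S'.gens_def using f_closed 2 by blast
    qed
  qed
  {
    case (incl h)
    then show ?case by (rule g)
  next
    case (inv h)
    have "h \<in> carrier S.FG" using inv S.gens_FG by blast
    then show ?case using S'.rel_diff[OF S'.rel_0 g[OF inv]] S.FG_inv by (simp add: F_uminus)
  }
next
  case (eng h1 h2)
  then show ?case using S'.rel_add by (simp add: F_simps)
qed

text \<open>\<open>tensor_map\<close> is a union over representatives. As \<open>F\<close> respects
  the relations, all representatives give the same coset, and the union collapses.\<close>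

lemma tensor_map_tcl: "tensor_map A' B f (S.tcl x) = S'.tcl (F x)"
proof -
  have "S'.tcl (F y) = S'.tcl (F x)" if "y \<in> S.tcl x" for y
    using F_rel[of "y - x"] that by (simp add: S.mem_tcl S'.tcl_eq_iff F_simps)
  moreover have "x \<in> S.tcl x" by (simp add: S.mem_tcl S.rel_0)
  ultimately show ?thesis unfolding tensor_map_def F_def by blast
qed

lemma tensor_map_hom: "tensor_map A' B f \<in> hom S.TT S'.TT"
proof (rule homI)
  fix x assume "x \<in> carrier S.TT"
  then obtain c where c: "c \<in> carrier S.FG" "x = S.tcl c" unfolding S.TT_carrier by blast
  then show "tensor_map A' B f x \<in> carrier S'.TT" by (simp only: tensor_map_tcl S'.tcl_closed F_closed)
  fix y assume "y \<in> carrier S.TT"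
  then obtain d where d: "d \<in> carrier S.FG" "y = S.tcl d" unfolding S.TT_carrier by blast
  show "tensor_map A' B f (x \<otimes>\<^bsub>S.TT\<^esub> y) = tensor_map A' B f x \<otimes>\<^bsub>S'.TT\<^esub> tensor_map A' B f y"
    unfolding c(2) d(2) S.TT_mult tensor_map_tcl S'.TT_mult by (simp add: F_simps)
qed

end

lemma tensor_map_comp:
  assumes 1: "tensor_hom A A' B f" and 2: "tensor_hom A' A'' B g" and 3: "tensor_hom A A'' B h"
    and eq: "\<And>a. a \<in> carrier A \<Longrightarrow> h a = g (f a)" and x: "x \<in> carrier (tensor A B)"
  shows "tensor_map A'' B g (tensor_map A' B f x) = tensor_map A'' B h x"
proof -
  interpret T1: tensor_hom A A' B f by (rule 1)
  interpret T2: tensor_hom A' A'' B g by (rule 2)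
  interpret T3: tensor_hom A A'' B h by (rule 3)
  obtain c where c: "Poly_Mapping.keys c \<subseteq> carrier A \<times> carrier B" "x = T1.S.tcl c"
    using x by (auto simp: T1.S.TT_carrier)
  have "T2.F (T1.F c) = T3.F c" using c(1)
    by (induction c rule: frag_induction) (auto simp: T1.F_simps T2.F_simps T3.F_simps eq)
  then show ?thesis unfolding c(2) by (simp add: T1.tensor_map_tcl T2.tensor_map_tcl T3.tensor_map_tcl)
qed

text \<open>Only finitely many left factors occur in an element. The form "for all \<open>m\<close>
  from \<open>n\<close> on" lets their exponents be merged by taking maxima.\<close>

lemma tensor_map_funpow_id:
  assumes th: "tensor_hom A A B f" and x: "x \<in> carrier (tensor A B)"
    and fin: "\<And>a. a \<in> carrier A \<Longrightarrow> \<exists>n. \<forall>m\<ge>n. (f ^^ (p ^ m)) a = a"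
  shows "\<exists>n. \<forall>m\<ge>n. (tensor_map A B f ^^ (p ^ m)) x = x"
proof -
  interpret T: tensor_hom A A B f by (rule th)
  obtain c where c: "Poly_Mapping.keys c \<subseteq> carrier A \<times> carrier B" "x = T.S.tcl c"
    using x by (auto simp: T.S.TT_carrier)
  have F0: "(T.F ^^ k) 0 = 0" for k by (induction k) (auto simp: T.F_simps)
  have Fd: "(T.F ^^ k) (a - b) = (T.F ^^ k) a - (T.F ^^ k) b" for k a b by (induction k) (auto simp: T.F_simps)
  have Fo: "(T.F ^^ k) (frag_of (a, b)) = frag_of ((f ^^ k) a, b)" for k a b by (induction k) (auto simp: T.F_simps)
  have "\<exists>n. \<forall>m\<ge>n. (T.F ^^ (p ^ m)) c = c" using c(1)
  proof (induction c rule: frag_induction)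
    case zero
    then show ?case by (simp add: F0)
  next
    case (one y)
    then obtain a b where y: "y = (a, b)" "a \<in> carrier A" by blast
    obtain n where "\<forall>m\<ge>n. (f ^^ (p ^ m)) a = a" using fin[OF y(2)] by blast
    then show ?case by (intro exI[of _ n]) (simp add: y(1) Fo)
  next
    case (diff a b)
    then obtain m n where "\<forall>k\<ge>m. (T.F ^^ (p ^ k)) a = a" "\<forall>k\<ge>n. (T.F ^^ (p ^ k)) b = b" by blast
    then show ?case by (intro exI[of _ "max m n"]) (simp add: Fd)
  qed
  moreover have "(tensor_map A B f ^^ k) x = T.S.tcl ((T.F ^^ k) c)" for k
    by (induction k) (simp_all add: c(2) T.tensor_map_tcl)
  ultimately show ?thesis using c(2) by metis
qed

section \<open>The chord and tangent law\<close>

text \<open>The following identities are checked by normalising their reified sides.\<close>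

lemma (in cring) weierstrass_vertical:
  assumes "x \<in> carrier R" "y \<in> carrier R" "y2 \<in> carrier R" "a1 \<in> carrier R" "a2 \<in> carrier R" "a3 \<in> carrier R" "a4 \<in> carrier R" "a6 \<in> carrier R"
  shows "(((((y \<otimes> y) \<oplus> ((a1 \<otimes> x) \<otimes> y)) \<oplus> (a3 \<otimes> y)) \<ominus> (((((x \<otimes> x) \<otimes> x) \<oplus> (a2 \<otimes> (x \<otimes> x))) \<oplus> (a4 \<otimes> x)) \<oplus> a6)) \<ominus> ((((y2 \<otimes> y2) \<oplus> ((a1 \<otimes> x) \<otimes> y2)) \<oplus> (a3 \<otimes> y2)) \<ominus> (((((x \<otimes> x) \<otimes> x) \<oplus> (a2 \<otimes> (x \<otimes> x))) \<oplus> (a4 \<otimes> x)) \<oplus> a6))) =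
    ((y \<ominus> y2) \<otimes> (((y \<oplus> y2) \<oplus> (a1 \<otimes> x)) \<oplus> a3))"
proof -
  have "norm (Sub (Sub (Add (Add (Mul (Var 1) (Var 1)) (Mul (Mul (Var 3) (Var 0)) (Var 1))) (Mul (Var 5) (Var 1))) (Add (Add (Add (Mul (Mul (Var 0) (Var 0)) (Var 0)) (Mul (Var 4) (Mul (Var 0) (Var 0)))) (Mul (Var 6) (Var 0))) (Var 7))) (Sub (Add (Add (Mul (Var 2) (Var 2)) (Mul (Mul (Var 3) (Var 0)) (Var 2))) (Mul (Var 5) (Var 2))) (Add (Add (Add (Mul (Mul (Var 0) (Var 0)) (Var 0)) (Mul (Var 4) (Mul (Var 0) (Var 0)))) (Mul (Var 6) (Var 0))) (Var 7)))) =
      norm (Mul (Sub (Var 1) (Var 2)) (Add (Add (Add (Var 1) (Var 2)) (Mul (Var 3) (Var 0))) (Var 5)))"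
    by code_simp
  from norm_eq[OF _ this, of "[x, y, y2, a1, a2, a3, a4, a6]"] show ?thesis using assms by (simp add: in_carrier_def)
qed

text \<open>The substitution of \<open>- y - a1 x - a3\<close> for \<open>y\<close>, here with
  \<open>y = l x + n\<close>, leaves the difference of the two sides of the curve equation
  unchanged; it is the passage to the opposite point.\<close>

lemma (in cring) weierstrass_reflect:
  assumes "l \<in> carrier R" "n \<in> carrier R" "x \<in> carrier R" "a1 \<in> carrier R" "a2 \<in> carrier R" "a3 \<in> carrier R" "a4 \<in> carrier R" "a6 \<in> carrier R"
  shows "((((((((\<ominus> (l \<oplus> a1)) \<otimes> x) \<ominus> n) \<ominus> a3) \<otimes> ((((\<ominus> (l \<oplus> a1)) \<otimes> x) \<ominus> n) \<ominus> a3)) \<oplus> ((a1 \<otimes> x) \<otimes> ((((\<ominus> (l \<oplus> a1)) \<otimes> x) \<ominus> n) \<ominus> a3))) \<oplus> (a3 \<otimes> ((((\<ominus> (l \<oplus> a1)) \<otimes> x) \<ominus> n) \<ominus> a3))) \<ominus> (((((x \<otimes> x) \<otimes> x) \<oplus> (a2 \<otimes> (x \<otimes> x))) \<oplus> (a4 \<otimes> x)) \<oplus> a6)) =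
    ((((((l \<otimes> x) \<oplus> n) \<otimes> ((l \<otimes> x) \<oplus> n)) \<oplus> ((a1 \<otimes> x) \<otimes> ((l \<otimes> x) \<oplus> n))) \<oplus> (a3 \<otimes> ((l \<otimes> x) \<oplus> n))) \<ominus> (((((x \<otimes> x) \<otimes> x) \<oplus> (a2 \<otimes> (x \<otimes> x))) \<oplus> (a4 \<otimes> x)) \<oplus> a6))"
proof -
  have "norm (Sub (Add (Add (Mul (Sub (Sub (Mul (Neg (Add (Var 0) (Var 3))) (Var 2)) (Var 1)) (Var 5)) (Sub (Sub (Mul (Neg (Add (Var 0) (Var 3))) (Var 2)) (Var 1)) (Var 5))) (Mul (Mul (Var 3) (Var 2)) (Sub (Sub (Mul (Neg (Add (Var 0) (Var 3))) (Var 2)) (Var 1)) (Var 5)))) (Mul (Var 5) (Sub (Sub (Mul (Neg (Add (Var 0) (Var 3))) (Var 2)) (Var 1)) (Var 5)))) (Add (Add (Add (Mul (Mul (Var 2) (Var 2)) (Var 2)) (Mul (Var 4) (Mul (Var 2) (Var 2)))) (Mul (Var 6) (Var 2))) (Var 7))) =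
      norm (Sub (Add (Add (Mul (Add (Mul (Var 0) (Var 2)) (Var 1)) (Add (Mul (Var 0) (Var 2)) (Var 1))) (Mul (Mul (Var 3) (Var 2)) (Add (Mul (Var 0) (Var 2)) (Var 1)))) (Mul (Var 5) (Add (Mul (Var 0) (Var 2)) (Var 1)))) (Add (Add (Add (Mul (Mul (Var 2) (Var 2)) (Var 2)) (Mul (Var 4) (Mul (Var 2) (Var 2)))) (Mul (Var 6) (Var 2))) (Var 7)))"
    by code_simp
  from norm_eq[OF _ this, of "[l, n, x, a1, a2, a3, a4, a6]"] show ?thesis using assms by (simp add: in_carrier_def)
qed

text \<open>Along the line \<open>y = l x + n\<close> the equation becomes a cubic \<open>f\<close>.
  With \<open>a2\<close> written as \<open>l l + a1 l - x1 - x2 - x3\<close>, the sum of its roots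
  is prescribed, so \<open>f\<close> is \<open>- (x - x1) (x - x2) (x - x3)\<close> plus a linear
  polynomial. The identity is linear interpolation of \<open>f\<close> between the three
  abscissas.\<close>

lemma (in cring) weierstrass_chord:
  assumes "l \<in> carrier R" "n \<in> carrier R" "x1 \<in> carrier R" "x2 \<in> carrier R" "x3 \<in> carrier R" "a1 \<in> carrier R" "a3 \<in> carrier R" "a4 \<in> carrier R" "a6 \<in> carrier R"
  shows "((x1 \<ominus> x2) \<otimes> ((((((l \<otimes> x3) \<oplus> n) \<otimes> ((l \<otimes> x3) \<oplus> n)) \<oplus> ((a1 \<otimes> x3) \<otimes> ((l \<otimes> x3) \<oplus> n))) \<oplus> (a3 \<otimes> ((l \<otimes> x3) \<oplus> n))) \<ominus> (((((x3 \<otimes> x3) \<otimes> x3) \<oplus> ((((((l \<otimes> l) \<oplus> (a1 \<otimes> l)) \<ominus> x1) \<ominus> x2) \<ominus> x3) \<otimes> (x3 \<otimes> x3))) \<oplus> (a4 \<otimes> x3)) \<oplus> a6))) =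
    (((x3 \<ominus> x2) \<otimes> ((((((l \<otimes> x1) \<oplus> n) \<otimes> ((l \<otimes> x1) \<oplus> n)) \<oplus> ((a1 \<otimes> x1) \<otimes> ((l \<otimes> x1) \<oplus> n))) \<oplus> (a3 \<otimes> ((l \<otimes> x1) \<oplus> n))) \<ominus> (((((x1 \<otimes> x1) \<otimes> x1) \<oplus> ((((((l \<otimes> l) \<oplus> (a1 \<otimes> l)) \<ominus> x1) \<ominus> x2) \<ominus> x3) \<otimes> (x1 \<otimes> x1))) \<oplus> (a4 \<otimes> x1)) \<oplus> a6))) \<ominus> ((x3 \<ominus> x1) \<otimes> ((((((l \<otimes> x2) \<oplus> n) \<otimes> ((l \<otimes> x2) \<oplus> n)) \<oplus> ((a1 \<otimes> x2) \<otimes> ((l \<otimes> x2) \<oplus> n))) \<oplus> (a3 \<otimes> ((l \<otimes> x2) \<oplus> n))) \<ominus> (((((x2 \<otimes> x2) \<otimes> x2) \<oplus> ((((((l \<otimes> l) \<oplus> (a1 \<otimes> l)) \<ominus> x1) \<ominus> x2) \<ominus> x3) \<otimes> (x2 \<otimes> x2))) \<oplus> (a4 \<otimes> x2)) \<oplus> a6))))"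
proof -
  have "norm (Mul (Sub (Var 2) (Var 3)) (Sub (Add (Add (Mul (Add (Mul (Var 0) (Var 4)) (Var 1)) (Add (Mul (Var 0) (Var 4)) (Var 1))) (Mul (Mul (Var 5) (Var 4)) (Add (Mul (Var 0) (Var 4)) (Var 1)))) (Mul (Var 6) (Add (Mul (Var 0) (Var 4)) (Var 1)))) (Add (Add (Add (Mul (Mul (Var 4) (Var 4)) (Var 4)) (Mul (Sub (Sub (Sub (Add (Mul (Var 0) (Var 0)) (Mul (Var 5) (Var 0))) (Var 2)) (Var 3)) (Var 4)) (Mul (Var 4) (Var 4)))) (Mul (Var 7) (Var 4))) (Var 8)))) =
      norm (Sub (Mul (Sub (Var 4) (Var 3)) (Sub (Add (Add (Mul (Add (Mul (Var 0) (Var 2)) (Var 1)) (Add (Mul (Var 0) (Var 2)) (Var 1))) (Mul (Mul (Var 5) (Var 2)) (Add (Mul (Var 0) (Var 2)) (Var 1)))) (Mul (Var 6) (Add (Mul (Var 0) (Var 2)) (Var 1)))) (Add (Add (Add (Mul (Mul (Var 2) (Var 2)) (Var 2)) (Mul (Sub (Sub (Sub (Add (Mul (Var 0) (Var 0)) (Mul (Var 5) (Var 0))) (Var 2)) (Var 3)) (Var 4)) (Mul (Var 2) (Var 2)))) (Mul (Var 7) (Var 2))) (Var 8)))) (Mul (Sub (Var 4) (Var 2)) (Sub (Add (Add (Mul (Add (Mul (Var 0) (Var 3)) (Var 1)) (Add (Mul (Var 0) (Var 3)) (Var 1))) (Mul (Mul (Var 5) (Var 3)) (Add (Mul (Var 0)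 (Var 3)) (Var 1)))) (Mul (Var 6) (Add (Mul (Var 0) (Var 3)) (Var 1)))) (Add (Add (Add (Mul (Mul (Var 3) (Var 3)) (Var 3)) (Mul (Sub (Sub (Sub (Add (Mul (Var 0) (Var 0)) (Mul (Var 5) (Var 0))) (Var 2)) (Var 3)) (Var 4)) (Mul (Var 3) (Var 3)))) (Mul (Var 7) (Var 3))) (Var 8)))))"
    by code_simp
  from norm_eq[OF _ this, of "[l, n, x1, x2, x3, a1, a3, a4, a6]"] show ?thesis using assms by (simp add: in_carrier_def)
qed

text \<open>The confluent case \<open>x2 = x1\<close> of the chord identity: \<open>f x3\<close>
  equals \<open>f x1\<close> plus \<open>x3 - x1\<close> times the derivative of \<open>f\<close> at
  \<open>x1\<close>, and the last factor on the right is this derivative.\<close>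

lemma (in cring) weierstrass_tangent:
  assumes "l \<in> carrier R" "n \<in> carrier R" "x1 \<in> carrier R" "x3 \<in> carrier R" "a1 \<in> carrier R" "a3 \<in> carrier R" "a4 \<in> carrier R" "a6 \<in> carrier R"
  shows "((((((l \<otimes> x3) \<oplus> n) \<otimes> ((l \<otimes> x3) \<oplus> n)) \<oplus> ((a1 \<otimes> x3) \<otimes> ((l \<otimes> x3) \<oplus> n))) \<oplus> (a3 \<otimes> ((l \<otimes> x3) \<oplus> n))) \<ominus> (((((x3 \<otimes> x3) \<otimes> x3) \<oplus> ((((((l \<otimes> l) \<oplus> (a1 \<otimes> l)) \<ominus> x1) \<ominus> x1) \<ominus> x3) \<otimes> (x3 \<otimes> x3))) \<oplus> (a4 \<otimes> x3)) \<oplus> a6)) =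
    (((((((l \<otimes> x1) \<oplus> n) \<otimes> ((l \<otimes> x1) \<oplus> n)) \<oplus> ((a1 \<otimes> x1) \<otimes> ((l \<otimes> x1) \<oplus> n))) \<oplus> (a3 \<otimes> ((l \<otimes> x1) \<oplus> n))) \<ominus> (((((x1 \<otimes> x1) \<otimes> x1) \<oplus> ((((((l \<otimes> l) \<oplus> (a1 \<otimes> l)) \<ominus> x1) \<ominus> x1) \<ominus> x3) \<otimes> (x1 \<otimes> x1))) \<oplus> (a4 \<otimes> x1)) \<oplus> a6)) \<oplus> ((x3 \<ominus> x1) \<otimes> ((l \<otimes> (((((l \<otimes> x1) \<oplus> n) \<oplus> ((l \<otimes> x1) \<oplus> n)) \<oplus> (a1 \<otimes> x1)) \<oplus> a3)) \<ominus> ((((((x1 \<otimes> x1) \<oplus> (x1 \<otimes> x1)) \<oplus> (x1 \<otimes> x1)) \<oplus> (((((((l \<otimes> l) \<oplus> (a1 \<otimes> l)) \<ominus> x1) \<ominus> x1) \<ominus> x3) \<otimes> x1) \<oplus> ((((((l \<otimes> l) \<oplus> (a1 \<otimes> l)) \<ominus> x1) \<ominus> x1) \<ominus> x3) \<otimes> x1))) \<oplus> a4) \<ominus> (a1 \<otimes> ((l \<otimes> x1) \<oplus> n))))))"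
proof -
  have "norm (Sub (Add (Add (Mul (Add (Mul (Var 0) (Var 3)) (Var 1)) (Add (Mul (Var 0) (Var 3)) (Var 1))) (Mul (Mul (Var 4) (Var 3)) (Add (Mul (Var 0) (Var 3)) (Var 1)))) (Mul (Var 5) (Add (Mul (Var 0) (Var 3)) (Var 1)))) (Add (Add (Add (Mul (Mul (Var 3) (Var 3)) (Var 3)) (Mul (Sub (Sub (Sub (Add (Mul (Var 0) (Var 0)) (Mul (Var 4) (Var 0))) (Var 2)) (Var 2)) (Var 3)) (Mul (Var 3) (Var 3)))) (Mul (Var 6) (Var 3))) (Var 7))) =
      norm (Add (Sub (Add (Add (Mul (Add (Mul (Var 0) (Var 2)) (Var 1)) (Add (Mul (Var 0) (Var 2)) (Var 1))) (Mul (Mul (Var 4) (Var 2)) (Add (Mul (Var 0) (Var 2)) (Var 1)))) (Mul (Var 5) (Add (Mul (Var 0) (Var 2)) (Var 1)))) (Add (Add (Add (Mul (Mul (Var 2) (Var 2)) (Var 2)) (Mul (Sub (Sub (Sub (Add (Mul (Var 0) (Var 0)) (Mul (Var 4) (Var 0))) (Var 2)) (Var 2)) (Var 3)) (Mul (Var 2) (Var 2)))) (Mul (Var 6) (Var 2))) (Var 7))) (Mul (Sub (Var 3) (Var 2)) (Sub (Mul (Var 0) (Add (Add (Add (Add (Mul (Var 0) (Var 2)) (Var 1)) (Add (Mul (Var 0) (Var 2)) (Var 1))) (Mul (Var 4) (Var 2))) (Var 5))) (Sub (Add (Add (Add (Add (Mul (Var 2) (Var 2)) (Mul (Var 2) (Var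 2))) (Mul (Var 2) (Var 2))) (Add (Mul (Sub (Sub (Sub (Add (Mul (Var 0) (Var 0)) (Mul (Var 4) (Var 0))) (Var 2)) (Var 2)) (Var 3)) (Var 2)) (Mul (Sub (Sub (Sub (Add (Mul (Var 0) (Var 0)) (Mul (Var 4) (Var 0))) (Var 2)) (Var 2)) (Var 3)) (Var 2)))) (Var 6)) (Mul (Var 4) (Add (Mul (Var 0) (Var 2)) (Var 1)))))))"
    by code_simp
  from norm_eq[OF _ this, of "[l, n, x1, x3, a1, a3, a4, a6]"] show ?thesis using assms by (simp add: in_carrier_def)
qed

text \<open>Solves the defining equation of the third abscissa for \<open>a2\<close>, which brings
  the curve into the form of the two preceding identities.\<close>

lemma (in cring) minus_swap:
  assumes "k \<in> carrier R" "a2 \<in> carrier R" "x1 \<in> carrier R" "x2 \<in> carrier R"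
  shows "(((k \<ominus> x1) \<ominus> x2) \<ominus> (((k \<ominus> a2) \<ominus> x1) \<ominus> x2)) =
    a2"
proof -
  have "norm (Sub (Sub (Sub (Var 0) (Var 2)) (Var 3)) (Sub (Sub (Sub (Var 0) (Var 1)) (Var 2)) (Var 3))) =
      norm (Var 1)"
    by code_simp
  from norm_eq[OF _ this, of "[k, a2, x1, x2]"] show ?thesis using assms by (simp add: in_carrier_def)
qed

section \<open>The chord and tangent law over a field\<close>

context field
begin

lemma in_points_iff:
  "Affine x y \<in> points R (Weierstrass a1 a2 a3 a4 a6) \<longleftrightarrow> x \<in> carrier R \<and> y \<in> carrier R \<and>
    y [^] (2::nat) \<oplus> a1 \<otimes> x \<otimes> y \<oplus> a3 \<otimes> y = x [^] (3::nat) \<oplus> a2 \<otimes> x [^] (2::nat) \<oplus> a4 \<otimes> x \<oplus> a6"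
  by (auto simp: points_def)

lemma points_iff:
  assumes "set_weierstrass (Weierstrass a1 a2 a3 a4 a6) \<subseteq> carrier R"
  shows "Affine x y \<in> points R (Weierstrass a1 a2 a3 a4 a6) \<longleftrightarrow> x \<in> carrier R \<and> y \<in> carrier R \<and>
    ((y \<otimes> y \<oplus> a1 \<otimes> x \<otimes> y) \<oplus> a3 \<otimes> y) \<ominus> (((x \<otimes> x \<otimes> x \<oplus> a2 \<otimes> (x \<otimes> x)) \<oplus> a4 \<otimes> x) \<oplus> a6) = \<zero>"
  using assms
  by (cases "x \<in> carrier R \<and> y \<in> carrier R")
    (auto simp: in_points_iff numeral_2_eq_2 numeral_3_eq_3 minus_eq_zero_iff)

lemma Infinity_points [simp]: "Infinity \<in> points R E"
  by (cases E) (simp add: points_def)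

text \<open>Two points with the same abscissa are equal or opposite, because the difference of their
  equations factors. Outside the vertical case this makes the tangent formula legitimate.\<close>

lemma vertical_unique:
  assumes E: "set_weierstrass (Weierstrass a1 a2 a3 a4 a6) \<subseteq> carrier R"
    and P: "Affine x y1 \<in> points R (Weierstrass a1 a2 a3 a4 a6)"
    and Q: "Affine x y2 \<in> points R (Weierstrass a1 a2 a3 a4 a6)"
    and nz: "y1 \<oplus> y2 \<oplus> a1 \<otimes> x \<oplus> a3 \<noteq> \<zero>"
  shows "y1 = y2"
proof -
  have c: "a1 \<in> carrier R" "a2 \<in> carrier R" "a3 \<in> carrier R" "a4 \<in> carrier R" "a6 \<in> carrier R" using E by auto
  have xy: "x \<in> carrier R" "y1 \<in> carrier R" "y2 \<in> carrier R" using P Q by (auto simp: points_iff[OF E])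
  have "(y1 \<ominus> y2) \<otimes> (y1 \<oplus> y2 \<oplus> a1 \<otimes> x \<oplus> a3) = \<zero>"
    using weierstrass_vertical[OF xy c] P Q by (simp add: points_iff[OF E])
  then have "y1 \<ominus> y2 = \<zero>" using nz xy c by (simp add: integral_iff)
  then show ?thesis using xy by (simp add: minus_eq_zero_iff)
qed

text \<open>The slope in \<open>point_add\<close>, with powers and integer multiples spelled out as
  products and sums, the form in which the identities above are stated.\<close>

definition slope :: "'a weierstrass \<Rightarrow> 'a \<Rightarrow> 'a \<Rightarrow> 'a \<Rightarrow> 'a \<Rightarrow> 'a" where
  "slope E x1 y1 x2 y2 = (case E of Weierstrass a1 a2 a3 a4 a6 \<Rightarrow>
    if x1 = x2
    then ((x1 \<otimes> x1 \<oplus> x1 \<otimes> x1 \<oplus> x1 \<otimes> x1) \<oplus> (a2 \<otimes> x1 \<oplus> a2 \<otimes> x1) \<oplus> a4 \<ominus> a1 \<otimes> y1)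
      \<otimes> inv (y1 \<oplus> y1 \<oplus> a1 \<otimes> x1 \<oplus> a3)
    else (y2 \<ominus> y1) \<otimes> inv (x2 \<ominus> x1))"

lemma point_add_vertical:
  "x1 = x2 \<and> y1 \<oplus> y2 \<oplus> a1 \<otimes> x2 \<oplus> a3 = \<zero> \<Longrightarrow>
    point_add R (Weierstrass a1 a2 a3 a4 a6) (Affine x1 y1) (Affine x2 y2) = Infinity"
  by simp

lemma point_add_Affine:
  assumes E: "set_weierstrass (Weierstrass a1 a2 a3 a4 a6) \<subseteq> carrier R"
    and xy: "x1 \<in> carrier R" "y1 \<in> carrier R" "x2 \<in> carrier R" "y2 \<in> carrier R"
    and l: "l = slope (Weierstrass a1 a2 a3 a4 a6) x1 y1 x2 y2" and lc: "l \<in> carrier R"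
    and ne: "\<not> (x1 = x2 \<and> y1 \<oplus> y2 \<oplus> a1 \<otimes> x2 \<oplus> a3 = \<zero>)"
    and x3: "x3 = l \<otimes> l \<oplus> a1 \<otimes> l \<ominus> a2 \<ominus> x1 \<ominus> x2"
  shows "point_add R (Weierstrass a1 a2 a3 a4 a6) (Affine x1 y1) (Affine x2 y2) =
    Affine x3 ((\<ominus> (l \<oplus> a1)) \<otimes> x3 \<ominus> (y1 \<ominus> l \<otimes> x1) \<ominus> a3)"
proof -
  have c: "a1 \<in> carrier R" "a2 \<in> carrier R" "a3 \<in> carrier R" "a4 \<in> carrier R" "a6 \<in> carrier R" using E by auto
  have e: "[(3::nat)] \<cdot> z = z \<oplus> z \<oplus> z" "[(2::nat)] \<cdot> z = z \<oplus> z" "z [^] (2::nat) = z \<otimes> z" if "z \<in> carrier R" for z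
    using that by (simp_all add: numeral_2_eq_2 numeral_3_eq_3)
  have "(if x1 = x2
      then ([(3::nat)] \<cdot> (x1 [^] (2::nat)) \<oplus> [(2::nat)] \<cdot> (a2 \<otimes> x1) \<oplus> a4 \<ominus> a1 \<otimes> y1)
             \<otimes> inv ([(2::nat)] \<cdot> y1 \<oplus> a1 \<otimes> x1 \<oplus> a3)
      else (y2 \<ominus> y1) \<otimes> inv (x2 \<ominus> x1)) = l"
    using c xy by (simp add: l slope_def e)
  then show ?thesis using ne by (simp add: Let_def x3 e(3)[OF lc])
qed

text \<open>Trades the inverse in the slope for polynomial relations. In the tangent case the
  relation says that the derivative along the line vanishes; in the chord case, that the second
  point lies on the line.\<close>

lemma slope_line:
  assumes E: "set_weierstrass (Weierstrass a1 a2 a3 a4 a6) \<subseteq> carrier R"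
    and P: "Affine x1 y1 \<in> points R (Weierstrass a1 a2 a3 a4 a6)"
    and Q: "Affine x2 y2 \<in> points R (Weierstrass a1 a2 a3 a4 a6)"
    and ne: "\<not> (x1 = x2 \<and> y1 \<oplus> y2 \<oplus> a1 \<otimes> x2 \<oplus> a3 = \<zero>)"
    and l: "l = slope (Weierstrass a1 a2 a3 a4 a6) x1 y1 x2 y2"
  shows "l \<in> carrier R"
    "x1 = x2 \<Longrightarrow> y1 = y2 \<and> y1 \<oplus> y1 \<oplus> a1 \<otimes> x1 \<oplus> a3 \<noteq> \<zero> \<and> l \<otimes> (y1 \<oplus> y1 \<oplus> a1 \<otimes> x1 \<oplus> a3) =
      (x1 \<otimes> x1 \<oplus> x1 \<otimes> x1 \<oplus> x1 \<otimes> x1) \<oplus> (a2 \<otimes> x1 \<oplus> a2 \<otimes> x1) \<oplus> a4 \<ominus> a1 \<otimes> y1"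
    "x1 \<noteq> x2 \<Longrightarrow> y2 = l \<otimes> x2 \<oplus> (y1 \<ominus> l \<otimes> x1)"
proof -
  have c: "a1 \<in> carrier R" "a2 \<in> carrier R" "a3 \<in> carrier R" "a4 \<in> carrier R" "a6 \<in> carrier R" using E by auto
  have xy: "x1 \<in> carrier R" "y1 \<in> carrier R" "x2 \<in> carrier R" "y2 \<in> carrier R"
    using P Q by (auto simp: points_iff[OF E])
  have tang: "y1 = y2 \<and> y1 \<oplus> y1 \<oplus> a1 \<otimes> x1 \<oplus> a3 \<noteq> \<zero>" if "x1 = x2"
  proof -
    have "y1 = y2" by (rule vertical_unique[OF E P]) (use Q ne that in auto)
    then show ?thesis using ne that by auto
  qed
  have unit: "z \<in> Units R" if "z \<in> carrier R" "z \<noteq> \<zero>" for z using that field_Units by simp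
  have dx: "x2 \<ominus> x1 \<noteq> \<zero>" if "x1 \<noteq> x2" using that xy by (auto simp: minus_eq_zero_iff)
  show lc: "l \<in> carrier R"
  proof (cases "x1 = x2")
    case True
    then have "y1 \<oplus> y1 \<oplus> a1 \<otimes> x1 \<oplus> a3 \<in> Units R" using tang xy c by (intro unit) auto
    then show ?thesis using True c xy by (simp add: l slope_def)
  next
    case False
    then have "x2 \<ominus> x1 \<in> Units R" using xy dx by (intro unit) auto
    then show ?thesis using False c xy by (simp add: l slope_def)
  qed
  show "y1 = y2 \<and> y1 \<oplus> y1 \<oplus> a1 \<otimes> x1 \<oplus> a3 \<noteq> \<zero> \<and> l \<otimes> (y1 \<oplus> y1 \<oplus> a1 \<otimes> x1 \<oplus> a3) =
      (x1 \<otimes> x1 \<oplus> x1 \<otimes> x1 \<oplus> x1 \<otimes> x1) \<oplus> (a2 \<otimes> x1 \<oplus> a2 \<otimes> x1) \<oplus> a4 \<ominus> a1 \<otimes> y1" if "x1 = x2"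
  proof (intro conjI)
    define d where "d = y1 \<oplus> y1 \<oplus> a1 \<otimes> x1 \<oplus> a3"
    have "d \<in> Units R" unfolding d_def using tang xy c that by (intro unit) auto
    then have "d \<in> carrier R" "inv d \<in> carrier R" "inv d \<otimes> d = \<one>" by auto
    then show "l \<otimes> (y1 \<oplus> y1 \<oplus> a1 \<otimes> x1 \<oplus> a3) =
        (x1 \<otimes> x1 \<oplus> x1 \<otimes> x1 \<oplus> x1 \<otimes> x1) \<oplus> (a2 \<otimes> x1 \<oplus> a2 \<otimes> x1) \<oplus> a4 \<ominus> a1 \<otimes> y1"
      unfolding d_def[symmetric] l slope_def weierstrass.case if_P[OF that] using c xy by (simp add: m_assoc)
  qed (use tang that in blast)+
  assume ne: "x1 \<noteq> x2"
  have u: "x2 \<ominus> x1 \<in> Units R" using xy dx[OF ne] by (intro unit) auto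
  have "l \<otimes> (x2 \<ominus> x1) = y2 \<ominus> y1" using ne u c xy by (simp add: l slope_def m_assoc)
  moreover have "l \<otimes> x2 \<oplus> (y1 \<ominus> l \<otimes> x1) = l \<otimes> (x2 \<ominus> x1) \<oplus> y1"
    using xy lc by (simp add: minus_eq r_distr r_minus a_ac)
  ultimately show "y2 = l \<otimes> x2 \<oplus> (y1 \<ominus> l \<otimes> x1)" using xy by (simp add: minus_eq a_assoc l_neg)
qed

lemma point_add_closed:
  assumes E: "set_weierstrass E \<subseteq> carrier R" and P: "P \<in> points R E" and Q: "Q \<in> points R E"
  shows "point_add R E P Q \<in> points R E"
proof (cases "P = Infinity \<or> Q = Infinity")
  case True
  then show ?thesis using P Q by (cases P; cases Q; cases E) auto
next
  case False
  then obtain x1 y1 x2 y2 where PQ: "P = Affine x1 y1" "Q = Affine x2 y2" by (cases P; cases Q) auto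
  obtain a1 a2 a3 a4 a6 where E': "E = Weierstrass a1 a2 a3 a4 a6" by (cases E)
  note E = E[unfolded E'] and P = P[unfolded E' PQ] and Q = Q[unfolded E' PQ] and pts = points_iff[OF E[unfolded E']]
  define l where "l = slope (Weierstrass a1 a2 a3 a4 a6) x1 y1 x2 y2"
  define n where "n = y1 \<ominus> l \<otimes> x1"
  define x3 where "x3 = l \<otimes> l \<oplus> a1 \<otimes> l \<ominus> a2 \<ominus> x1 \<ominus> x2"
  have c: "a1 \<in> carrier R" "a2 \<in> carrier R" "a3 \<in> carrier R" "a4 \<in> carrier R" "a6 \<in> carrier R" using E by auto
  have xy: "x1 \<in> carrier R" "y1 \<in> carrier R" "x2 \<in> carrier R" "y2 \<in> carrier R" using P Q by (auto simp: pts)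
  show ?thesis
  proof (cases "x1 = x2 \<and> y1 \<oplus> y2 \<oplus> a1 \<otimes> x2 \<oplus> a3 = \<zero>")
    case True
    then show ?thesis unfolding E' PQ by (subst point_add_vertical) auto
  next
    case ne: False
    note sl = slope_line[OF E P Q ne l_def]
    have lc: "l \<in> carrier R" by (rule sl(1))
    then have nc: "n \<in> carrier R" and x3c: "x3 \<in> carrier R" using c xy by (auto simp: n_def x3_def)
    have y1: "y1 = l \<otimes> x1 \<oplus> n" using lc xy by (simp add: n_def minus_eq a_lcomm r_neg)
    \<comment> \<open>With this rewriting the chord and tangent identities speak about the actual
      curve.\<close>
    have a2: "a2 = l \<otimes> l \<oplus> a1 \<otimes> l \<ominus> x1 \<ominus> x2 \<ominus> x3"
      using minus_swap[of "l \<otimes> l \<oplus> a1 \<otimes> l" a2 x1 x2] lc c xy by (simp add: x3_def)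
    have P0: "(((l \<otimes> x1 \<oplus> n) \<otimes> (l \<otimes> x1 \<oplus> n) \<oplus> a1 \<otimes> x1 \<otimes> (l \<otimes> x1 \<oplus> n)) \<oplus> a3 \<otimes> (l \<otimes> x1 \<oplus> n)) \<ominus>
        (((x1 \<otimes> x1 \<otimes> x1 \<oplus> a2 \<otimes> (x1 \<otimes> x1)) \<oplus> a4 \<otimes> x1) \<oplus> a6) = \<zero>"
      using P unfolding pts y1[symmetric] by simp
    have g3: "(((l \<otimes> x3 \<oplus> n) \<otimes> (l \<otimes> x3 \<oplus> n) \<oplus> a1 \<otimes> x3 \<otimes> (l \<otimes> x3 \<oplus> n)) \<oplus> a3 \<otimes> (l \<otimes> x3 \<oplus> n)) \<ominus>
        (((x3 \<otimes> x3 \<otimes> x3 \<oplus> a2 \<otimes> (x3 \<otimes> x3)) \<oplus> a4 \<otimes> x3) \<oplus> a6) = \<zero>" (is "?g3 = \<zero>")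
    proof (cases "x1 = x2")
      case True
      note t = sl(2)[OF True]
      have a2': "a2 = l \<otimes> l \<oplus> a1 \<otimes> l \<ominus> x1 \<ominus> x1 \<ominus> x3" using a2 True by simp
      have z: "l \<otimes> (y1 \<oplus> y1 \<oplus> a1 \<otimes> x1 \<oplus> a3) \<ominus>
          ((((x1 \<otimes> x1 \<oplus> x1 \<otimes> x1) \<oplus> x1 \<otimes> x1) \<oplus> (a2 \<otimes> x1 \<oplus> a2 \<otimes> x1)) \<oplus> a4 \<ominus> a1 \<otimes> y1) = \<zero>"
        using t c xy by (subst minus_eq_zero_iff) auto
      show ?thesis
        using weierstrass_tangent[OF lc nc xy(1) x3c c(1,3,4,5)] z P0 x3c xy(1)
        unfolding a2'[symmetric] y1[symmetric] by simp
    next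
      case False
      have y2: "y2 = l \<otimes> x2 \<oplus> n" using sl(3)[OF False] by (simp add: n_def)
      have Q0: "(((l \<otimes> x2 \<oplus> n) \<otimes> (l \<otimes> x2 \<oplus> n) \<oplus> a1 \<otimes> x2 \<otimes> (l \<otimes> x2 \<oplus> n)) \<oplus> a3 \<otimes> (l \<otimes> x2 \<oplus> n)) \<ominus>
          (((x2 \<otimes> x2 \<otimes> x2 \<oplus> a2 \<otimes> (x2 \<otimes> x2)) \<oplus> a4 \<otimes> x2) \<oplus> a6) = \<zero>"
        using Q unfolding pts y2[symmetric] by simp
      \<comment> \<open>Both given points satisfy the equation, so the right-hand side of the chord
        identity vanishes; the factor \<open>x1 - x2\<close> can be cancelled.\<close>
      have "(x1 \<ominus> x2) \<otimes> ?g3 = \<zero>"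
        using weierstrass_chord[OF lc nc xy(1,3) x3c c(1,3,4,5)] x3c xy
        unfolding a2[symmetric] P0 Q0 by (simp add: minus_eq r_neg)
      moreover have "x1 \<ominus> x2 \<noteq> \<zero>" using False xy by (simp add: minus_eq_zero_iff)
      moreover have "?g3 \<in> carrier R" using lc nc x3c c by simp
      ultimately show ?thesis using xy by (simp add: integral_iff)
    qed
    have "point_add R E P Q = Affine x3 ((\<ominus> (l \<oplus> a1)) \<otimes> x3 \<ominus> n \<ominus> a3)"
      unfolding E' PQ n_def by (rule point_add_Affine[OF E xy l_def lc ne x3_def])
    moreover have "\<dots> \<in> points R E" unfolding E' pts
      using weierstrass_reflect[OF lc nc x3c c] g3 lc nc x3c c by simp
    ultimately show ?thesis by simp
  qed
qed

end

section \<open>Functoriality of the law in the field\<close>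

locale field_hom = K: field K + K': field K' for K (structure) and K' (structure) +
  fixes \<sigma> assumes hom: "\<sigma> \<in> ring_hom K K'"
begin

sublocale \<sigma>: ring_hom_ring K K' \<sigma>
  by (intro ring_hom_ringI2 K.ring_axioms K'.ring_axioms hom)

lemma \<sigma>_eq_iff: "x \<in> carrier K \<Longrightarrow> y \<in> carrier K \<Longrightarrow> \<sigma> x = \<sigma> y \<longleftrightarrow> x = y"
proof -
  have "\<one>\<^bsub>K'\<^esub> \<in> \<sigma> ` carrier K" using imageI[OF K.one_closed, of \<sigma>] by simp
  then have "\<sigma> ` carrier K \<noteq> {\<zero>\<^bsub>K'\<^esub>}" using K'.one_not_zero by blast
  then have "inj_on \<sigma> (carrier K)" by (rule \<sigma>.non_trivial_field_hom_imp_inj[OF K.field_axioms])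
  then show "x \<in> carrier K \<Longrightarrow> y \<in> carrier K \<Longrightarrow> \<sigma> x = \<sigma> y \<longleftrightarrow> x = y" by (auto simp: inj_on_def)
qed

lemma \<sigma>_zero_iff: "x \<in> carrier K \<Longrightarrow> \<sigma> x = \<zero>\<^bsub>K'\<^esub> \<longleftrightarrow> x = \<zero>\<^bsub>K\<^esub>"
  using \<sigma>_eq_iff[of x "\<zero>\<^bsub>K\<^esub>"] by simp

lemma \<sigma>_minus: "x \<in> carrier K \<Longrightarrow> y \<in> carrier K \<Longrightarrow> \<sigma> (x \<ominus>\<^bsub>K\<^esub> y) = \<sigma> x \<ominus>\<^bsub>K'\<^esub> \<sigma> y"
  by (simp add: K.minus_eq K'.minus_eq)

lemma \<sigma>_inv: "x \<in> carrier K \<Longrightarrow> x \<noteq> \<zero>\<^bsub>K\<^esub> \<Longrightarrow> \<sigma> (inv\<^bsub>K\<^esub> x) = inv\<^bsub>K'\<^esub> (\<sigma> x)"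
proof -
  assume x: "x \<in> carrier K" "x \<noteq> \<zero>\<^bsub>K\<^esub>"
  then have u: "x \<in> Units K" by (simp add: K.field_Units)
  have "\<sigma> x \<otimes>\<^bsub>K'\<^esub> \<sigma> (inv\<^bsub>K\<^esub> x) = \<one>\<^bsub>K'\<^esub>"
    using u x by (simp flip: \<sigma>.hom_mult)
  then show ?thesis using u x by (intro K'.comm_inv_char[symmetric]) auto
qed

lemma weierstrass_map:
  "set_weierstrass E \<subseteq> carrier K \<Longrightarrow> set_weierstrass (map_weierstrass \<sigma> E) \<subseteq> carrier K'"
  by (auto simp: weierstrass.set_map)

lemma points_map:
  assumes E: "set_weierstrass E \<subseteq> carrier K" and P: "P \<in> points K E"
  shows "map_point \<sigma> P \<in> points K' (map_weierstrass \<sigma> E)"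
proof (cases P)
  case (Affine x y)
  obtain a1 a2 a3 a4 a6 where E': "E = Weierstrass a1 a2 a3 a4 a6" by (cases E)
  note E = E[unfolded E']
  have c: "a1 \<in> carrier K" "a2 \<in> carrier K" "a3 \<in> carrier K" "a4 \<in> carrier K" "a6 \<in> carrier K" using E by auto
  have xy: "x \<in> carrier K" "y \<in> carrier K" and
    e: "y [^]\<^bsub>K\<^esub> (2::nat) \<oplus>\<^bsub>K\<^esub> a1 \<otimes>\<^bsub>K\<^esub> x \<otimes>\<^bsub>K\<^esub> y \<oplus>\<^bsub>K\<^esub> a3 \<otimes>\<^bsub>K\<^esub> y =
      x [^]\<^bsub>K\<^esub> (3::nat) \<oplus>\<^bsub>K\<^esub> a2 \<otimes>\<^bsub>K\<^esub> x [^]\<^bsub>K\<^esub> (2::nat) \<oplus>\<^bsub>K\<^esub> a4 \<otimes>\<^bsub>K\<^esub> x \<oplus>\<^bsub>K\<^esub> a6"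
    using P unfolding Affine E' K.in_points_iff by auto
  show ?thesis unfolding Affine E' using arg_cong[OF e, of \<sigma>] xy c
    by (simp add: K'.in_points_iff numeral_2_eq_2 numeral_3_eq_3)
qed simp

lemma slope_map:
  assumes E: "set_weierstrass (Weierstrass a1 a2 a3 a4 a6) \<subseteq> carrier K"
    and P: "Affine x1 y1 \<in> points K (Weierstrass a1 a2 a3 a4 a6)"
    and Q: "Affine x2 y2 \<in> points K (Weierstrass a1 a2 a3 a4 a6)"
    and ne: "\<not> (x1 = x2 \<and> y1 \<oplus>\<^bsub>K\<^esub> y2 \<oplus>\<^bsub>K\<^esub> a1 \<otimes>\<^bsub>K\<^esub> x2 \<oplus>\<^bsub>K\<^esub> a3 = \<zero>\<^bsub>K\<^esub>)"
  shows "\<sigma> (K.slope (Weierstrass a1 a2 a3 a4 a6) x1 y1 x2 y2) =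
    K'.slope (Weierstrass (\<sigma> a1) (\<sigma> a2) (\<sigma> a3) (\<sigma> a4) (\<sigma> a6)) (\<sigma> x1) (\<sigma> y1) (\<sigma> x2) (\<sigma> y2)"
proof -
  have c: "a1 \<in> carrier K" "a2 \<in> carrier K" "a3 \<in> carrier K" "a4 \<in> carrier K" "a6 \<in> carrier K" using E by auto
  have xy: "x1 \<in> carrier K" "y1 \<in> carrier K" "x2 \<in> carrier K" "y2 \<in> carrier K"
    using P Q by (auto simp: K.points_iff[OF E])
  note sl = K.slope_line[OF E P Q ne refl]
  show ?thesis
  proof (cases "x1 = x2")
    case True
    define d where "d = y1 \<oplus>\<^bsub>K\<^esub> y1 \<oplus>\<^bsub>K\<^esub> a1 \<otimes>\<^bsub>K\<^esub> x1 \<oplus>\<^bsub>K\<^esub> a3"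
    have d: "d \<in> carrier K" "d \<noteq> \<zero>\<^bsub>K\<^esub>" using sl(2)[OF True] xy c by (auto simp: d_def)
    have "d \<in> Units K" using d by (simp add: K.field_Units)
    then have di: "inv\<^bsub>K\<^esub> d \<in> carrier K" by simp
    have "\<sigma> d = \<sigma> y1 \<oplus>\<^bsub>K'\<^esub> \<sigma> y1 \<oplus>\<^bsub>K'\<^esub> \<sigma> a1 \<otimes>\<^bsub>K'\<^esub> \<sigma> x1 \<oplus>\<^bsub>K'\<^esub> \<sigma> a3" using xy c by (simp add: d_def)
    then show ?thesis unfolding K.slope_def K'.slope_def weierstrass.case if_P[OF True] if_P[OF arg_cong[OF True]]
      using xy c d di by (simp add: \<sigma>_minus \<sigma>_inv flip: d_def)
  next
    case False
    define d where "d = x2 \<ominus>\<^bsub>K\<^esub> x1"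
    have d: "d \<in> carrier K" "d \<noteq> \<zero>\<^bsub>K\<^esub>" using False xy by (auto simp: d_def K.minus_eq_zero_iff)
    have "d \<in> Units K" using d by (simp add: K.field_Units)
    then have di: "inv\<^bsub>K\<^esub> d \<in> carrier K" by simp
    have "\<sigma> d = \<sigma> x2 \<ominus>\<^bsub>K'\<^esub> \<sigma> x1" using xy by (simp add: d_def \<sigma>_minus)
    then show ?thesis using False xy c d di
      by (simp add: K.slope_def K'.slope_def \<sigma>_minus \<sigma>_inv \<sigma>_eq_iff flip: d_def)
  qed
qed

text \<open>Field homomorphisms are injective, so both sides are in the same case of the law; within
  a case the coordinates are rational expressions.\<close>

lemma point_add_map:
  assumes E: "set_weierstrass E \<subseteq> carrier K" and P: "P \<in> points K E" and Q: "Q \<in> points K E"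
  shows "map_point \<sigma> (point_add K E P Q) =
    point_add K' (map_weierstrass \<sigma> E) (map_point \<sigma> P) (map_point \<sigma> Q)"
proof (cases "P = Infinity \<or> Q = Infinity")
  case True
  then show ?thesis by (cases P; cases Q; cases E) auto
next
  case False
  then obtain x1 y1 x2 y2 where PQ: "P = Affine x1 y1" "Q = Affine x2 y2" by (cases P; cases Q) auto
  obtain a1 a2 a3 a4 a6 where E': "E = Weierstrass a1 a2 a3 a4 a6" by (cases E)
  note E = E[unfolded E'] and P = P[unfolded E' PQ] and Q = Q[unfolded E' PQ]
  have c: "a1 \<in> carrier K" "a2 \<in> carrier K" "a3 \<in> carrier K" "a4 \<in> carrier K" "a6 \<in> carrier K" using E by auto
  have xy: "x1 \<in> carrier K" "y1 \<in> carrier K" "x2 \<in> carrier K" "y2 \<in> carrier K"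
    using P Q by (auto simp: K.points_iff[OF E])
  have E2: "set_weierstrass (Weierstrass (\<sigma> a1) (\<sigma> a2) (\<sigma> a3) (\<sigma> a4) (\<sigma> a6)) \<subseteq> carrier K'" using c by auto
  have xy2: "\<sigma> x1 \<in> carrier K'" "\<sigma> y1 \<in> carrier K'" "\<sigma> x2 \<in> carrier K'" "\<sigma> y2 \<in> carrier K'" using xy by auto
  have "\<sigma> y1 \<oplus>\<^bsub>K'\<^esub> \<sigma> y2 \<oplus>\<^bsub>K'\<^esub> \<sigma> a1 \<otimes>\<^bsub>K'\<^esub> \<sigma> x2 \<oplus>\<^bsub>K'\<^esub> \<sigma> a3 = \<sigma> (y1 \<oplus>\<^bsub>K\<^esub> y2 \<oplus>\<^bsub>K\<^esub> a1 \<otimes>\<^bsub>K\<^esub> x2 \<oplus>\<^bsub>K\<^esub> a3)"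
    using xy c by simp
  then have cond: "\<sigma> y1 \<oplus>\<^bsub>K'\<^esub> \<sigma> y2 \<oplus>\<^bsub>K'\<^esub> \<sigma> a1 \<otimes>\<^bsub>K'\<^esub> \<sigma> x2 \<oplus>\<^bsub>K'\<^esub> \<sigma> a3 = \<zero>\<^bsub>K'\<^esub> \<longleftrightarrow>
      y1 \<oplus>\<^bsub>K\<^esub> y2 \<oplus>\<^bsub>K\<^esub> a1 \<otimes>\<^bsub>K\<^esub> x2 \<oplus>\<^bsub>K\<^esub> a3 = \<zero>\<^bsub>K\<^esub>"
    using xy c by (simp only: \<sigma>_zero_iff K.add.m_closed K.m_closed)
  show ?thesis
  proof (cases "x1 = x2 \<and> y1 \<oplus>\<^bsub>K\<^esub> y2 \<oplus>\<^bsub>K\<^esub> a1 \<otimes>\<^bsub>K\<^esub> x2 \<oplus>\<^bsub>K\<^esub> a3 = \<zero>\<^bsub>K\<^esub>")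
    case True
    then show ?thesis unfolding PQ E' using cond
      by (simp add: K.point_add_vertical K'.point_add_vertical)
  next
    case ne: False
    define l where "l = K.slope (Weierstrass a1 a2 a3 a4 a6) x1 y1 x2 y2"
    have lc: "l \<in> carrier K" unfolding l_def by (rule K.slope_line(1)[OF E P Q ne refl])
    have ne': "\<not> (\<sigma> x1 = \<sigma> x2 \<and> \<sigma> y1 \<oplus>\<^bsub>K'\<^esub> \<sigma> y2 \<oplus>\<^bsub>K'\<^esub> \<sigma> a1 \<otimes>\<^bsub>K'\<^esub> \<sigma> x2 \<oplus>\<^bsub>K'\<^esub> \<sigma> a3 = \<zero>\<^bsub>K'\<^esub>)"
      using ne cond xy by (simp add: \<sigma>_eq_iff)
    have l: "\<sigma> l = K'.slope (Weierstrass (\<sigma> a1) (\<sigma> a2) (\<sigma> a3) (\<sigma> a4) (\<sigma> a6)) (\<sigma> x1) (\<sigma> y1) (\<sigma> x2) (\<sigma> y2)"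
      unfolding l_def by (rule slope_map[OF E P Q ne])
    show ?thesis unfolding PQ E'
      using ne ne' lc c xy
      by (subst K.point_add_Affine[OF E xy l_def lc ne refl])
        (simp add: K'.point_add_Affine[OF E2 xy2 l _ ne' refl] \<sigma>_minus del: point_add.simps)
  qed
qed

end

section \<open>Galois groups of \<open>\<int>\<^sub>p\<close>-extensions\<close>

lemma galois_group_carrier:
  "\<rho> \<in> carrier (galois_group K F) \<longleftrightarrow>
    \<rho> \<in> extensional (carrier K) \<and> bij_betw \<rho> (carrier K) (carrier K) \<and> \<rho> \<in> ring_hom K K \<and> (\<forall>x\<in>F. \<rho> x = x)"
  by (auto simp: galois_group_def Bij_def)

lemma galois_group_mult:
  "\<rho> \<in> carrier (galois_group K F) \<Longrightarrow> \<tau> \<in> carrier (galois_group K F) \<Longrightarrow>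
    \<rho> \<otimes>\<^bsub>galois_group K F\<^esub> \<tau> = compose (carrier K) \<rho> \<tau>"
  by (simp add: galois_group_def BijGroup_def)

lemma galois_group_closed: "\<rho> \<in> carrier (galois_group K F) \<Longrightarrow> x \<in> carrier K \<Longrightarrow> \<rho> x \<in> carrier K"
  by (auto simp: galois_group_carrier bij_betw_def)

locale zp_ext = padic p + field K for p and K :: "'k ring" (structure) +
  fixes F
  assumes zp: "Zp_extension p K F"
begin

abbreviation Gal where "Gal \<equiv> galois_group K F"

lemma F_subfield: "subfield F K" and F_algebraic: "x \<in> carrier K \<Longrightarrow> (algebraic over F) x"
  using zp by (auto simp: Zp_extension_def galois_extension_def over_def)

lemma F_carrier: "x \<in> F \<Longrightarrow> x \<in> carrier K"
  using subfieldE(3)[OF F_subfield] by blast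

lemma Zp_iso: "\<exists>h. h \<in> iso (add_monoid (Zp p)) Gal"
  using zp by (auto simp: Zp_extension_def)

text \<open>Closure under composition and inverses is transported from Z_p: \<open>h\<close> is onto
  and multiplicative, so products and inverses in the group of bijections are again values of
  \<open>h\<close>.\<close>

lemma Gal_group: "group Gal"
proof -
  obtain h where h: "h \<in> iso (add_monoid (Zp p)) Gal" using Zp_iso by blast
  interpret B: group "BijGroup (carrier K)" by (rule group_BijGroup)
  have Gal: "Gal = (BijGroup (carrier K))\<lparr>carrier := carrier Gal\<rparr>" by (simp add: galois_group_def)
  have sub: "\<rho> \<in> carrier (BijGroup (carrier K))" if "\<rho> \<in> carrier Gal" for \<rho>
    using that by (auto simp: galois_group_def BijGroup_def)
  have mult: "\<rho> \<otimes>\<^bsub>Gal\<^esub> \<tau> = \<rho> \<otimes>\<^bsub>BijGroup (carrier K)\<^esub> \<tau>" for \<rho> \<tau> by (simp add: galois_group_def)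
  have hc: "h z \<in> carrier Gal" if "z \<in> Zp_set p" for z using h that by (auto simp: iso_def hom_def)
  have hm: "h (z \<oplus>\<^bsub>Zp p\<^esub> w) = h z \<otimes>\<^bsub>BijGroup (carrier K)\<^esub> h w" if "z \<in> Zp_set p" "w \<in> Zp_set p" for z w
    using h that by (simp add: iso_def hom_def mult)
  have hs: "\<exists>z\<in>Zp_set p. \<rho> = h z" if "\<rho> \<in> carrier Gal" for \<rho>
    using h that by (auto simp: iso_def bij_betw_def)
  have z0: "\<zero>\<^bsub>Zp p\<^esub> \<in> Zp_set p" using Zp.zero_closed unfolding Zp_simps(1) .
  \<comment> \<open>The value at zero is idempotent, and in the group of bijections only the
    identity is.\<close>
  have "h \<zero>\<^bsub>Zp p\<^esub> \<otimes>\<^bsub>BijGroup (carrier K)\<^esub> h \<zero>\<^bsub>Zp p\<^esub> = h \<zero>\<^bsub>Zp p\<^esub>"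
    using hm[OF z0 z0] Zp.l_zero[OF Zp.zero_closed] by simp
  then have h0: "h \<zero>\<^bsub>Zp p\<^esub> = \<one>\<^bsub>BijGroup (carrier K)\<^esub>"
    using sub[OF hc[OF z0]] by simp
  have "subgroup (carrier Gal) (BijGroup (carrier K))"
  proof (rule B.subgroupI)
    show "carrier Gal \<noteq> {}" using hc[OF z0] by blast
    fix \<rho> assume \<rho>: "\<rho> \<in> carrier Gal"
    obtain z where z: "z \<in> Zp_set p" "\<rho> = h z" using hs[OF \<rho>] by blast
    have mz: "\<ominus>\<^bsub>Zp p\<^esub> z \<in> Zp_set p" using Zp.a_inv_closed[of z] z(1) unfolding Zp_simps(1) by blast
    have "h (\<ominus>\<^bsub>Zp p\<^esub> z) \<otimes>\<^bsub>BijGroup (carrier K)\<^esub> h z = \<one>\<^bsub>BijGroup (carrier K)\<^esub>"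
      using hm[OF mz z(1)] Zp.l_neg[of z] z(1) h0 unfolding Zp_simps(1) by simp
    then have "inv\<^bsub>BijGroup (carrier K)\<^esub> \<rho> = h (\<ominus>\<^bsub>Zp p\<^esub> z)"
      unfolding z(2) using sub[OF hc[OF z(1)]] sub[OF hc[OF mz]] by (rule B.inv_equality)
    then show "inv\<^bsub>BijGroup (carrier K)\<^esub> \<rho> \<in> carrier Gal" using hc[OF mz] by simp
  next
    fix \<rho> \<tau> assume "\<rho> \<in> carrier Gal" "\<tau> \<in> carrier Gal"
    then obtain z w where zw: "z \<in> Zp_set p" "w \<in> Zp_set p" "\<rho> = h z" "\<tau> = h w" using hs by metis
    have "z \<oplus>\<^bsub>Zp p\<^esub> w \<in> Zp_set p" using Zp.a_closed[of z w] zw unfolding Zp_simps(1) by blast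
    then show "\<rho> \<otimes>\<^bsub>BijGroup (carrier K)\<^esub> \<tau> \<in> carrier Gal" unfolding zw(3,4) hm[OF zw(1,2), symmetric] by (rule hc)
  qed (use sub in blast)
  then show ?thesis by (subst Gal) (rule B.subgroup_imp_group)
qed

sublocale Gal: group Gal by (rule Gal_group)

lemma Gal_one: "x \<in> carrier K \<Longrightarrow> \<one>\<^bsub>Gal\<^esub> x = x"
  by (simp add: galois_group_def BijGroup_def)

lemma Gal_pow: "\<rho> \<in> carrier Gal \<Longrightarrow> x \<in> carrier K \<Longrightarrow> (\<rho> [^]\<^bsub>Gal\<^esub> (n::nat)) x = (\<rho> ^^ n) x"
proof (induction n arbitrary: x)
  case 0
  then show ?case by (simp add: Gal_one)
next
  case (Suc n)
  then show ?case using galois_group_closed[OF Suc.prems]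
    by (simp add: galois_group_mult compose_def funpow_swap1)
qed

text \<open>The iterates of \<open>x\<close> stay among the roots of a polynomial over
  \<open>F\<close>, so every orbit has length at most their number. The exponent must serve all
  automorphisms at once, since it is later applied to a root of the given one.\<close>

lemma orbit_power:
  assumes x: "x \<in> carrier K"
  shows "\<exists>N>0. \<forall>\<tau>\<in>carrier Gal. (\<tau> ^^ N) x = x"
proof -
  obtain P where P: "P \<in> carrier (F[X])" "P \<noteq> []" "eval P x = \<zero>"
    using algebraicE[OF subfieldE(1)[OF F_subfield] x F_algebraic[OF x]] by blast
  have PF: "set P \<subseteq> F" using P(1) unfolding sym[OF univ_poly_carrier] polynomial_def by auto
  have PF': "set P \<subseteq> carrier K" using PF F_carrier by blast
  have PK: "P \<in> carrier (poly_ring K)"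
    using P(1) F_carrier unfolding sym[OF univ_poly_carrier] polynomial_def by auto
  define O' where "O' = {y. is_root P y}"
  have fin: "finite O'" unfolding O'_def by (rule finite_number_of_roots[OF PK])
  \<comment> \<open>The factorial is divisible by every possible orbit length.\<close>
  define N where "N = (fact (card O') :: nat)"
  have "(\<tau> ^^ N) x = x" if \<tau>: "\<tau> \<in> carrier Gal" for \<tau>
  proof -
    have hom: "\<tau> \<in> ring_hom K K" and fix': "\<And>a. a \<in> F \<Longrightarrow> \<tau> a = a" and inj: "inj_on \<tau> (carrier K)"
      using \<tau> by (auto simp: galois_group_carrier bij_betw_def)
    interpret \<tau>: ring_hom_ring K K \<tau> by (intro ring_hom_ringI2 ring_axioms hom)
    have map: "map \<tau> P = P" using PF fix' by (intro map_idI) blast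
    have step: "\<tau> y \<in> O'" if "y \<in> O'" for y
    proof -
      have y: "y \<in> carrier K" "eval P y = \<zero>" using that by (auto simp: O'_def is_root_def)
      have "eval P (\<tau> y) = \<tau> (eval P y)" using \<tau>.eval_hom'[OF y(1), of P] PF' map by simp
      then show ?thesis using y P(2) galois_group_closed[OF \<tau>] by (simp add: O'_def is_root_def)
    qed
    have it: "(\<tau> ^^ k) x \<in> O'" for k
      by (induction k) (use step x P in \<open>auto simp: O'_def is_root_def\<close>)
    have itK: "(\<tau> ^^ k) y \<in> carrier K" if "y \<in> carrier K" for k y
      by (induction k) (use that galois_group_closed[OF \<tau>] in auto)
    have injk: "y = z" if "(\<tau> ^^ k) y = (\<tau> ^^ k) z" "y \<in> carrier K" "z \<in> carrier K" for k y z
      using that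
    proof (induction k)
      case (Suc k)
      then show ?case using inj_onD[OF inj _ itK itK] by simp
    qed simp
    have "\<not> inj_on (\<lambda>k. (\<tau> ^^ k) x) {..card O'}"
    proof
      assume "inj_on (\<lambda>k. (\<tau> ^^ k) x) {..card O'}"
      then have "card {..card O'} \<le> card O'" using fin it by (intro card_inj_on_le[of _ _ O']) auto
      then show False by simp
    qed
    then obtain i j where "i \<le> card O'" "j \<le> card O'" "i \<noteq> j" "(\<tau> ^^ i) x = (\<tau> ^^ j) x"
      by (auto simp: inj_on_def)
    then obtain i j where ij: "i < j" "j \<le> card O'" "(\<tau> ^^ i) x = (\<tau> ^^ j) x" by (metis linorder_neqE_nat)
    define d where "d = j - i"
    have "(\<tau> ^^ (i + d)) x = (\<tau> ^^ i) x" using ij by (simp add: d_def)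
    then have "(\<tau> ^^ i) ((\<tau> ^^ d) x) = (\<tau> ^^ i) x" by (simp add: funpow_add)
    then have d: "(\<tau> ^^ d) x = x" using injk[of i] itK x by blast
    have "d dvd N" unfolding N_def d_def using ij by (intro dvd_fact) auto
    then obtain k where "N = d * k" by blast
    moreover have "(\<tau> ^^ (d * k)) x = x" by (induction k) (use d in \<open>auto simp: funpow_add\<close>)
    ultimately show ?thesis by simp
  qed
  moreover have "N > 0" by (simp add: N_def)
  ultimately show ?thesis by blast
qed

text \<open>The group is divisible by all integers prime to \<open>p\<close>, so only the \<open>p\<close>-part of the exponent matters.\<close>

lemma Gal_p_power:
  assumes \<rho>: "\<rho> \<in> carrier Gal" and x: "x \<in> carrier K"
  shows "\<exists>n. \<forall>m\<ge>n. (\<rho> ^^ (p ^ m)) x = x"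
proof -
  obtain N where N: "N > 0" "\<And>\<tau>. \<tau> \<in> carrier Gal \<Longrightarrow> (\<tau> ^^ N) x = x" using orbit_power[OF x] by blast
  obtain n u where nu: "N = p ^ n * u" "\<not> p dvd u"
  proof (rule that[of "multiplicity p N" "N div p ^ multiplicity p N"])
    have nu: "\<not> is_unit p" using p_gt by simp
    show "N = p ^ multiplicity p N * (N div p ^ multiplicity p N)"
      using multiplicity_dvd[of p N] by simp
    show "\<not> p dvd N div p ^ multiplicity p N" using multiplicity_decompose[of N p] N(1) nu by simp
  qed
  obtain h where h: "h \<in> iso (add_monoid (Zp p)) Gal" using Zp_iso by blast
  interpret h: group_hom "add_monoid (Zp p)" Gal h
    by (intro group_hom.intro group_hom_axioms.intro Zp.add.is_group Gal_group) (use h in \<open>simp add: iso_def\<close>)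
  obtain z where z: "z \<in> Zp_set p" "\<rho> = h z" using h \<rho> by (auto simp: iso_def bij_betw_def)
  obtain y where y: "y \<in> Zp_set p" "[u] \<cdot>\<^bsub>Zp p\<^esub> y = z" using Zp_divide_coprime[OF z(1) nu(2)] by blast
  have yc: "y \<in> carrier (add_monoid (Zp p))" using y(1) by simp
  \<comment> \<open>A \<open>u\<close>-th root of \<open>\<rho>\<close>, with \<open>u\<close> the
    part of \<open>N\<close> prime to \<open>p\<close>. Then \<open>\<rho>\<close> iterated
    \<open>p ^ n\<close> times is \<open>\<tau>\<close> iterated \<open>N\<close> times, which fixes
    \<open>x\<close>.\<close>
  define \<tau> where "\<tau> = h y"
  have \<tau>: "\<tau> \<in> carrier Gal" unfolding \<tau>_def by (rule h.hom_closed[OF yc])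
  have "\<rho> = \<tau> [^]\<^bsub>Gal\<^esub> u" unfolding z(2) y(2)[symmetric] \<tau>_def add_pow_def by (rule h.hom_nat_pow[OF yc])
  then have \<rho>\<tau>: "\<rho> w = (\<tau> ^^ u) w" if "w \<in> carrier K" for w using Gal_pow[OF \<tau> that] by simp
  have it: "(\<rho> ^^ k) x = (\<tau> ^^ (u * k)) x \<and> (\<rho> ^^ k) x \<in> carrier K" for k
  proof (induction k)
    case (Suc k)
    then have k: "(\<rho> ^^ k) x = (\<tau> ^^ (u * k)) x" "(\<rho> ^^ k) x \<in> carrier K" by blast+
    have "(\<rho> ^^ Suc k) x = \<rho> ((\<rho> ^^ k) x)" by simp
    also have "\<dots> = (\<tau> ^^ u) ((\<rho> ^^ k) x)" by (rule \<rho>\<tau>[OF k(2)])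
    also have "\<dots> = (\<tau> ^^ u) ((\<tau> ^^ (u * k)) x)" by (simp only: k(1))
    finally have "(\<rho> ^^ Suc k) x = (\<tau> ^^ (u * Suc k)) x" by (simp add: funpow_add)
    moreover have "(\<rho> ^^ Suc k) x \<in> carrier K" using galois_group_closed[OF \<rho> k(2)] by simp
    ultimately show ?case by blast
  qed (use x in simp)
  have n: "(\<rho> ^^ (p ^ n)) x = x" using it[of "p ^ n"] N(2)[OF \<tau>] nu(1) by (simp add: mult.commute)
  have "(\<rho> ^^ (p ^ n * k)) x = x" for k by (induction k) (use n in \<open>auto simp: funpow_add\<close>)
  then have "(\<rho> ^^ (p ^ m)) x = x" if "m \<ge> n" for m
    using that by (metis le_add_diff_inverse power_add)
  then show ?thesis by blast
qed

text \<open>Adjoining finite bases of both fields gives a field generated by finitely many algebraic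
  elements, and such a field is finite over \<open>F\<close>.\<close>

lemma finite_subextension_directed:
  assumes L: "L \<in> finite_subextensions K F" and L': "L' \<in> finite_subextensions K F"
  shows "\<exists>M\<in>finite_subextensions K F. L \<subseteq> M \<and> L' \<subseteq> M"
proof -
  have base: "\<exists>Us. set Us \<subseteq> carrier K \<and> Span F Us = L" if "L \<in> finite_subextensions K F" for L
    using that exists_base[OF F_subfield] by (auto simp: finite_subextensions_def finite_dimension_def)
  obtain Us where Us: "set Us \<subseteq> carrier K" "Span F Us = L" using base[OF L] by blast
  obtain Vs where Vs: "set Vs \<subseteq> carrier K" "Span F Vs = L'" using base[OF L'] by blast
  define M where "M = finite_extension F (Us @ Vs)"
  have UV: "set (Us @ Vs) \<subseteq> carrier K" using Us Vs by simp
  have alg: "\<And>x. x \<in> set (Us @ Vs) \<Longrightarrow> (algebraic over F) x" using UV F_algebraic by blast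
  have M: "M \<in> finite_subextensions K F" unfolding finite_subextensions_def M_def
    using finite_extension_is_subfield[OF F_subfield UV alg] finite_extension_finite_dimension(1)[OF F_subfield UV alg]
      finite_extension_incl[OF subfieldE(3)[OF F_subfield] UV] by simp
  then have Msub: "subring M K" and FM: "F \<subseteq> M" by (auto simp: finite_subextensions_def subfieldE(1))
  have UVM: "set (Us @ Vs) \<subseteq> M" unfolding M_def by (rule finite_extension_mem[OF subfieldE(1)[OF F_subfield] UV])
  have span: "Span F Ws \<subseteq> M" if "set Ws \<subseteq> carrier K" "set Ws \<subseteq> M" for Ws
  proof (rule Span_min[OF F_subfield that(1)])
    show "subgroup M (add_monoid K)" using Msub by (rule subring.axioms(1))
    show "F <#>\<^bsub>K\<^esub> set Ws \<subseteq> M" using that(2) FM subringE(6)[OF Msub] unfolding set_mult_def by auto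
  qed
  show ?thesis using M span[OF Us(1)] span[OF Vs(1)] Us(2) Vs(2) UVM by auto
qed

lemma finite_subextension_cover:
  assumes "x \<in> carrier K" shows "\<exists>L\<in>finite_subextensions K F. x \<in> L"
proof -
  have x: "set [x] \<subseteq> carrier K" and alg: "\<And>y. y \<in> set [x] \<Longrightarrow> (algebraic over F) y"
    using assms F_algebraic by auto
  have "finite_extension F [x] \<in> finite_subextensions K F" unfolding finite_subextensions_def
    using finite_extension_is_subfield[OF F_subfield x alg] finite_extension_finite_dimension(1)[OF F_subfield x alg]
      finite_extension_incl[OF subfieldE(3)[OF F_subfield] x] by blast
  moreover have "x \<in> finite_extension F [x]"
    using finite_extension_mem[OF subfieldE(1)[OF F_subfield] x] by auto
  ultimately show ?thesis by blast
qed

lemma finite_subextension_image: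
  assumes \<rho>: "\<rho> \<in> carrier Gal" and L: "L \<in> finite_subextensions K F"
  shows "\<rho> ` L \<in> finite_subextensions K F"
proof -
  have hom: "\<rho> \<in> ring_hom K K" and fix': "\<And>a. a \<in> F \<Longrightarrow> \<rho> a = a" and inj: "inj_on \<rho> (carrier K)"
    using \<rho> by (auto simp: galois_group_carrier bij_betw_def)
  interpret \<rho>: ring_hom_ring K K \<rho> by (intro ring_hom_ringI2 ring_axioms hom)
  have L': "subfield L K" "F \<subseteq> L" "finite_dimension F L" using L by (auto simp: finite_subextensions_def)
  have F: "\<rho> ` F = F" using fix' by force
  obtain n where "dimension n F L" using L'(3) by (auto simp: finite_dimension_def)
  then have "dimension n (\<rho> ` F) (\<rho> ` L)"
    using inj subfieldE(3)[OF L'(1)] by (intro \<rho>.inj_hom_dimension[OF F_subfield]) (auto intro: inj_on_subset)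
  then have "finite_dimension F (\<rho> ` L)" unfolding F by (rule finite_dimensionI)
  moreover have "F \<subseteq> \<rho> ` L" using image_mono[OF L'(2), of \<rho>] F by simp
  ultimately show ?thesis using \<rho>.img_is_subfield(2)[OF L'(1)] by (simp add: finite_subextensions_def)
qed

lemma place_nonarch: assumes v: "place_above p K v" shows "nonarch_field K v (finite_subextensions K F)"
proof (intro nonarch_field.intro field_axioms nonarch_field_axioms.intro)
  show "finite_subextensions K F \<noteq> {}" using finite_subextension_cover[OF zero_closed] by blast
  show "subfield L K" if "L \<in> finite_subextensions K F" for L using that by (simp add: finite_subextensions_def)
  show "carrier K \<subseteq> \<Union> (finite_subextensions K F)" using finite_subextension_cover by blast
qed (use v finite_subextension_directed in \<open>auto simp: place_above_def\<close>)

end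

section \<open>The fine Mordell--Weil group\<close>

text \<open>\<open>\<rho>\<close> is isometric from \<open>v'\<close> to \<open>v\<close> and
  permutes the subfields in \<open>Ls\<close> among themselves, so its termwise application to
  Cauchy sequences passes to the completions.\<close>

lemma completion_transport:
  assumes S: "nonarch_field K v' Ls" and D: "nonarch_field K v Ls" and \<rho>: "\<rho> \<in> ring_hom K K"
    and v: "\<And>x. x \<in> carrier K \<Longrightarrow> v' x = v (\<rho> x)" and Ls: "\<And>L. L \<in> Ls \<Longrightarrow> \<rho> ` L \<in> Ls"
  shows "\<exists>h\<in>ring_hom (completion K Ls v') (completion K Ls v).
    \<forall>x\<in>carrier K. h (completion_embed K Ls v' x) = completion_embed K Ls v (\<rho> x)"
proof -
  interpret S: nonarch_field K v' Ls by (rule S)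
  interpret D: nonarch_field K v Ls by (rule D)
  interpret \<rho>: ring_hom_ring K K \<rho> by (intro ring_hom_ringI2 S.ring_axioms \<rho>)
  have \<rho>minus: "\<rho> (x \<ominus>\<^bsub>K\<^esub> y) = \<rho> x \<ominus>\<^bsub>K\<^esub> \<rho> y" if "x \<in> carrier K" "y \<in> carrier K" for x y
    using that by (simp add: S.minus_eq)
  have closed: "(\<lambda>n. \<rho> (t n)) \<in> carrier D.C" if t: "t \<in> carrier S.C" for t
  proof -
    obtain L where L: "L \<in> Ls" "range t \<subseteq> L" using t by (auto simp: S.in_C_iff)
    then have "range (\<lambda>n. \<rho> (t n)) \<subseteq> \<rho> ` L" by blast
    moreover have "cauchy_seq K v (\<lambda>n. \<rho> (t n))"
      using S.cauchyD[OF t] S.C_closed[OF t] by (simp add: cauchy_seq_def v flip: \<rho>minus)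
    ultimately show ?thesis using Ls[OF L(1)] by (auto simp: D.in_C_iff)
  qed
  \<comment> \<open>A representative is picked by choice; the next claim shows that any
    representative may be used instead.\<close>
  define h where "h c = D.cl (\<lambda>n. \<rho> ((SOME t. t \<in> carrier S.C \<and> S.cl t = c) n))" for c
  have h: "h (S.cl t) = D.cl (\<lambda>n. \<rho> (t n))" if t: "t \<in> carrier S.C" for t
  proof -
    define t' where "t' = (SOME t'. t' \<in> carrier S.C \<and> S.cl t' = S.cl t)"
    have t': "t' \<in> carrier S.C" "S.cl t' = S.cl t"
      unfolding t'_def using someI[of "\<lambda>t'. t' \<in> carrier S.C \<and> S.cl t' = S.cl t" t] t by auto
    then have N: "(\<lambda>n. t' n \<ominus>\<^bsub>K\<^esub> t n) \<in> S.N" using S.cl_eq_iff[OF t'(1) t] by simp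
    have "(\<lambda>n. \<rho> (t' n) \<ominus>\<^bsub>K\<^esub> \<rho> (t n)) = (\<lambda>n. \<rho> (t' n \<ominus>\<^bsub>K\<^esub> t n))"
      using S.C_closed[OF t] S.C_closed[OF t'(1)] by (simp add: \<rho>minus)
    moreover have "(\<lambda>n. \<rho> (t' n \<ominus>\<^bsub>K\<^esub> t n)) \<in> D.N"
    proof -
      have c: "(\<lambda>n. t' n \<ominus>\<^bsub>K\<^esub> t n) \<in> carrier S.C" and l: "(\<lambda>n. v' (t' n \<ominus>\<^bsub>K\<^esub> t n)) \<longlonglongrightarrow> 0"
        using N unfolding S.in_N_iff by blast+
      have "(\<lambda>n. v' (t' n \<ominus>\<^bsub>K\<^esub> t n)) = (\<lambda>n. v (\<rho> (t' n \<ominus>\<^bsub>K\<^esub> t n)))"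
        by (intro ext v S.minus_closed S.C_closed[OF t] S.C_closed[OF t'(1)])
      then show ?thesis using closed[OF c] l unfolding D.in_N_iff by simp
    qed
    ultimately show ?thesis
      unfolding h_def t'_def[symmetric] D.cl_eq_iff[OF closed[OF t'(1)] closed[OF t]] by (simp only:)
  qed
  have "h \<in> ring_hom S.Q D.Q"
  proof (rule ring_hom_memI)
    fix x assume "x \<in> carrier S.Q"
    then obtain s where s: "s \<in> carrier S.C" "x = S.cl s" unfolding S.Q_carrier by blast
    show "h x \<in> carrier D.Q" unfolding s(2) h[OF s(1)] by (rule D.cl_closed[OF closed[OF s(1)]])
    fix y assume "y \<in> carrier S.Q"
    then obtain t where t: "t \<in> carrier S.C" "y = S.cl t" unfolding S.Q_carrier by blast
    note st = S.C_closed[OF s(1)] S.C_closed[OF t(1)]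
    show "h (x \<otimes>\<^bsub>S.Q\<^esub> y) = h x \<otimes>\<^bsub>D.Q\<^esub> h y"
      unfolding s(2) t(2) S.cl_mult[OF s(1) t(1)] h[OF S.C_mult[OF s(1) t(1)]] h[OF s(1)] h[OF t(1)]
        D.cl_mult[OF closed[OF s(1)] closed[OF t(1)]] \<rho>.hom_mult[OF st] ..
    show "h (x \<oplus>\<^bsub>S.Q\<^esub> y) = h x \<oplus>\<^bsub>D.Q\<^esub> h y"
      unfolding s(2) t(2) S.cl_add[OF s(1) t(1)] h[OF S.C_add[OF s(1) t(1)]] h[OF s(1)] h[OF t(1)]
        D.cl_add[OF closed[OF s(1)] closed[OF t(1)]] \<rho>.hom_add[OF st] ..
  next
    show "h \<one>\<^bsub>S.Q\<^esub> = \<one>\<^bsub>D.Q\<^esub>"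
      unfolding S.cl_one h[OF S.C_const[OF S.one_closed]] D.cl_one \<rho>.hom_one ..
  qed
  moreover have "\<forall>x\<in>carrier K. h (completion_embed K Ls v' x) = completion_embed K Ls v (\<rho> x)"
    using h[OF S.C_const] unfolding S.embed_eq D.embed_eq by blast
  ultimately show ?thesis by blast
qed

lemma point_group_simps:
  "carrier (point_group K E) = points K E" "P \<otimes>\<^bsub>point_group K E\<^esub> Q = point_add K E P Q"
  by (simp_all add: point_group_def)

lemma (in field) point_group_tensor_setup:
  assumes "set_weierstrass E \<subseteq> carrier R" "comm_group B"
  shows "tensor_setup (point_group R E) B"
  using assms point_add_closed
  by (intro tensor_setup.intro tensor_setup_axioms.intro) (auto simp: point_group_simps)

lemma (in field_hom) point_group_tensor_hom:
  assumes E: "set_weierstrass E \<subseteq> carrier K" and B: "comm_group B"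
  shows "tensor_hom (point_group K E) (point_group K' (map_weierstrass \<sigma> E)) B (map_point \<sigma>)"
  using K.point_group_tensor_setup[OF E B] K'.point_group_tensor_setup[OF weierstrass_map[OF E] B]
    points_map[OF E] point_add_map[OF E]
  by (intro tensor_hom.intro tensor_hom_axioms.intro) (auto simp: point_group_simps)

lemma tensor_hom_group_hom:
  assumes "tensor_hom A A' B f"
  shows "group_hom (tensor A B) (tensor A' B) (tensor_map A' B f)"
proof -
  interpret tensor_hom A A' B f by (rule assms)
  show ?thesis
    by (intro group_hom.intro group_hom_axioms.intro S.TT.is_group S'.TT.is_group tensor_map_hom)
qed

section \<open>Galois action and localization on the Mordell--Weil tensor product\<close>

locale mw = zp_ext p K F for p and K :: "'k ring" (structure) and F +
  fixes E :: "'k weierstrass"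
  assumes E_F: "set_weierstrass E \<subseteq> F"
begin

lemma E_K: "set_weierstrass E \<subseteq> carrier K"
  using E_F F_carrier by blast

abbreviation A where "A \<equiv> MW_tensor p K E"

lemma E_map: "(\<And>x. x \<in> F \<Longrightarrow> f x = g x) \<Longrightarrow> map_weierstrass f E = map_weierstrass g E"
  using E_F by (intro weierstrass.map_cong) auto

lemma Gal_field_hom: "\<rho> \<in> carrier Gal \<Longrightarrow> field_hom K K \<rho>"
  by (intro field_hom.intro field_hom_axioms.intro field_axioms) (simp add: galois_group_carrier)

lemma Gal_tensor_hom:
  assumes \<rho>: "\<rho> \<in> carrier Gal"
  shows "tensor_hom (point_group K E) (point_group K E) (QpZp p) (map_point \<rho>)"
proof -
  have "map_weierstrass \<rho> E = map_weierstrass id E"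
    using \<rho> by (intro E_map) (simp add: galois_group_carrier)
  then show ?thesis
    using field_hom.point_group_tensor_hom[OF Gal_field_hom[OF \<rho>] E_K QpZp.comm_group_axioms]
    by (simp add: weierstrass.map_id)
qed

lemma local_field_hom:
  assumes v: "place_above p K v"
  shows "field_hom K (local_field K F v) (local_embed K F v)"
proof -
  interpret V: nonarch_field K v "finite_subextensions K F" by (rule place_nonarch[OF v])
  show ?thesis unfolding local_field_def local_embed_def
    by (intro field_hom.intro field_hom_axioms.intro field_axioms V.Q_field V.embed_hom)
qed

lemma local_tensor_hom:
  assumes v: "place_above p K v"
  shows "tensor_hom (point_group K E) (point_group (local_field K F v) (map_weierstrass (local_embed K F v) E))
    (QpZp p) (map_point (local_embed K F v))"
  by (rule field_hom.point_group_tensor_hom[OF local_field_hom[OF v] E_K QpZp.comm_group_axioms])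

lemma place_conjugate:
  assumes \<rho>: "\<rho> \<in> carrier Gal" and v: "place_above p K v"
  shows "place_above p K (\<lambda>x. v (\<rho> x))"
proof -
  interpret \<rho>: field_hom K K \<rho> by (rule Gal_field_hom[OF \<rho>])
  have "\<rho> ([p] \<cdot> \<one>) = [p] \<cdot> \<one>"
  proof -
    have "\<rho> ([n] \<cdot> \<one>) = [n] \<cdot> \<one>" for n :: nat by (induction n) simp_all
    then show ?thesis .
  qed
  then show ?thesis using v by (auto simp: place_above_def \<rho>.\<sigma>_zero_iff)
qed

text \<open>The localization of the conjugate \<open>\<rho> x\<close> at \<open>v\<close> is the image of the localization of \<open>x\<close> at the
  place \<open>v \<circ> \<rho>\<close> under the isomorphism of local fields induced by \<open>\<rho>\<close>.\<close>

lemma localization_conjugate: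
  assumes \<rho>: "\<rho> \<in> carrier Gal" and v: "place_above p K v" and x: "x \<in> carrier A"
    and one: "localization p K F E (\<lambda>x. v (\<rho> x)) x = \<one>\<^bsub>MW_tensor p (local_field K F (\<lambda>x. v (\<rho> x))) (map_weierstrass (local_embed K F (\<lambda>x. v (\<rho> x))) E)\<^esub>"
  shows "localization p K F E v (MW_action p K E \<rho> x) =
    \<one>\<^bsub>MW_tensor p (local_field K F v) (map_weierstrass (local_embed K F v) E)\<^esub>"
proof -
  define v' where "v' = (\<lambda>x. v (\<rho> x))"
  let ?e = "local_embed K F v" and ?e' = "local_embed K F v'"
  let ?Q = "local_field K F v" and ?Q' = "local_field K F v'"
  have v': "place_above p K v'" unfolding v'_def by (rule place_conjugate[OF \<rho> v])
  have hom: "\<rho> \<in> ring_hom K K" using \<rho> by (simp add: galois_group_carrier)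
  obtain h where h: "h \<in> ring_hom ?Q' ?Q" and he: "\<And>x. x \<in> carrier K \<Longrightarrow> h (?e' x) = ?e (\<rho> x)"
    using completion_transport[OF place_nonarch[OF v'] place_nonarch[OF v] hom _ finite_subextension_image[OF \<rho>]]
    unfolding local_field_def local_embed_def v'_def by blast
  interpret V: field_hom K ?Q ?e by (rule local_field_hom[OF v])
  interpret V': field_hom K ?Q' ?e' by (rule local_field_hom[OF v'])
  interpret H: field_hom ?Q' ?Q h
    by (intro field_hom.intro field_hom_axioms.intro V.K'.field_axioms V'.K'.field_axioms h)
  \<comment> \<open>The coefficients of \<open>E\<close> lie in \<open>F\<close> and are fixed by
    \<open>\<rho>\<close>, so the induced map of local fields carries the curve at \<open>v'\<close>
    to the curve at \<open>v\<close>.\<close>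
  have Eh: "map_weierstrass h (map_weierstrass ?e' E) = map_weierstrass ?e E"
    unfolding weierstrass.map_comp
    using \<rho> he F_carrier by (intro E_map) (simp add: galois_group_carrier)
  have th1: "tensor_hom (point_group ?Q' (map_weierstrass ?e' E)) (point_group ?Q (map_weierstrass ?e E)) (QpZp p) (map_point h)"
    using H.point_group_tensor_hom[OF V'.weierstrass_map[OF E_K] QpZp.comm_group_axioms] unfolding Eh .
  interpret TH: group_hom "MW_tensor p ?Q' (map_weierstrass ?e' E)" "MW_tensor p ?Q (map_weierstrass ?e E)"
    "tensor_map (point_group ?Q (map_weierstrass ?e E)) (QpZp p) (map_point h)"
    unfolding MW_tensor_def by (rule tensor_hom_group_hom[OF th1])
  have x': "x \<in> carrier (tensor (point_group K E) (QpZp p))" using x by (simp add: MW_tensor_def)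
  have th2: "tensor_hom (point_group K E) (point_group ?Q (map_weierstrass ?e E)) (QpZp p) (map_point ?e \<circ> map_point \<rho>)"
  proof -
    interpret T1: tensor_hom "point_group K E" "point_group K E" "QpZp p" "map_point \<rho>" by (rule Gal_tensor_hom[OF \<rho>])
    interpret T2: tensor_hom "point_group K E" "point_group ?Q (map_weierstrass ?e E)" "QpZp p" "map_point ?e"
      by (rule local_tensor_hom[OF v])
    show ?thesis
      by (intro tensor_hom.intro tensor_hom_axioms.intro T1.S.tensor_setup_axioms T2.S'.tensor_setup_axioms)
        (simp_all add: T1.f_closed T1.f_mult T2.f_closed T2.f_mult)
  qed
  \<comment> \<open>The commuting square on points: conjugating and then embedding at
    \<open>v\<close> is the same as embedding at \<open>v'\<close> and then applying
    \<open>h\<close>.\<close>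
  have pt: "(map_point ?e \<circ> map_point \<rho>) P = map_point h (map_point ?e' P)" if "P \<in> carrier (point_group K E)" for P
  proof (cases P)
    case (Affine a b)
    then have "a \<in> carrier K" "b \<in> carrier K" using that by (cases E; auto simp: point_group_simps points_def)+
    then show ?thesis by (simp add: Affine he)
  qed simp
  have "localization p K F E v (MW_action p K E \<rho> x) =
      tensor_map (point_group ?Q (map_weierstrass ?e E)) (QpZp p) (map_point ?e \<circ> map_point \<rho>) x"
    unfolding localization_def MW_action_def
    by (rule tensor_map_comp[OF Gal_tensor_hom[OF \<rho>] local_tensor_hom[OF v] th2 _ x']) simp
  also have "\<dots> = tensor_map (point_group ?Q (map_weierstrass ?e E)) (QpZp p) (map_point h) (localization p K F E v' x)"
    unfolding localization_def
    by (rule tensor_map_comp[OF local_tensor_hom[OF v'] th1 th2 pt x', symmetric])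
  also have "localization p K F E v' x = \<one>\<^bsub>MW_tensor p ?Q' (map_weierstrass ?e' E)\<^esub>"
    using one unfolding v'_def .
  also have "tensor_map (point_group ?Q (map_weierstrass ?e E)) (QpZp p) (map_point h) \<dots> =
      \<one>\<^bsub>MW_tensor p ?Q (map_weierstrass ?e E)\<^esub>"
    by (rule TH.hom_one)
  finally show ?thesis .
qed

definition fine where
  "fine = {x \<in> carrier A. \<forall>v. place_above p K v \<longrightarrow>
    localization p K F E v x = \<one>\<^bsub>MW_tensor p (local_field K F v) (map_weierstrass (local_embed K F v) E)\<^esub>}"

lemma fine_MW_eq: "fine_MW p K F E = A\<lparr>carrier := fine\<rparr>"
  by (simp add: fine_MW_def fine_def)

lemma A_setup: "tensor_setup (point_group K E) (QpZp p)"
  by (rule point_group_tensor_setup[OF E_K QpZp.comm_group_axioms])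

sublocale A: comm_group A
  unfolding MW_tensor_def
proof -
  interpret tensor_setup "point_group K E" "QpZp p" by (rule A_setup)
  show "comm_group (tensor (point_group K E) (QpZp p))" by (rule TT.comm_group_axioms)
qed

lemma localization_group_hom:
  assumes v: "place_above p K v"
  shows "group_hom A (MW_tensor p (local_field K F v) (map_weierstrass (local_embed K F v) E)) (localization p K F E v)"
  unfolding MW_tensor_def localization_def by (rule tensor_hom_group_hom[OF local_tensor_hom[OF v]])

lemma fine_subgroup: "subgroup fine A"
proof (rule A.subgroupI)
  show "fine \<subseteq> carrier A" by (auto simp: fine_def)
  have "\<one>\<^bsub>A\<^esub> \<in> fine" unfolding fine_def using group_hom.hom_one[OF localization_group_hom] by auto
  then show "fine \<noteq> {}" by blast
next
  fix x assume "x \<in> fine"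
  then have x: "x \<in> carrier A" "\<And>v. place_above p K v \<Longrightarrow> localization p K F E v x =
      \<one>\<^bsub>MW_tensor p (local_field K F v) (map_weierstrass (local_embed K F v) E)\<^esub>" by (auto simp: fine_def)
  have "localization p K F E v (inv\<^bsub>A\<^esub> x) = \<one>\<^bsub>MW_tensor p (local_field K F v) (map_weierstrass (local_embed K F v) E)\<^esub>"
    if v: "place_above p K v" for v
  proof -
    interpret L: group_hom A "MW_tensor p (local_field K F v) (map_weierstrass (local_embed K F v) E)" "localization p K F E v"
      by (rule localization_group_hom[OF v])
    show ?thesis by (simp add: x(1) x(2)[OF v])
  qed
  then show "inv\<^bsub>A\<^esub> x \<in> fine" using x(1) by (auto simp: fine_def)
next
  fix x y assume "x \<in> fine" "y \<in> fine"
  then have xy: "x \<in> carrier A" "y \<in> carrier A"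
    "\<And>v. place_above p K v \<Longrightarrow> localization p K F E v x =
      \<one>\<^bsub>MW_tensor p (local_field K F v) (map_weierstrass (local_embed K F v) E)\<^esub>"
    "\<And>v. place_above p K v \<Longrightarrow> localization p K F E v y =
      \<one>\<^bsub>MW_tensor p (local_field K F v) (map_weierstrass (local_embed K F v) E)\<^esub>" by (auto simp: fine_def)
  have "localization p K F E v (x \<otimes>\<^bsub>A\<^esub> y) = \<one>\<^bsub>MW_tensor p (local_field K F v) (map_weierstrass (local_embed K F v) E)\<^esub>"
    if v: "place_above p K v" for v
  proof -
    interpret L: group_hom A "MW_tensor p (local_field K F v) (map_weierstrass (local_embed K F v) E)" "localization p K F E v"
      by (rule localization_group_hom[OF v])
    show ?thesis by (simp add: xy(1,2) xy(3)[OF v] xy(4)[OF v])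
  qed
  then show "x \<otimes>\<^bsub>A\<^esub> y \<in> fine" using xy(1,2) by (auto simp: fine_def)
qed

lemma action_closed_fine:
  assumes \<rho>: "\<rho> \<in> carrier Gal" and x: "x \<in> fine" shows "MW_action p K E \<rho> x \<in> fine"
proof -
  have xA: "x \<in> carrier A" using x by (simp add: fine_def)
  have "MW_action p K E \<rho> x \<in> carrier A"
    using group_hom.hom_closed[OF tensor_hom_group_hom[OF Gal_tensor_hom[OF \<rho>]], of x] xA
    by (simp add: MW_action_def MW_tensor_def)
  moreover have "localization p K F E v (MW_action p K E \<rho> x) =
      \<one>\<^bsub>MW_tensor p (local_field K F v) (map_weierstrass (local_embed K F v) E)\<^esub>" if v: "place_above p K v" for v
    by (rule localization_conjugate[OF \<rho> v xA]) (use x place_conjugate[OF \<rho> v] in \<open>simp add: fine_def\<close>)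
  ultimately show ?thesis by (simp add: fine_def)
qed

lemma action_group_endo:
  assumes \<rho>: "\<rho> \<in> carrier Gal" shows "group_endo A (MW_action p K E \<rho>)"
  unfolding MW_action_def
  using group_hom.homh[OF tensor_hom_group_hom[OF Gal_tensor_hom[OF \<rho>]]]
  by (intro group_endo.intro group_endo_axioms.intro A.comm_group_axioms) (simp add: MW_tensor_def)

text \<open>Each point has two coordinates fixed by some \<open>p\<close>-power iterate of
  \<open>\<rho>\<close>, and an element involves finitely many points. As it is also killed by a
  power of \<open>p\<close>, \<open>T_nilpotent\<close> applies.\<close>

lemma action_dual_setup:
  assumes odd: "odd p" and \<rho>: "\<rho> \<in> carrier Gal"
  shows "dual_setup p A (MW_action p K E \<rho>)"
proof (intro dual_setup.intro padic_axioms action_group_endo[OF \<rho>] dual_setup_axioms.intro)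
  interpret e: group_endo A "MW_action p K E \<rho>" by (rule action_group_endo[OF \<rho>])
  interpret TS: tensor_setup "point_group K E" "QpZp p" by (rule A_setup)
  fix x assume x: "x \<in> carrier A"
  then have x': "x \<in> carrier (tensor (point_group K E) (QpZp p))" by (simp add: MW_tensor_def)
  have fin: "\<exists>n. \<forall>m\<ge>n. (map_point \<rho> ^^ (p ^ m)) P = P" if P: "P \<in> carrier (point_group K E)" for P
  proof (cases P)
    case Infinity
    have "(map_point \<rho> ^^ k) Infinity = Infinity" for k by (induction k) auto
    then show ?thesis using Infinity by blast
  next
    case (Affine a b)
    then have ab: "a \<in> carrier K" "b \<in> carrier K" using P by (cases E; auto simp: point_group_simps points_def)+
    obtain m n where "\<forall>k\<ge>m. (\<rho> ^^ (p ^ k)) a = a" "\<forall>k\<ge>n. (\<rho> ^^ (p ^ k)) b = b"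
      using Gal_p_power[OF \<rho>] ab by meson
    moreover have "(map_point \<rho> ^^ k) (Affine a b) = Affine ((\<rho> ^^ k) a) ((\<rho> ^^ k) b)" for k by (induction k) auto
    ultimately show ?thesis unfolding Affine by (intro exI[of _ "max m n"]) simp
  qed
  have "\<exists>n. \<forall>m\<ge>n. (MW_action p K E \<rho> ^^ (p ^ m)) x = x"
    unfolding MW_action_def by (rule tensor_map_funpow_id[OF Gal_tensor_hom[OF \<rho>] x' fin])
  then obtain n where n: "(MW_action p K E \<rho> ^^ (p ^ n)) x = x" by blast
  obtain m where m: "x [^]\<^bsub>A\<^esub> (p ^ m) = \<one>\<^bsub>A\<^esub>"
    using TS.TT_p_primary[OF QpZp_p_primary x'] unfolding MW_tensor_def by blast
  show "\<exists>n. (e.T ^^ n) x = \<one>\<^bsub>A\<^esub>" by (rule exI) (rule e.T_nilpotent[OF prime_p odd x n m])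
qed

end

section \<open>Removal of the free part and conclusion\<close>

lemma direct_sum2_simps:
  "carrier (direct_sum2 M N) = carrier M \<times> carrier N" "\<zero>\<^bsub>direct_sum2 M N\<^esub> = (\<zero>\<^bsub>M\<^esub>, \<zero>\<^bsub>N\<^esub>)"
  "x \<oplus>\<^bsub>direct_sum2 M N\<^esub> y = (fst x \<oplus>\<^bsub>M\<^esub> fst y, snd x \<oplus>\<^bsub>N\<^esub> snd y)"
  "r \<odot>\<^bsub>direct_sum2 M N\<^esub> x = (r \<odot>\<^bsub>M\<^esub> fst x, r \<odot>\<^bsub>N\<^esub> snd x)"
  by (simp_all add: direct_sum2_def)

lemma direct_sum2_abelian_group:
  assumes M: "abelian_group M" and N: "abelian_group N"
  shows "abelian_group (direct_sum2 M N)"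
proof -
  interpret M: abelian_group M by (rule M)
  interpret N: abelian_group N by (rule N)
  show ?thesis
  proof (rule abelian_groupI)
    fix x assume "x \<in> carrier (direct_sum2 M N)"
    then show "\<exists>y\<in>carrier (direct_sum2 M N). y \<oplus>\<^bsub>direct_sum2 M N\<^esub> x = \<zero>\<^bsub>direct_sum2 M N\<^esub>"
      by (intro bexI[of _ "(\<ominus>\<^bsub>M\<^esub> fst x, \<ominus>\<^bsub>N\<^esub> snd x)"]) (auto simp: direct_sum2_simps M.l_neg N.l_neg)
  qed (auto simp: direct_sum2_simps M.a_ac N.a_ac)
qed

text \<open>For \<open>r = 0\<close> the free part is an empty direct sum, which has a single
  element; projecting it away changes neither kernel nor cokernel.\<close>

lemma pseudo_isomorphic_direct_sum2_trivial:
  assumes L: "abelian_group L" and M: "abelian_group M" and N: "abelian_group N"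
    and triv: "carrier M = {\<zero>\<^bsub>M\<^esub>}" and ps: "pseudo_isomorphic R L (direct_sum2 M N)"
  shows "pseudo_isomorphic R L N"
proof -
  obtain h D where h: "h \<in> module_hom R L (direct_sum2 M N)"
    and ker: "finite {x \<in> carrier L. h x = \<zero>\<^bsub>direct_sum2 M N\<^esub>}"
    and D: "finite D" "D \<subseteq> carrier (direct_sum2 M N)"
      "\<forall>z\<in>carrier (direct_sum2 M N). \<exists>d\<in>D. \<exists>x\<in>carrier L. z = d \<oplus>\<^bsub>direct_sum2 M N\<^esub> h x"
    using pseudo_isomorphicD[OF ps L direct_sum2_abelian_group[OF M N]] by blast
  note hD = module_homD[OF h]
  show ?thesis
  proof (rule pseudo_isomorphicI[OF L N, of "\<lambda>x. snd (h x)" _ "snd ` D"])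
    show "(\<lambda>x. snd (h x)) \<in> module_hom R L N" unfolding module_hom_def
      using hD(1) by (auto simp: hD(2,3) direct_sum2_simps mem_Times_iff)
    have "{x \<in> carrier L. snd (h x) = \<zero>\<^bsub>N\<^esub>} \<subseteq> {x \<in> carrier L. h x = \<zero>\<^bsub>direct_sum2 M N\<^esub>}"
      using hD(1) triv by (auto simp: direct_sum2_simps prod_eq_iff mem_Times_iff)
    then show "finite {x \<in> carrier L. snd (h x) = \<zero>\<^bsub>N\<^esub>}" using ker finite_subset by blast
    show "snd ` D \<subseteq> carrier N" using D(2) by (auto simp: direct_sum2_simps)
    fix z assume z: "z \<in> carrier N"
    then have "(\<zero>\<^bsub>M\<^esub>, z) \<in> carrier (direct_sum2 M N)" using triv by (simp add: direct_sum2_simps)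
    then obtain d x where dx: "d \<in> D" "x \<in> carrier L" "(\<zero>\<^bsub>M\<^esub>, z) = d \<oplus>\<^bsub>direct_sum2 M N\<^esub> h x" using D(3) by blast
    then have "z = snd d \<oplus>\<^bsub>N\<^esub> snd (h x)" by (simp add: direct_sum2_simps)
    then show "\<exists>d\<in>snd ` D. \<exists>x\<in>carrier L. z = d \<oplus>\<^bsub>N\<^esub> snd (h x)" using dx(1,2) by blast
  qed (use D(1) in simp)
qed

theorem theoremA:
  fixes p :: nat and F_inf :: "'a ring" and F :: "'a set" and E :: "'a weierstrass"
    and \<gamma> :: "'a \<Rightarrow> 'a" and r t :: nat and b :: "nat \<Rightarrow> nat"
  assumes "Factorial_Ring.prime p" and "odd p"
    and "number_field F_inf F"
    and "Zp_extension p F_inf F"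
    and "topological_generator F_inf F \<gamma>"
    and "elliptic_curve F_inf F E"
    and "pseudo_isomorphic (Lambda p) (MW_dual p F_inf F E \<gamma>)
           (direct_sum2 (direct_sum {1..r} (\<lambda>_. regular_module (Lambda p)))
                        (direct_sum {1..t} (\<lambda>i. Lambda_mod_Phi p (b i))))"
    and "r = 0"
  shows "\<exists>(u::nat) (c :: nat \<Rightarrow> nat). pseudo_isomorphic (Lambda p) (fine_MW_dual p F_inf F E \<gamma>)
           (direct_sum {1..u} (\<lambda>i. Lambda_mod_Phi p (c i)))"
proof -
  interpret field F_inf using assms(4) by (simp add: Zp_extension_def galois_extension_def)
  interpret mw p F_inf F E
    by (intro mw.intro zp_ext.intro padic.intro zp_ext_axioms.intro mw_axioms.intro field_axioms assms)
      (use assms(6) in \<open>simp add: elliptic_curve_def\<close>)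
  \<comment> \<open>The dual lets \<open>\<gamma>\<close> act through its inverse on the argument,
    so nilpotence is needed for this element.\<close>
  define s where "s = inv\<^bsub>galois_group F_inf F\<^esub> \<gamma>"
  have s: "s \<in> carrier (galois_group F_inf F)"
    unfolding s_def using assms(5) by (intro Gal.inv_closed) (simp add: topological_generator_def)
  define S where "S = MW_action p F_inf E s"
  interpret DA: dual_setup p A S unfolding S_def by (rule action_dual_setup[OF assms(2) s])
  have sub: "subgroup fine A" "\<And>x. x \<in> fine \<Longrightarrow> S x \<in> fine"
    using fine_subgroup action_closed_fine[OF s] by (auto simp: S_def)
  interpret DB: dual_setup p "A\<lparr>carrier := fine\<rparr>" S by (rule DA.sub_dual_setup[OF sub])
  interpret PM: pseudo_module "Lambda p" Zd.PI by (rule Lambda_pseudo_module)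
  let ?N = "\<lambda>i. Lambda_mod_Phi p (b i)"
  let ?Z = "direct_sum {1..r} (\<lambda>_. regular_module (Lambda p)) :: (nat \<Rightarrow> padic, nat \<Rightarrow> nat \<Rightarrow> padic) module"
  have mod: "module (Lambda p) (?N i)" for i by (rule PM.good_module[OF Lambda_mod_Phi_good])
  have eqA: "MW_dual p F_inf F E \<gamma> = DA.D" by (simp add: MW_dual_def S_def s_def)
  have eqB: "fine_MW_dual p F_inf F E \<gamma> = DB.D" by (simp add: fine_MW_dual_def S_def s_def fine_MW_eq)
  have modP: "module (Lambda p) (direct_sum {1..t} ?N)" by (rule direct_sum_module[OF PM.is_cring mod])
  \<comment> \<open>The index set is empty, so nothing has to be known about the summands.\<close>
  have modZ: "module (Lambda p) ?Z" unfolding assms(8) by (rule direct_sum_module[OF PM.is_cring]) simp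
  have "pseudo_isomorphic (Lambda p) DA.D (direct_sum {1..t} ?N)"
  proof (rule pseudo_isomorphic_direct_sum2_trivial[OF DA.D_abelian_group])
    show "abelian_group ?Z" by (rule module.axioms(2)[OF modZ])
    show "abelian_group (direct_sum {1..t} ?N)" by (rule module.axioms(2)[OF modP])
    show "carrier ?Z = {\<zero>\<^bsub>?Z\<^esub>}" by (simp add: direct_sum_simps assms(8) restrict_def)
    show "pseudo_isomorphic (Lambda p) DA.D (direct_sum2 ?Z (direct_sum {1..t} ?N))"
      using assms(7) unfolding eqA .
  qed
  then have "\<exists>J\<subseteq>{1..t}. pseudo_isomorphic (Lambda p) DB.D (direct_sum J ?N)"
    by (rule PM.pseudo_isomorphic_quotient[OF finite_atLeastAtMost Lambda_mod_Phi_good DA.D_abelian_group DA.smult_D_closed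
          DB.D_abelian_group DB.smult_D_zero DA.restrict_module_hom[OF sub] DA.restrict_surj[OF sub], rotated -1])
  then obtain J where J: "J \<subseteq> {1..t}" "pseudo_isomorphic (Lambda p) DB.D (direct_sum J ?N)" by blast
  have "finite J" using J(1) finite_subset by blast
  \<comment> \<open>Enumerates the surviving summands, so that \<open>u\<close> is the size of
    \<open>J\<close> and the new indices are \<open>b (e i)\<close>.\<close>
  then obtain e where e: "bij_betw e {1..card J} J" using ex_bij_betw_nat_finite_1 by blast
  have "pseudo_isomorphic (Lambda p) DB.D (direct_sum {1..card J} (\<lambda>i. ?N (e i)))"
    by (rule pseudo_isomorphic_reindex[OF PM.is_cring DB.D_abelian_group mod e J(2)])
  then show ?thesis unfolding eqB by (intro exI[of _ "card J"] exI[of _ "\<lambda>i. b (e i)"])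
qed

end
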